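(* (1) Let $H$ be a braided unital algebra and $V$ a braided left $H$-module with action $\nu_L:H\otimes V\to V$ (and braiding $\Psi_{HV}:H\otimes V\to V\otimes H$). Let $U$ be a non-degenerate subcoalgebra of $H^{\underline\circ}$ such that $\Psi_{UU}$ and $\Psi_{UV}^\circ$ are bijective. Consider the linear map $\rho_R:V\to(V'\otimes H)'$, $\rho_R(v)(e\otimes a):=e\big(\nu_L(\Psi_{HV}^{-1}(v\otimes a))\big)$ for $v\in V$, $a\in H$, $e\in V'$. If $\rho_R(V)\subset V\otimes U\subset(V'\otimes H)'$, then $\rho_R$ is a right $U$-coaction making $V$ a braided right $U$-comodule with respect to the braidings $\Psi_{UU}$, $\Psi_{UV}^\circ$ and the coproduct $\underline\Delta_{-2}:=\Psi_{UU}^{-2}\,\underline\Delta$ on $U$. If $H$ is a braided bialgebra, $V$ is a braided left $H$-module algebra, and $U$ is a standard left dual of $H$, then the coaction $\rho_R$ turns $V$ into a braided right $U^{(2,-2)}$-comodule algebra. (2) Let $H$ be a braided unital algebra and $V$ a braided right $H$-module with action $\nu_R:V\otimes H\to V$ (and braiding $\Psi_{VH}:V\otimes H\to H\otimes V$). Let $U$ be a non-degenerate subcoalgebra of $H^{\underline\circ}$ such that $\Psi_{UU}$ and $\Psi_{VU}^\circ$ are bijective. Consider $\rho_L:V\to(H\otimes V')'$, $\rho_L(v)(a\otimes e):=e\big(\nu_R(\Psi_{VH}^{-1}(a\otimes v))\big)$. If $\rho_L(V)\subset U\otimes V\subset(H\otimes V')'$, then $\rho_L$ is a left $U$-coaction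 making $V$ a braided left $U$-comodule with respect to the braidings $\Psi_{UU}$, $\Psi_{VU}^\circ$ and the coproduct $\underline\Delta_{-2}$ on $U$. If $H$ is a braided bialgebra, $V$ is a braided right $H$-module algebra, and $U$ is a standard right dual of $H$, then $\rho_L$ turns $V$ into a braided left $U^{(2,-2)}$-comodule algebra.
   Context: All vector spaces are over a fixed field $\mathbb K$, $\otimes$ is the algebraic tensor product, $X'$ is the full linear dual of $X$, and composition of maps is written by juxtaposition. A braiding on $V$ is a bijective linear map $\Psi_{VV}:V\otimes V\to V\otimes V$ with $(\Psi_{VV}\otimes\mathrm{id})(\mathrm{id}\otimes\Psi_{VV})(\Psi_{VV}\otimes\mathrm{id})=(\mathrm{id}\otimes\Psi_{VV})(\Psi_{VV}\otimes\mathrm{id})(\mathrm{id}\otimes\Psi_{VV})$; $V$ is then a braided vector space. Let $\Psi_{VW}:V\otimes W\to W\otimes V$ be bijective and linear. If $V$ is braided, $W$ is a left $V$-braided vector space if $(\Psi_{VW}\otimes\mathrm{id})(\mathrm{id}\otimes\Psi_{VW})(\Psi_{VV}\otimes\mathrm{id})=(\mathrm{id}\otimes\Psi_{VV})(\Psi_{VW}\otimes\mathrm{id})(\mathrm{id}\otimes\Psi_{VW})$. If $W$ is braided, $V$ is a right $W$-braided vector space if $(\mathrm{id}\otimes\Psi_{VW})(\Psi_{VW}\otimes\mathrm{id})(\mathrm{id}\otimes\Psi_{WW})=(\Psi_{WW}\otimes\mathrm{id})(\mathrm{id}\otimes\Psi_{VW})(\Psi_{VW}\otimes\mathrm{id})$.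 Compatibility of $\Psi=\Psi_{VW}$: with the multiplication of an algebra $V$: $\Psi(m_V\otimes\mathrm{id})=(\mathrm{id}\otimes m_V)(\Psi\otimes\mathrm{id})(\mathrm{id}\otimes\Psi)$ and $\Psi(1\otimes w)=w\otimes1$ if $1\in V$; with the multiplication of an algebra $W$: $\Psi(\mathrm{id}\otimes m_W)=(m_W\otimes\mathrm{id})(\mathrm{id}\otimes\Psi)(\Psi\otimes\mathrm{id})$ and $\Psi(v\otimes1)=1\otimes v$ if $1\in W$; with the comultiplication of a coalgebra $V$: $(\mathrm{id}\otimes\Delta)\Psi=(\Psi\otimes\mathrm{id})(\mathrm{id}\otimes\Psi)(\Delta\otimes\mathrm{id})$ and $(\mathrm{id}\otimes\varepsilon)\Psi=\varepsilon\otimes\mathrm{id}$; with the comultiplication of a coalgebra $W$: $(\Delta\otimes\mathrm{id})\Psi=(\mathrm{id}\otimes\Psi)(\Psi\otimes\mathrm{id})(\mathrm{id}\otimes\Delta)$ and $(\varepsilon\otimes\mathrm{id})\Psi=\mathrm{id}\otimes\varepsilon$. A braided (co)algebra is a (co)algebra with a braiding satisfying both compatibility conditions with its (co)multiplication. A braided bialgebra is a unital algebra $(H,m)$ with a coalgebra structure $(\Delta,\varepsilon)$ and a braiding $\Psi_{HH}$ making it a braided algebra and a braided coalgebra, such that $\Delta m=(m\otimes m)(\mathrm{id}\otimes\Psi_{HH}\otimes\mathrm{id})(\Delta\otimes\Delta)$, $\Delta(1)=1\otimes1$, and $\varepsilon$ is a unital algebra homomorphism. For a braided bialgebra $U$ with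 product $m$ and coproduct $\Delta$, $U^{(2,-2)}$ is the braided bialgebra with the same space, unit, counit and braiding $\Psi_{UU}$, product $m\Psi_{UU}^2$ and coproduct $\Psi_{UU}^{-2}\Delta$. Braided modules over a braided (unital) algebra $(A,m)$: a braided left $A$-module is a left $A$-braided vector space $W$ with $\Psi_{AW}$ compatible with $m$ and a map $\nu_L:A\otimes W\to W$ with $\nu_L(\mathrm{id}\otimes\nu_L)=\nu_L(m\otimes\mathrm{id})$, $\nu_L(1\otimes w)=w$, $\Psi_{AW}(\mathrm{id}\otimes\nu_L)=(\nu_L\otimes\mathrm{id})(\mathrm{id}\otimes\Psi_{AW})(\Psi_{AA}\otimes\mathrm{id})$. A braided right $A$-module is a right $A$-braided vector space $V$ with $\Psi_{VA}$ compatible with $m$ and $\nu_R:V\otimes A\to V$ with $\nu_R(\nu_R\otimes\mathrm{id})=\nu_R(\mathrm{id}\otimes m)$, $\nu_R(v\otimes1)=v$, $\Psi_{VA}(\nu_R\otimes\mathrm{id})=(\mathrm{id}\otimes\nu_R)(\Psi_{VA}\otimes\mathrm{id})(\mathrm{id}\otimes\Psi_{AA})$. Braided comodules over a braided coalgebra $H$: a braided right $H$-comodule is a left $H$-braided vector space $V$ with $\Psi_{HV}$ compatible with the comultiplication of $H$ and $\rho_R:V\to V\otimes H$ with $(\rho_R\otimes\mathrm{id})\rho_R=(\mathrm{id}\otimes\Delta)\rho_R$, $(\mathrm{id}\otimes\varepsilon)\rho_R=\mathrm{id}$, $(\rho_R\otimes\mathrm{id})\Psi_{HV}=(\mathrm{id}\otimes\Psi_{HH})(\Psi_{HV}\otimes\mathrm{id})(\mathrm{id}\otimes\rho_R)$.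 A braided left $H$-comodule is a right $H$-braided vector space $V$ with $\Psi_{VH}$ compatible with the comultiplication of $H$ and $\rho_L:V\to H\otimes V$ with $(\mathrm{id}\otimes\rho_L)\rho_L=(\Delta\otimes\mathrm{id})\rho_L$, $(\varepsilon\otimes\mathrm{id})\rho_L=\mathrm{id}$, $(\mathrm{id}\otimes\rho_L)\Psi_{VH}=(\Psi_{HH}\otimes\mathrm{id})(\mathrm{id}\otimes\Psi_{VH})(\rho_L\otimes\mathrm{id})$. (Co)module algebras: let $H$ be a braided bialgebra and $B$ a braided algebra. Suppose $B$ is left $H$-braided with $\Psi_{HB}$ compatible with the multiplications of $H$ and $B$ and the comultiplication of $H$. $B$ is a braided left $H$-module algebra if it is a braided left $H$-module with $\nu_L(\mathrm{id}\otimes m_B)=m_B(\nu_L\otimes\nu_L)(\mathrm{id}\otimes\Psi_{HB}\otimes\mathrm{id})(\Delta\otimes\mathrm{id}\otimes\mathrm{id})$ and, if $1\in B$, $\nu_L(h\otimes1)=\varepsilon(h)1$; a braided right $H$-comodule algebra if it is a braided right $H$-comodule with $\rho_Rm_B=(m_B\otimes m_H)(\mathrm{id}\otimes\Psi_{HB}\otimes\mathrm{id})(\rho_R\otimes\rho_R)$ and, if $1\in B$, $\rho_R(1)=1\otimes1$. Mirror versions: $B$ is right $H$-braided with $\Psi_{BH}$ satisfying the same compatibilities; braided right $H$-module algebra: $\nu_R(m_B\otimes\mathrm{id})=m_B(\nu_R\otimes\nu_R)(\mathrm{id}\otimes\Psi_{BH}\otimes\mathrm{id})(\mathrm{id}\otimes\mathrm{id}\otimes\Delta)$,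 $\nu_R(1\otimes h)=\varepsilon(h)1$; braided left $H$-comodule algebra: $\rho_Lm_B=(m_H\otimes m_B)(\mathrm{id}\otimes\Psi_{BH}\otimes\mathrm{id})(\rho_L\otimes\rho_L)$, $\rho_L(1)=1\otimes1$. Duality notation: $\langle f,a\rangle=\langle a,f\rangle=f(a)$. $U\subset H'$ is non-degenerate if it separates the points of $H$. $\langle\langle\xi\otimes\eta,x\otimes y\rangle\rangle:=\langle\xi,y\rangle\langle\eta,x\rangle$. Tensor products are embedded into duals by $(\xi\otimes\eta)(x\otimes y)=\langle\xi,x\rangle\langle\eta,y\rangle$. For $f,g\in U$, $a,b\in H$, $v\in V$, $e\in V'$ define $\Psi_{UU}(f\otimes g)(b\otimes a):=\langle\langle f\otimes g,\Psi_{HH}(a\otimes b)\rangle\rangle$ (values in $(H\otimes H)'\supset U\otimes U$); if $V$ is left $H$-braided, $\Psi_{UV}^\circ(f\otimes v)(e\otimes a):=\langle\langle e\otimes f,\Psi_{HV}^{-1}(v\otimes a)\rangle\rangle$ (values in $(V'\otimes H)'\supset V\otimes U$); if $V$ is right $H$-braided, $\Psi_{VU}^\circ(v\otimes f)(a\otimes e):=\langle\langle f\otimes e,\Psi_{VH}^{-1}(a\otimes v)\rangle\rangle$ (values in $(H\otimes V')'\supset U\otimes V$); $\Psi_{UH}^\circ(g\otimes a)(f\otimes b):=\langle\langle f\otimes g,\Psi_{HH}^{-1}(a\otimes b)\rangle\rangle$, $f\in H'$ (values in $(H'\otimes H)'\supset H\otimes U$); $\Psi_{HU}^\circ(b\otimes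 f)(a\otimes g):=\langle\langle f\otimes g,\Psi_{HH}^{-1}(a\otimes b)\rangle\rangle$, $g\in H'$ (values in $(H\otimes H')'\supset U\otimes H$). Such a map $\Psi_{XY}$ is called bijective if it is a bijection $X\otimes Y\to Y\otimes X$. Product and coproduct on duals: $\underline m(f\otimes g)(a):=\langle\langle f\otimes g,\Psi_{HH}^{-1}(\Delta(a))\rangle\rangle$ on $H'$, with unit $\varepsilon$ (for $H$ a braided coalgebra); $\underline\Delta(f)$ is determined by $\langle\langle\underline\Delta(f),a\otimes b\rangle\rangle=f(m\Psi_{HH}(a\otimes b))$ (for $H$ a braided unital algebra). $H^{\underline\circ}$ is the largest coalgebra in $H'$ with coproduct $\underline\Delta$ and counit $f\mapsto f(1)$; thus a subcoalgebra $U$ satisfies $\underline\Delta(U)\subset U\otimes U$. A standard left (resp. right) dual of a braided bialgebra $H$ is a non-degenerate subspace $U\subset H'$ containing $\varepsilon$, closed under $\underline m$, with $\underline\Delta(U)\subset U\otimes U$, and such that $\Psi_{UU}$ and $\Psi_{UH}^\circ$ (resp. $\Psi_{UU}$ and $\Psi_{HU}^\circ$) are bijective; $U$ is then regarded as braided bialgebra with product $\underline m$, unit $\varepsilon$, coproduct $\underline\Delta$, counit $f\mapsto f(1)$ and braiding $\Psi_{UU}$. *)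

theory Defs
  imports Complex_Main "HOL-Library.Function_Algebras"
begin

section \<open>Vector spaces, linear maps and tensor products\<close>

text \<open>A vector space over the field \<^typ>\<open>'k\<close> is a subspace \<open>carr X\<close> of an ambient type that is a
  vector space under \<open>scl X\<close>. The carrier is needed because duals, tensor products and subspaces
  of duals are not whole types.\<close>

datatype ('k, 'a) vs = VS (carr: "'a set") (scl: "'k \<Rightarrow> 'a \<Rightarrow> 'a")

definition vspace :: "('k::field, 'a::ab_group_add) vs \<Rightarrow> bool" where
  "vspace X \<longleftrightarrow> vector_space (scl X) \<and> module.subspace (scl X) (carr X)"

definition is_subspace :: "('k::field, 'a::ab_group_add) vs \<Rightarrow> ('k, 'a) vs \<Rightarrow> bool" where
  "is_subspace U X \<longleftrightarrow> scl U = scl X \<and> carr U \<subseteq> carr X \<and> module.subspace (scl X) (carr U)"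

definition base_field :: "('k::field, 'k) vs" where
  "base_field = VS UNIV (*)"

abbreviation fscl :: "'k::times \<Rightarrow> ('a \<Rightarrow> 'k) \<Rightarrow> ('a \<Rightarrow> 'k)" where
  "fscl \<equiv> \<lambda>c f x. c * f x"

text \<open>Linear maps carry their source and target, and their underlying functions vanish outside the
  carrier of the source. Thus equality of linear maps is equality of terms.\<close>

datatype ('k, 'a, 'b) lmap =
  LMap (src: "('k, 'a) vs") (trg: "('k, 'b) vs") (app: "'a \<Rightarrow> 'b")

definition hom ::
    "('k::field, 'a::ab_group_add) vs \<Rightarrow> ('k, 'b::ab_group_add) vs \<Rightarrow> ('k, 'a, 'b) lmap set" where
  "hom X Y = {f. src f = X \<and> trg f = Y \<and>
     (\<forall>x\<in>carr X. app f x \<in> carr Y) \<and>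
     (\<forall>x\<in>carr X. \<forall>x'\<in>carr X. app f (x + x') = app f x + app f x') \<and>
     (\<forall>c. \<forall>x\<in>carr X. app f (scl X c x) = scl Y c (app f x)) \<and>
     (\<forall>x. x \<notin> carr X \<longrightarrow> app f x = 0)}"

definition iso ::
    "('k::field, 'a::ab_group_add) vs \<Rightarrow> ('k, 'b::ab_group_add) vs \<Rightarrow> ('k, 'a, 'b) lmap set" where
  "iso X Y = {f \<in> hom X Y. bij_betw (app f) (carr X) (carr Y)}"

definition idm :: "('k, 'a::zero) vs \<Rightarrow> ('k, 'a, 'a) lmap" where
  "idm X = LMap X X (\<lambda>x. if x \<in> carr X then x else 0)"

definition comp :: "('k, 'b, 'c::zero) lmap \<Rightarrow> ('k, 'a, 'b) lmap \<Rightarrow> ('k, 'a, 'c) lmap"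
    (infixr "\<odot>" 60) where
  "g \<odot> f = LMap (src f) (trg g) (\<lambda>x. if x \<in> carr (src f) then app g (app f x) else 0)"

definition linv :: "('k, 'a::zero, 'b) lmap \<Rightarrow> ('k, 'b, 'a) lmap" where
  "linv f = LMap (trg f) (src f)
     (\<lambda>y. if y \<in> carr (trg f) then inv_into (carr (src f)) (app f) y else 0)"

text \<open>The dual space. Functionals are extended by \<open>0\<close> outside the carrier.\<close>

definition dual :: "('k::field, 'a::ab_group_add) vs \<Rightarrow> ('k, 'a \<Rightarrow> 'k) vs" where
  "dual X = VS {f. LMap X base_field f \<in> hom X base_field} fscl"

definition bilin ::
    "('k::field, 'a::ab_group_add) vs \<Rightarrow> ('k, 'b::ab_group_add) vs \<Rightarrow> ('k, 'c::ab_group_add) vs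
     \<Rightarrow> ('a \<Rightarrow> 'b \<Rightarrow> 'c) \<Rightarrow> bool" where
  "bilin X Y Z b \<longleftrightarrow>
     (\<forall>x\<in>carr X. \<forall>y\<in>carr Y. b x y \<in> carr Z) \<and>
     (\<forall>x\<in>carr X. \<forall>x'\<in>carr X. \<forall>y\<in>carr Y. b (x + x') y = b x y + b x' y) \<and>
     (\<forall>x\<in>carr X. \<forall>y\<in>carr Y. \<forall>y'\<in>carr Y. b x (y + y') = b x y + b x y') \<and>
     (\<forall>c. \<forall>x\<in>carr X. \<forall>y\<in>carr Y. b (scl X c x) y = scl Z c (b x y)) \<and>
     (\<forall>c. \<forall>x\<in>carr X. \<forall>y\<in>carr Y. b x (scl Y c y) = scl Z c (b x y))"

text \<open>The algebraic tensor product is realised in the usual way inside the linear dual of the space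
  of bilinear forms on \<open>X \<times> Y\<close>: \<open>x \<otimes> y\<close> is evaluation at \<open>(x, y)\<close>, and \<open>X \<otimes> Y\<close> is the span of these
  elementary tensors. Over a field this has the universal property of the tensor product, see
  \<open>tlift_hom\<close>, \<open>tlift_tens\<close> and \<open>tlift_unique\<close>.\<close>

type_synonym ('k, 'a, 'b) tensor = "('a \<Rightarrow> 'b \<Rightarrow> 'k) \<Rightarrow> 'k"

definition tens ::
    "('k::field, 'a::ab_group_add) vs \<Rightarrow> ('k, 'b::ab_group_add) vs \<Rightarrow> 'a \<Rightarrow> 'b
     \<Rightarrow> ('k, 'a, 'b) tensor" where
  "tens X Y x y = (\<lambda>b. if bilin X Y base_field b then b x y else 0)"

definition tprod ::
    "('k::field, 'a::ab_group_add) vs \<Rightarrow> ('k, 'b::ab_group_add) vs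
     \<Rightarrow> ('k, ('k, 'a, 'b) tensor) vs" (infixr "\<otimes>" 75) where
  "X \<otimes> Y = VS (module.span fscl {tens X Y x y |x y. x \<in> carr X \<and> y \<in> carr Y}) fscl"

text \<open>The linear map \<open>X \<otimes> Y \<rightarrow> Z\<close> induced by a bilinear map \<open>b : X \<times> Y \<rightarrow> Z\<close>.\<close>

definition tlift ::
    "('k::field, 'a::ab_group_add) vs \<Rightarrow> ('k, 'b::ab_group_add) vs \<Rightarrow> ('k, 'c::ab_group_add) vs
     \<Rightarrow> ('a \<Rightarrow> 'b \<Rightarrow> 'c) \<Rightarrow> ('k, ('k, 'a, 'b) tensor, 'c) lmap" where
  "tlift X Y Z b = LMap (X \<otimes> Y) Z (\<lambda>t. if t \<in> carr (X \<otimes> Y) then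
     (THE z. \<exists>(n::nat) x y. (\<forall>i<n. x i \<in> carr X \<and> y i \<in> carr Y) \<and>
        t = (\<Sum>i<n. tens X Y (x i) (y i)) \<and> z = (\<Sum>i<n. b (x i) (y i))) else 0)"

lemma vector_space_fscl: "vector_space (fscl :: 'k::field \<Rightarrow> ('a \<Rightarrow> 'k) \<Rightarrow> _)"
  by unfold_locales (auto simp: fun_eq_iff algebra_simps)

lemma vspace_tprod:
  fixes X :: "('k::field, 'a::ab_group_add) vs" and Y :: "('k, 'b::ab_group_add) vs"
  shows "vspace (X \<otimes> Y)"
proof -
  interpret vector_space "fscl :: 'k \<Rightarrow> ('k, 'a, 'b) tensor \<Rightarrow> _" by (rule vector_space_fscl)
  show ?thesis unfolding vspace_def tprod_def
    by (simp add: vector_space_fscl subspace_span)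
qed

lemma tens_in:
  fixes X :: "('k::field, 'a::ab_group_add) vs" and Y :: "('k, 'b::ab_group_add) vs"
  assumes "x \<in> carr X" "y \<in> carr Y"
  shows "tens X Y x y \<in> carr (X \<otimes> Y)"
proof -
  interpret vector_space "fscl :: 'k \<Rightarrow> ('k, 'a, 'b) tensor \<Rightarrow> _" by (rule vector_space_fscl)
  show ?thesis using assms unfolding tprod_def vs.sel by (intro span_base) blast
qed

lemma bilin_tens: "bilin X Y (X \<otimes> Y) (tens X Y)"
proof -
  have sc: "scl (X \<otimes> Y) = fscl" by (simp add: tprod_def)
  have *: "b (x + x') y = b x y + b x' y" "b x (y + y') = b x y + b x y'"
    "b (scl X c x) y = c * b x y" "b x (scl Y c y) = c * b x y"
    if "bilin X Y base_field b" "x \<in> carr X" "x' \<in> carr X" "y \<in> carr Y" "y' \<in> carr Y"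
    for b x x' y y' c
    using that unfolding bilin_def base_field_def by simp_all
  show ?thesis
    unfolding bilin_def[where Z="X \<otimes> Y"] sc
  proof (intro conjI ballI allI)
    fix x y assume "x \<in> carr X" "y \<in> carr Y"
    then show "tens X Y x y \<in> carr (X \<otimes> Y)" by (rule tens_in)
  qed (auto simp: tens_def fun_eq_iff *)
qed

definition trep where
  "trep X Y t n x y \<longleftrightarrow> (\<forall>i<n. x i \<in> carr X \<and> y i \<in> carr Y) \<and>
     t = (\<Sum>i<(n::nat). tens X Y (x i) (y i))"

lemma trep_add:
  assumes "trep X Y t n x y" "trep X Y t' n' x' y'"
  shows "\<exists>x'' y''. trep X Y (t + t') (n + n') x'' y'' \<and>
     (\<forall>b :: _ \<Rightarrow> _ \<Rightarrow> 'c::ab_group_add. (\<Sum>i<n + n'. b (x'' i) (y'' i)) =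
        (\<Sum>i<n. b (x i) (y i)) + (\<Sum>i<n'. b (x' i) (y' i)))"
proof -
  define x'' where "x'' i = (if i < n then x i else x' (i - n))" for i
  define y'' where "y'' i = (if i < n then y i else y' (i - n))" for i
  have split: "(\<Sum>i<n + n'. F (x'' i) (y'' i)) = (\<Sum>i<n. F (x i) (y i)) + (\<Sum>i<n'. F (x' i) (y' i))"
    for F :: "_ \<Rightarrow> _ \<Rightarrow> 'z::ab_group_add"
  proof -
    have "(\<Sum>i<n + n'. F (x'' i) (y'' i)) =
        (\<Sum>i<n. F (x'' i) (y'' i)) + (\<Sum>i=n..<n + n'. F (x'' i) (y'' i))"
      by (metis atLeast0LessThan le0 le_add1 sum.atLeastLessThan_concat)
    also have "(\<Sum>i=n..<n + n'. F (x'' i) (y'' i)) = (\<Sum>i<n'. F (x' i) (y' i))"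
      using sum.shift_bounds_nat_ivl[of "\<lambda>i. F (x'' i) (y'' i)" 0 n n']
      by (simp add: x''_def y''_def add.commute atLeast0LessThan)
    also have "(\<Sum>i<n. F (x'' i) (y'' i)) = (\<Sum>i<n. F (x i) (y i))"
      by (simp add: x''_def y''_def)
    finally show ?thesis .
  qed
  have "t + t' = (\<Sum>i<n + n'. tens X Y (x'' i) (y'' i))"
    using assms unfolding trep_def split[of "tens X Y"] by blast
  then have "trep X Y (t + t') (n + n') x'' y''"
    using assms unfolding trep_def by (auto simp: x''_def y''_def)
  then show ?thesis using split by blast
qed

lemma trep_scl:
  assumes X: "vspace X" and r: "trep X Y t n x y"
  shows "trep X Y (fscl c t) n (\<lambda>i. scl X c (x i)) y"
proof -
  interpret X: vector_space "scl X" using X by (simp add: vspace_def)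
  have *: "scl X c u \<in> carr X" if "u \<in> carr X" for u
    using X that X.subspace_scale unfolding vspace_def by blast
  have "fscl c (\<Sum>i<k. tens X Y (x i) (y i)) = (\<Sum>i<k. tens X Y (scl X c (x i)) (y i))"
    if "k \<le> n" for k
    using that
  proof (induction k)
    case 0
    show ?case by (simp add: fun_eq_iff)
  next
    case (Suc k)
    then have "x k \<in> carr X" "y k \<in> carr Y" using r by (auto simp: trep_def)
    then have "tens X Y (scl X c (x k)) (y k) = fscl c (tens X Y (x k) (y k))"
      using bilin_tens[of X Y] unfolding bilin_def[where Z="X \<otimes> Y"] by (simp add: tprod_def)
    with Suc show ?case by (simp add: fun_eq_iff algebra_simps)
  qed
  from this[of n] show ?thesis using r * by (simp add: trep_def)
qed

lemma trep_exists:
  fixes X :: "('k::field, 'a::ab_group_add) vs" and Y :: "('k, 'b::ab_group_add) vs"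
  assumes X: "vspace X" and t: "t \<in> carr (X \<otimes> Y)"
  shows "\<exists>n x y. trep X Y t n x y"
proof -
  interpret vector_space "fscl :: 'k \<Rightarrow> ('k, 'a, 'b) tensor \<Rightarrow> _" by (rule vector_space_fscl)
  have t': "t \<in> span {tens X Y x y |x y. x \<in> carr X \<and> y \<in> carr Y}"
    using t by (simp add: tprod_def)
  show ?thesis
  proof (rule span_induct_alt[OF t'])
    show "\<exists>n x y. trep X Y 0 n x y" by (rule exI[of _ 0]) (simp add: trep_def)
  next
    fix c s u assume "s \<in> {tens X Y x y |x y. x \<in> carr X \<and> y \<in> carr Y}"
      and u: "\<exists>n x y. trep X Y u n x y"
    then obtain x y where s: "s = tens X Y x y" "x \<in> carr X" "y \<in> carr Y" by blast
    then have "trep X Y s 1 (\<lambda>_. x) (\<lambda>_. y)" by (simp add: trep_def)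
    from trep_scl[OF X this] u show "\<exists>n x y. trep X Y (fscl c s + u) n x y"
      using trep_add by blast
  qed
qed

lemma bilin_sum_unique:
  fixes X :: "('k::field, 'a::ab_group_add) vs" and Y :: "('k, 'b::ab_group_add) vs" and Z :: "('k, 'c::ab_group_add) vs"
  assumes Z: "vspace Z" and b: "bilin X Y Z b"
    and r: "trep X Y t n x y" and r': "trep X Y t n' x' y'"
  shows "(\<Sum>i<n. b (x i) (y i)) = (\<Sum>i<n'. b (x' i) (y' i))"
proof (rule ccontr)
  interpret Z: vector_space "scl Z" using Z by (simp add: vspace_def)
  interpret F: vector_space "(*) :: 'k \<Rightarrow> 'k \<Rightarrow> 'k" by unfold_locales (auto simp: algebra_simps)
  interpret P: vector_space_pair "scl Z" "(*) :: 'k \<Rightarrow> 'k \<Rightarrow> 'k" ..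
  let ?d = "(\<Sum>i<n. b (x i) (y i)) - (\<Sum>i<n'. b (x' i) (y' i))"
  assume "\<not> ?thesis"
  then have "Z.independent {?d}" by (simp add: Z.dependent_single)
  then obtain g where g: "Vector_Spaces.linear (scl Z) (*) g" "g ?d = 1"
    using P.linear_independent_extend[of "{?d}" "\<lambda>_. 1"] by auto
  interpret g: Vector_Spaces.linear "scl Z" "(*)" g by fact
  have gb: "bilin X Y base_field (\<lambda>x y. g (b x y))"
    using b unfolding bilin_def by (simp add: g.add g.scale base_field_def)
  have *: "g (\<Sum>i<m. b (u i) (v i)) = t (\<lambda>x y. g (b x y))" if "trep X Y t m u v" for m u v
  proof -
    have "(\<Sum>i<k. tens X Y (u i) (v i)) (\<lambda>x y. g (b x y)) = (\<Sum>i<k. g (b (u i) (v i)))" for k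
      by (induction k) (auto simp: tens_def gb)
    then show ?thesis using that unfolding trep_def by (simp add: g.sum)
  qed
  show False using g(2) *[OF r] *[OF r'] by (simp add: g.diff)
qed

lemma tlift_app:
  assumes X: "vspace X" and Z: "vspace Z" and b: "bilin X Y Z b" and r: "trep X Y t n x y"
    and t: "t \<in> carr (X \<otimes> Y)"
  shows "app (tlift X Y Z b) t = (\<Sum>i<n. b (x i) (y i))"
proof -
  have "(THE z. \<exists>(n::nat) x y. (\<forall>i<n. x i \<in> carr X \<and> y i \<in> carr Y) \<and>
        t = (\<Sum>i<n. tens X Y (x i) (y i)) \<and> z = (\<Sum>i<n. b (x i) (y i))) = (\<Sum>i<n. b (x i) (y i))"
  proof (rule the_equality)
    show "\<exists>(n'::nat) x' y'. (\<forall>i<n'. x' i \<in> carr X \<and> y' i \<in> carr Y) \<and>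
        t = (\<Sum>i<n'. tens X Y (x' i) (y' i)) \<and>
        (\<Sum>i<n. b (x i) (y i)) = (\<Sum>i<n'. b (x' i) (y' i))"
      using r unfolding trep_def by - (rule exI[of _ n], rule exI[of _ x], rule exI[of _ y], blast)
  next
    fix z assume "\<exists>(n::nat) x y. (\<forall>i<n. x i \<in> carr X \<and> y i \<in> carr Y) \<and>
        t = (\<Sum>i<n. tens X Y (x i) (y i)) \<and> z = (\<Sum>i<n. b (x i) (y i))"
    then obtain n' x' y' where "trep X Y t n' x' y'" "z = (\<Sum>i<n'. b (x' i) (y' i))"
      unfolding trep_def by blast
    then show "z = (\<Sum>i<n. b (x i) (y i))" using bilin_sum_unique[OF Z b _ r] by blast
  qed
  then show ?thesis unfolding tlift_def using t by simp
qed

lemma tlift_tens: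
  assumes "vspace X" "vspace Z" "bilin X Y Z b" "x \<in> carr X" "y \<in> carr Y"
  shows "app (tlift X Y Z b) (tens X Y x y) = b x y"
  using tlift_app[OF assms(1,2,3), where n=1 and x="\<lambda>_. x" and y="\<lambda>_. y"] assms(4,5)
  by (simp add: trep_def tens_in)

lemma tlift_hom:
  fixes X :: "('k::field, 'a::ab_group_add) vs" and Y :: "('k, 'b::ab_group_add) vs" and Z :: "('k, 'c::ab_group_add) vs"
  assumes X: "vspace X" and Z: "vspace Z" and b: "bilin X Y Z b"
  shows "tlift X Y Z b \<in> hom (X \<otimes> Y) Z"
proof -
  interpret Z: vector_space "scl Z" using Z by (simp add: vspace_def)
  interpret T: vector_space "fscl :: 'k \<Rightarrow> ('k, 'a, 'b) tensor \<Rightarrow> _" by (rule vector_space_fscl)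
  have subT: "T.subspace (carr (X \<otimes> Y))" by (simp add: tprod_def T.subspace_span)
  have subZ: "Z.subspace (carr Z)" using Z by (simp add: vspace_def)
  let ?L = "app (tlift X Y Z b)"
  have in_Z: "?L t \<in> carr Z" if t: "t \<in> carr (X \<otimes> Y)" for t
  proof -
    obtain n x y where r: "trep X Y t n x y" using trep_exists[OF X t] by blast
    show ?thesis unfolding tlift_app[OF X Z b r t]
      using r b unfolding trep_def bilin_def by (intro Z.subspace_sum[OF subZ]) auto
  qed
  have add: "?L (t + t') = ?L t + ?L t'" if t: "t \<in> carr (X \<otimes> Y)" "t' \<in> carr (X \<otimes> Y)" for t t'
  proof -
    obtain n x y where r: "trep X Y t n x y" using trep_exists[OF X t(1)] by blast
    obtain n' x' y' where r': "trep X Y t' n' x' y'" using trep_exists[OF X t(2)] by blast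
    obtain x'' y'' where "trep X Y (t + t') (n + n') x'' y''"
      "(\<Sum>i<n + n'. b (x'' i) (y'' i)) = (\<Sum>i<n. b (x i) (y i)) + (\<Sum>i<n'. b (x' i) (y' i))"
      using trep_add[OF r r'] by blast
    with r r' t show ?thesis
      by (simp add: tlift_app[OF X Z b] T.subspace_add[OF subT])
  qed
  have scale: "?L (fscl c t) = scl Z c (?L t)" if t: "t \<in> carr (X \<otimes> Y)" for c t
  proof -
    obtain n x y where r: "trep X Y t n x y" using trep_exists[OF X t] by blast
    have "?L (fscl c t) = (\<Sum>i<n. b (scl X c (x i)) (y i))"
      by (rule tlift_app[OF X Z b trep_scl[OF X r]]) (rule T.subspace_scale[OF subT t])
    also have "\<dots> = (\<Sum>i<n. scl Z c (b (x i) (y i)))"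
      using r b by (intro sum.cong) (auto simp: trep_def bilin_def)
    finally show ?thesis by (simp add: tlift_app[OF X Z b r t] Z.scale_sum_right)
  qed
  have "scl (X \<otimes> Y) = fscl" by (simp add: tprod_def)
  then show ?thesis unfolding hom_def using in_Z add scale by (auto simp: tlift_def)
qed

lemma tlift_unique:
  fixes X :: "('k::field, 'a::ab_group_add) vs" and Y :: "('k, 'b::ab_group_add) vs" and Z :: "('k, 'c::ab_group_add) vs"
  assumes X: "vspace X" and Z: "vspace Z" and b: "bilin X Y Z b"
    and f: "f \<in> hom (X \<otimes> Y) Z"
    and fb: "\<And>x y. x \<in> carr X \<Longrightarrow> y \<in> carr Y \<Longrightarrow> app f (tens X Y x y) = b x y"
  shows "f = tlift X Y Z b"
proof -
  interpret T: vector_space "fscl :: 'k \<Rightarrow> ('k, 'a, 'b) tensor \<Rightarrow> _" by (rule vector_space_fscl)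
  have subT: "T.subspace (carr (X \<otimes> Y))" by (simp add: tprod_def T.subspace_span)
  let ?L = "tlift X Y Z b"
  have L: "?L \<in> hom (X \<otimes> Y) Z" by (rule tlift_hom[OF X Z b])
  have "app f (0 + 0) = app f 0 + app f 0"
    using f T.subspace_0[OF subT] unfolding hom_def by blast
  then have f0: "app f 0 = 0" by simp
  have "app f t = app ?L t" for t
  proof (cases "t \<in> carr (X \<otimes> Y)")
    case True
    obtain n x y where r: "trep X Y t n x y" using trep_exists[OF X True] by blast
    have "(\<Sum>i<k. tens X Y (x i) (y i)) \<in> carr (X \<otimes> Y) \<and>
        app f (\<Sum>i<k. tens X Y (x i) (y i)) = (\<Sum>i<k. b (x i) (y i))" if "k \<le> n" for k
      using that
    proof (induction k)
      case 0
      show ?case unfolding lessThan_0 sum.empty using T.subspace_0[OF subT] f0 by blast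
    next
      case (Suc k)
      then have "x k \<in> carr X" "y k \<in> carr Y" using r by (auto simp: trep_def)
      with Suc have *: "(\<Sum>i<k. tens X Y (x i) (y i)) \<in> carr (X \<otimes> Y)"
        "tens X Y (x k) (y k) \<in> carr (X \<otimes> Y)"
        "app f (\<Sum>i<k. tens X Y (x i) (y i)) = (\<Sum>i<k. b (x i) (y i))"
        "app f (tens X Y (x k) (y k)) = b (x k) (y k)"
        by (simp_all add: fb tens_in)
      have "\<forall>t\<in>carr (X \<otimes> Y). \<forall>t'\<in>carr (X \<otimes> Y). app f (t + t') = app f t + app f t'"
        using f unfolding hom_def by blast
      from this[rule_format, OF *(1,2)] show ?case
        unfolding sum.lessThan_Suc *(3,4) using T.subspace_add[OF subT *(1,2)] by blast
    qed
    from this[of n] show ?thesis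
      using r unfolding tlift_app[OF X Z b r True] trep_def by blast
  next
    case False
    then show ?thesis using f L by (simp add: hom_def)
  qed
  then have "app f = app ?L" by (rule ext)
  moreover have "src f = src ?L" "trg f = trg ?L" using f L by (simp_all add: hom_def)
  ultimately show ?thesis by (rule lmap.expand[OF conjI[OF _ conjI], rotated 2])
qed

text \<open>For a bilinear form \<open>b\<close>, the induced functional on \<open>X \<otimes> Y\<close> is evaluation at \<open>b\<close>, by
  construction of \<open>X \<otimes> Y\<close>.\<close>

definition tform ::
    "('k::field, 'a::ab_group_add) vs \<Rightarrow> ('k, 'b::ab_group_add) vs \<Rightarrow> ('a \<Rightarrow> 'b \<Rightarrow> 'k)
     \<Rightarrow> ('k, 'a, 'b) tensor \<Rightarrow> 'k" where
  "tform X Y b = (\<lambda>t. if t \<in> carr (X \<otimes> Y) then t b else 0)"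

definition tmap ::
    "('k::field, 'a::ab_group_add, 'c::ab_group_add) lmap
     \<Rightarrow> ('k, 'b::ab_group_add, 'd::ab_group_add) lmap
     \<Rightarrow> ('k, ('k, 'a, 'b) tensor, ('k, 'c, 'd) tensor) lmap" (infixr "\<otimes>\<^sub>m" 75) where
  "f \<otimes>\<^sub>m g = tlift (src f) (src g) (trg f \<otimes> trg g)
     (\<lambda>x y. tens (trg f) (trg g) (app f x) (app g y))"

text \<open>The canonical isomorphisms \<open>(X \<otimes> Y) \<otimes> Z \<cong> X \<otimes> (Y \<otimes> Z)\<close>, \<open>K \<otimes> X \<cong> X\<close> and \<open>X \<otimes> K \<cong> X\<close>,
  which are implicit in the usual notation.\<close>

definition assoc where
  "assoc X Y Z = tlift (X \<otimes> Y) Z (X \<otimes> (Y \<otimes> Z))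
     (\<lambda>t z. app (tlift X Y (X \<otimes> (Y \<otimes> Z)) (\<lambda>x y. tens X (Y \<otimes> Z) x (tens Y Z y z))) t)"

definition unassoc where
  "unassoc X Y Z = tlift X (Y \<otimes> Z) ((X \<otimes> Y) \<otimes> Z)
     (\<lambda>x t. app (tlift Y Z ((X \<otimes> Y) \<otimes> Z) (\<lambda>y z. tens (X \<otimes> Y) Z (tens X Y x y) z)) t)"

definition lunit where
  "lunit X = tlift base_field X X (\<lambda>c x. scl X c x)"

definition runit where
  "runit X = tlift X base_field X (\<lambda>x c. scl X c x)"

text \<open>For \<open>p : Y \<otimes> Z \<rightarrow> Z \<otimes> Y\<close>: \<open>id \<otimes> p : (X \<otimes> Y) \<otimes> Z \<rightarrow> (X \<otimes> Z) \<otimes> Y\<close>.\<close>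

definition idt where
  "idt X Y Z p = unassoc X Z Y \<odot> (idm X \<otimes>\<^sub>m p) \<odot> assoc X Y Z"

text \<open>For \<open>p : B \<otimes> C \<rightarrow> C \<otimes> B\<close>: \<open>id \<otimes> p \<otimes> id : (A \<otimes> B) \<otimes> (C \<otimes> D) \<rightarrow> (A \<otimes> C) \<otimes> (B \<otimes> D)\<close>.\<close>

definition mid where
  "mid A B C D p = assoc (A \<otimes> C) B D \<odot> (idt A B C p \<otimes>\<^sub>m idm D) \<odot> unassoc (A \<otimes> B) C D"


section \<open>Braided vector spaces and compatibility conditions\<close>

text \<open>The braid equations are stated on triple tensor products bracketed to the left,
  \<open>(X \<otimes> Y) \<otimes> Z\<close>.\<close>

definition braided where
  "braided V p \<longleftrightarrow> vspace V \<and> p \<in> iso (V \<otimes> V) (V \<otimes> V) \<and>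
     (p \<otimes>\<^sub>m idm V) \<odot> idt V V V p \<odot> (p \<otimes>\<^sub>m idm V) =
     idt V V V p \<odot> (p \<otimes>\<^sub>m idm V) \<odot> idt V V V p"

text \<open>\<open>W\<close> is a left \<open>V\<close>-braided vector space with \<open>p = \<Psi>\<^sub>V\<^sub>V\<close> and \<open>q = \<Psi>\<^sub>V\<^sub>W\<close>.\<close>

definition left_braided where
  "left_braided V p W q \<longleftrightarrow> braided V p \<and> vspace W \<and> q \<in> iso (V \<otimes> W) (W \<otimes> V) \<and>
     (q \<otimes>\<^sub>m idm V) \<odot> idt V V W q \<odot> (p \<otimes>\<^sub>m idm W) =
     idt W V V p \<odot> (q \<otimes>\<^sub>m idm V) \<odot> idt V V W q"

text \<open>\<open>V\<close> is a right \<open>W\<close>-braided vector space with \<open>p = \<Psi>\<^sub>W\<^sub>W\<close> and \<open>q = \<Psi>\<^sub>V\<^sub>W\<close>.\<close>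

definition right_braided where
  "right_braided W p V q \<longleftrightarrow> braided W p \<and> vspace V \<and> q \<in> iso (V \<otimes> W) (W \<otimes> V) \<and>
     idt W V W q \<odot> (q \<otimes>\<^sub>m idm W) \<odot> idt V W W p =
     (p \<otimes>\<^sub>m idm V) \<odot> idt W V W q \<odot> (q \<otimes>\<^sub>m idm W)"

text \<open>Algebras are associative; the unit is optional: \<open>u = Some e\<close> means that \<open>1 = e\<close> is the unit,
  \<open>u = None\<close> that no unit is required.\<close>

definition algebra where
  "algebra A m u \<longleftrightarrow> vspace A \<and> m \<in> hom (A \<otimes> A) A \<and>
     m \<odot> (m \<otimes>\<^sub>m idm A) = m \<odot> (idm A \<otimes>\<^sub>m m) \<odot> assoc A A A \<and>
     (\<forall>e. u = Some e \<longrightarrow> e \<in> carr A \<and>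
        (\<forall>a\<in>carr A. app m (tens A A e a) = a \<and> app m (tens A A a e) = a))"

definition coalgebra where
  "coalgebra C \<Delta> \<epsilon> \<longleftrightarrow> vspace C \<and> \<Delta> \<in> hom C (C \<otimes> C) \<and> \<epsilon> \<in> hom C base_field \<and>
     assoc C C C \<odot> (\<Delta> \<otimes>\<^sub>m idm C) \<odot> \<Delta> = (idm C \<otimes>\<^sub>m \<Delta>) \<odot> \<Delta> \<and>
     lunit C \<odot> (\<epsilon> \<otimes>\<^sub>m idm C) \<odot> \<Delta> = idm C \<and>
     runit C \<odot> (idm C \<otimes>\<^sub>m \<epsilon>) \<odot> \<Delta> = idm C"

text \<open>Compatibility of \<open>p : V \<otimes> W \<rightarrow> W \<otimes> V\<close> with the multiplication of \<open>V\<close>, the multiplication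
  of \<open>W\<close>, the comultiplication of \<open>V\<close> and the comultiplication of \<open>W\<close>, respectively.\<close>

definition compat_mult_left where
  "compat_mult_left V m u W p \<longleftrightarrow>
     p \<odot> (m \<otimes>\<^sub>m idm W) = (idm W \<otimes>\<^sub>m m) \<odot> assoc W V V \<odot> (p \<otimes>\<^sub>m idm V) \<odot> idt V V W p \<and>
     (\<forall>e. u = Some e \<longrightarrow> (\<forall>w\<in>carr W. app p (tens V W e w) = tens W V w e))"

definition compat_mult_right where
  "compat_mult_right V W m u p \<longleftrightarrow>
     p \<odot> (idm V \<otimes>\<^sub>m m) \<odot> assoc V W W = (m \<otimes>\<^sub>m idm V) \<odot> idt W V W p \<odot> (p \<otimes>\<^sub>m idm W) \<and>
     (\<forall>e. u = Some e \<longrightarrow> (\<forall>v\<in>carr V. app p (tens V W v e) = tens W V e v))"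

definition compat_comult_left where
  "compat_comult_left V \<Delta> \<epsilon> W p \<longleftrightarrow>
     unassoc W V V \<odot> (idm W \<otimes>\<^sub>m \<Delta>) \<odot> p = (p \<otimes>\<^sub>m idm V) \<odot> idt V V W p \<odot> (\<Delta> \<otimes>\<^sub>m idm W) \<and>
     runit W \<odot> (idm W \<otimes>\<^sub>m \<epsilon>) \<odot> p = lunit W \<odot> (\<epsilon> \<otimes>\<^sub>m idm W)"

definition compat_comult_right where
  "compat_comult_right V W \<Delta> \<epsilon> p \<longleftrightarrow>
     (\<Delta> \<otimes>\<^sub>m idm V) \<odot> p = idt W V W p \<odot> (p \<otimes>\<^sub>m idm W) \<odot> unassoc V W W \<odot> (idm V \<otimes>\<^sub>m \<Delta>) \<and>
     lunit V \<odot> (\<epsilon> \<otimes>\<^sub>m idm V) \<odot> p = runit V \<odot> (idm V \<otimes>\<^sub>m \<epsilon>)"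

definition braided_algebra where
  "braided_algebra A m u p \<longleftrightarrow> braided A p \<and> algebra A m u \<and>
     compat_mult_left A m u A p \<and> compat_mult_right A A m u p"

definition braided_coalgebra where
  "braided_coalgebra C \<Delta> \<epsilon> p \<longleftrightarrow> braided C p \<and> coalgebra C \<Delta> \<epsilon> \<and>
     compat_comult_left C \<Delta> \<epsilon> C p \<and> compat_comult_right C C \<Delta> \<epsilon> p"

definition braided_bialgebra where
  "braided_bialgebra H m e \<Delta> \<epsilon> p \<longleftrightarrow>
     braided_algebra H m (Some e) p \<and> braided_coalgebra H \<Delta> \<epsilon> p \<and>
     \<Delta> \<odot> m = (m \<otimes>\<^sub>m m) \<odot> mid H H H H p \<odot> (\<Delta> \<otimes>\<^sub>m \<Delta>) \<and>
     app \<Delta> e = tens H H e e \<and>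
     (\<forall>a\<in>carr H. \<forall>b\<in>carr H. app \<epsilon> (app m (tens H H a b)) = app \<epsilon> a * app \<epsilon> b) \<and>
     app \<epsilon> e = 1"

text \<open>The product of \<open>U\<^sup>(\<^sup>2\<^sup>,\<^sup>-\<^sup>2\<^sup>)\<close> and its coproduct \<open>\<Psi>\<^sup>-\<^sup>2 \<Delta>\<close>.\<close>

definition tw_mult where
  "tw_mult p m = m \<odot> p \<odot> p"

definition tw_comult where
  "tw_comult p \<Delta> = linv p \<odot> linv p \<odot> \<Delta>"


section \<open>Braided modules, comodules, module algebras and comodule algebras\<close>

definition braided_left_module where
  "braided_left_module A m e p W q \<nu> \<longleftrightarrow>
     braided_algebra A m (Some e) p \<and> left_braided A p W q \<and> compat_mult_left A m (Some e) W q \<and>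
     \<nu> \<in> hom (A \<otimes> W) W \<and>
     \<nu> \<odot> (idm A \<otimes>\<^sub>m \<nu>) \<odot> assoc A A W = \<nu> \<odot> (m \<otimes>\<^sub>m idm W) \<and>
     (\<forall>w\<in>carr W. app \<nu> (tens A W e w) = w) \<and>
     q \<odot> (idm A \<otimes>\<^sub>m \<nu>) \<odot> assoc A A W = (\<nu> \<otimes>\<^sub>m idm A) \<odot> idt A A W q \<odot> (p \<otimes>\<^sub>m idm W)"

definition braided_right_module where
  "braided_right_module A m e p V q \<nu> \<longleftrightarrow>
     braided_algebra A m (Some e) p \<and> right_braided A p V q \<and> compat_mult_right V A m (Some e) q \<and>
     \<nu> \<in> hom (V \<otimes> A) V \<and>
     \<nu> \<odot> (\<nu> \<otimes>\<^sub>m idm A) = \<nu> \<odot> (idm V \<otimes>\<^sub>m m) \<odot> assoc V A A \<and>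
     (\<forall>v\<in>carr V. app \<nu> (tens V A v e) = v) \<and>
     q \<odot> (\<nu> \<otimes>\<^sub>m idm A) =
       (idm A \<otimes>\<^sub>m \<nu>) \<odot> assoc A V A \<odot> (q \<otimes>\<^sub>m idm A) \<odot> idt V A A p"

definition braided_right_comodule where
  "braided_right_comodule H \<Delta> \<epsilon> p V q \<rho> \<longleftrightarrow>
     braided_coalgebra H \<Delta> \<epsilon> p \<and> left_braided H p V q \<and> compat_comult_left H \<Delta> \<epsilon> V q \<and>
     \<rho> \<in> hom V (V \<otimes> H) \<and>
     (\<rho> \<otimes>\<^sub>m idm H) \<odot> \<rho> = unassoc V H H \<odot> (idm V \<otimes>\<^sub>m \<Delta>) \<odot> \<rho> \<and>
     runit V \<odot> (idm V \<otimes>\<^sub>m \<epsilon>) \<odot> \<rho> = idm V \<and>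
     (\<rho> \<otimes>\<^sub>m idm H) \<odot> q = idt V H H p \<odot> (q \<otimes>\<^sub>m idm H) \<odot> unassoc H V H \<odot> (idm H \<otimes>\<^sub>m \<rho>)"

definition braided_left_comodule where
  "braided_left_comodule H \<Delta> \<epsilon> p V q \<rho> \<longleftrightarrow>
     braided_coalgebra H \<Delta> \<epsilon> p \<and> right_braided H p V q \<and> compat_comult_right V H \<Delta> \<epsilon> q \<and>
     \<rho> \<in> hom V (H \<otimes> V) \<and>
     (idm H \<otimes>\<^sub>m \<rho>) \<odot> \<rho> = assoc H H V \<odot> (\<Delta> \<otimes>\<^sub>m idm V) \<odot> \<rho> \<and>
     lunit V \<odot> (\<epsilon> \<otimes>\<^sub>m idm V) \<odot> \<rho> = idm V \<and>
     (idm H \<otimes>\<^sub>m \<rho>) \<odot> q = assoc H H V \<odot> (p \<otimes>\<^sub>m idm V) \<odot> idt H V H q \<odot> (\<rho> \<otimes>\<^sub>m idm H)"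

definition braided_left_module_algebra where
  "braided_left_module_algebra H m e \<Delta> \<epsilon> p B mB uB pB q \<nu> \<longleftrightarrow>
     braided_bialgebra H m e \<Delta> \<epsilon> p \<and> braided_algebra B mB uB pB \<and>
     compat_mult_left H m (Some e) B q \<and> compat_mult_right H B mB uB q \<and>
     compat_comult_left H \<Delta> \<epsilon> B q \<and>
     braided_left_module H m e p B q \<nu> \<and>
     \<nu> \<odot> (idm H \<otimes>\<^sub>m mB) =
       mB \<odot> (\<nu> \<otimes>\<^sub>m \<nu>) \<odot> mid H H B B q \<odot> (\<Delta> \<otimes>\<^sub>m idm (B \<otimes> B)) \<and>
     (\<forall>b. uB = Some b \<longrightarrow> (\<forall>h\<in>carr H. app \<nu> (tens H B h b) = scl B (app \<epsilon> h) b))"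

definition braided_right_comodule_algebra where
  "braided_right_comodule_algebra H m e \<Delta> \<epsilon> p B mB uB pB q \<rho> \<longleftrightarrow>
     braided_bialgebra H m e \<Delta> \<epsilon> p \<and> braided_algebra B mB uB pB \<and>
     compat_mult_left H m (Some e) B q \<and> compat_mult_right H B mB uB q \<and>
     compat_comult_left H \<Delta> \<epsilon> B q \<and>
     braided_right_comodule H \<Delta> \<epsilon> p B q \<rho> \<and>
     \<rho> \<odot> mB = (mB \<otimes>\<^sub>m m) \<odot> mid B H B H q \<odot> (\<rho> \<otimes>\<^sub>m \<rho>) \<and>
     (\<forall>b. uB = Some b \<longrightarrow> app \<rho> b = tens B H b e)"

definition braided_right_module_algebra where
  "braided_right_module_algebra H m e \<Delta> \<epsilon> p B mB uB pB q \<nu> \<longleftrightarrow>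
     braided_bialgebra H m e \<Delta> \<epsilon> p \<and> braided_algebra B mB uB pB \<and>
     compat_mult_right B H m (Some e) q \<and> compat_mult_left B mB uB H q \<and>
     compat_comult_right B H \<Delta> \<epsilon> q \<and>
     braided_right_module H m e p B q \<nu> \<and>
     \<nu> \<odot> (mB \<otimes>\<^sub>m idm H) =
       mB \<odot> (\<nu> \<otimes>\<^sub>m \<nu>) \<odot> mid B B H H q \<odot> (idm (B \<otimes> B) \<otimes>\<^sub>m \<Delta>) \<and>
     (\<forall>b. uB = Some b \<longrightarrow> (\<forall>h\<in>carr H. app \<nu> (tens B H b h) = scl B (app \<epsilon> h) b))"

definition braided_left_comodule_algebra where
  "braided_left_comodule_algebra H m e \<Delta> \<epsilon> p B mB uB pB q \<rho> \<longleftrightarrow>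
     braided_bialgebra H m e \<Delta> \<epsilon> p \<and> braided_algebra B mB uB pB \<and>
     compat_mult_right B H m (Some e) q \<and> compat_mult_left B mB uB H q \<and>
     compat_comult_right B H \<Delta> \<epsilon> q \<and>
     braided_left_comodule H \<Delta> \<epsilon> p B q \<rho> \<and>
     \<rho> \<odot> mB = (m \<otimes>\<^sub>m mB) \<odot> mid H B H B q \<odot> (\<rho> \<otimes>\<^sub>m \<rho>) \<and>
     (\<forall>b. uB = Some b \<longrightarrow> app \<rho> b = tens H B e b)"


section \<open>Duality\<close>

definition nondegenerate where
  "nondegenerate U H \<longleftrightarrow> (\<forall>x\<in>carr H. \<forall>y\<in>carr H. x \<noteq> y \<longrightarrow> (\<exists>f\<in>carr U. f x \<noteq> f y))"

text \<open>\<open>\<langle>\<langle>\<xi> \<otimes> \<eta>, t\<rangle>\<rangle>\<close> for functionals \<open>\<xi>\<close> on \<open>Y\<close>, \<open>\<eta>\<close> on \<open>X\<close> and \<open>t\<close> in \<open>X \<otimes> Y\<close>, and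
  \<open>\<langle>\<langle>t, a \<otimes> b\<rangle>\<rangle>\<close> for \<open>t\<close> in a tensor product of two spaces of functionals. A tensor is evaluated at the
  bilinear form that defines the pairing.\<close>

definition tpair :: "('b \<Rightarrow> 'k::field) \<Rightarrow> ('a \<Rightarrow> 'k) \<Rightarrow> ('k, 'a, 'b) tensor \<Rightarrow> 'k" where
  "tpair \<xi> \<eta> t = t (\<lambda>x y. \<xi> y * \<eta> x)"

definition tpair' :: "('k, 'b \<Rightarrow> 'k, 'a \<Rightarrow> 'k) tensor \<Rightarrow> 'a \<Rightarrow> 'b \<Rightarrow> 'k::field" where
  "tpair' t a b = t (\<lambda>\<xi> \<eta>. \<xi> b * \<eta> a)"

text \<open>The embedding \<open>X \<otimes> Y \<rightarrow> (P \<otimes> Q)'\<close> given by pairings of \<open>X\<close> with \<open>P\<close> and of \<open>Y\<close> with \<open>Q\<close>. The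
  pairings used are \<open>ev\<close> (functionals with vectors) and \<open>coev\<close> (vectors with functionals).\<close>

definition temb where
  "temb X Y P Q s t =
     tlift X Y (dual (P \<otimes> Q)) (\<lambda>\<xi> \<eta>. tform P Q (\<lambda>x y. s \<xi> x * t \<eta> y))"

definition ev :: "('a \<Rightarrow> 'k) \<Rightarrow> 'a \<Rightarrow> 'k" where "ev f a = f a"

definition coev :: "'a \<Rightarrow> ('a \<Rightarrow> 'k) \<Rightarrow> 'k" where "coev a f = f a"

text \<open>Let \<open>j\<close> be an embedding into a dual space and \<open>f\<close> a linear map with values in this dual space.
  \<open>corestrict j f\<close> is \<open>f\<close> viewed as a map into the source of \<open>j\<close> if the image of \<open>f\<close> lies in the
  image of \<open>j\<close>. \<open>bij_onto j f\<close> says that \<open>f\<close> is a bijection onto the embedded source of \<open>j\<close>.\<close>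

definition corestrict ::
    "('k, 'b, 'd) lmap \<Rightarrow> ('k, 'a, 'd) lmap \<Rightarrow> ('k, 'a, 'b::zero) lmap" where
  "corestrict j f = LMap (src f) (src j)
     (\<lambda>x. if x \<in> carr (src f) then inv_into (carr (src j)) (app j) (app f x) else 0)"

definition bij_onto :: "('k, 'b, 'd) lmap \<Rightarrow> ('k, 'a, 'd) lmap \<Rightarrow> bool" where
  "bij_onto j f \<longleftrightarrow> bij_betw (app f) (carr (src f)) (app j ` carr (src j))"

text \<open>The maps \<open>\<Psi>\<^sub>U\<^sub>U\<close>, \<open>\<Psi>\<^sub>U\<^sub>V\<^sup>\<circ>\<close>, \<open>\<Psi>\<^sub>V\<^sub>U\<^sup>\<circ>\<close> with values in \<open>(H \<otimes> H)'\<close>, \<open>(V' \<otimes> H)'\<close>, \<open>(H \<otimes> V')'\<close>,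
  where \<open>p = \<Psi>\<^sub>H\<^sub>H\<close>, and \<open>q = \<Psi>\<^sub>H\<^sub>V\<close> or \<open>q = \<Psi>\<^sub>V\<^sub>H\<close>. The maps \<open>\<Psi>\<^sub>U\<^sub>H\<^sup>\<circ>\<close> and \<open>\<Psi>\<^sub>H\<^sub>U\<^sup>\<circ>\<close> are the special
  cases \<open>V = H\<close>, \<open>q = p\<close>.\<close>

definition raw_UU where
  "raw_UU H p U = tlift U U (dual (H \<otimes> H))
     (\<lambda>f g. tform H H (\<lambda>b a. tpair f g (app p (tens H H a b))))"

definition raw_UV where
  "raw_UV H U V q = tlift U V (dual (dual V \<otimes> H))
     (\<lambda>f v. tform (dual V) H (\<lambda>e a. tpair e f (app (linv q) (tens V H v a))))"

definition raw_VU where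
  "raw_VU H U V q = tlift V U (dual (H \<otimes> dual V))
     (\<lambda>v f. tform H (dual V) (\<lambda>a e. tpair f e (app (linv q) (tens H V a v))))"

abbreviation "emb_UU H U \<equiv> temb U U H H ev ev"
abbreviation "emb_VU H U V \<equiv> temb V U (dual V) H coev ev"
abbreviation "emb_UV H U V \<equiv> temb U V H (dual V) ev coev"

definition UU_bijective where
  "UU_bijective H p U \<longleftrightarrow> bij_onto (emb_UU H U) (raw_UU H p U)"

definition UV_bijective where
  "UV_bijective H U V q \<longleftrightarrow> bij_onto (emb_VU H U V) (raw_UV H U V q)"

definition VU_bijective where
  "VU_bijective H U V q \<longleftrightarrow> bij_onto (emb_UV H U V) (raw_VU H U V q)"

definition braid_UU where
  "braid_UU H p U = corestrict (emb_UU H U) (raw_UU H p U)"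

definition braid_UV where
  "braid_UV H U V q = corestrict (emb_VU H U V) (raw_UV H U V q)"

definition braid_VU where
  "braid_VU H U V q = corestrict (emb_UV H U V) (raw_VU H U V q)"

definition dual_mult_fun where
  "dual_mult_fun H \<Delta> p f g =
     (\<lambda>a. if a \<in> carr H then tpair f g (app (linv p) (app \<Delta> a)) else 0)"

definition dual_mult where
  "dual_mult H \<Delta> p U = tlift U U U (dual_mult_fun H \<Delta> p)"

text \<open>\<open>is_dual_coprod H m p U f t\<close>: the element \<open>t\<close> of \<open>U \<otimes> U\<close> is the coproduct of \<open>f\<close>.\<close>

definition is_dual_coprod where
  "is_dual_coprod H m p U f t \<longleftrightarrow> t \<in> carr (U \<otimes> U) \<and>
     (\<forall>a\<in>carr H. \<forall>b\<in>carr H. tpair' t a b = f (app m (app p (tens H H a b))))"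

definition dual_comult where
  "dual_comult H m p U =
     LMap U (U \<otimes> U) (\<lambda>f. if f \<in> carr U then THE t. is_dual_coprod H m p U f t else 0)"

definition dual_counit :: "'a \<Rightarrow> ('k, 'a \<Rightarrow> 'k) vs \<Rightarrow> ('k::field, 'a \<Rightarrow> 'k, 'k) lmap" where
  "dual_counit e U = LMap U base_field (\<lambda>f. if f \<in> carr U then f e else 0)"

text \<open>\<open>\<Delta>\<^sub>-\<^sub>2 = \<Psi>\<^sub>U\<^sub>U\<^sup>-\<^sup>2 \<Delta>\<close>, where \<open>\<Delta>\<close> is \<open>dual_comult\<close>.\<close>

definition dual_comult2 where
  "dual_comult2 H m p U = tw_comult (braid_UU H p U) (dual_comult H m p U)"

definition comult_closed where
  "comult_closed H m p U \<longleftrightarrow> (\<forall>f\<in>carr U. \<exists>t. is_dual_coprod H m p U f t)"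

text \<open>The largest coalgebra in \<open>H'\<close>, as the union of all coalgebras in \<open>H'\<close>.\<close>

definition finite_dual where
  "finite_dual H m e p = VS (\<Union>{carr C |C. is_subspace C (dual H) \<and> comult_closed H m p C \<and>
     coalgebra C (dual_comult H m p C) (dual_counit e C)}) fscl"

definition is_subcoalgebra where
  "is_subcoalgebra H m e p U \<longleftrightarrow> is_subspace U (finite_dual H m e p) \<and> comult_closed H m p U"

definition standard_dual where
  "standard_dual H m \<Delta> \<epsilon> p U \<longleftrightarrow>
     is_subspace U (dual H) \<and> nondegenerate U H \<and> app \<epsilon> \<in> carr U \<and>
     (\<forall>f\<in>carr U. \<forall>g\<in>carr U. dual_mult_fun H \<Delta> p f g \<in> carr U) \<and>
     comult_closed H m p U \<and> UU_bijective H p U"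

definition standard_left_dual where
  "standard_left_dual H m \<Delta> \<epsilon> p U \<longleftrightarrow> standard_dual H m \<Delta> \<epsilon> p U \<and> UV_bijective H U H p"

definition standard_right_dual where
  "standard_right_dual H m \<Delta> \<epsilon> p U \<longleftrightarrow> standard_dual H m \<Delta> \<epsilon> p U \<and> VU_bijective H U H p"

text \<open>The map \<open>\<rho>\<^sub>R : V \<rightarrow> (V' \<otimes> H)'\<close> obtained from a left action, and \<open>\<rho>\<^sub>L : V \<rightarrow> (H \<otimes> V')'\<close>
  obtained from a right action.\<close>

definition raw_rho_R where
  "raw_rho_R H V q \<nu> = LMap V (dual (dual V \<otimes> H)) (\<lambda>v. if v \<in> carr V then
     tform (dual V) H (\<lambda>e a. e (app \<nu> (app (linv q) (tens V H v a)))) else 0)"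

definition raw_rho_L where
  "raw_rho_L H V q \<nu> = LMap V (dual (H \<otimes> dual V)) (\<lambda>v. if v \<in> carr V then
     tform H (dual V) (\<lambda>a e. e (app \<nu> (app (linv q) (tens H V a v)))) else 0)"

definition rho_R where
  "rho_R H U V q \<nu> = corestrict (emb_VU H U V) (raw_rho_R H V q \<nu>)"

definition rho_L where
  "rho_L H U V q \<nu> = corestrict (emb_UV H U V) (raw_rho_L H V q \<nu>)"

end

theory Submission imports Defs "HOL-Library.Poly_Mapping" begin

text \<open>
Maps between tensor products are read as planar string diagrams. The functionals in \<open>U\<close> are paired with \<open>H\<close> by
an arc \<open>ev\<close>, and the form \<open>\<langle>\<langle>f \<otimes> g, a \<otimes> b\<rangle>\<rangle> = \<langle>f, b\<rangle> \<langle>g, a\<rangle>\<close> consists of two nested arcs. Nested arcs need no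
crossing of strands, so transposition along them makes sense without a flip, and it reverses the order of
composition. Write \<open>P\<close> for the braiding of \<open>H\<close>. The definitions of the maps on \<open>U\<close> say what they are transposes
of:

\<^item> the braiding \<open>R = \<Psi>\<^sub>U\<^sub>U\<close> of \<open>P\<close>, the coproduct of \<open>U\<close> of \<open>m P\<close>, the product of \<open>U\<close> of \<open>P\<^sup>-\<^sup>1 \<Delta>\<close>;
\<^item> the braiding \<open>S = \<Psi>\<^sub>U\<^sub>V\<^sup>\<circ>\<close> of \<open>D = \<Psi>\<^sub>H\<^sub>V\<^sup>-\<^sup>1\<close>, and the coaction \<open>\<rho>\<close> of \<open>\<alpha> = \<nu> D\<close>.

Hence the twisted coproduct \<open>R\<^sup>-\<^sup>2 \<Delta>\<^sub>U\<close> is the transpose of \<open>n = m P\<^sup>-\<^sup>1\<close>, and the twisted product \<open>m\<^sub>U R\<^sup>2\<close> is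
the transpose of \<open>\<delta> = P \<Delta>\<close>. Now \<open>n\<close> and \<open>\<delta>\<close> make \<open>H\<close>, with its old braiding, unit and counit, a braided
bialgebra (lemmas \<open>n_assoc\<close>, \<open>\<delta>_n\<close>), and \<open>\<alpha>\<close> is a right action of the algebra \<open>(H, n)\<close>: moving \<open>v\<close> past \<open>h\<close> by
the inverse braiding turns a left action of \<open>m\<close> into a right action of \<open>m P\<^sup>-\<^sup>1\<close> (lemma \<open>\<alpha>_assoc\<close>), which
respects the product of a module algebra (lemma \<open>\<alpha>_mV\<close>). Every axiom of a braided comodule (algebra) over \<open>U\<close> is
the transpose of a fact of this kind about \<open>H\<close> and \<open>V\<close>. An equation between maps into \<open>W \<otimes> U\<close> follows from its
transpose because evaluation at the elements of \<open>H\<close> separates the elements of \<open>W \<otimes> U\<close>, for every space \<open>W\<close> and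
every space \<open>U\<close> of functionals on \<open>H\<close> (lemma \<open>sepR\<close>). The statement about right modules is the mirror image: it
is the same calculation in the category of reflected diagrams (lemma \<open>mirror\<close>).

Diagrams suppress associativity and unit constraints, which the tensor products of the statement have.
Coordinates remove them. A choice of bases identifies a tensor product of spaces with a span of words in a free
algebra. There the tensor product of elements is the product of the algebra, so associativity holds strictly,
the constraints become identities, and a linear map becomes an arrow between words (predicate \<open>rep\<close>). Two linear
maps are equal if and only if their arrows are (lemma \<open>rep_eq_iff\<close>), and the arrows form a strict monoidal
category, in which the diagrammatic calculation takes place.
\<close>

section \<open>Duality in a strict monoidal category\<close>

text \<open>Objects are words. The diagram \<open>wh L f R\<close> is \<open>f\<close> with strands \<open>L\<close> to its left and \<open>R\<close> to its right. Both
  contexts are listed from \<open>f\<close> outwards, hence \<open>rev L\<close> in the domain. In this way a context grows by appending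
  on both sides, and reflection of diagrams exchanges \<open>L\<close> and \<open>R\<close>.\<close>
locale strict_monoidal =
  fixes arr :: "'m \<Rightarrow> bool" and dm cd :: "'m \<Rightarrow> 'o list"
    and comp :: "'m \<Rightarrow> 'm \<Rightarrow> 'm" (infixr "\<cdot>" 65)
    and idn :: "'o list \<Rightarrow> 'm" and wh :: "'o list \<Rightarrow> 'm \<Rightarrow> 'o list \<Rightarrow> 'm"
  assumes arr_comp [simp]: "arr f \<Longrightarrow> arr g \<Longrightarrow> cd f = dm g \<Longrightarrow> arr (g \<cdot> f)"
    and dm_comp [simp]: "dm (g \<cdot> f) = dm f" and cd_comp [simp]: "cd (g \<cdot> f) = cd g"
    and comp_assoc: "(k \<cdot> g) \<cdot> f = k \<cdot> g \<cdot> f"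
    and arr_idn [simp]: "arr (idn w)" and dm_idn [simp]: "dm (idn w) = w"
    and cd_idn [simp]: "cd (idn w) = w"
    and idn_left [simp]: "arr f \<Longrightarrow> cd f = w \<Longrightarrow> idn w \<cdot> f = f"
    and idn_right [simp]: "arr f \<Longrightarrow> dm f = w \<Longrightarrow> f \<cdot> idn w = f"
    and arr_wh [simp]: "arr f \<Longrightarrow> arr (wh L f R)"
    and dm_wh [simp]: "dm (wh L f R) = rev L @ dm f @ R"
    and cd_wh [simp]: "cd (wh L f R) = rev L @ cd f @ R"
    and wh_idn [simp]: "wh L (idn w) R = idn (rev L @ w @ R)"
    and wh_comp [simp]: "arr f \<Longrightarrow> arr g \<Longrightarrow> cd f = dm g \<Longrightarrow> wh L (g \<cdot> f) R = wh L g R \<cdot> wh L f R"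
    and wh_wh [simp]: "arr f \<Longrightarrow> wh L (wh L' f R') R = wh (L' @ L) f (R' @ R)"
    and wh_Nil [simp]: "arr f \<Longrightarrow> wh [] f [] = f"
    and interchange: "arr f \<Longrightarrow> arr g \<Longrightarrow>
      wh [] f (cd g) \<cdot> wh (rev (dm f)) g [] = wh (rev (cd f)) g [] \<cdot> wh [] f (dm g)"
begin

declare comp_assoc [simp]

text \<open>Diagrams on disjoint strands may be moved past each other: the interchange law, with further strands \<open>N\<close>
  between the two diagrams and around them.\<close>
lemma slide_general:
  assumes "arr f" "arr g" and L': "L' = rev N @ rev (cd f) @ L" and R': "R' = N @ dm g @ R"
  shows "wh L' g R \<cdot> wh L f R' = wh L f (N @ cd g @ R) \<cdot> wh (rev N @ rev (dm f) @ L) g R"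
proof -
  have "wh L (wh [] f (cd (wh (rev N) g R)) \<cdot> wh (rev (dm f)) (wh (rev N) g R) []) [] =
     wh L (wh (rev (cd f)) (wh (rev N) g R) [] \<cdot> wh [] f (dm (wh (rev N) g R))) []"
    using interchange[of f "wh (rev N) g R"] assms by simp
  then show ?thesis using assms by simp
qed

text \<open>The interchange law as a rewrite rule, where \<open>N\<close> is computed from the contexts. Rewriting lets the
  diagram on the right act first. The third assumption excludes a cap and a cup next to each other with nothing
  between them: either may be regarded as the one on the left, and rewriting would not end.\<close>
lemma slide:
  assumes "arr f" "arr g" "R' \<noteq> dm g @ R \<or> cd f \<noteq> [] \<or> dm g \<noteq> []"
    "length (dm g) + length R \<le> length R'"
    "R' = take (length R' - length (dm g) - length R) R' @ dm g @ R"
    "L' = rev (take (length R' - length (dm g) - length R) R') @ rev (cd f) @ L"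
  shows "wh L' g R \<cdot> wh L f R' =
    wh L f (take (length R' - length (dm g) - length R) R' @ cd g @ R) \<cdot>
      wh (rev (take (length R' - length (dm g) - length R) R') @ rev (dm f) @ L) g R"
  using assms(1,2) by (rule slide_general) (use assms in auto)

lemma slide_tail:
  assumes "arr f" "arr g" "R' \<noteq> dm g @ R \<or> cd f \<noteq> [] \<or> dm g \<noteq> []"
    "length (dm g) + length R \<le> length R'"
    "R' = take (length R' - length (dm g) - length R) R' @ dm g @ R"
    "L' = rev (take (length R' - length (dm g) - length R) R') @ rev (cd f) @ L"
  shows "wh L' g R \<cdot> wh L f R' \<cdot> x =
    wh L f (take (length R' - length (dm g) - length R) R' @ cd g @ R) \<cdot>
      wh (rev (take (length R' - length (dm g) - length R) R') @ rev (dm f) @ L) g R \<cdot> x"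
  using slide[OF assms] by (metis comp_assoc)

text \<open>The case in which the context of \<open>g\<close> is empty and \<open>wh [] g []\<close> has been simplified to \<open>g\<close>.\<close>
lemma slide_bare:
  assumes "arr f" "arr g" "cd f = []" "dm g = R"
  shows "g \<cdot> wh [] f R = wh [] f (cd g) \<cdot> wh (rev (dm f)) g []"
  using interchange[of f g] assms by simp

lemma slide_bare_tail:
  assumes "arr f" "arr g" "cd f = []" "dm g = R"
  shows "g \<cdot> wh [] f R \<cdot> x = wh [] f (cd g) \<cdot> wh (rev (dm f)) g [] \<cdot> x"
  using slide_bare[OF assms] by (metis comp_assoc)

lemmas slides = slide slide_tail slide_bare slide_bare_tail

lemma whisker: "f = g \<Longrightarrow> wh L f R = wh L g R" by simp
lemma tail: "f = g \<Longrightarrow> f \<cdot> x = g \<cdot> x" by simp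
lemma whisker_tail: "f = g \<Longrightarrow> wh L f R \<cdot> x = wh L g R \<cdot> x" by simp

text \<open>Cancellation of inverses, by which a compatibility with a braiding becomes one with the inverse braiding.\<close>
lemma conj_inverse:
  assumes e: "X \<cdot> f = g \<cdot> X'" and i: "Y \<cdot> X = idn w" "X' \<cdot> Y' = idn w'"
    and "arr f" "arr g" "cd f = w" "dm g = w'"
  shows "f \<cdot> Y' = Y \<cdot> g"
proof -
  have "f \<cdot> Y' = (Y \<cdot> X) \<cdot> f \<cdot> Y'" using assms by (metis comp_assoc idn_left)
  also have "\<dots> = Y \<cdot> (X \<cdot> f) \<cdot> Y'" by simp
  also have "\<dots> = (Y \<cdot> g) \<cdot> X' \<cdot> Y'" unfolding e by simp
  also have "\<dots> = Y \<cdot> g" unfolding i using assms by simp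
  finally show ?thesis .
qed

text \<open>Reflecting all diagrams from left to right gives a strict monoidal category again. Results about right
  coactions thus become results about left coactions.\<close>
lemma mirror:
  "strict_monoidal arr (\<lambda>f. rev (dm f)) (\<lambda>f. rev (cd f)) comp (\<lambda>w. idn (rev w)) (\<lambda>L f R. wh R f L)"
  by unfold_locales (auto simp: interchange)

end

text \<open>Assumption \<open>adj_R\<close> says that \<open>R\<close> is the transpose of \<open>P\<close> with respect to two nested arcs, and \<open>sep\<close> says
  that a morphism into \<open>W @ [u]\<close> is determined by pairing its last strand with \<open>h\<close>.\<close>
locale dual_pairing = strict_monoidal +
  fixes h u :: 'o and P Pi R Ri ev :: 'm
  assumes typ_P [simp]: "arr P" "dm P = [h,h]" "cd P = [h,h]" "arr Pi" "dm Pi = [h,h]" "cd Pi = [h,h]"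
    and typ_R [simp]: "arr R" "dm R = [u,u]" "cd R = [u,u]" "arr Ri" "dm Ri = [u,u]" "cd Ri = [u,u]"
    and typ_ev [simp]: "arr ev" "dm ev = [u,h]" "cd ev = []"
    and inv_P: "Pi \<cdot> P = idn [h,h]" "P \<cdot> Pi = idn [h,h]"
    and inv_R: "Ri \<cdot> R = idn [u,u]" "R \<cdot> Ri = idn [u,u]"
    and yb: "wh [] P [h] \<cdot> wh [h] P [] \<cdot> wh [] P [h] = wh [h] P [] \<cdot> wh [] P [h] \<cdot> wh [h] P []"
    and adj_R: "ev \<cdot> wh [u] ev [h] \<cdot> wh [] R [h,h] = ev \<cdot> wh [u] ev [h] \<cdot> wh [u,u] P []"
    and sep: "\<And>f g W. arr f \<Longrightarrow> arr g \<Longrightarrow> dm f = dm g \<Longrightarrow> cd f = W @ [u] \<Longrightarrow> cd g = W @ [u] \<Longrightarrow>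
        wh (rev W) ev [] \<cdot> wh [] f [h] = wh (rev W) ev [] \<cdot> wh [] g [h] \<Longrightarrow> f = g"
begin

text \<open>Two strands \<open>u\<close> are paired with two strands \<open>h\<close> by nested arcs, the inner ones first.\<close>
lemma sep2:
  assumes "arr f" "arr g" "dm f = dm g" "cd f = W @ [u,u]" "cd g = W @ [u,u]"
    and "wh (rev W) ev [] \<cdot> wh (u # rev W) ev [h] \<cdot> wh [] f [h,h] =
      wh (rev W) ev [] \<cdot> wh (u # rev W) ev [h] \<cdot> wh [] g [h,h]"
  shows "f = g"
proof (rule sep[of f g "W @ [u]"])
  show "wh (rev (W @ [u])) ev [] \<cdot> wh [] f [h] = wh (rev (W @ [u])) ev [] \<cdot> wh [] g [h]"
    by (rule sep[of _ _ W]) (use assms in simp_all)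
qed (use assms in simp_all)

lemma sep3:
  assumes "arr f" "arr g" "dm f = dm g" "cd f = W @ [u,u,u]" "cd g = W @ [u,u,u]"
    and "wh (rev W) ev [] \<cdot> wh (u # rev W) ev [h] \<cdot> wh (u # u # rev W) ev [h,h] \<cdot> wh [] f [h,h,h] =
      wh (rev W) ev [] \<cdot> wh (u # rev W) ev [h] \<cdot> wh (u # u # rev W) ev [h,h] \<cdot> wh [] g [h,h,h]"
  shows "f = g"
proof (rule sep[of f g "W @ [u,u]"])
  show "wh (rev (W @ [u,u])) ev [] \<cdot> wh [] f [h] = wh (rev (W @ [u,u])) ev [] \<cdot> wh [] g [h]"
    by (rule sep2[of _ _ W]) (use assms in simp_all)
qed (use assms in simp_all)

lemmas yb' = yb tail[OF yb, simplified] whisker[OF yb, simplified] whisker_tail[OF yb, simplified]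
lemmas adj_R' = adj_R tail[OF adj_R, simplified] whisker[OF adj_R, simplified] whisker_tail[OF adj_R, simplified]
lemmas inv_P' = inv_P inv_P[THEN tail, simplified] inv_P[THEN whisker, simplified]
    inv_P[THEN whisker_tail, simplified]
lemmas inv_R' = inv_R inv_R[THEN tail, simplified] inv_R[THEN whisker, simplified]
    inv_R[THEN whisker_tail, simplified]

text \<open>The Yang-Baxter equation is its own transpose.\<close>
lemma yb_R: "wh [] R [u] \<cdot> wh [u] R [] \<cdot> wh [] R [u] = wh [u] R [] \<cdot> wh [] R [u] \<cdot> wh [u] R []"
  by (rule sep3[of _ _ "[]"]) (simp_all add: slides adj_R' yb')

text \<open>In terms of crossings, \<open>P\<^sub>1\<^sub>2 P\<^sub>2\<^sub>3 P\<^sub>1\<^sub>2\<^sup>-\<^sup>1 = P\<^sub>2\<^sub>3\<^sup>-\<^sup>1 P\<^sub>1\<^sub>2 P\<^sub>2\<^sub>3\<close>.\<close>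
lemma yb_mixed:
  "wh [] P [h] \<cdot> wh [h] P [] \<cdot> wh [] Pi [h] = wh [h] Pi [] \<cdot> wh [] P [h] \<cdot> wh [h] P []"
  using conj_inverse[of "wh [h] P []" "wh [] P [h] \<cdot> wh [h] P []" "wh [] P [h] \<cdot> wh [h] P []"
     "wh [] P [h]" "wh [h] Pi []" "[h,h,h]" "wh [] Pi [h]" "[h,h,h]"]
  by (simp add: yb' inv_P')

lemma yb_mixed2:
  "wh [h] P [] \<cdot> wh [] P [h] \<cdot> wh [h] Pi [] = wh [] Pi [h] \<cdot> wh [h] P [] \<cdot> wh [] P [h]"
  using conj_inverse[of "wh [] P [h]" "wh [h] P [] \<cdot> wh [] P [h]" "wh [h] P [] \<cdot> wh [] P [h]"
     "wh [h] P []" "wh [] Pi [h]" "[h,h,h]" "wh [h] Pi []" "[h,h,h]"]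
  by (simp add: yb' inv_P')

lemma yb_inv: "wh [] Pi [h] \<cdot> wh [h] Pi [] \<cdot> wh [] Pi [h] = wh [h] Pi [] \<cdot> wh [] Pi [h] \<cdot> wh [h] Pi []"
  using conj_inverse[of "wh [] P [h] \<cdot> wh [h] P []" "wh [] Pi [h]" "wh [h] Pi []" "wh [] P [h] \<cdot> wh [h] P []" 
   "wh [h] Pi [] \<cdot> wh [] Pi [h]" "[h,h,h]" "wh [h] Pi [] \<cdot> wh [] Pi [h]" "[h,h,h]"]
  by (simp add: yb_mixed inv_P')

lemmas yb_inv' = yb_inv tail[OF yb_inv, simplified] whisker[OF yb_inv, simplified] whisker_tail[OF yb_inv, simplified]
lemmas yb_mixed' = yb_mixed tail[OF yb_mixed, simplified] whisker[OF yb_mixed, simplified]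
    whisker_tail[OF yb_mixed, simplified]
lemmas yb_mixed2' = yb_mixed2 tail[OF yb_mixed2, simplified] whisker[OF yb_mixed2, simplified]
    whisker_tail[OF yb_mixed2, simplified]

end

text \<open>A braided algebra on \<open>h\<close>, and on \<open>u\<close> the transpose \<open>\<Delta>u\<close> of \<open>m P\<close> and the evaluation \<open>\<epsilon>u\<close> at the unit \<open>\<eta>\<close>.\<close>
locale dual_coalgebra = dual_pairing +
  fixes m \<eta> \<Delta>u \<epsilon>u
  assumes typ_m [simp]: "arr m" "dm m = [h,h]" "cd m = [h]" "arr \<eta>" "dm \<eta> = []" "cd \<eta> = [h]"
    and typ_\<Delta>u [simp]: "arr \<Delta>u" "dm \<Delta>u = [u]" "cd \<Delta>u = [u,u]" "arr \<epsilon>u" "dm \<epsilon>u = [u]" "cd \<epsilon>u = []"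
    and m_assoc: "m \<cdot> wh [] m [h] = m \<cdot> wh [h] m []"
    and m_unit: "m \<cdot> wh [] \<eta> [h] = idn [h]" "m \<cdot> wh [h] \<eta> [] = idn [h]"
    and P_m: "P \<cdot> wh [] m [h] = wh [h] m [] \<cdot> wh [] P [h] \<cdot> wh [h] P []"
      "P \<cdot> wh [h] m [] = wh [] m [h] \<cdot> wh [h] P [] \<cdot> wh [] P [h]"
    and P_\<eta>: "P \<cdot> wh [] \<eta> [h] = wh [h] \<eta> []" "P \<cdot> wh [h] \<eta> [] = wh [] \<eta> [h]"
    and adj_\<Delta>u: "ev \<cdot> wh [u] ev [h] \<cdot> wh [] \<Delta>u [h,h] = ev \<cdot> wh [u] m [] \<cdot> wh [u] P []"
    and adj_\<epsilon>u: "\<epsilon>u = ev \<cdot> wh [u] \<eta> []"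
begin

text \<open>Another associative product on \<open>h\<close>. The twisted coproduct \<open>\<Delta>n\<close> below is its transpose.\<close>
definition "n = m \<cdot> Pi"

lemma typ_n [simp]: "arr n" "dm n = [h,h]" "cd n = [h]" by (simp_all add: n_def)

lemma Pi_m: "Pi \<cdot> wh [h] m [] = wh [] m [h] \<cdot> wh [h] Pi [] \<cdot> wh [] Pi [h]"
   "Pi \<cdot> wh [] m [h] = wh [h] m [] \<cdot> wh [] Pi [h] \<cdot> wh [h] Pi []"
proof -
  have "Pi \<cdot> wh [h] m [] = Pi \<cdot> (wh [h] m [] \<cdot> wh [] P [h] \<cdot> wh [h] P []) \<cdot> wh [h] Pi [] \<cdot> wh [] Pi [h]"
    by (simp add: inv_P')
  also have "\<dots> = wh [] m [h] \<cdot> wh [h] Pi [] \<cdot> wh [] Pi [h]"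
    unfolding P_m(1)[symmetric] by (simp add: inv_P')
  finally show "Pi \<cdot> wh [h] m [] = wh [] m [h] \<cdot> wh [h] Pi [] \<cdot> wh [] Pi [h]" .
  have "Pi \<cdot> wh [] m [h] = Pi \<cdot> (wh [] m [h] \<cdot> wh [h] P [] \<cdot> wh [] P [h]) \<cdot> wh [] Pi [h] \<cdot> wh [h] Pi []"
    by (simp add: inv_P')
  also have "\<dots> = wh [h] m [] \<cdot> wh [] Pi [h] \<cdot> wh [h] Pi []"
    unfolding P_m(2)[symmetric] by (simp add: inv_P')
  finally show "Pi \<cdot> wh [] m [h] = wh [h] m [] \<cdot> wh [] Pi [h] \<cdot> wh [h] Pi []" .
qed
lemmas Pi_m' = Pi_m Pi_m[THEN tail, simplified]

text \<open>Moving the inverse braidings past the inner product leaves three crossings on three strands, in the two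
  orders that the Yang-Baxter equation identifies, followed by the two bracketings of \<open>m\<close>.\<close>
lemma n_assoc: "n \<cdot> wh [] n [h] = n \<cdot> wh [h] n []"
  using tail[OF m_assoc, simplified] by (simp add: n_def Pi_m' yb_inv')

lemma Pi_\<eta>: "Pi \<cdot> wh [] \<eta> [h] = wh [h] \<eta> []" "Pi \<cdot> wh [h] \<eta> [] = wh [] \<eta> [h]"
proof -
  show "Pi \<cdot> wh [] \<eta> [h] = wh [h] \<eta> []" unfolding P_\<eta>(2)[symmetric] by (simp add: inv_P')
  show "Pi \<cdot> wh [h] \<eta> [] = wh [] \<eta> [h]" unfolding P_\<eta>(1)[symmetric] by (simp add: inv_P')
qed

lemma n_unit: "n \<cdot> wh [] \<eta> [h] = idn [h]" "n \<cdot> wh [h] \<eta> [] = idn [h]"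
  by (simp_all add: n_def Pi_\<eta> m_unit)

lemma P_n: "P \<cdot> wh [] n [h] = wh [h] n [] \<cdot> wh [] P [h] \<cdot> wh [h] P []"
      "P \<cdot> wh [h] n [] = wh [] n [h] \<cdot> wh [h] P [] \<cdot> wh [] P [h]"
  using P_m[THEN tail, simplified] by (simp_all add: n_def yb_mixed yb_mixed2)

definition "\<Delta>n = Ri \<cdot> Ri \<cdot> \<Delta>u"
lemma typ_\<Delta>n [simp]: "arr \<Delta>n" "dm \<Delta>n = [u]" "cd \<Delta>n = [u,u]" by (simp_all add: \<Delta>n_def)

lemma adj_Ri: "ev \<cdot> wh [u] ev [h] \<cdot> wh [] Ri [h,h] = ev \<cdot> wh [u] ev [h] \<cdot> wh [u,u] Pi []"
proof -
  have "ev \<cdot> wh [u] ev [h] \<cdot> wh [] Ri [h,h] = 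
     ev \<cdot> wh [u] ev [h] \<cdot> wh [u,u] P [] \<cdot> wh [u,u] Pi [] \<cdot> wh [] Ri [h,h]" by (simp add: inv_P')
  also have "\<dots> = (ev \<cdot> wh [u] ev [h] \<cdot> wh [] R [h,h]) \<cdot> wh [u,u] Pi [] \<cdot> wh [] Ri [h,h]"
    unfolding adj_R by simp
  also have "\<dots> = ev \<cdot> wh [u] ev [h] \<cdot> wh [u,u] Pi []"
    by (simp add: slides inv_R')
  finally show ?thesis .
qed
lemmas adj_Ri' = adj_Ri tail[OF adj_Ri, simplified] whisker[OF adj_Ri, simplified] whisker_tail[OF adj_Ri, simplified]
lemmas adj_\<Delta>u' = adj_\<Delta>u tail[OF adj_\<Delta>u, simplified]

text \<open>Transposition reverses the order of composition: \<open>R\<^sup>-\<^sup>2 \<Delta>u\<close> becomes \<open>(m P) P\<^sup>-\<^sup>2\<close>.\<close>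
lemma adj_\<Delta>n: "ev \<cdot> wh [u] ev [h] \<cdot> wh [] \<Delta>n [h,h] = ev \<cdot> wh [u] n []"
  by (simp add: \<Delta>n_def n_def adj_Ri' slides adj_\<Delta>u' inv_P')
lemmas adj_\<Delta>n' = adj_\<Delta>n tail[OF adj_\<Delta>n, simplified] whisker[OF adj_\<Delta>n, simplified] whisker_tail[OF adj_\<Delta>n, simplified]

text \<open>The transpose of \<open>n_assoc\<close>.\<close>
lemma \<Delta>n_coassoc: "wh [] \<Delta>n [u] \<cdot> \<Delta>n = wh [u] \<Delta>n [] \<cdot> \<Delta>n"
  using whisker[OF n_assoc, of "[u]" "[]"] 
  by - (rule sep3[of _ _ "[]"], simp_all add: slides adj_\<Delta>n')

text \<open>A counit on the left strand is an outer arc that ends at \<open>\<eta>\<close>. In this form it meets the nested arcs of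
  the transposition rules.\<close>
lemma \<epsilon>u_left: "ev \<cdot> wh [] \<epsilon>u [u,h] = ev \<cdot> wh [u] ev [h] \<cdot> wh [h,u,u] \<eta> []"
proof -
  have "ev \<cdot> wh [] \<epsilon>u [u,h] = (wh [] ev [] \<cdot> wh [] ev [u,h]) \<cdot> wh [u] \<eta> [u,h]"
    by (simp add: adj_\<epsilon>u)
  also have "\<dots> = ev \<cdot> wh [h,u] ev [] \<cdot> wh [u] \<eta> [u,h]"
    by (subst slide_general[of ev ev "[]" "[]" "[]"]) simp_all
  also have "\<dots> = ev \<cdot> (wh [u] \<eta> [] \<cdot> wh [u] ev [])"
    by (simp add: slides)
  also have "wh [u] \<eta> [] \<cdot> wh [u] ev [] = wh [u] ev [h] \<cdot> wh [h,u,u] \<eta> []"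
    using slide_general[of ev \<eta> "[u]" "[]" "[u]" "[]" "[]"] by simp
  finally show ?thesis .
qed

lemma \<epsilon>u_right: "ev \<cdot> wh [u] \<epsilon>u [h] = ev \<cdot> wh [u] ev [h] \<cdot> wh [u,u] \<eta> [h]"
  by (simp add: adj_\<epsilon>u)

lemmas \<epsilon>u' = \<epsilon>u_left \<epsilon>u_left[THEN tail, simplified] \<epsilon>u_right \<epsilon>u_right[THEN tail, simplified]

lemma \<Delta>n_counit: "wh [] \<epsilon>u [u] \<cdot> \<Delta>n = idn [u]" "wh [u] \<epsilon>u [] \<cdot> \<Delta>n = idn [u]"
proof -
  show "wh [] \<epsilon>u [u] \<cdot> \<Delta>n = idn [u]"
    using whisker[OF n_unit(2), of "[u]" "[]"] adj_\<epsilon>u[THEN arg_cong[where f=arr]] adj_\<epsilon>u[THEN arg_cong[where f=dm]]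
    by - (rule sep[of _ _ "[]"], simp_all add: slides adj_\<Delta>n' \<epsilon>u')
  show "wh [u] \<epsilon>u [] \<cdot> \<Delta>n = idn [u]"
    using whisker[OF n_unit(1), of "[u]" "[]"]
    by - (rule sep[of _ _ "[]"], simp_all add: slides adj_\<Delta>n' \<epsilon>u')
qed

text \<open>The transpose of \<open>P_n\<close>.\<close>
lemma R_\<Delta>n: "wh [u] \<Delta>n [] \<cdot> R = wh [] R [u] \<cdot> wh [u] R [] \<cdot> wh [] \<Delta>n [u]"
  "wh [] \<Delta>n [u] \<cdot> R = wh [u] R [] \<cdot> wh [] R [u] \<cdot> wh [u] \<Delta>n []"
  using whisker[OF P_n(1), of "[u,u]" "[]"] whisker[OF P_n(2), of "[u,u]" "[]"]
  by - (rule sep3[of _ _ "[]"]; simp add: slides adj_\<Delta>n' adj_R')+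

lemma R_\<epsilon>u: "wh [u] \<epsilon>u [] \<cdot> R = wh [] \<epsilon>u [u]" "wh [] \<epsilon>u [u] \<cdot> R = wh [u] \<epsilon>u []"
proof -
  show "wh [u] \<epsilon>u [] \<cdot> R = wh [] \<epsilon>u [u]"
    using whisker[OF P_\<eta>(1), of "[u,u]" "[]"]
    by - (rule sep[of _ _ "[]"], simp_all add: slides adj_R' \<epsilon>u')
  show "wh [] \<epsilon>u [u] \<cdot> R = wh [u] \<epsilon>u []"
    using whisker[OF P_\<eta>(2), of "[u,u]" "[]"]
    by - (rule sep[of _ _ "[]"], simp_all add: slides adj_R' \<epsilon>u')
qed

end

text \<open>Here \<open>Q\<close> is the braiding of \<open>h\<close> with \<open>v\<close>, \<open>D\<close> its inverse and \<open>\<nu>\<close> a left action compatible with it. The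
  braiding \<open>S\<close> of \<open>u\<close> with \<open>v\<close> is the transpose of \<open>D\<close>, and the coaction \<open>\<rho>\<close> is the transpose of \<open>\<nu> D\<close>.\<close>
locale dual_comodule = dual_coalgebra +
  fixes v and Q D S Si \<nu> \<rho>
  assumes typ_Q [simp]: "arr Q" "dm Q = [h,v]" "cd Q = [v,h]" "arr D" "dm D = [v,h]" "cd D = [h,v]"
    and typ_S [simp]: "arr S" "dm S = [u,v]" "cd S = [v,u]" "arr Si" "dm Si = [v,u]" "cd Si = [u,v]"
    and typ_\<nu> [simp]: "arr \<nu>" "dm \<nu> = [h,v]" "cd \<nu> = [v]"
    and typ_\<rho> [simp]: "arr \<rho>" "dm \<rho> = [v]" "cd \<rho> = [v,u]"
    and inv_Q: "D \<cdot> Q = idn [h,v]" "Q \<cdot> D = idn [v,h]"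
    and inv_S: "Si \<cdot> S = idn [u,v]" "S \<cdot> Si = idn [v,u]"
    and yb_Q: "wh [] Q [h] \<cdot> wh [h] Q [] \<cdot> wh [] P [v] = wh [v] P [] \<cdot> wh [] Q [h] \<cdot> wh [h] Q []"
    and Q_m: "Q \<cdot> wh [] m [v] = wh [v] m [] \<cdot> wh [] Q [h] \<cdot> wh [h] Q []"
    and Q_\<eta>: "Q \<cdot> wh [] \<eta> [v] = wh [v] \<eta> []"
    and \<nu>_assoc: "\<nu> \<cdot> wh [h] \<nu> [] = \<nu> \<cdot> wh [] m [v]"
    and \<nu>_unit: "\<nu> \<cdot> wh [] \<eta> [v] = idn [v]"
    and Q_\<nu>: "Q \<cdot> wh [h] \<nu> [] = wh [] \<nu> [h] \<cdot> wh [h] Q [] \<cdot> wh [] P [v]"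
    and adj_S: "wh [v] ev [] \<cdot> wh [] S [h] = wh [] ev [v] \<cdot> wh [u] D []"
    and adj_\<rho>: "wh [v] ev [] \<cdot> wh [] \<rho> [h] = \<nu> \<cdot> D"
begin

lemmas inv_Q' = inv_Q inv_Q[THEN tail, simplified] inv_Q[THEN whisker, simplified]
    inv_Q[THEN whisker_tail, simplified]
lemmas adj_S' = adj_S tail[OF adj_S, simplified] whisker[OF adj_S, simplified] whisker_tail[OF adj_S, simplified]
lemmas adj_\<rho>' = adj_\<rho> tail[OF adj_\<rho>, simplified] whisker[OF adj_\<rho>, simplified] whisker_tail[OF adj_\<rho>, simplified]

lemma D_P: "wh [h] D [] \<cdot> wh [] D [h] \<cdot> wh [v] P [] = wh [] P [v] \<cdot> wh [h] D [] \<cdot> wh [] D [h]"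
  using conj_inverse[of "wh [] Q [h] \<cdot> wh [h] Q []" "wh [] P [v]" "wh [v] P []" "wh [] Q [h] \<cdot> wh [h] Q []"
     "wh [h] D [] \<cdot> wh [] D [h]" "[h,h,v]" "wh [h] D [] \<cdot> wh [] D [h]" "[v,h,h]"]
  by (simp add: yb_Q inv_Q')

lemma D_Pi: "wh [h] D [] \<cdot> wh [] D [h] \<cdot> wh [v] Pi [] = wh [] Pi [v] \<cdot> wh [h] D [] \<cdot> wh [] D [h]"
  using conj_inverse[of "wh [] P [v]" "wh [h] D [] \<cdot> wh [] D [h]" "wh [h] D [] \<cdot> wh [] D [h]" "wh [v] P []"
    "wh [] Pi [v]" "[h,h,v]" "wh [v] Pi []" "[v,h,h]"]
  by (simp add: D_P inv_P')

lemma D_m: "D \<cdot> wh [v] m [] = wh [] m [v] \<cdot> wh [h] D [] \<cdot> wh [] D [h]"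
  using conj_inverse[of "Q" "wh [] m [v]" "wh [v] m []" "wh [] Q [h] \<cdot> wh [h] Q []"
     "D" "[h,v]" "wh [h] D [] \<cdot> wh [] D [h]" "[v,h,h]"]
  by (simp add: Q_m inv_Q')

lemma D_n: "D \<cdot> wh [v] n [] = wh [] n [v] \<cdot> wh [h] D [] \<cdot> wh [] D [h]"
  using tail[OF D_m, simplified] by (simp add: n_def D_Pi)

lemma D_\<eta>: "D \<cdot> wh [v] \<eta> [] = wh [] \<eta> [v]"
  unfolding Q_\<eta>[symmetric] by (simp add: inv_Q')

lemma D_\<nu>: "D \<cdot> wh [] \<nu> [h] = wh [h] \<nu> [] \<cdot> wh [] Pi [v] \<cdot> wh [h] D []"
  using conj_inverse[of "Q" "wh [h] \<nu> []" "wh [] \<nu> [h]" "wh [h] Q [] \<cdot> wh [] P [v]"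
     "D" "[h,v]" "wh [] Pi [v] \<cdot> wh [h] D []" "[h,v,h]"]
  by (simp add: Q_\<nu> inv_Q' inv_P')

text \<open>The left action \<open>\<nu>\<close> as a right action, with \<open>v\<close> first moved past \<open>h\<close>. It is an action of the algebra with
  product \<open>n\<close>, see \<open>\<alpha>_assoc\<close>.\<close>
definition "\<alpha> = \<nu> \<cdot> D"
lemma typ_\<alpha> [simp]: "arr \<alpha>" "dm \<alpha> = [v,h]" "cd \<alpha> = [v]" by (simp_all add: \<alpha>_def)

lemma \<nu>_n: "\<nu> \<cdot> wh [h] \<nu> [] \<cdot> wh [] Pi [v] = \<nu> \<cdot> wh [] n [v]"
  using tail[OF \<nu>_assoc, simplified] by (simp add: n_def)

text \<open>Moving the inner action past \<open>D\<close> costs a crossing \<open>P\<^sup>-\<^sup>1\<close> (lemma \<open>D_\<nu>\<close>), which turns the product \<open>m\<close> from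
  the associativity of \<open>\<nu>\<close> into \<open>n\<close>.\<close>
lemma \<alpha>_assoc: "\<alpha> \<cdot> wh [] \<alpha> [h] = \<alpha> \<cdot> wh [v] n []"
  using tail[OF D_\<nu>, simplified] tail[OF \<nu>_n, simplified] by (simp add: \<alpha>_def D_n)

lemma \<alpha>_unit: "\<alpha> \<cdot> wh [v] \<eta> [] = idn [v]"
  by (simp add: \<alpha>_def D_\<eta> \<nu>_unit)

lemma D_\<alpha>: "D \<cdot> wh [] \<alpha> [h] \<cdot> wh [v] P [] = wh [h] \<alpha> [] \<cdot> wh [] D [h]"
  using tail[OF D_\<nu>, simplified] by (simp add: \<alpha>_def D_P inv_P')

lemma D_\<alpha>2: "D \<cdot> wh [] \<alpha> [h] = wh [h] \<alpha> [] \<cdot> wh [] D [h] \<cdot> wh [v] Pi []"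
  using tail[OF D_\<alpha>, of "wh [v] Pi []"] by (simp add: inv_P')

text \<open>The transpose of \<open>D_P\<close>.\<close>
lemma yb_S: "wh [] S [u] \<cdot> wh [u] S [] \<cdot> wh [] R [v] = wh [v] R [] \<cdot> wh [] S [u] \<cdot> wh [u] S []"
  using whisker[OF D_P, of "[u,u]" "[]"]
  by - (rule sep2[of _ _ "[v]"], simp_all add: slides adj_S' adj_R')

lemma S_\<Delta>n: "wh [v] \<Delta>n [] \<cdot> S = wh [] S [u] \<cdot> wh [u] S [] \<cdot> wh [] \<Delta>n [v]"
  using whisker[OF D_n, of "[u]" "[]"]
  by - (rule sep2[of _ _ "[v]"], simp_all add: slides adj_S' adj_\<Delta>n')

lemma S_\<epsilon>u: "wh [v] \<epsilon>u [] \<cdot> S = wh [] \<epsilon>u [v]"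
  using whisker[OF D_\<eta>, of "[u]" "[]"] interchange[of S \<eta>, symmetric]
  by (simp add: adj_S' adj_\<epsilon>u)

text \<open>The transpose of \<open>\<alpha>_assoc\<close>.\<close>
lemma \<rho>_coassoc: "wh [] \<rho> [u] \<cdot> \<rho> = wh [v] \<Delta>n [] \<cdot> \<rho>"
  using \<alpha>_assoc
  by - (rule sep2[of _ _ "[v]"], simp_all add: slides adj_\<rho>' adj_\<Delta>n' \<alpha>_def)

lemma \<rho>_counit: "wh [v] \<epsilon>u [] \<cdot> \<rho> = idn [v]"
  using \<alpha>_unit interchange[of \<rho> \<eta>, symmetric] by (simp add: adj_\<rho>' \<alpha>_def adj_\<epsilon>u)

text \<open>The transpose of \<open>D_\<alpha>\<close>.\<close>
lemma \<rho>_S: "wh [] \<rho> [u] \<cdot> S = wh [v] R [] \<cdot> wh [] S [u] \<cdot> wh [u] \<rho> []"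
  using whisker[OF D_\<alpha>, of "[u]" "[]"]
  by - (rule sep2[of _ _ "[v]"], simp_all add: slides adj_\<rho>' adj_S' adj_R' \<alpha>_def)

end

text \<open>In addition, \<open>h\<close> is a braided bialgebra, \<open>mu\<close> is the transpose of \<open>P\<^sup>-\<^sup>1 \<Delta>\<close>, and \<open>\<eta>u\<close> is the counit \<open>\<epsilon>\<close>
  regarded as an element of \<open>u\<close>.\<close>
locale dual_bialgebra = dual_coalgebra +
  fixes \<Delta> \<epsilon> mu \<eta>u
  assumes typ_\<Delta> [simp]: "arr \<Delta>" "dm \<Delta> = [h]" "cd \<Delta> = [h,h]" "arr \<epsilon>" "dm \<epsilon> = [h]" "cd \<epsilon> = []"
    and typ_mu [simp]: "arr mu" "dm mu = [u,u]" "cd mu = [u]" "arr \<eta>u" "dm \<eta>u = []" "cd \<eta>u = [u]"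
    and \<Delta>_coassoc: "wh [] \<Delta> [h] \<cdot> \<Delta> = wh [h] \<Delta> [] \<cdot> \<Delta>"
    and \<Delta>_counit: "wh [] \<epsilon> [h] \<cdot> \<Delta> = idn [h]" "wh [h] \<epsilon> [] \<cdot> \<Delta> = idn [h]"
    and P_\<Delta>: "wh [h] \<Delta> [] \<cdot> P = wh [] P [h] \<cdot> wh [h] P [] \<cdot> wh [] \<Delta> [h]"
      "wh [] \<Delta> [h] \<cdot> P = wh [h] P [] \<cdot> wh [] P [h] \<cdot> wh [h] \<Delta> []"
    and P_\<epsilon>: "wh [h] \<epsilon> [] \<cdot> P = wh [] \<epsilon> [h]" "wh [] \<epsilon> [h] \<cdot> P = wh [h] \<epsilon> []"
    and \<Delta>_m: "\<Delta> \<cdot> m = wh [] m [h] \<cdot> wh [h,h] m [] \<cdot> wh [h] P [h] \<cdot> wh [] \<Delta> [h,h] \<cdot> wh [h] \<Delta> []"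
    and \<Delta>_\<eta>: "\<Delta> \<cdot> \<eta> = wh [] \<eta> [h] \<cdot> \<eta>"
    and \<epsilon>_m: "\<epsilon> \<cdot> m = \<epsilon> \<cdot> wh [h] \<epsilon> []" and \<epsilon>_\<eta>: "\<epsilon> \<cdot> \<eta> = idn []"
    and adj_mu: "ev \<cdot> wh [] mu [h] = ev \<cdot> wh [u] ev [h] \<cdot> wh [u,u] Pi [] \<cdot> wh [u,u] \<Delta> []"
    and adj_\<eta>u: "ev \<cdot> wh [] \<eta>u [h] = \<epsilon>"
begin

text \<open>The coproduct that goes with the product \<open>n\<close>. Its transpose is the twisted product \<open>mun\<close>.\<close>
definition "\<delta> = P \<cdot> \<Delta>"
definition "mun = mu \<cdot> R \<cdot> R"
lemma typ_\<delta> [simp]: "arr \<delta>" "dm \<delta> = [h]" "cd \<delta> = [h,h]" by (simp_all add: \<delta>_def)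
lemma typ_mun [simp]: "arr mun" "dm mun = [u,u]" "cd mun = [u]" by (simp_all add: mun_def)

lemmas adj_mu' = adj_mu tail[OF adj_mu, simplified]
lemmas P_\<Delta>' = P_\<Delta> P_\<Delta>[THEN tail, simplified] 

text \<open>Transposition turns \<open>mu R\<^sup>2\<close> into \<open>P\<^sup>2 (P\<^sup>-\<^sup>1 \<Delta>)\<close>.\<close>
lemma adj_mun: "ev \<cdot> wh [] mun [h] = ev \<cdot> wh [u] ev [h] \<cdot> wh [u,u] \<delta> []"
proof -
  have "ev \<cdot> wh [] mun [h] = ev \<cdot> wh [u] ev [h] \<cdot> wh [u,u] (Pi \<cdot> \<Delta>) [] \<cdot> wh [] R [h] \<cdot> wh [] R [h]"
    by (simp add: mun_def adj_mu')
  also have "\<dots> = ev \<cdot> wh [u] ev [h] \<cdot> wh [] R [h,h] \<cdot> wh [] R [h,h] \<cdot> wh [u,u] (Pi \<cdot> \<Delta>) []"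
    by (simp add: slides)
  also have "\<dots> = ev \<cdot> wh [u] ev [h] \<cdot> wh [u,u] P [] \<cdot> wh [] R [h,h] \<cdot> wh [u,u] (Pi \<cdot> \<Delta>) []"
    by (simp add: adj_R')
  also have "\<dots> = ev \<cdot> wh [u] ev [h] \<cdot> wh [] R [h,h] \<cdot> wh [u,u] (P \<cdot> Pi \<cdot> \<Delta>) []"
    by (simp add: slides)
  also have "\<dots> = ev \<cdot> wh [u] ev [h] \<cdot> wh [u,u] \<delta> []"
    by (simp add: adj_R' inv_P' \<delta>_def)
  finally show ?thesis .
qed
lemmas adj_mun' = adj_mun tail[OF adj_mun, simplified] whisker[OF adj_mun, simplified]
    whisker_tail[OF adj_mun, simplified]
lemmas adj_\<eta>u' = adj_\<eta>u tail[OF adj_\<eta>u, simplified] whisker[OF adj_\<eta>u, simplified] whisker_tail[OF adj_\<eta>u, simplified]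

lemma \<delta>_coassoc: "wh [] \<delta> [h] \<cdot> \<delta> = wh [h] \<delta> [] \<cdot> \<delta>"
  by (simp add: \<delta>_def P_\<Delta>' yb' \<Delta>_coassoc)

lemma \<delta>_counit: "wh [] \<epsilon> [h] \<cdot> \<delta> = idn [h]" "wh [h] \<epsilon> [] \<cdot> \<delta> = idn [h]"
  using P_\<epsilon>[THEN tail, simplified] by (simp_all add: \<delta>_def \<Delta>_counit)

lemma P_\<delta>: "wh [h] \<delta> [] \<cdot> P = wh [] P [h] \<cdot> wh [h] P [] \<cdot> wh [] \<delta> [h]"
      "wh [] \<delta> [h] \<cdot> P = wh [h] P [] \<cdot> wh [] P [h] \<cdot> wh [h] \<delta> []"
  by (simp_all add: \<delta>_def P_\<Delta>' yb')

lemma \<delta>_\<eta>: "\<delta> \<cdot> \<eta> = wh [] \<eta> [h] \<cdot> \<eta>"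
  using P_\<eta>[THEN tail, simplified] interchange[of \<eta> \<eta>] by (simp add: \<delta>_def \<Delta>_\<eta>)

lemma \<epsilon>_n: "\<epsilon> \<cdot> n = \<epsilon> \<cdot> wh [h] \<epsilon> []"
proof -
  have "\<epsilon> \<cdot> n = \<epsilon> \<cdot> wh [h] \<epsilon> [] \<cdot> Pi" using tail[OF \<epsilon>_m, simplified] by (simp add: n_def)
  also have "\<dots> = \<epsilon> \<cdot> (wh [] \<epsilon> [h] \<cdot> P) \<cdot> Pi" by (simp only: P_\<epsilon>)
  also have "\<dots> = \<epsilon> \<cdot> wh [h] \<epsilon> []" using interchange[of \<epsilon> \<epsilon>] by (simp add: inv_P')
  finally show ?thesis .
qed

text \<open>An identity in the braid group on four strands. It remains of \<open>\<delta>_n\<close> after the products have been moved to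
  one end of the diagram and the coproducts to the other.\<close>
lemma braid4:
  "wh [h] P [h] \<cdot> wh [] P [h,h] \<cdot> wh [h,h] P [] \<cdot> wh [h] P [h] \<cdot>
     wh [] Pi [h,h] \<cdot> wh [h,h] Pi [] \<cdot> wh [h] Pi [h] =
   wh [] Pi [h,h] \<cdot> wh [h,h] Pi [] \<cdot> wh [h] P [h] \<cdot> wh [] P [h,h] \<cdot> wh [h,h] P []"
proof -
  let ?a = "wh [] P [h,h]" and ?b = "wh [h] P [h]" and ?c = "wh [h,h] P []"
  let ?a' = "wh [] Pi [h,h]" and ?b' = "wh [h] Pi [h]" and ?c' = "wh [h,h] Pi []"
  have "?b \<cdot> ?a \<cdot> ?c \<cdot> ?b \<cdot> ?a' \<cdot> ?c' \<cdot> ?b' = ?b \<cdot> (?a \<cdot> ?c) \<cdot> ?b \<cdot> ?a' \<cdot> ?c' \<cdot> ?b'" by simp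
  also have "?a \<cdot> ?c = ?c \<cdot> ?a" by (simp add: slides)
  also have "?b \<cdot> (?c \<cdot> ?a) \<cdot> ?b \<cdot> ?a' \<cdot> ?c' \<cdot> ?b' = ?b \<cdot> ?c \<cdot> (?a \<cdot> ?b \<cdot> ?a') \<cdot> ?c' \<cdot> ?b'" by simp
  also have "?a \<cdot> ?b \<cdot> ?a' = ?b' \<cdot> ?a \<cdot> ?b" by (simp add: yb_mixed')
  also have "?b \<cdot> ?c \<cdot> (?b' \<cdot> ?a \<cdot> ?b) \<cdot> ?c' \<cdot> ?b' = (?b \<cdot> ?c \<cdot> ?b') \<cdot> ?a \<cdot> ?b \<cdot> ?c' \<cdot> ?b'" by simp
  also have "?b \<cdot> ?c \<cdot> ?b' = ?c' \<cdot> ?b \<cdot> ?c" by (simp add: yb_mixed')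
  also have "(?c' \<cdot> ?b \<cdot> ?c) \<cdot> ?a \<cdot> ?b \<cdot> ?c' \<cdot> ?b' = ?c' \<cdot> ?b \<cdot> (?c \<cdot> ?a) \<cdot> ?b \<cdot> ?c' \<cdot> ?b'" by simp
  also have "?c \<cdot> ?a = ?a \<cdot> ?c" by (simp add: slides)
  also have "?c' \<cdot> ?b \<cdot> (?a \<cdot> ?c) \<cdot> ?b \<cdot> ?c' \<cdot> ?b' = ?c' \<cdot> ?b \<cdot> ?a \<cdot> (?c \<cdot> ?b \<cdot> ?c') \<cdot> ?b'" by simp
  also have "?c \<cdot> ?b \<cdot> ?c' = ?b' \<cdot> ?c \<cdot> ?b" by (simp add: yb_mixed2')
  also have "?c' \<cdot> ?b \<cdot> ?a \<cdot> (?b' \<cdot> ?c \<cdot> ?b) \<cdot> ?b' = ?c' \<cdot> (?b \<cdot> ?a \<cdot> ?b') \<cdot> ?c" by (simp add: inv_P')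
  also have "?b \<cdot> ?a \<cdot> ?b' = ?a' \<cdot> ?b \<cdot> ?a" by (simp add: yb_mixed2')
  also have "?c' \<cdot> (?a' \<cdot> ?b \<cdot> ?a) \<cdot> ?c = (?c' \<cdot> ?a') \<cdot> ?b \<cdot> ?a \<cdot> ?c" by simp
  also have "?c' \<cdot> ?a' = ?a' \<cdot> ?c'" by (simp add: slides)
  finally show ?thesis by simp
qed

lemma \<Delta>_Pi: "wh [] \<Delta> [h] \<cdot> Pi = wh [h] Pi [] \<cdot> wh [] Pi [h] \<cdot> wh [h] \<Delta> []"
  "wh [h] \<Delta> [] \<cdot> Pi = wh [] Pi [h] \<cdot> wh [h] Pi [] \<cdot> wh [] \<Delta> [h]"
  using conj_inverse[of "wh [] P [h] \<cdot> wh [h] P []" "wh [] \<Delta> [h]" "wh [h] \<Delta> []" P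
      "wh [h] Pi [] \<cdot> wh [] Pi [h]" "[h,h,h]" Pi "[h,h]"]
    conj_inverse[of "wh [h] P [] \<cdot> wh [] P [h]" "wh [h] \<Delta> []" "wh [] \<Delta> [h]" P
      "wh [] Pi [h] \<cdot> wh [h] Pi []" "[h,h,h]" Pi "[h,h]"]
  by (simp_all add: P_\<Delta> inv_P')

text \<open>The bialgebra axiom for the product \<open>m P\<^sup>-\<^sup>1\<close> and the coproduct \<open>P \<Delta>\<close>.\<close>
lemma \<delta>_n: "\<delta> \<cdot> n = wh [] n [h] \<cdot> wh [h,h] n [] \<cdot> wh [h] P [h] \<cdot> wh [] \<delta> [h,h] \<cdot> wh [h] \<delta> []"
proof -
  \<comment> \<open>In \<open>\<delta> n = P \<Delta> m P\<^sup>-\<^sup>1\<close>, the crossing \<open>P\<close> is moved past both products, and \<open>P\<^sup>-\<^sup>1\<close> past both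
    coproducts.\<close>
  have mm: "P \<cdot> wh [] m [h] \<cdot> wh [h,h] m [] = wh [] m [h] \<cdot> wh [h,h] m [] \<cdot>
     wh [h] P [h] \<cdot> wh [] P [h,h] \<cdot> wh [h,h] P [] \<cdot> wh [h] P [h]"
    by (simp add: slides P_m[THEN whisker_tail, simplified] P_m[THEN tail, simplified] P_m[THEN whisker, simplified])
  have dd: "wh [] \<Delta> [h,h] \<cdot> wh [h] \<Delta> [] \<cdot> Pi =
     wh [h] Pi [h] \<cdot> wh [] Pi [h,h] \<cdot> wh [h,h] Pi [] \<cdot> wh [h] Pi [h] \<cdot> wh [] \<Delta> [h,h] \<cdot> wh [h] \<Delta> []"
    using \<Delta>_Pi[THEN whisker_tail, simplified] \<Delta>_Pi[THEN tail, simplified] by (simp add: slides \<Delta>_Pi)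
  have "\<delta> \<cdot> n = P \<cdot> (\<Delta> \<cdot> m) \<cdot> Pi" by (simp add: \<delta>_def n_def)
  also have "\<dots> = (P \<cdot> wh [] m [h] \<cdot> wh [h,h] m []) \<cdot> wh [h] P [h] \<cdot> (wh [] \<Delta> [h,h] \<cdot> wh [h] \<Delta> [] \<cdot> Pi)"
    unfolding \<Delta>_m by simp
  also have "\<dots> = wh [] m [h] \<cdot> wh [h,h] m [] \<cdot> (wh [h] P [h] \<cdot> wh [] P [h,h] \<cdot> wh [h,h] P [] \<cdot> wh [h] P [h] \<cdot>
     wh [] Pi [h,h] \<cdot> wh [h,h] Pi [] \<cdot> wh [h] Pi [h]) \<cdot> wh [] \<Delta> [h,h] \<cdot> wh [h] \<Delta> []"
    unfolding mm dd by (simp add: inv_P')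
  also have "\<dots> = wh [] n [h] \<cdot> wh [h,h] n [] \<cdot> wh [h] P [h] \<cdot> wh [] \<delta> [h,h] \<cdot> wh [h] \<delta> []"
    unfolding braid4 by (simp add: n_def \<delta>_def slides)
  finally show ?thesis .
qed

text \<open>The transpose of \<open>\<delta>_coassoc\<close>.\<close>
lemma mun_assoc: "mun \<cdot> wh [] mun [u] = mun \<cdot> wh [u] mun []"
  using whisker[OF \<delta>_coassoc, of "[u,u,u]" "[]"]
  by - (rule sep[of _ _ "[]"], simp_all add: slides adj_mun')

lemma mun_unit: "mun \<cdot> wh [] \<eta>u [u] = idn [u]" "mun \<cdot> wh [u] \<eta>u [] = idn [u]"
proof -
  show "mun \<cdot> wh [] \<eta>u [u] = idn [u]"
    using whisker[OF \<delta>_counit(2), of "[u]" "[]"]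
    by - (rule sep[of _ _ "[]"], simp_all add: slides adj_mun' adj_\<eta>u')
  show "mun \<cdot> wh [u] \<eta>u [] = idn [u]"
    using whisker[OF \<delta>_counit(1), of "[u]" "[]"]
    by - (rule sep[of _ _ "[]"], simp_all add: slides adj_mun' adj_\<eta>u')
qed

lemma R_mun: "R \<cdot> wh [] mun [u] = wh [u] mun [] \<cdot> wh [] R [u] \<cdot> wh [u] R []"
  "R \<cdot> wh [u] mun [] = wh [] mun [u] \<cdot> wh [u] R [] \<cdot> wh [] R [u]"
proof -
  show "R \<cdot> wh [] mun [u] = wh [u] mun [] \<cdot> wh [] R [u] \<cdot> wh [u] R []"
    using whisker[OF P_\<delta>(1), of "[u,u,u]" "[]"]
    by - (rule sep2[of _ _ "[]"], simp_all add: slides adj_mun' adj_R')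
  show "R \<cdot> wh [u] mun [] = wh [] mun [u] \<cdot> wh [u] R [] \<cdot> wh [] R [u]"
    using whisker[OF P_\<delta>(2), of "[u,u,u]" "[]"]
    by - (rule sep2[of _ _ "[]"], simp_all add: slides adj_mun' adj_R')
qed

lemma R_\<eta>u: "R \<cdot> wh [] \<eta>u [u] = wh [u] \<eta>u []" "R \<cdot> wh [u] \<eta>u [] = wh [] \<eta>u [u]"
proof -
  show "R \<cdot> wh [] \<eta>u [u] = wh [u] \<eta>u []"
    using whisker[OF P_\<epsilon>(1), of "[u]" "[]"]
    by - (rule sep2[of _ _ "[]"], simp_all add: slides adj_\<eta>u' adj_R')
  show "R \<cdot> wh [u] \<eta>u [] = wh [] \<eta>u [u]"
    using whisker[OF P_\<epsilon>(2), of "[u]" "[]"]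
    by - (rule sep2[of _ _ "[]"], simp_all add: slides adj_\<eta>u' adj_R')
qed

text \<open>Transposition exchanges products and coproducts, and the bialgebra axiom is symmetric in them: this is
  the transpose of \<open>\<delta>_n\<close>.\<close>
lemma \<Delta>n_mun: "\<Delta>n \<cdot> mun = wh [] mun [u] \<cdot> wh [u,u] mun [] \<cdot> wh [u] R [u] \<cdot> wh [] \<Delta>n [u,u] \<cdot> wh [u] \<Delta>n []"
  using whisker[OF \<delta>_n, of "[u,u]" "[]"]
  by - (rule sep2[of _ _ "[]"], simp_all add: slides adj_mun' adj_R' adj_\<Delta>n')

lemma \<Delta>n_\<eta>u: "\<Delta>n \<cdot> \<eta>u = wh [] \<eta>u [u] \<cdot> \<eta>u"
  using \<epsilon>_n
  by - (rule sep2[of _ _ "[]"], simp_all add: slides adj_\<eta>u' adj_\<Delta>n')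

lemma \<epsilon>u_mun: "\<epsilon>u \<cdot> mun = \<epsilon>u \<cdot> wh [u] \<epsilon>u []"
  using whisker[OF \<delta>_\<eta>, of "[u,u]" "[]"] interchange[of mun \<eta>, symmetric]
    tail[OF slide_general[of ev \<eta> "[u]" "[]" "[u]" "[]" "[]"]]
  by (simp add: slides adj_mun' adj_\<epsilon>u)

lemma \<epsilon>u_\<eta>u: "\<epsilon>u \<cdot> \<eta>u = idn []"
  using interchange[of \<eta>u \<eta>, symmetric] by (simp add: adj_\<eta>u' adj_\<epsilon>u \<epsilon>_\<eta>)

end

locale dual_comodule_algebra = dual_comodule + dual_bialgebra +
  fixes mV
  assumes typ_mV [simp]: "arr mV" "dm mV = [v,v]" "cd mV = [v]"
    and Q_\<Delta>: "wh [v] \<Delta> [] \<cdot> Q = wh [] Q [h] \<cdot> wh [h] Q [] \<cdot> wh [] \<Delta> [v]"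
    and Q_\<epsilon>: "wh [v] \<epsilon> [] \<cdot> Q = wh [] \<epsilon> [v]"
    and Q_mV: "Q \<cdot> wh [h] mV [] = wh [] mV [h] \<cdot> wh [v] Q [] \<cdot> wh [] Q [v]"
    and \<nu>_mV: "\<nu> \<cdot> wh [h] mV [] = mV \<cdot> wh [] \<nu> [v] \<cdot> wh [v,h] \<nu> [] \<cdot> wh [h] Q [v] \<cdot> wh [] \<Delta> [v,v]"
begin

lemma D_\<Delta>: "wh [h] D [] \<cdot> wh [] D [h] \<cdot> wh [v] \<Delta> [] = wh [] \<Delta> [v] \<cdot> D"
  using conj_inverse[of "wh [] Q [h] \<cdot> wh [h] Q []" "wh [] \<Delta> [v]" "wh [v] \<Delta> []" Q
    "wh [h] D [] \<cdot> wh [] D [h]" "[h,h,v]" D "[v,h]"]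
  by (simp add: Q_\<Delta> inv_Q')

lemma D_\<delta>: "wh [h] D [] \<cdot> wh [] D [h] \<cdot> wh [v] \<delta> [] = wh [] \<delta> [v] \<cdot> D"
  using tail[OF D_P, simplified] by (simp add: \<delta>_def D_\<Delta>)

lemma D_\<epsilon>: "wh [] \<epsilon> [v] \<cdot> D = wh [v] \<epsilon> []"
  unfolding Q_\<epsilon>[symmetric] by (simp add: inv_Q')

lemma D_mV: "D \<cdot> wh [] mV [h] = wh [h] mV [] \<cdot> wh [] D [v] \<cdot> wh [v] D []"
  using conj_inverse[of Q "wh [h] mV []" "wh [] mV [h]" "wh [v] Q [] \<cdot> wh [] Q [v]"
    D "[h,v]" "wh [] D [v] \<cdot> wh [v] D []" "[v,v,h]"]
  by (simp add: Q_mV inv_Q')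

lemma S_mun: "S \<cdot> wh [] mun [v] = wh [v] mun [] \<cdot> wh [] S [u] \<cdot> wh [u] S []"
  using whisker[OF D_\<delta>, of "[u,u]" "[]"]
  by - (rule sep[of _ _ "[v]"], simp_all add: slides adj_S' adj_mun')

lemma S_\<eta>u: "S \<cdot> wh [] \<eta>u [v] = wh [v] \<eta>u []"
  using D_\<epsilon>
  by - (rule sep[of _ _ "[v]"], simp_all add: slides adj_S' adj_\<eta>u')

lemma S_mV: "S \<cdot> wh [u] mV [] = wh [] mV [u] \<cdot> wh [v] S [] \<cdot> wh [] S [v]"
  using whisker[OF D_mV, of "[u]" "[]"]
  by - (rule sep[of _ _ "[v]"], simp_all add: slides adj_S')

text \<open>The right action \<open>\<alpha>\<close> respects the product of \<open>v\<close> with respect to the coproduct \<open>\<delta>\<close>. The crossing \<open>Q\<close> in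
  the axiom for \<open>\<nu>\<close> cancels one of the crossings \<open>D\<close> produced by moving \<open>\<Delta>\<close> past \<open>D\<close>.\<close>
lemma \<alpha>_mV: "\<alpha> \<cdot> wh [] mV [h] = mV \<cdot> wh [] \<alpha> [v] \<cdot> wh [v] D [] \<cdot> wh [v] \<alpha> [h] \<cdot> wh [v,v] \<delta> []"
proof -
  have "\<alpha> \<cdot> wh [] mV [h] = (\<nu> \<cdot> wh [h] mV []) \<cdot> wh [] D [v] \<cdot> wh [v] D []"
    by (simp add: \<alpha>_def D_mV)
  also have "\<dots> = mV \<cdot> wh [] \<nu> [v] \<cdot> wh [v,h] \<nu> [] \<cdot> wh [h] Q [v] \<cdot> wh [] (wh [] \<Delta> [v] \<cdot> D) [v] \<cdot> wh [v] D []"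
    unfolding \<nu>_mV by simp
  also have "\<dots> = mV \<cdot> wh [] \<nu> [v] \<cdot> wh [v,h] \<nu> [] \<cdot> wh [] D [h,v] \<cdot> wh [v] \<Delta> [v] \<cdot> wh [v] D []"
    unfolding D_\<Delta>[symmetric] by (simp add: inv_Q')
  also have "\<dots> = mV \<cdot> wh [] \<nu> [v] \<cdot> wh [v,h] \<nu> [] \<cdot> wh [] D [h,v] \<cdot> wh [v] (wh [] \<Delta> [v] \<cdot> D) []"
    by simp
  also have "\<dots> = mV \<cdot> wh [] \<alpha> [v] \<cdot> wh [v] (wh [h] \<alpha> [] \<cdot> wh [] D [h] \<cdot> wh [v] (Pi \<cdot> \<delta>) []) []"
    unfolding D_\<Delta>[symmetric] by (simp add: inv_P' \<alpha>_def \<delta>_def slides)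
  also have "\<dots> = mV \<cdot> wh [] \<alpha> [v] \<cdot> wh [v] (D \<cdot> wh [] \<alpha> [h]) [] \<cdot> wh [v,v] \<delta> []"
    unfolding D_\<alpha>2 by simp
  finally show ?thesis by simp
qed

text \<open>The transpose of \<open>\<alpha>_mV\<close>.\<close>
lemma \<rho>_mV: "\<rho> \<cdot> mV = wh [] mV [u] \<cdot> wh [v,v] mun [] \<cdot> wh [v] S [u] \<cdot> wh [] \<rho> [v,u] \<cdot> wh [v] \<rho> []"
  using \<alpha>_mV
  by - (rule sep[of _ _ "[v]"], simp_all add: slides adj_S' adj_\<rho>' adj_mun' \<alpha>_def)

lemma S_\<eta>V:
  assumes "arr \<eta>V" "dm \<eta>V = []" "cd \<eta>V = [v]" and Q: "Q \<cdot> wh [h] \<eta>V [] = wh [] \<eta>V [h]"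
  shows "S \<cdot> wh [u] \<eta>V [] = wh [] \<eta>V [u]"
proof -
  have "D \<cdot> wh [] \<eta>V [h] = wh [h] \<eta>V []" unfolding Q[symmetric] using assms(1-3) by (simp add: inv_Q')
  from whisker[OF this, of "[u]" "[]"] show ?thesis using assms interchange[of ev \<eta>V]
    by - (rule sep[of _ _ "[v]"], simp_all add: slides adj_S')
qed

lemma \<rho>_\<eta>V:
  assumes "arr \<eta>V" "dm \<eta>V = []" "cd \<eta>V = [v]" and Q: "Q \<cdot> wh [h] \<eta>V [] = wh [] \<eta>V [h]"
    and \<nu>: "\<nu> \<cdot> wh [h] \<eta>V [] = \<eta>V \<cdot> \<epsilon>"
  shows "\<rho> \<cdot> \<eta>V = wh [] \<eta>V [u] \<cdot> \<eta>u"
proof -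
  have "D \<cdot> wh [] \<eta>V [h] = wh [h] \<eta>V []" unfolding Q[symmetric] using assms(1-3) by (simp add: inv_Q')
  then show ?thesis using assms \<nu>
    by - (rule sep[of _ _ "[v]"], simp_all add: slides adj_\<rho>' adj_\<eta>u')
qed

end

section \<open>The strict monoidal category of words in a free algebra\<close>

text \<open>With concatenation as addition of words, the convolution product on finitely supported functions makes
  them the free algebra on the letters.\<close>
instantiation list :: (type) monoid_add
begin
definition zero_list :: "'a list" where "zero_list = []"
definition plus_list :: "'a list \<Rightarrow> 'a list \<Rightarrow> 'a list" where "plus_list xs ys = xs @ ys"
instance by standard (simp_all add: zero_list_def plus_list_def)
end

definition sc :: "'k::field \<Rightarrow> ('i list \<Rightarrow>\<^sub>0 'k) \<Rightarrow> ('i list \<Rightarrow>\<^sub>0 'k)" where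
  "sc c t = Poly_Mapping.single [] c * t"

definition mon :: "'i list \<Rightarrow> ('i list \<Rightarrow>\<^sub>0 'k::field)" where
  "mon u = Poly_Mapping.single u 1"

lemma single_mult: "Poly_Mapping.single u a * Poly_Mapping.single v b = Poly_Mapping.single (u @ v) (a * b)"
  by (simp add: mult_single plus_list_def)

lemma sc_mon: "sc c (mon u) = Poly_Mapping.single u c"
  by (simp add: sc_def mon_def single_mult)

lemma mon_mult: "mon u * mon v = mon (u @ v)"
  by (simp add: mon_def single_mult)

lemma mon_Nil: "mon [] = 1"
  by (simp add: mon_def single_one[symmetric] zero_list_def del: single_one)

lemma monomial_sum: "t = (\<Sum>u\<in>Poly_Mapping.keys t. sc (Poly_Mapping.lookup t u) (mon u))"
  unfolding sc_mon
  by (rule poly_mapping_eqI) (simp add: lookup_sum lookup_single when_def sum.delta in_keys_iff)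

lemma mult_sc_left: "sc c s * t = sc c (s * t)" by (simp add: sc_def mult.assoc)
lemma sc_sum: "sc c (sum f A) = (\<Sum>x\<in>A. sc c (f x))"
  by (simp add: sc_def sum_distrib_left)

lemma mult_sc_right: "s * sc c t = sc c (s * t)"
proof -
  have "s * Poly_Mapping.single [] c = sc c s"
    by (subst (1 2) monomial_sum[of s])
      (simp add: sc_mon sum_distrib_right sc_sum single_mult, simp add: sc_def single_mult mult.commute)
  then show ?thesis by (simp add: sc_def flip: mult.assoc)
qed

interpretation sc: vector_space sc
proof
  show "sc 1 x = x" for x by (simp add: sc_def mon_Nil[unfolded mon_def])
  show "sc a (sc b x) = sc (a * b) x" for a b x by (simp add: sc_def single_mult flip: mult.assoc)
qed (simp_all add: sc_def algebra_simps single_add)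

definition lnr :: "(('i list \<Rightarrow>\<^sub>0 'k::field) \<Rightarrow> ('i list \<Rightarrow>\<^sub>0 'k)) \<Rightarrow> bool" where
  "lnr f \<longleftrightarrow> (\<forall>s t. f (s + t) = f s + f t) \<and> (\<forall>c t. f (sc c t) = sc c (f t))"

lemma lnr_add: "lnr f \<Longrightarrow> f (s + t) = f s + f t" and lnr_sc: "lnr f \<Longrightarrow> f (sc c t) = sc c (f t)"
  by (simp_all add: lnr_def)

lemma lnr_0: "lnr f \<Longrightarrow> f 0 = 0"
  using lnr_sc[of f 0 0] by simp

lemma lnr_comp: "lnr f \<Longrightarrow> lnr g \<Longrightarrow> lnr (\<lambda>t. g (f t))"
  by (simp add: lnr_def)
lemma lnr_mult: "lnr f \<Longrightarrow> lnr (\<lambda>t. f t * a)" "lnr f \<Longrightarrow> lnr (\<lambda>t. a * f t)"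
  by (simp_all add: lnr_def algebra_simps mult_sc_left mult_sc_right)
lemma lnr_id: "lnr (\<lambda>t. t)" by (simp add: lnr_def)

text \<open>The linear map with values \<open>F\<close> on words.\<close>
definition lin :: "('i list \<Rightarrow> ('i list \<Rightarrow>\<^sub>0 'k::field)) \<Rightarrow> ('i list \<Rightarrow>\<^sub>0 'k) \<Rightarrow> ('i list \<Rightarrow>\<^sub>0 'k)" where
  "lin F t = (\<Sum>u\<in>Poly_Mapping.keys t. sc (Poly_Mapping.lookup t u) (F u))"

lemma lin_superset:
  "finite A \<Longrightarrow> Poly_Mapping.keys t \<subseteq> A \<Longrightarrow> lin F t = (\<Sum>u\<in>A. sc (Poly_Mapping.lookup t u) (F u))"
  unfolding lin_def by (rule sum.mono_neutral_left) (auto simp: in_keys_iff)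

lemma lnr_lin: "lnr (lin F)"
  unfolding lnr_def
proof (intro conjI allI)
  fix s t :: "'a list \<Rightarrow>\<^sub>0 'b"
  let ?A = "Poly_Mapping.keys s \<union> Poly_Mapping.keys t"
  have "Poly_Mapping.keys (s + t) \<subseteq> ?A" by (rule keys_add)
  then show "lin F (s + t) = lin F s + lin F t"
    by (simp add: lin_superset[of ?A] lookup_add sc.scale_left_distrib sum.distrib)
next
  fix c and t :: "'a list \<Rightarrow>\<^sub>0 'b"
  have l: "Poly_Mapping.lookup (sc c t) u = c * Poly_Mapping.lookup t u" for u
    by (subst monomial_sum[of t], simp add: sc_sum lookup_sum sc_mon)
      (simp add: sc_def single_mult lookup_single when_def in_keys_iff)
  have "Poly_Mapping.keys (sc c t) \<subseteq> Poly_Mapping.keys t" by (auto simp: in_keys_iff l)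
  then show "lin F (sc c t) = sc c (lin F t)"
    by (simp add: lin_superset[of "Poly_Mapping.keys t"] l sc_sum)
qed

lemma lin_mon [simp]: "lin F (mon u) = F u"
  by (simp add: lin_def mon_def)

text \<open>If \<open>B l\<close> is a basis of the space named by \<open>l\<close>, these words form a basis of the tensor product of the
  spaces named by \<open>w\<close>.\<close>
definition idx :: "('l \<Rightarrow> 'i set) \<Rightarrow> 'l list \<Rightarrow> 'i list set" where
  "idx B w = {u. list_all2 (\<lambda>l i. i \<in> B l) w u}"

lemma idx_append: "u \<in> idx B (w @ w') \<longleftrightarrow> (\<exists>x y. u = x @ y \<and> x \<in> idx B w \<and> y \<in> idx B w')"
  by (auto simp: idx_def list_all2_append1 dest: list_all2_lengthD)
     (metis list_all2_lengthD)
lemma idx_appendI: "x \<in> idx B w \<Longrightarrow> y \<in> idx B w' \<Longrightarrow> x @ y \<in> idx B (w @ w')"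
  using idx_append by blast
lemma idx_length: "u \<in> idx B w \<Longrightarrow> length u = length w"
  by (auto simp: idx_def dest: list_all2_lengthD)
lemma idx_Nil [simp]: "u \<in> idx B [] \<longleftrightarrow> u = []" by (simp add: idx_def)
lemma idx_single: "idx B [l] = (\<lambda>i. [i]) ` B l"
  by (auto simp: idx_def list_all2_Cons1)

text \<open>The tensor product of the spaces named by \<open>w\<close>, inside the free algebra. Tensoring is multiplication there
  (lemma \<open>tsp_mult\<close>).\<close>
definition tsp :: "('l \<Rightarrow> 'i set) \<Rightarrow> 'l list \<Rightarrow> ('i list \<Rightarrow>\<^sub>0 'k::field) set" where
  "tsp B w = sc.span (mon ` idx B w)"

lemma tsp_mon: "u \<in> idx B w \<Longrightarrow> mon u \<in> tsp B w"
  by (simp add: tsp_def sc.span_base)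

lemma tsp_induct [consumes 1, case_names zero add]:
  fixes t :: "'i list \<Rightarrow>\<^sub>0 'k::field"
  assumes "t \<in> tsp B w" "P 0" "\<And>c u s. u \<in> idx B w \<Longrightarrow> s \<in> tsp B w \<Longrightarrow> P s \<Longrightarrow> P (sc c (mon u) + s)"
  shows "P t"
proof -
  have "t \<in> tsp B w \<and> P t"
    using assms(1) unfolding tsp_def
  proof (rule sc.span_induct_alt)
    show "0 \<in> sc.span (mon ` idx B w) \<and> P 0" using assms(2) by (simp add: sc.span_zero)
  next
    fix c :: 'k and x y :: "'i list \<Rightarrow>\<^sub>0 'k" assume "x \<in> mon ` idx B w" "y \<in> sc.span (mon ` idx B w) \<and> P y"
    then show "sc c x + y \<in> sc.span (mon ` idx B w) \<and> P (sc c x + y)"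
      using assms(3) by (auto simp: tsp_def sc.span_base intro!: sc.span_add sc.span_scale)
  qed
  then show ?thesis ..
qed

lemma tsp_add: "s \<in> tsp B w \<Longrightarrow> t \<in> tsp B w \<Longrightarrow> s + t \<in> tsp B w"
  and tsp_sc: "s \<in> tsp B w \<Longrightarrow> sc c s \<in> tsp B w" and tsp_0: "0 \<in> tsp B w"
  by (simp_all add: tsp_def sc.span_add sc.span_scale sc.span_zero)

lemma lnr_eq_on_tsp:
  assumes "t \<in> tsp B w" "lnr f" "lnr g" "\<And>u. u \<in> idx B w \<Longrightarrow> f (mon u) = g (mon u)"
  shows "f t = g t"
  using assms(1) by (induction rule: tsp_induct) (simp_all add: assms lnr_0 lnr_add lnr_sc)

lemma lnr_into_tsp:
  assumes "t \<in> tsp B w" "lnr f" "\<And>u. u \<in> idx B w \<Longrightarrow> f (mon u) \<in> tsp B w'"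
  shows "f t \<in> tsp B w'"
  using assms(1) by (induction rule: tsp_induct)
    (simp_all add: assms lnr_0 lnr_add lnr_sc tsp_add tsp_sc tsp_0)

lemma tsp_mult: "s \<in> tsp B w \<Longrightarrow> t \<in> tsp B w' \<Longrightarrow> s * t \<in> tsp B (w @ w')"
  by (rule lnr_into_tsp[where f="\<lambda>s. s * t" and w=w], assumption, simp add: lnr_mult lnr_id)
    (rule lnr_into_tsp[where f="\<lambda>t. mon _ * t" and w=w'],
      simp_all add: lnr_mult lnr_id mon_mult idx_appendI tsp_mon)

text \<open>The projection that annihilates all other words.\<close>
definition proj :: "('l \<Rightarrow> 'i set) \<Rightarrow> 'l list \<Rightarrow> ('i list \<Rightarrow>\<^sub>0 'k::field) \<Rightarrow> ('i list \<Rightarrow>\<^sub>0 'k)" where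
  "proj B w = lin (\<lambda>u. if u \<in> idx B w then mon u else 0)"

lemma lnr_proj: "lnr (proj B w)" by (simp add: proj_def lnr_lin)
lemma lnr_eqI: "lnr f \<Longrightarrow> lnr g \<Longrightarrow> (\<And>u. f (mon u) = g (mon u)) \<Longrightarrow> f = g"
proof
  fix t assume *: "lnr f" "lnr g" "\<And>u. f (mon u) = g (mon u)"
  have "t \<in> tsp (\<lambda>_::unit. UNIV) w \<Longrightarrow> f t = g t" for w
    by (erule lnr_eq_on_tsp) (simp_all add: *)
  have f: "f (sum F A) = (\<Sum>x\<in>A. f (F x))" if "lnr f" for F and A :: "'a list set" and f :: "('a list \<Rightarrow>\<^sub>0 'b) \<Rightarrow> _"
    by (induction A rule: infinite_finite_induct) (simp_all add: lnr_0 lnr_add that)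
  show "f t = g t"
    by (subst (1 2) monomial_sum) (simp add: f * lnr_sc)
qed
lemma proj_tsp [simp]: "t \<in> tsp B w \<Longrightarrow> proj B w t = t"
  by (rule lnr_eq_on_tsp[where g="\<lambda>t. t"]) (simp_all add: lnr_proj lnr_id, simp add: proj_def)
lemma lin_in_tsp: "(\<And>u. F u \<in> tsp B w) \<Longrightarrow> lin F t \<in> tsp B w"
  unfolding lin_def by (auto simp: tsp_def intro!: sc.span_sum sc.span_scale)
lemma proj_in_tsp: "proj B w t \<in> tsp B w"
  unfolding proj_def by (rule lin_in_tsp) (simp add: tsp_mon tsp_0)

datatype ('l, 't) arrow = Arrow (adm: "'l list") (acd: "'l list") (fn: "'t \<Rightarrow> 't")

text \<open>An arrow acts on the whole free algebra, but it factors through the projection to its domain. Therefore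
  arrows that agree on the domain are equal.\<close>
definition is_arrow :: "('l \<Rightarrow> 'i set) \<Rightarrow> ('l, 'i list \<Rightarrow>\<^sub>0 'k::field) arrow \<Rightarrow> bool" where
  "is_arrow B f \<longleftrightarrow> lnr (fn f) \<and> (\<forall>t. fn f (proj B (adm f) t) = fn f t) \<and> (\<forall>t. fn f t \<in> tsp B (acd f))"

definition acomp :: "('l, 'i list \<Rightarrow>\<^sub>0 'k::field) arrow \<Rightarrow> ('l, 'i list \<Rightarrow>\<^sub>0 'k) arrow \<Rightarrow> ('l, 'i list \<Rightarrow>\<^sub>0 'k) arrow"
    (infixr "\<cdot>" 65) where
  "g \<cdot> f = Arrow (adm f) (acd g) (\<lambda>t. fn g (fn f t))"

definition aid :: "('l \<Rightarrow> 'i set) \<Rightarrow> 'l list \<Rightarrow> ('l, 'i list \<Rightarrow>\<^sub>0 'k::field) arrow" where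
  "aid B w = Arrow w w (proj B w)"

text \<open>A word over \<open>rev L @ adm f @ R\<close> is cut by lengths, and \<open>f\<close> acts on the middle part.\<close>
definition awh :: "('l \<Rightarrow> 'i set) \<Rightarrow> 'l list \<Rightarrow> ('l, 'i list \<Rightarrow>\<^sub>0 'k::field) arrow \<Rightarrow> 'l list \<Rightarrow>
    ('l, 'i list \<Rightarrow>\<^sub>0 'k) arrow" where
  "awh B L f R = Arrow (rev L @ adm f @ R) (rev L @ acd f @ R)
     (lin (\<lambda>u. if u \<in> idx B (rev L @ adm f @ R) then
        mon (take (length L) u) * fn f (mon (take (length (adm f)) (drop (length L) u))) *
          mon (drop (length L + length (adm f)) u) else 0))"

lemma awh_mon:
  assumes "x \<in> idx B (rev L)" "y \<in> idx B (adm f)" "z \<in> idx B R"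
  shows "fn (awh B L f R) (mon (x @ y @ z)) = mon x * fn f (mon y) * mon z"
  using assms assms[THEN idx_length] by (simp add: awh_def idx_appendI)

lemma awh_apply:
  assumes f: "lnr (fn f)" and "s \<in> tsp B (rev L)" "t \<in> tsp B (adm f)" "r \<in> tsp B R"
  shows "fn (awh B L f R) (s * t * r) = s * fn f t * r"
proof -
  have l: "lnr (fn (awh B L f R))" by (simp add: awh_def lnr_lin)
  note * = lnr_comp[OF _ l] lnr_mult lnr_id lnr_comp[OF _ f]
  show ?thesis
  proof (rule lnr_eq_on_tsp[OF assms(2), where f="\<lambda>s. fn (awh B L f R) (s * t * r)"])
    fix x assume x: "x \<in> idx B (rev L)"
    show "fn (awh B L f R) (mon x * t * r) = mon x * fn f t * r"
    proof (rule lnr_eq_on_tsp[OF assms(3), where f="\<lambda>t. fn (awh B L f R) (mon x * t * r)"])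
      fix y assume y: "y \<in> idx B (adm f)"
      show "fn (awh B L f R) (mon x * mon y * r) = mon x * fn f (mon y) * r"
        by (rule lnr_eq_on_tsp[OF assms(4), where f="\<lambda>r. fn (awh B L f R) (mon x * mon y * r)"])
          (simp_all add: * mon_mult awh_mon x y)
    qed (simp_all add: *)
  qed (simp_all add: *)
qed

lemma arrow_eqI:
  assumes f: "is_arrow B f" and g: "is_arrow B g" and e: "adm f = adm g" "acd f = acd g"
    and m: "\<And>u. u \<in> idx B (adm f) \<Longrightarrow> fn f (mon u) = fn g (mon u)"
  shows "f = g"
proof -
  have "fn f t = fn g t" for t
  proof -
    have "fn f (proj B (adm f) t) = fn g (proj B (adm f) t)"
      by (rule lnr_eq_on_tsp[OF proj_in_tsp]) (use f g m in \<open>simp_all add: is_arrow_def\<close>)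
    then show ?thesis using f g e by (simp add: is_arrow_def)
  qed
  then show ?thesis using e by (simp add: arrow.expand fun_eq_iff)
qed

lemma is_arrow_lin:
  assumes "\<And>u. u \<in> idx B w \<Longrightarrow> F u \<in> tsp B w'" "\<And>u. u \<notin> idx B w \<Longrightarrow> F u = 0"
  shows "is_arrow B (Arrow w w' (lin F))"
proof -
  have "(\<lambda>t. lin F (proj B w t)) = lin F"
    by (rule lnr_eqI) (simp_all add: lnr_comp lnr_proj lnr_lin proj_def assms lnr_0)
  then have "lin F (proj B w t) = lin F t" for t by (rule fun_cong)
  moreover have "lin F t \<in> tsp B w'" for t by (rule lin_in_tsp) (metis assms tsp_0)
  ultimately show ?thesis by (simp add: is_arrow_def lnr_lin)
qed

lemma is_arrow_id: "is_arrow B (aid B w)"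
  unfolding aid_def proj_def by (rule is_arrow_lin) (simp_all add: tsp_mon)

lemma is_arrow_wh: "is_arrow B f \<Longrightarrow> is_arrow B (awh B L f R)"
  unfolding awh_def
proof (rule is_arrow_lin, goal_cases)
  case (1 u)
  then obtain x y z where u: "u = x @ y @ z" "x \<in> idx B (rev L)" "y \<in> idx B (adm f)" "z \<in> idx B R"
    by (auto simp: idx_append)
  have "mon x * fn f (mon y) * mon z \<in> tsp B ((rev L @ acd f) @ R)"
    using 1 u by (intro tsp_mult tsp_mon) (simp_all add: is_arrow_def)
  then show ?case using 1 u(1) u(2-4)[THEN idx_length] by simp
qed simp

lemma is_arrow_comp: "is_arrow B f \<Longrightarrow> is_arrow B g \<Longrightarrow> is_arrow B (g \<cdot> f)"
  by (simp add: is_arrow_def acomp_def lnr_comp)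

lemma sel_simps [simp]: "adm (g \<cdot> f) = adm f" "acd (g \<cdot> f) = acd g" "fn (g \<cdot> f) t = fn g (fn f t)"
  "adm (aid B w) = w" "acd (aid B w) = w" "fn (aid B w) = proj B w"
  "adm (awh B L f R) = rev L @ adm f @ R" "acd (awh B L f R) = rev L @ acd f @ R"
  by (simp_all add: acomp_def aid_def awh_def)

lemma is_arrow_lnr: "is_arrow B f \<Longrightarrow> lnr (fn f)"
  and is_arrow_into: "is_arrow B f \<Longrightarrow> fn f t \<in> tsp B (acd f)"
  by (simp_all add: is_arrow_def)

interpretation words: strict_monoidal "is_arrow B" adm acd acomp "aid B" "awh B"
  for B :: "'l \<Rightarrow> 'i set"
proof (unfold_locales, goal_cases)
  case (8 f w)
  then have w: "w = acd f" by simp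
  show ?case unfolding w using 8(1)
    by (intro arrow_eqI[of B]) (simp_all add: is_arrow_comp is_arrow_id is_arrow_into)
next
  case (9 f w)
  then show ?case
    by (intro arrow_eqI[of B]) (simp_all add: is_arrow_comp is_arrow_id tsp_mon)
next
  case (13 L w R)
  show ?case
  proof (rule arrow_eqI[of B])
    fix u assume "u \<in> idx B (adm (awh B L (aid B w) R))"
    then obtain x y z where "u = x @ y @ z" "x \<in> idx B (rev L)" "y \<in> idx B w" "z \<in> idx B R"
      by (auto simp: idx_append)
    then show "fn (awh B L (aid B w) R) (mon u) = fn (aid B (rev L @ w @ R)) (mon u)"
      by (simp add: awh_mon tsp_mon idx_appendI mon_mult)
  qed (simp_all add: is_arrow_wh is_arrow_id)
next
  case (14 f g L R)
  show ?case
  proof (rule arrow_eqI[of B])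
    fix u assume "u \<in> idx B (adm (awh B L (g \<cdot> f) R))"
    then obtain x y z where "u = x @ y @ z" "x \<in> idx B (rev L)" "y \<in> idx B (adm f)" "z \<in> idx B R"
      by (auto simp: idx_append)
    then show "fn (awh B L (g \<cdot> f) R) (mon u) = fn (awh B L g R \<cdot> awh B L f R) (mon u)"
      using 14 is_arrow_into[of B f "mon y"]
      by (simp add: awh_mon awh_apply is_arrow_lnr tsp_mon)
  qed (use 14 in \<open>simp_all add: is_arrow_wh is_arrow_comp\<close>)
next
  case (15 f L L' R' R)
  show ?case
  proof (rule arrow_eqI[of B])
    fix u assume "u \<in> idx B (adm (awh B L (awh B L' f R') R))"
    then obtain x x' y z z' where u: "u = x @ x' @ y @ z' @ z" "x \<in> idx B (rev L)" "x' \<in> idx B (rev L')"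
      "y \<in> idx B (adm f)" "z' \<in> idx B R'" "z \<in> idx B R"
      by (auto simp: idx_append)
    have "fn (awh B L (awh B L' f R') R) (mon (x @ (x' @ y @ z') @ z)) =
       mon x * (mon x' * fn f (mon y) * mon z') * mon z"
      using u by (subst awh_mon) (simp_all add: awh_mon idx_appendI)
    moreover have "fn (awh B (L' @ L) f (R' @ R)) (mon ((x @ x') @ y @ (z' @ z))) =
       mon (x @ x') * fn f (mon y) * mon (z' @ z)"
      using u by (intro awh_mon) (simp_all add: idx_appendI)
    ultimately show "fn (awh B L (awh B L' f R') R) (mon u) = fn (awh B (L' @ L) f (R' @ R)) (mon u)"
      using u by (simp add: mult.assoc flip: mon_mult)
  qed (use 15 in \<open>simp_all add: is_arrow_wh\<close>)
next
  case (16 f)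
  show ?case
  proof (rule arrow_eqI[of B])
    fix u assume "u \<in> idx B (adm (awh B [] f []))"
    then show "fn (awh B [] f []) (mon u) = fn f (mon u)"
      using awh_mon[of "[]" B "[]" u f "[]" "[]"] by (simp add: mon_Nil)
  qed (use 16 in \<open>simp_all add: is_arrow_wh\<close>)
next
  case (17 f g)
  show ?case
  proof (rule arrow_eqI[of B])
    fix u assume "u \<in> idx B (adm (awh B [] f (acd g) \<cdot> awh B (rev (adm f)) g []))"
    then obtain x y where u: "u = x @ y" "x \<in> idx B (adm f)" "y \<in> idx B (adm g)"
      by (auto simp: idx_append)
    have "fn (awh B [] f (acd g)) (mon [] * mon x * fn g (mon y)) = mon [] * fn f (mon x) * fn g (mon y)"
      using 17 u by (intro awh_apply) (simp_all add: is_arrow_lnr is_arrow_into tsp_mon)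
    moreover have "fn (awh B (rev (acd f)) g []) (fn f (mon x) * mon y * mon []) =
        fn f (mon x) * fn g (mon y) * mon []"
      using 17 u by (intro awh_apply) (simp_all add: is_arrow_lnr is_arrow_into tsp_mon)
    ultimately show "fn (awh B [] f (acd g) \<cdot> awh B (rev (adm f)) g []) (mon u) =
        fn (awh B (rev (acd f)) g [] \<cdot> awh B [] f (adm g)) (mon u)"
      using u awh_mon[of x B "rev (adm f)" y g "[]" "[]"] awh_mon[of "[]" B "[]" x f y "adm g"]
      by (simp add: mon_Nil)
  qed (use 17 in \<open>simp_all add: is_arrow_wh is_arrow_comp\<close>)
qed (simp_all add: is_arrow_comp is_arrow_id is_arrow_wh, simp_all add: acomp_def)

section \<open>Linear maps on tensor products\<close>

declare plus_fun_apply [simp del] zero_fun_apply [simp del]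

lemma vspace_0: "vspace X \<Longrightarrow> 0 \<in> carr X"
  and vspace_add: "vspace X \<Longrightarrow> x \<in> carr X \<Longrightarrow> y \<in> carr X \<Longrightarrow> x + y \<in> carr X"
  and vspace_scl: "vspace X \<Longrightarrow> x \<in> carr X \<Longrightarrow> scl X c x \<in> carr X"
proof -
  assume "vspace X"
  then interpret X: vector_space "scl X" by (simp add: vspace_def)
  from \<open>vspace X\<close> have X: "X.subspace (carr X)" by (simp add: vspace_def)
  show "0 \<in> carr X" by (rule X.subspace_0[OF X])
  show "x + y \<in> carr X" if "x \<in> carr X" "y \<in> carr X" by (rule X.subspace_add[OF X that])
  show "scl X c x \<in> carr X" if "x \<in> carr X" by (rule X.subspace_scale[OF X that])
qed

lemma vspace_base_field: "vspace (base_field :: ('k::field, 'k) vs)"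
proof -
  interpret vector_space "(*) :: 'k \<Rightarrow> 'k \<Rightarrow> 'k" by unfold_locales (simp_all add: algebra_simps)
  show ?thesis by (simp add: vspace_def base_field_def vector_space_axioms)
qed

lemma base_field_simps [simp]: "carr base_field = UNIV" "scl base_field = (*)"
  by (simp_all add: base_field_def)

lemma homD:
  assumes "f \<in> hom X Y"
  shows hom_src: "src f = X" and hom_trg: "trg f = Y"
    and hom_in: "x \<in> carr X \<Longrightarrow> app f x \<in> carr Y"
    and hom_add: "x \<in> carr X \<Longrightarrow> y \<in> carr X \<Longrightarrow> app f (x + y) = app f x + app f y"
    and hom_scl: "x \<in> carr X \<Longrightarrow> app f (scl X c x) = scl Y c (app f x)"
    and hom_out: "x \<notin> carr X \<Longrightarrow> app f x = 0"
  using assms by (auto simp: hom_def)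

lemma hom_0: "f \<in> hom X Y \<Longrightarrow> vspace X \<Longrightarrow> app f 0 = 0"
  using hom_add[of f X Y 0 0] vspace_0[of X] by simp

lemma hom_eqI:
  assumes "f \<in> hom X Y" "g \<in> hom X Y" "\<And>x. x \<in> carr X \<Longrightarrow> app f x = app g x"
  shows "f = g"
proof -
  have "app f x = app g x" for x
    using assms hom_out[OF assms(1)] hom_out[OF assms(2)] by (cases "x \<in> carr X") auto
  then show ?thesis using assms by (simp add: hom_src hom_trg lmap.expand fun_eq_iff)
qed

lemma homI:
  assumes "\<And>x. x \<in> carr X \<Longrightarrow> F x \<in> carr Y"
    "\<And>x y. x \<in> carr X \<Longrightarrow> y \<in> carr X \<Longrightarrow> F (x + y) = F x + F y"
    "\<And>c x. x \<in> carr X \<Longrightarrow> F (scl X c x) = scl Y c (F x)" "vspace X"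
  shows "LMap X Y (\<lambda>x. if x \<in> carr X then F x else 0) \<in> hom X Y"
  using assms by (simp add: hom_def vspace_add vspace_scl)

lemma idm_hom: "vspace X \<Longrightarrow> idm X \<in> hom X X"
  unfolding idm_def by (rule homI) simp_all
lemma idm_app: "x \<in> carr X \<Longrightarrow> app (idm X) x = x" by (simp add: idm_def)

lemma comp_app: "f \<in> hom X Y \<Longrightarrow> x \<in> carr X \<Longrightarrow> app (g \<odot> f) x = app g (app f x)"
  by (simp add: comp_def hom_src)
lemma comp_hom: "f \<in> hom X Y \<Longrightarrow> g \<in> hom Y Z \<Longrightarrow> vspace X \<Longrightarrow> g \<odot> f \<in> hom X Z"
  unfolding comp_def hom_src hom_trg
  by (rule homI) (simp_all add: homD)

lemma bilinD:
  assumes "bilin X Y Z b"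
  shows bilin_in: "x \<in> carr X \<Longrightarrow> y \<in> carr Y \<Longrightarrow> b x y \<in> carr Z"
    and bilin_add_left: "x \<in> carr X \<Longrightarrow> x' \<in> carr X \<Longrightarrow> y \<in> carr Y \<Longrightarrow> b (x + x') y = b x y + b x' y"
    and bilin_add_right: "x \<in> carr X \<Longrightarrow> y \<in> carr Y \<Longrightarrow> y' \<in> carr Y \<Longrightarrow> b x (y + y') = b x y + b x y'"
    and bilin_scl_left: "x \<in> carr X \<Longrightarrow> y \<in> carr Y \<Longrightarrow> b (scl X c x) y = scl Z c (b x y)"
    and bilin_scl_right: "x \<in> carr X \<Longrightarrow> y \<in> carr Y \<Longrightarrow> b x (scl Y c y) = scl Z c (b x y)"
  using assms by (auto simp: bilin_def)

lemma bilin_hom: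
  assumes "f \<in> hom Z W" "bilin X Y Z b"
  shows "bilin X Y W (\<lambda>x y. app f (b x y))"
  using assms(2) by (auto simp: bilin_def homD[OF assms(1)])

lemma scl_tens [simp]: "scl (X \<otimes> Y) = fscl" by (simp add: tprod_def)

lemma tens_simps:
  fixes X :: "('k::field, 'a::ab_group_add) vs" and Y :: "('k, 'b::ab_group_add) vs"
  shows "x \<in> carr X \<Longrightarrow> x' \<in> carr X \<Longrightarrow> y \<in> carr Y \<Longrightarrow> tens X Y (x + x') y = tens X Y x y + tens X Y x' y"
    "x \<in> carr X \<Longrightarrow> y \<in> carr Y \<Longrightarrow> y' \<in> carr Y \<Longrightarrow> tens X Y x (y + y') = tens X Y x y + tens X Y x y'"
    "x \<in> carr X \<Longrightarrow> y \<in> carr Y \<Longrightarrow> tens X Y (scl X c x) y = fscl c (tens X Y x y)"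
    "x \<in> carr X \<Longrightarrow> y \<in> carr Y \<Longrightarrow> tens X Y x (scl Y c y) = fscl c (tens X Y x y)"
  using bilin_add_left[OF bilin_tens, of x X x' y Y] bilin_add_right[OF bilin_tens, of x X y Y y']
    bilin_scl_left[OF bilin_tens, of x X y Y c] bilin_scl_right[OF bilin_tens, of x X y Y c]
  unfolding scl_tens by blast+

lemma tens_induct [consumes 2, case_names zero add]:
  assumes X: "vspace X" and t: "t \<in> carr (X \<otimes> Y)" and "P 0"
    and "\<And>x y s. x \<in> carr X \<Longrightarrow> y \<in> carr Y \<Longrightarrow> s \<in> carr (X \<otimes> Y) \<Longrightarrow> P s \<Longrightarrow> P (tens X Y x y + s)"
  shows "P t"
proof -
  obtain n x y where r: "trep X Y t n x y" using trep_exists[OF X t] by blast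
  have "(\<Sum>i<k. tens X Y (x i) (y i)) \<in> carr (X \<otimes> Y) \<and> P (\<Sum>i<k. tens X Y (x i) (y i))" if "k \<le> n" for k
    using that
  proof (induction k)
    case 0
    show ?case unfolding lessThan_0 sum.empty
      using vspace_0[OF vspace_tprod] assms(3) by blast
  next
    case (Suc k)
    then have "x k \<in> carr X" "y k \<in> carr Y" using r by (auto simp: trep_def)
    moreover have "(\<Sum>i<k. tens X Y (x i) (y i)) \<in> carr (X \<otimes> Y)" "P (\<Sum>i<k. tens X Y (x i) (y i))"
      using Suc by (blast dest: Suc_leD)+
    ultimately have "tens X Y (x k) (y k) + (\<Sum>i<k. tens X Y (x i) (y i)) \<in> carr (X \<otimes> Y) \<and>
        P (tens X Y (x k) (y k) + (\<Sum>i<k. tens X Y (x i) (y i)))"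
      by (intro conjI assms(4) vspace_add[OF vspace_tprod] tens_in)
    then show ?case unfolding sum.lessThan_Suc by (subst (1 2) add.commute)
  qed
  from this[of n] r show ?thesis unfolding trep_def by blast
qed

lemma hom_tens_eqI:
  fixes X :: "('k::field, 'a::ab_group_add) vs" and Y :: "('k, 'b::ab_group_add) vs"
      and Z :: "('k, 'c::ab_group_add) vs"
  assumes X: "vspace X" and f: "f \<in> hom (X \<otimes> Y) Z" and g: "g \<in> hom (X \<otimes> Y) Z"
    and e: "\<And>x y. x \<in> carr X \<Longrightarrow> y \<in> carr Y \<Longrightarrow> app f (tens X Y x y) = app g (tens X Y x y)"
  shows "f = g"
proof (rule hom_eqI[OF f g])
  fix t assume "t \<in> carr (X \<otimes> Y)"
  with X show "app f t = app g t"
    by (induction rule: tens_induct)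
      (simp_all only: hom_0[OF f vspace_tprod] hom_0[OF g vspace_tprod] hom_add[OF f] hom_add[OF g] tens_in e)
qed

lemma bilin_hom_tens: "f \<in> hom (X \<otimes> Y) Z \<Longrightarrow> bilin X Y Z (\<lambda>x y. app f (tens X Y x y))"
  by (rule bilin_hom[OF _ bilin_tens])

lemma bilin_section_hom:
  assumes "bilin X Y Z b"
  shows "vspace X \<Longrightarrow> y \<in> carr Y \<Longrightarrow> LMap X Z (\<lambda>x. if x \<in> carr X then b x y else 0) \<in> hom X Z"
    and "vspace Y \<Longrightarrow> x \<in> carr X \<Longrightarrow> LMap Y Z (\<lambda>y. if y \<in> carr Y then b x y else 0) \<in> hom Y Z"
  using assms by (auto intro!: homI simp: bilinD)

lemma hom_tens3_eqI:
  fixes X :: "('k::field, 'a::ab_group_add) vs" and Y :: "('k, 'b::ab_group_add) vs"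
    and Z :: "('k, 'c::ab_group_add) vs" and W :: "('k, 'd::ab_group_add) vs"
  assumes X: "vspace X" and f: "f \<in> hom ((X \<otimes> Y) \<otimes> Z) W" and g: "g \<in> hom ((X \<otimes> Y) \<otimes> Z) W"
    and e: "\<And>x y z. x \<in> carr X \<Longrightarrow> y \<in> carr Y \<Longrightarrow> z \<in> carr Z \<Longrightarrow>
      app f (tens (X \<otimes> Y) Z (tens X Y x y) z) = app g (tens (X \<otimes> Y) Z (tens X Y x y) z)"
  shows "f = g"
proof (rule hom_tens_eqI[OF vspace_tprod f g])
  fix t z assume t: "t \<in> carr (X \<otimes> Y)" and z: "z \<in> carr Z"
  let ?F = "\<lambda>f. LMap (X \<otimes> Y) W (\<lambda>t. if t \<in> carr (X \<otimes> Y) then app f (tens (X \<otimes> Y) Z t z) else 0)"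
  have "?F f = ?F g"
    by (rule hom_tens_eqI[OF X bilin_section_hom(1) bilin_section_hom(1)])
      (use f g z e in \<open>simp_all add: vspace_tprod bilin_hom_tens tens_in\<close>)
  then have "app (?F f) t = app (?F g) t" by simp
  then show "app f (tens (X \<otimes> Y) Z t z) = app g (tens (X \<otimes> Y) Z t z)" using t by simp
qed

lemma hom_tens3_eqI':
  fixes X :: "('k::field, 'a::ab_group_add) vs" and Y :: "('k, 'b::ab_group_add) vs"
    and Z :: "('k, 'c::ab_group_add) vs" and W :: "('k, 'd::ab_group_add) vs"
  assumes X: "vspace X" and Y: "vspace Y" and f: "f \<in> hom (X \<otimes> (Y \<otimes> Z)) W" and g: "g \<in> hom (X \<otimes> (Y \<otimes> Z)) W"
    and e: "\<And>x y z. x \<in> carr X \<Longrightarrow> y \<in> carr Y \<Longrightarrow> z \<in> carr Z \<Longrightarrow>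
      app f (tens X (Y \<otimes> Z) x (tens Y Z y z)) = app g (tens X (Y \<otimes> Z) x (tens Y Z y z))"
  shows "f = g"
proof (rule hom_tens_eqI[OF X f g])
  fix x t assume t: "t \<in> carr (Y \<otimes> Z)" and x: "x \<in> carr X"
  let ?F = "\<lambda>f. LMap (Y \<otimes> Z) W (\<lambda>t. if t \<in> carr (Y \<otimes> Z) then app f (tens X (Y \<otimes> Z) x t) else 0)"
  have "?F f = ?F g"
    by (rule hom_tens_eqI[OF Y bilin_section_hom(2) bilin_section_hom(2)])
      (use f g x e in \<open>simp_all add: vspace_tprod bilin_hom_tens tens_in\<close>)
  then have "app (?F f) t = app (?F g) t" by simp
  then show "app f (tens X (Y \<otimes> Z) x t) = app g (tens X (Y \<otimes> Z) x t)" using t by simp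
qed

text \<open>A family of bilinear maps that depends linearly on a parameter \<open>w\<close> induces a bilinear map of a tensor and
  the parameter. The associativity constraints are of this form.\<close>
lemma tlift_bilin2:
  assumes X: "vspace X" and Z: "vspace Z"
    and b: "\<And>w. w \<in> carr W \<Longrightarrow> bilin X Y Z (b w)"
    and l: "\<And>x y. x \<in> carr X \<Longrightarrow> y \<in> carr Y \<Longrightarrow> LMap W Z (\<lambda>w. if w \<in> carr W then b w x y else 0) \<in> hom W Z"
    and W: "vspace W"
  shows "bilin (X \<otimes> Y) W Z (\<lambda>t w. app (tlift X Y Z (b w)) t)"
    and "bilin W (X \<otimes> Y) Z (\<lambda>w t. app (tlift X Y Z (b w)) t)"
proof -
  note h = tlift_hom[OF X Z b]
  note a = hom_add[OF l, simplified] and s = hom_scl[OF l, simplified]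
  have add: "app (tlift X Y Z (b (w + w'))) t = app (tlift X Y Z (b w)) t + app (tlift X Y Z (b w')) t"
    if "t \<in> carr (X \<otimes> Y)" "w \<in> carr W" "w' \<in> carr W" for t w w'
    using X that(1)
  proof (induction rule: tens_induct)
    case zero
    show ?case using hom_0[OF h[OF that(2)] vspace_tprod] hom_0[OF h[OF that(3)] vspace_tprod]
        hom_0[OF h[OF vspace_add[OF W that(2,3)]] vspace_tprod] by simp
  next
    case (add x y s)
    then show ?case using that W a[OF add(1,2) that(2,3)]
      by (simp add: hom_add[OF h] vspace_add tens_in tlift_tens[OF X Z b])
  qed
  interpret Z: vector_space "scl Z" using Z by (simp add: vspace_def)
  have scl: "app (tlift X Y Z (b (scl W c w))) t = scl Z c (app (tlift X Y Z (b w)) t)"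
    if "t \<in> carr (X \<otimes> Y)" "w \<in> carr W" for t w c
    using X that(1)
  proof (induction rule: tens_induct)
    case zero
    show ?case using hom_0[OF h[OF that(2)] vspace_tprod]
        hom_0[OF h[OF vspace_scl[OF W that(2)]] vspace_tprod] by simp
  next
    case (add x y t)
    then show ?case using that W s[OF add(1,2) that(2), of c]
      by (simp add: hom_add[OF h] vspace_scl tens_in tlift_tens[OF X Z b] Z.scale_right_distrib)
  qed
  show "bilin (X \<otimes> Y) W Z (\<lambda>t w. app (tlift X Y Z (b w)) t)"
    "bilin W (X \<otimes> Y) Z (\<lambda>w t. app (tlift X Y Z (b w)) t)"
    unfolding bilin_def using hom_in[OF h] hom_add[OF h] hom_scl[OF h] add scl by simp_all
qed

lemma tens_left_hom: "vspace Y \<Longrightarrow> x \<in> carr X \<Longrightarrow> LMap Y (X \<otimes> Y) (\<lambda>y. if y \<in> carr Y then tens X Y x y else 0) \<in> hom Y (X \<otimes>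
    Y)"
  and tens_right_hom: "vspace X \<Longrightarrow> y \<in> carr Y \<Longrightarrow> LMap X (X \<otimes> Y) (\<lambda>x. if x \<in> carr X then tens X Y x y else 0) \<in> hom X (X
      \<otimes> Y)"
  by (rule bilin_section_hom[OF bilin_tens]; assumption)+

lemma assoc_hom: 
  assumes "vspace X" "vspace Y" "vspace Z"
  shows "assoc X Y Z \<in> hom ((X \<otimes> Y) \<otimes> Z) (X \<otimes> (Y \<otimes> Z))" (is ?h)
    and assoc_tens: "x \<in> carr X \<Longrightarrow> y \<in> carr Y \<Longrightarrow> z \<in> carr Z \<Longrightarrow>
     app (assoc X Y Z) (tens (X \<otimes> Y) Z (tens X Y x y) z) = tens X (Y \<otimes> Z) x (tens Y Z y z)" (is "_ \<Longrightarrow> _ \<Longrightarrow> _ \<Longrightarrow> ?t")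
proof -
  have b: "bilin X Y (X \<otimes> (Y \<otimes> Z)) (\<lambda>x y. tens X (Y \<otimes> Z) x (tens Y Z y z))" if "z \<in> carr Z" for z
    using that unfolding bilin_def by (simp add: tens_in tens_simps) (simp add: tens_simps(4)[where Y="Y \<otimes> Z",
        simplified] tens_in)
  have l: "LMap Z (X \<otimes> (Y \<otimes> Z)) (\<lambda>z. if z \<in> carr Z then tens X (Y \<otimes> Z) x (tens Y Z y z) else 0) \<in> hom Z (X \<otimes> (Y \<otimes> Z))"
    if "x \<in> carr X" "y \<in> carr Y" for x y
    using that assms by (intro homI) (simp_all add: tens_in tens_simps tens_simps(4)[where Y="Y \<otimes> Z", simplified])
  note bb = tlift_bilin2(1)[OF assms(1) vspace_tprod b l assms(3)]
  show ?h unfolding assoc_def by (rule tlift_hom[OF vspace_tprod vspace_tprod bb])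
  show ?t if "x \<in> carr X" "y \<in> carr Y" "z \<in> carr Z"
    unfolding assoc_def using that assms
    by (simp add: tlift_tens[OF vspace_tprod vspace_tprod bb] tens_in tlift_tens[OF _ vspace_tprod b])
qed

lemma unassoc_hom: 
  assumes "vspace X" "vspace Y" "vspace Z"
  shows "unassoc X Y Z \<in> hom (X \<otimes> (Y \<otimes> Z)) ((X \<otimes> Y) \<otimes> Z)" (is ?h)
    and unassoc_tens: "x \<in> carr X \<Longrightarrow> y \<in> carr Y \<Longrightarrow> z \<in> carr Z \<Longrightarrow>
     app (unassoc X Y Z) (tens X (Y \<otimes> Z) x (tens Y Z y z)) = tens (X \<otimes> Y) Z (tens X Y x y) z" (is "_ \<Longrightarrow> _ \<Longrightarrow> _ \<Longrightarrow> ?t")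
proof -
  have b: "bilin Y Z ((X \<otimes> Y) \<otimes> Z) (\<lambda>y z. tens (X \<otimes> Y) Z (tens X Y x y) z)" if "x \<in> carr X" for x
    using that unfolding bilin_def by (simp add: tens_in tens_simps) (simp add: tens_simps(3)[where X="X \<otimes> Y",
        simplified] tens_in)
  have l: "LMap X ((X \<otimes> Y) \<otimes> Z) (\<lambda>x. if x \<in> carr X then tens (X \<otimes> Y) Z (tens X Y x y) z else 0) \<in> hom X ((X \<otimes> Y) \<otimes> Z)"
    if "y \<in> carr Y" "z \<in> carr Z" for y z
    using that assms by (intro homI) (simp_all add: tens_in tens_simps tens_simps(3)[where X="X \<otimes> Y", simplified])
  note bb = tlift_bilin2(2)[OF assms(2) vspace_tprod b l assms(1)]
  show ?h unfolding unassoc_def by (rule tlift_hom[OF assms(1) vspace_tprod bb])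
  show ?t if "x \<in> carr X" "y \<in> carr Y" "z \<in> carr Z"
    unfolding unassoc_def using that assms
    by (simp add: tlift_tens[OF assms(1) vspace_tprod bb] tens_in tlift_tens[OF _ vspace_tprod b])
qed

lemma lunit_hom:
  assumes "vspace X"
  shows "lunit X \<in> hom (base_field \<otimes> X) X"
    and lunit_tens: "x \<in> carr X \<Longrightarrow> app (lunit X) (tens base_field X c x) = scl X c x"
proof -
  interpret X: vector_space "scl X" using assms by (simp add: vspace_def)
  have b: "bilin base_field X X (\<lambda>c x. scl X c x)"
    by (simp add: bilin_def vspace_scl assms X.scale_left_distrib X.scale_right_distrib mult.commute)
  show "lunit X \<in> hom (base_field \<otimes> X) X" "x \<in> carr X \<Longrightarrow> app (lunit X) (tens base_field X c x) = scl X c x"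
    unfolding lunit_def using tlift_hom[OF vspace_base_field assms b] tlift_tens[OF vspace_base_field assms b]
        by simp_all
qed

lemma runit_hom:
  assumes "vspace X"
  shows "runit X \<in> hom (X \<otimes> base_field) X"
    and runit_tens: "x \<in> carr X \<Longrightarrow> app (runit X) (tens X base_field x c) = scl X c x"
proof -
  interpret X: vector_space "scl X" using assms by (simp add: vspace_def)
  have b: "bilin X base_field X (\<lambda>x c. scl X c x)"
    by (simp add: bilin_def vspace_scl assms X.scale_left_distrib X.scale_right_distrib mult.commute)
  show "runit X \<in> hom (X \<otimes> base_field) X" "x \<in> carr X \<Longrightarrow> app (runit X) (tens X base_field x c) = scl X c x"
    unfolding runit_def using tlift_hom[OF assms assms b] tlift_tens[OF assms assms b] by simp_all
qed

lemma tmap_hom: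
  assumes "f \<in> hom X X'" "g \<in> hom Y Y'" "vspace X"
  shows "f \<otimes>\<^sub>m g \<in> hom (X \<otimes> Y) (X' \<otimes> Y')"
    and tmap_tens: "x \<in> carr X \<Longrightarrow> y \<in> carr Y \<Longrightarrow> app (f \<otimes>\<^sub>m g) (tens X Y x y) = tens X' Y' (app f x) (app g y)"
proof -
  have b: "bilin X Y (X' \<otimes> Y') (\<lambda>x y. tens X' Y' (app f x) (app g y))"
    unfolding bilin_def using assms(1,2) by (simp add: tens_in tens_simps homD)
  show "f \<otimes>\<^sub>m g \<in> hom (X \<otimes> Y) (X' \<otimes> Y')" "x \<in> carr X \<Longrightarrow> y \<in> carr Y \<Longrightarrow> app (f \<otimes>\<^sub>m g) (tens X Y x y) =
      tens X' Y' (app f x) (app g y)"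
    unfolding tmap_def hom_src[OF assms(1)] hom_src[OF assms(2)] hom_trg[OF assms(1)] hom_trg[OF assms(2)]
    using tlift_hom[OF assms(3) vspace_tprod b] tlift_tens[OF assms(3) vspace_tprod b] by simp_all
qed

section \<open>Coordinates of tensors and arrows of linear maps\<close>

text \<open>The free algebra as a vector space, the common target of all coordinate maps.\<close>
definition falg :: "('k::field, 'i list \<Rightarrow>\<^sub>0 'k) vs" where "falg = VS UNIV sc"

lemma vspace_falg: "vspace falg"
  by (simp add: falg_def vspace_def sc.vector_space_axioms)

lemma falg_simps [simp]: "carr falg = UNIV" "scl falg = sc" by (simp_all add: falg_def)

text \<open>Coordinates on a space: a word \<open>wo\<close>, and a linear isomorphism \<open>cm\<close> from the space to the span of the word
  in the free algebra.\<close>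
datatype ('k, 'a, 'l, 't) crd = Crd (wo: "'l list") (cm: "('k, 'a, 't) lmap")

abbreviation "sp C \<equiv> src (cm C)"

definition valid :: "('l \<Rightarrow> 'i set) \<Rightarrow> ('k::field, 'a::ab_group_add, 'l, 'i list \<Rightarrow>\<^sub>0 'k) crd \<Rightarrow> bool" where
  "valid B C \<longleftrightarrow> vspace (sp C) \<and> cm C \<in> hom (sp C) falg \<and> bij_betw (app (cm C)) (carr (sp C)) (tsp B (wo C))"

lemma validD:
  assumes "valid B C"
  shows valid_vspace: "vspace (sp C)" and valid_hom: "cm C \<in> hom (sp C) falg"
    and valid_in: "x \<in> carr (sp C) \<Longrightarrow> app (cm C) x \<in> tsp B (wo C)"
    and valid_inj: "x \<in> carr (sp C) \<Longrightarrow> y \<in> carr (sp C) \<Longrightarrow> app (cm C) x = app (cm C) y \<Longrightarrow> x = y"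
    and valid_surj: "t \<in> tsp B (wo C) \<Longrightarrow> \<exists>x\<in>carr (sp C). t = app (cm C) x"
  using assms by (auto simp: valid_def bij_betw_def inj_on_def)

text \<open>The inverse coordinate map. The projection makes it linear on the whole free algebra.\<close>
definition ci :: "('l \<Rightarrow> 'i set) \<Rightarrow> ('k::field, 'a::ab_group_add, 'l, 'i list \<Rightarrow>\<^sub>0 'k) crd \<Rightarrow> ('i list \<Rightarrow>\<^sub>0 'k) \<Rightarrow> 'a" where
  "ci B C t = inv_into (carr (sp C)) (app (cm C)) (proj B (wo C) t)"

lemma ci_facts:
  assumes "valid B C"
  shows ci_in: "ci B C t \<in> carr (sp C)" and cm_ci: "app (cm C) (ci B C t) = proj B (wo C) t"
proof -
  have "proj B (wo C) t \<in> app (cm C) ` carr (sp C)"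
    using assms proj_in_tsp[of B "wo C" t] by (simp add: valid_def bij_betw_def)
  then show "ci B C t \<in> carr (sp C)" "app (cm C) (ci B C t) = proj B (wo C) t"
    unfolding ci_def by (rule inv_into_into, rule f_inv_into_f)
qed

lemma ci_eqI: "valid B C \<Longrightarrow> x \<in> carr (sp C) \<Longrightarrow> app (cm C) x = proj B (wo C) t \<Longrightarrow> ci B C t = x"
  by (rule valid_inj[of B C]) (simp_all add: ci_in cm_ci)

lemma ci_cm: "valid B C \<Longrightarrow> x \<in> carr (sp C) \<Longrightarrow> ci B C (app (cm C) x) = x"
  by (rule ci_eqI) (simp_all add: valid_in)

lemma ci_linear:
  assumes "valid B C"
  shows "ci B C (s + t) = ci B C s + ci B C t" "ci B C (sc c t) = scl (sp C) c (ci B C t)"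
  by (rule ci_eqI[OF assms]; simp add: vspace_add vspace_scl valid_vspace[OF assms] ci_in[OF assms]
        hom_add[OF valid_hom[OF assms]] hom_scl[OF valid_hom[OF assms]] cm_ci[OF assms]
        lnr_add[OF lnr_proj] lnr_sc[OF lnr_proj])+

definition ctens :: "('k::field, 'a::ab_group_add, 'l, 'i list \<Rightarrow>\<^sub>0 'k) crd \<Rightarrow>
    ('k, 'b::ab_group_add, 'l, 'i list \<Rightarrow>\<^sub>0 'k) crd \<Rightarrow>
    ('k, ('k, 'a, 'b) tensor, 'l, 'i list \<Rightarrow>\<^sub>0 'k) crd" (infixr "\<boxtimes>" 75) where
  "C \<boxtimes> D = Crd (wo C @ wo D) (tlift (sp C) (sp D) falg (\<lambda>x y. app (cm C) x * app (cm D) y))"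

lemma ctens_simps [simp]: "wo (C \<boxtimes> D) = wo C @ wo D" "sp (C \<boxtimes> D) = sp C \<otimes> sp D"
  by (simp_all add: ctens_def tlift_def)

lemma ctens_cm:
  assumes C: "valid B C" and D: "valid B D"
  shows ctens_hom: "cm (C \<boxtimes> D) \<in> hom (sp C \<otimes> sp D) falg"
    and ctens_tens: "x \<in> carr (sp C) \<Longrightarrow> y \<in> carr (sp D) \<Longrightarrow>
      app (cm (C \<boxtimes> D)) (tens (sp C) (sp D) x y) = app (cm C) x * app (cm D) y"
proof -
  have b: "bilin (sp C) (sp D) falg (\<lambda>x y. app (cm C) x * app (cm D) y)"
    unfolding bilin_def
    by (simp add: hom_add[OF valid_hom[OF C]] hom_add[OF valid_hom[OF D]] hom_scl[OF valid_hom[OF C]]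
      hom_scl[OF valid_hom[OF D]] distrib_left distrib_right mult_sc_left mult_sc_right)
  show "cm (C \<boxtimes> D) \<in> hom (sp C \<otimes> sp D) falg"
    "x \<in> carr (sp C) \<Longrightarrow> y \<in> carr (sp D) \<Longrightarrow>
      app (cm (C \<boxtimes> D)) (tens (sp C) (sp D) x y) = app (cm C) x * app (cm D) y"
    unfolding ctens_def crd.sel using tlift_hom[OF valid_vspace[OF C] vspace_falg b]
      tlift_tens[OF valid_vspace[OF C] vspace_falg b] by simp_all
qed

text \<open>A tensor is a function on bilinear forms, and its value at a form \<open>b\<close> can be computed from its
  coordinates: cut the words at the length of \<open>wo C\<close> and apply \<open>b\<close> to the two parts. Hence a tensor is
  determined by its coordinates.\<close>
lemma ctens_detects:
  fixes C :: "('k::field, 'a::ab_group_add, 'l, 'i list \<Rightarrow>\<^sub>0 'k) crd"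
      and D :: "('k, 'b::ab_group_add, 'l, 'i list \<Rightarrow>\<^sub>0 'k) crd"
  assumes C: "valid B C" and D: "valid B D" and b: "bilin (sp C) (sp D) base_field b"
  shows "\<exists>G. lnr G \<and> (\<forall>t\<in>carr (sp C \<otimes> sp D). G (app (cm (C \<boxtimes> D)) t) = sc (t b) 1)"
proof -
  define G where "G = lin (\<lambda>u. sc (b (ci B C (mon (take (length (wo C)) u))) (ci B D (mon (drop (length (wo C)) u))))
      1)"
  have G: "G (s * t) = sc (b (ci B C s) (ci B D t)) 1" if "s \<in> tsp B (wo C)" "t \<in> tsp B (wo D)" for s t
  proof (rule lnr_eq_on_tsp[OF that(1), where f="\<lambda>s. G (s * t)"])
    show "lnr (\<lambda>s. G (s * t))" unfolding G_def by (rule lnr_comp[OF lnr_mult(1)[OF lnr_id] lnr_lin])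
    show "lnr (\<lambda>s. sc (b (ci B C s) (ci B D t)) 1)"
      unfolding lnr_def using bilinD[OF b] by (simp add: ci_linear C D ci_in sc.scale_left_distrib)
    fix u assume u: "u \<in> idx B (wo C)"
    show "G (mon u * t) = sc (b (ci B C (mon u)) (ci B D t)) 1"
    proof (rule lnr_eq_on_tsp[OF that(2), where f="\<lambda>t. G (mon u * t)"])
      show "lnr (\<lambda>s. G (mon u * s))" unfolding G_def by (rule lnr_comp[OF lnr_mult(2)[OF lnr_id] lnr_lin])
      show "lnr (\<lambda>s. sc (b (ci B C (mon u)) (ci B D s)) 1)"
        unfolding lnr_def using bilinD[OF b] by (simp add: ci_linear C D ci_in sc.scale_left_distrib)
    qed (use u in \<open>simp add: G_def mon_mult idx_length\<close>)
  qed
  have lG: "lnr G" unfolding G_def by (rule lnr_lin)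
  have "G (app (cm (C \<boxtimes> D)) t) = sc (t b) 1" if "t \<in> carr (sp C \<otimes> sp D)" for t
    using valid_vspace[OF C] that
  proof (induction rule: tens_induct)
    case zero
    show ?case unfolding hom_0[OF ctens_hom[OF C D] vspace_tprod] lnr_0[OF lG] by (simp add: zero_fun_apply)
  next
    case (add x y s)
    have 1: "G (app (cm (C \<boxtimes> D)) (tens (sp C) (sp D) x y + s)) = sc (b x y) 1 + sc (s b) 1"
      using add G[OF valid_in[OF C] valid_in[OF D], of x y]
      by (simp add: hom_add[OF ctens_hom[OF C D]] tens_in ctens_tens[OF C D] lnr_add[OF lG] ci_cm C D)
    show ?case unfolding 1 using b by (simp add: plus_fun_apply tens_def sc.scale_left_distrib)
  qed
  with lG show ?thesis by blast
qed

lemma tensor_outside: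
  assumes "t \<in> carr (X \<otimes> Y)" "vspace X" "\<not> bilin X Y base_field b"
  shows "t b = 0"
  using assms(2,1) by (induction rule: tens_induct) (simp_all add: zero_fun_apply plus_fun_apply tens_def assms(3))

lemma valid_ctens [intro]:
  fixes C :: "('k::field, 'a::ab_group_add, 'l, 'i list \<Rightarrow>\<^sub>0 'k) crd"
      and D :: "('k, 'b::ab_group_add, 'l, 'i list \<Rightarrow>\<^sub>0 'k) crd"
  assumes C: "valid B C" and D: "valid B D"
  shows "valid B (C \<boxtimes> D)"
proof -
  let ?f = "app (cm (C \<boxtimes> D))"
  note h = ctens_hom[OF C D]
  have into: "?f t \<in> tsp B (wo C @ wo D)" if "t \<in> carr (sp C \<otimes> sp D)" for t
    using valid_vspace[OF C] that
    by (induction rule: tens_induct)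
      (simp_all add: hom_0[OF h vspace_tprod] hom_add[OF h] tsp_0 tens_in ctens_tens[OF C D]
          tsp_add tsp_mult valid_in C D)
  have "inj_on ?f (carr (sp C \<otimes> sp D))"
  proof (rule inj_onI)
    fix s t assume st: "s \<in> carr (sp C \<otimes> sp D)" "t \<in> carr (sp C \<otimes> sp D)" "?f s = ?f t"
    show "s = t"
    proof
      fix b
      show "s b = t b"
      proof (cases "bilin (sp C) (sp D) base_field b")
        case True
        from ctens_detects[OF C D True] st have "sc (s b) 1 = sc (t b) (1 :: 'i list \<Rightarrow>\<^sub>0 'k)" by metis
        then show ?thesis by (simp add: sc.scale_right_imp_eq)
      qed (simp add: tensor_outside[OF st(1) valid_vspace[OF C]] tensor_outside[OF st(2) valid_vspace[OF C]])
    qed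
  qed
  moreover have "\<exists>x\<in>carr (sp C \<otimes> sp D). t = ?f x" if "t \<in> tsp B (wo C @ wo D)" for t
    using that
  proof (induction rule: tsp_induct)
    case zero
    show ?case using hom_0[OF h vspace_tprod] vspace_0[OF vspace_tprod] by metis
  next
    case (add c u s)
    then obtain x where x: "x \<in> carr (sp C \<otimes> sp D)" "s = ?f x" by blast
    obtain u1 u2 where u: "u = u1 @ u2" "u1 \<in> idx B (wo C)" "u2 \<in> idx B (wo D)"
      using add by (auto simp: idx_append)
    obtain a b where "a \<in> carr (sp C)" "mon u1 = app (cm C) a" "b \<in> carr (sp D)" "mon u2 = app (cm D) b"
      using valid_surj[OF C tsp_mon[OF u(2)]] valid_surj[OF D tsp_mon[OF u(3)]] by blast
    moreover from this have "mon u = ?f (tens (sp C) (sp D) a b)"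
      by (simp add: u ctens_tens[OF C D] flip: mon_mult)
    ultimately have "sc c (mon u) + s = ?f (scl (sp C \<otimes> sp D) c (tens (sp C) (sp D) a b) + x)"
      using x by (simp add: hom_add[OF h] hom_scl[OF h, simplified] vspace_scl[OF vspace_tprod, simplified] tens_in)
    then show ?case using x \<open>a \<in> _\<close> \<open>b \<in> _\<close> vspace_add[OF vspace_tprod] vspace_scl[OF vspace_tprod] tens_in by meson
  qed
  ultimately show ?thesis using h into by (auto simp: valid_def vspace_tprod bij_betw_def)
qed

text \<open>Scalars are multiples of the empty word.\<close>
definition cK :: "('k::field, 'k, 'l, 'i list \<Rightarrow>\<^sub>0 'k) crd" where "cK = Crd [] (LMap base_field falg (\<lambda>c. sc c 1))"

lemma cK_simps [simp]: "wo cK = []" "sp cK = base_field" "app (cm cK) c = sc c 1"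
  by (simp_all add: cK_def)

lemma tsp_Nil: "t \<in> tsp B [] \<longleftrightarrow> (\<exists>c. t = sc c 1)"
  by (auto simp: tsp_def idx_def mon_Nil sc.span_singleton)

lemma valid_cK [intro]: "valid B cK"
  by (auto simp: valid_def vspace_base_field hom_def cK_def sc.scale_left_distrib bij_betw_def inj_on_def tsp_Nil
       dest: sc.scale_right_imp_eq)

text \<open>The linear map \<open>f\<close> is given by the arrow \<open>F\<close> in coordinates \<open>C\<close> and \<open>D\<close>.\<close>
definition rep :: "('l \<Rightarrow> 'i set) \<Rightarrow> ('k::field, 'a::ab_group_add, 'l, 'i list \<Rightarrow>\<^sub>0 'k) crd \<Rightarrow>
    ('k, 'b::ab_group_add, 'l, 'i list \<Rightarrow>\<^sub>0 'k) crd \<Rightarrow>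
    ('k, 'a, 'b) lmap \<Rightarrow> ('l, 'i list \<Rightarrow>\<^sub>0 'k) arrow \<Rightarrow> bool" where
  "rep B C D f F \<longleftrightarrow> valid B C \<and> valid B D \<and> f \<in> hom (sp C) (sp D) \<and>
     is_arrow B F \<and> adm F = wo C \<and> acd F = wo D \<and>
     (\<forall>x\<in>carr (sp C). app (cm D) (app f x) = fn F (app (cm C) x))"

lemma repD:
  assumes "rep B C D f F"
  shows rep_valid: "valid B C" "valid B D" and rep_hom: "f \<in> hom (sp C) (sp D)"
    and rep_arrow: "is_arrow B F" "adm F = wo C" "acd F = wo D"
    and rep_app: "x \<in> carr (sp C) \<Longrightarrow> app (cm D) (app f x) = fn F (app (cm C) x)"
  using assms by (auto simp: rep_def)

lemma rep_ex:
  assumes C: "valid B C" and D: "valid B D" and f: "f \<in> hom (sp C) (sp D)"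
  obtains F where "rep B C D f F"
proof -
  let ?F = "Arrow (wo C) (wo D) (\<lambda>t. app (cm D) (app f (ci B C t)))"
  have "rep B C D f ?F"
    unfolding rep_def is_arrow_def lnr_def
  proof (intro conjI allI ballI)
    fix t show "fn ?F (proj B (adm ?F) t) = fn ?F t"
      by (simp add: ci_def proj_in_tsp)
  qed (use assms in \<open>simp_all add: ci_linear hom_add[OF f] hom_scl[OF f] hom_add[OF valid_hom[OF D]]
      hom_scl[OF valid_hom[OF D]] ci_in hom_in[OF f] valid_in ci_cm\<close>)
  then show ?thesis ..
qed

text \<open>The arrow of a linear map is unique, because coordinates fill the span of their word, and it determines
  the map, because coordinates are injective.\<close>
lemma rep_eq_iff:
  assumes f: "rep B C D f F" and g: "rep B C D g G"
  shows "f = g \<longleftrightarrow> F = G"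
proof
  assume "f = g"
  show "F = G"
  proof (rule arrow_eqI[OF rep_arrow(1)[OF f] rep_arrow(1)[OF g]])
    fix u assume "u \<in> idx B (adm F)"
    then obtain x where "x \<in> carr (sp C)" "mon u = app (cm C) x"
      using valid_surj[OF rep_valid(1)[OF f] tsp_mon] rep_arrow[OF f] by metis
    then show "fn F (mon u) = fn G (mon u)" using rep_app[OF f] rep_app[OF g] \<open>f = g\<close> by simp
  qed (simp_all add: rep_arrow[OF f] rep_arrow[OF g])
next
  assume "F = G"
  show "f = g"
  proof (rule hom_eqI[OF rep_hom[OF f] rep_hom[OF g]])
    fix x assume x: "x \<in> carr (sp C)"
    show "app f x = app g x"
      using x rep_app[OF f x] rep_app[OF g x] \<open>F = G\<close>
      by (intro valid_inj[OF rep_valid(2)[OF f]]) (simp_all add: hom_in[OF rep_hom[OF f]] hom_in[OF rep_hom[OF g]])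
  qed
qed

lemma rep_comp:
  assumes "rep B C D f F" "rep B D E g G"
  shows "rep B C E (g \<odot> f) (G \<cdot> F)"
proof -
  note f = assms(1) and g = assms(2)
  show ?thesis
    unfolding rep_def
    using comp_hom[OF rep_hom[OF f] rep_hom[OF g] valid_vspace[OF rep_valid(1)[OF f]]]
      rep_valid[OF f] rep_valid[OF g] rep_arrow[OF f] rep_arrow[OF g]
    by (simp add: comp_app[OF rep_hom[OF f]] rep_app[OF f] rep_app[OF g] hom_in[OF rep_hom[OF f]] is_arrow_comp)
qed

lemma rep_idm: "valid B C \<Longrightarrow> rep B C C (idm (sp C)) (aid B (wo C))"
  by (simp add: rep_def idm_hom valid_vspace is_arrow_id idm_app valid_in)

lemma fn_lmap:
  assumes "is_arrow B F"
  shows "LMap falg falg (fn F) \<in> hom falg falg"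
  using is_arrow_lnr[OF assms] by (simp add: hom_def lnr_def)

text \<open>Linear maps on a tensor product are determined by elementary tensors, whose coordinates are products.\<close>
lemma rep_tensI:
  assumes C: "valid B C" and D: "valid B D" and E: "valid B E" and f: "f \<in> hom (sp C \<otimes> sp D) (sp E)"
    and F: "is_arrow B F" "adm F = wo C @ wo D" "acd F = wo E"
    and e: "\<And>x y. x \<in> carr (sp C) \<Longrightarrow> y \<in> carr (sp D) \<Longrightarrow>
      app (cm E) (app f (tens (sp C) (sp D) x y)) = fn F (app (cm C) x * app (cm D) y)"
  shows "rep B (C \<boxtimes> D) E f F"
proof -
  have 1: "cm E \<odot> f \<in> hom (sp C \<otimes> sp D) falg" by (rule comp_hom[OF f valid_hom[OF E] vspace_tprod])
  have 2: "LMap falg falg (fn F) \<odot> cm (C \<boxtimes> D) \<in> hom (sp C \<otimes> sp D) falg"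
    by (rule comp_hom[OF ctens_hom[OF C D] fn_lmap[OF F(1)] vspace_tprod])
  have "cm E \<odot> f = LMap falg falg (fn F) \<odot> cm (C \<boxtimes> D)"
    by (rule hom_tens_eqI[OF valid_vspace[OF C] 1 2])
      (simp add: comp_app[OF f] comp_app[OF ctens_hom[OF C D]] tens_in e ctens_tens[OF C D])
  then have "app (cm E \<odot> f) t = app (LMap falg falg (fn F) \<odot> cm (C \<boxtimes> D)) t" for t by simp
  from this have "app (cm E) (app f t) = fn F (app (cm (C \<boxtimes> D)) t)" if "t \<in> carr (sp C \<otimes> sp D)" for t
    using that comp_app[OF f that] comp_app[OF ctens_hom[OF C D] that] by (metis lmap.sel(3))
  then show ?thesis using C D E f F by (simp add: rep_def valid_ctens)
qed

lemma rep_tens3I: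
  assumes C: "valid B C" and D: "valid B D" and E: "valid B E" and G: "valid B G"
    and f: "f \<in> hom ((sp C \<otimes> sp D) \<otimes> sp E) (sp G)"
    and F: "is_arrow B F" "adm F = wo C @ wo D @ wo E" "acd F = wo G"
    and e: "\<And>x y z. x \<in> carr (sp C) \<Longrightarrow> y \<in> carr (sp D) \<Longrightarrow> z \<in> carr (sp E) \<Longrightarrow>
      app (cm G) (app f (tens (sp C \<otimes> sp D) (sp E) (tens (sp C) (sp D) x y) z)) =
        fn F (app (cm C) x * app (cm D) y * app (cm E) z)"
  shows "rep B ((C \<boxtimes> D) \<boxtimes> E) G f F"
proof -
  have CD: "valid B (C \<boxtimes> D)" using C D by blast
  have f': "f \<in> hom (sp (C \<boxtimes> D) \<otimes> sp E) (sp G)" using f by simp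
  have 1: "cm G \<odot> f \<in> hom ((sp C \<otimes> sp D) \<otimes> sp E) falg" by (rule comp_hom[OF f valid_hom[OF G] vspace_tprod])
  note h = ctens_hom[OF CD E, simplified]
  have 2: "LMap falg falg (fn F) \<odot> cm ((C \<boxtimes> D) \<boxtimes> E) \<in> hom ((sp C \<otimes> sp D) \<otimes> sp E) falg"
    by (rule comp_hom[OF h fn_lmap[OF F(1)] vspace_tprod])
  have eq: "cm G \<odot> f = LMap falg falg (fn F) \<odot> cm ((C \<boxtimes> D) \<boxtimes> E)"
    by (rule hom_tens3_eqI[OF valid_vspace[OF C] 1 2])
      (simp add: comp_app[OF f] comp_app[OF h] tens_in e ctens_tens[OF CD E, simplified] ctens_tens[OF C D])
  show ?thesis
  proof (rule rep_tensI[OF CD E G f' F(1)])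
    fix x y assume xy: "x \<in> carr (sp (C \<boxtimes> D))" "y \<in> carr (sp E)"
    then have t: "tens (sp C \<otimes> sp D) (sp E) x y \<in> carr ((sp C \<otimes> sp D) \<otimes> sp E)" by (simp add: tens_in)
    show "app (cm G) (app f (tens (sp (C \<boxtimes> D)) (sp E) x y)) = fn F (app (cm (C \<boxtimes> D)) x * app (cm E) y)"
      using arg_cong[OF eq, of "\<lambda>f. app f (tens (sp C \<otimes> sp D) (sp E) x y)"] xy
      by (simp add: comp_app[OF f] comp_app[OF h] t ctens_tens[OF CD E, simplified])
  qed (simp_all add: F)
qed

lemma rep_tens3I':
  assumes C: "valid B C" and D: "valid B D" and E: "valid B E" and G: "valid B G"
    and f: "f \<in> hom (sp C \<otimes> (sp D \<otimes> sp E)) (sp G)"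
    and F: "is_arrow B F" "adm F = wo C @ wo D @ wo E" "acd F = wo G"
    and e: "\<And>x y z. x \<in> carr (sp C) \<Longrightarrow> y \<in> carr (sp D) \<Longrightarrow> z \<in> carr (sp E) \<Longrightarrow>
      app (cm G) (app f (tens (sp C) (sp D \<otimes> sp E) x (tens (sp D) (sp E) y z))) =
        fn F (app (cm C) x * app (cm D) y * app (cm E) z)"
  shows "rep B (C \<boxtimes> (D \<boxtimes> E)) G f F"
proof -
  have DE: "valid B (D \<boxtimes> E)" using D E by blast
  have f': "f \<in> hom (sp C \<otimes> sp (D \<boxtimes> E)) (sp G)" using f by simp
  have 1: "cm G \<odot> f \<in> hom (sp C \<otimes> (sp D \<otimes> sp E)) falg" by (rule comp_hom[OF f valid_hom[OF G] vspace_tprod])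
  note h = ctens_hom[OF C DE, simplified]
  have 2: "LMap falg falg (fn F) \<odot> cm (C \<boxtimes> (D \<boxtimes> E)) \<in> hom (sp C \<otimes> (sp D \<otimes> sp E)) falg"
    by (rule comp_hom[OF h fn_lmap[OF F(1)] vspace_tprod])
  have eq: "cm G \<odot> f = LMap falg falg (fn F) \<odot> cm (C \<boxtimes> (D \<boxtimes> E))"
    by (rule hom_tens3_eqI'[OF valid_vspace[OF C] valid_vspace[OF D] 1 2])
      (simp add: comp_app[OF f] comp_app[OF h] tens_in e ctens_tens[OF C DE, simplified] ctens_tens[OF D E]
          mult.assoc)
  show ?thesis
  proof (rule rep_tensI[OF C DE G f' F(1)])
    fix x y assume xy: "x \<in> carr (sp C)" "y \<in> carr (sp (D \<boxtimes> E))"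
    then have t: "tens (sp C) (sp D \<otimes> sp E) x y \<in> carr (sp C \<otimes> (sp D \<otimes> sp E))" by (simp add: tens_in)
    show "app (cm G) (app f (tens (sp C) (sp (D \<boxtimes> E)) x y)) = fn F (app (cm C) x * app (cm (D \<boxtimes> E)) y)"
      using arg_cong[OF eq, of "\<lambda>f. app f (tens (sp C) (sp D \<otimes> sp E) x y)"] xy
      by (simp add: comp_app[OF f] comp_app[OF h] t ctens_tens[OF C DE, simplified])
  qed (simp_all add: F)
qed

section \<open>Arrows of the structural maps\<close>

lemma awh_left:
  "is_arrow B F \<Longrightarrow> t \<in> tsp B (adm F) \<Longrightarrow> r \<in> tsp B R \<Longrightarrow> fn (awh B [] F R) (t * r) = fn F t * r"
  using awh_apply[of F 1 B "[]" t r R] tsp_mon[of "[]" B "[]"] by (simp add: is_arrow_lnr mon_Nil)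

lemma awh_right:
  "is_arrow B F \<Longrightarrow> s \<in> tsp B (rev L) \<Longrightarrow> t \<in> tsp B (adm F) \<Longrightarrow> fn (awh B L F []) (s * t) = s * fn F t"
  using awh_apply[of F s B L t 1 "[]"] tsp_mon[of "[]" B "[]"] by (simp add: is_arrow_lnr mon_Nil)

definition coords :: "('l \<Rightarrow> 'i set) \<Rightarrow> ('k::field, 'a::ab_group_add, 'l, 'i list \<Rightarrow>\<^sub>0 'k) crd \<Rightarrow> ('k, 'a) vs \<Rightarrow>
    bool" where
  "coords B C X \<longleftrightarrow> valid B C \<and> sp C = X"

lemma coords_valid: "coords B C X \<Longrightarrow> valid B C" and coords_sp: "coords B C X \<Longrightarrow> sp C = X"
  and coords_vspace: "coords B C X \<Longrightarrow> vspace X"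
  by (auto simp: coords_def valid_vspace)

lemma coords_ctens: "coords B C X \<Longrightarrow> coords B D Y \<Longrightarrow> coords B (C \<boxtimes> D) (X \<otimes> Y)"
  by (auto simp: coords_def)
lemma coords_cK: "coords B cK base_field" by (auto simp: coords_def)

lemma rep_idm': "coords B C X \<Longrightarrow> rep B C C (idm X) (aid B (wo C))"
  using rep_idm coords_def by metis

text \<open>Of the two orders in which the factors can act, the arrow takes the one with the right factor first.\<close>
lemma rep_tmap:
  assumes f: "rep B C C' f F" and g: "rep B D D' g G"
  shows "rep B (C \<boxtimes> D) (C' \<boxtimes> D') (f \<otimes>\<^sub>m g) (awh B [] F (wo D') \<cdot> awh B (rev (wo C)) G [])"
proof -
  note v = rep_valid[OF f] rep_valid[OF g]
  note h = tmap_hom[OF rep_hom[OF f] rep_hom[OF g] valid_vspace[OF v(1)]]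
    tmap_tens[OF rep_hom[OF f] rep_hom[OF g] valid_vspace[OF v(1)]]
  note a = rep_arrow[OF f] rep_arrow[OF g]
  show ?thesis
  proof (rule rep_tensI)
    fix x y assume xy: "x \<in> carr (sp C)" "y \<in> carr (sp D)"
    have "fn (awh B (rev (wo C)) G []) (app (cm C) x * app (cm D) y) = app (cm C) x * fn G (app (cm D) y)"
      using a v xy by (intro awh_right) (simp_all add: valid_in)
    moreover have "fn (awh B [] F (wo D')) (app (cm C) x * fn G (app (cm D) y)) =
        fn F (app (cm C) x) * fn G (app (cm D) y)"
      using a v xy is_arrow_into[OF a(4)] by (intro awh_left) (simp_all add: valid_in)
    ultimately show "app (cm (C' \<boxtimes> D')) (app (f \<otimes>\<^sub>m g) (tens (sp C) (sp D) x y)) =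
       fn (awh B [] F (wo D') \<cdot> awh B (rev (wo C)) G []) (app (cm C) x * app (cm D) y)"
      using xy v by (simp add: h ctens_tens hom_in[OF rep_hom[OF f]] hom_in[OF rep_hom[OF g]]
          rep_app[OF f] rep_app[OF g])
  qed (use h a v in \<open>simp_all add: valid_ctens\<close>)
qed

lemma rep_tmap_right: "rep B C C' f F \<Longrightarrow> coords B D Y \<Longrightarrow> rep B (C \<boxtimes> D) (C' \<boxtimes> D) (f \<otimes>\<^sub>m idm Y) (awh B [] F (wo D))"
  using rep_tmap[OF _ rep_idm', of B C C' f F D Y] by (simp add: rep_arrow)

lemma rep_tmap_left: "rep B D D' g G \<Longrightarrow> coords B C X \<Longrightarrow> rep B (C \<boxtimes> D) (C \<boxtimes> D') (idm X \<otimes>\<^sub>m g) (awh B (rev (wo C)) G [])"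
  using rep_tmap[OF rep_idm', of B C X D D' g G] by (simp add: rep_arrow)

text \<open>The product of the free algebra is associative, so an associativity constraint does nothing to
  coordinates.\<close>
lemma rep_assoc:
  assumes "coords B C X" "coords B D Y" "coords B E Z"
  shows "rep B ((C \<boxtimes> D) \<boxtimes> E) (C \<boxtimes> (D \<boxtimes> E)) (assoc X Y Z) (aid B (wo C @ wo D @ wo E))"
proof -
  note v = assms[THEN coords_valid] and s = assms[THEN coords_sp]
  have de: "valid B (D \<boxtimes> E)" using v by blast
  note w = v[THEN valid_vspace]
  have "rep B ((C \<boxtimes> D) \<boxtimes> E) (C \<boxtimes> (D \<boxtimes> E)) (assoc (sp C) (sp D) (sp E)) (aid B (wo C @ wo D @ wo E))"
    by (rule rep_tens3I[OF v])
      (use v de assoc_hom[OF w] in \<open>simp_all add: valid_ctens is_arrow_id assoc_tens w tens_in ctens_tens[OF v(1) de,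
          simplified]
         ctens_tens valid_in mult.assoc tsp_mult\<close>)
  then show ?thesis unfolding s .
qed

lemma rep_unassoc:
  assumes "coords B C X" "coords B D Y" "coords B E Z"
  shows "rep B (C \<boxtimes> (D \<boxtimes> E)) ((C \<boxtimes> D) \<boxtimes> E) (unassoc X Y Z) (aid B (wo C @ wo D @ wo E))"
proof -
  note v = assms[THEN coords_valid] and s = assms[THEN coords_sp]
  have cd: "valid B (C \<boxtimes> D)" using v by blast
  note w = v[THEN valid_vspace]
  have "rep B (C \<boxtimes> (D \<boxtimes> E)) ((C \<boxtimes> D) \<boxtimes> E) (unassoc (sp C) (sp D) (sp E)) (aid B (wo C @ wo D @ wo E))"
    by (rule rep_tens3I'[OF v])
      (use v cd unassoc_hom[OF w] in \<open>simp_all add: valid_ctens is_arrow_id unassoc_tens w tens_in ctens_tens[OF cd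
          v(3), simplified]
         ctens_tens valid_in mult.assoc tsp_mult\<close>)
  then show ?thesis unfolding s .
qed

lemma rep_lunit: "coords B C X \<Longrightarrow> rep B (cK \<boxtimes> C) C (lunit X) (aid B (wo C))"
  by (rule rep_tensI) (auto simp: coords_def valid_cK lunit_hom valid_vspace is_arrow_id lunit_tens
      hom_scl[OF valid_hom] mult_sc_left valid_in tsp_sc)

lemma rep_runit: "coords B C X \<Longrightarrow> rep B (C \<boxtimes> cK) C (runit X) (aid B (wo C))"
  by (rule rep_tensI) (auto simp: coords_def valid_cK runit_hom valid_vspace is_arrow_id runit_tens
      hom_scl[OF valid_hom] mult_sc_right valid_in tsp_sc)

text \<open>The constraints on both sides of the braiding are identities in coordinates.\<close>
lemma rep_idt:
  assumes "coords B C X" "coords B D Y" "coords B E Z" and p: "rep B (D \<boxtimes> E) (E \<boxtimes> D) p P"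
  shows "rep B ((C \<boxtimes> D) \<boxtimes> E) ((C \<boxtimes> E) \<boxtimes> D) (idt X Y Z p) (awh B (rev (wo C)) P [])"
  using rep_comp[OF rep_comp[OF rep_assoc[OF assms(1-3)] rep_tmap_left[OF p assms(1)]] rep_unassoc[OF assms(1,3,2)]]
    rep_arrow[OF p]
  unfolding idt_def by (simp add: comp_def) 

lemma rep_mid:
  assumes "coords B C X" "coords B D Y" "coords B E Z" "coords B G W" and p: "rep B (D \<boxtimes> E) (E \<boxtimes> D) p P"
  shows "rep B ((C \<boxtimes> D) \<boxtimes> (E \<boxtimes> G)) ((C \<boxtimes> E) \<boxtimes> (D \<boxtimes> G)) (mid X Y Z W p) (awh B (rev (wo C)) P (wo G))"
  using rep_comp[OF rep_comp[OF rep_unassoc[OF coords_ctens[OF assms(1,2)] assms(3,4)]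
      rep_tmap_right[OF rep_idt[OF assms(1-3) p] assms(4)]] rep_assoc[OF coords_ctens[OF assms(1,3)] assms(2,4)]]
    rep_arrow[OF p]
  unfolding mid_def by (simp add: comp_def)

lemma isoD:
  assumes "f \<in> iso X Y" "vspace X" "vspace Y"
  shows iso_hom: "f \<in> hom X Y" and linv_hom: "linv f \<in> hom Y X"
    and linv_left: "linv f \<odot> f = idm X" and linv_right: "f \<odot> linv f = idm Y"
proof -
  show f: "f \<in> hom X Y" using assms by (simp add: iso_def)
  have b: "bij_betw (app f) (carr X) (carr Y)" using assms by (simp add: iso_def)
  let ?g = "inv_into (carr X) (app f)"
  have g: "?g y \<in> carr X" "app f (?g y) = y" if "y \<in> carr Y" for y
    using that b by (auto simp: bij_betw_def intro: inv_into_into f_inv_into_f)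
  have gf: "?g (app f x) = x" if "x \<in> carr X" for x
    using that b by (simp add: bij_betw_def)
  have g_add: "?g (y + y') = ?g y + ?g y'" if "y \<in> carr Y" "y' \<in> carr Y" for y y'
  proof -
    have "?g (app f (?g y + ?g y')) = ?g y + ?g y'" by (intro gf vspace_add assms g that)
    then show ?thesis by (simp add: hom_add[OF f] g that)
  qed
  have g_scl: "?g (scl Y c y) = scl X c (?g y)" if "y \<in> carr Y" for c y
  proof -
    have "?g (app f (scl X c (?g y))) = scl X c (?g y)" by (intro gf vspace_scl assms g that)
    then show ?thesis by (simp add: hom_scl[OF f] g that)
  qed
  show h: "linv f \<in> hom Y X"
    unfolding linv_def hom_src[OF f] hom_trg[OF f] by (rule homI) (simp_all add: g g_add g_scl assms)
  have l: "app (linv f) y = ?g y" if "y \<in> carr Y" for y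
    using that by (simp add: linv_def hom_src[OF f] hom_trg[OF f])
  show "linv f \<odot> f = idm X"
    by (rule hom_eqI[OF comp_hom[OF f h] idm_hom])
      (simp_all add: comp_app[OF f] l hom_in[OF f] gf idm_app assms)
  show "f \<odot> linv f = idm Y"
    by (rule hom_eqI[OF comp_hom[OF h f] idm_hom])
      (simp_all add: comp_app[OF h] l g idm_app assms)
qed

lemma rep_linv:
  assumes f: "rep B C D f F" and i: "f \<in> iso (sp C) (sp D)"
  obtains G where "rep B D C (linv f) G" "G \<cdot> F = aid B (wo C)" "F \<cdot> G = aid B (wo D)"
proof -
  note v = rep_valid[OF f]
  note i = isoD[OF i v[THEN valid_vspace]]
  obtain G where G: "rep B D C (linv f) G" using rep_ex[OF v(2,1) i(2)] .
  show ?thesis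
    by (rule that[OF G])
      (use rep_eq_iff[OF rep_comp[OF f G] rep_idm[OF v(1)]] rep_eq_iff[OF rep_comp[OF G f] rep_idm[OF v(2)]]
          i in simp_all)
qed

text \<open>An element as a linear map, and tensoring with a fixed element as a linear map. They turn conditions on
  units, which are stated for elements, into equations between linear maps.\<close>
definition elt :: "('k::field, 'a::ab_group_add) vs \<Rightarrow> 'a \<Rightarrow> ('k, 'k, 'a) lmap" where
  "elt X x = LMap base_field X (\<lambda>c. scl X c x)"
definition ltens :: "('k::field, 'a::ab_group_add) vs \<Rightarrow> ('k, 'b::ab_group_add) vs \<Rightarrow> 'a \<Rightarrow>
    ('k, 'b, ('k, 'a, 'b) tensor) lmap" where
  "ltens X Y x = LMap Y (X \<otimes> Y) (\<lambda>y. if y \<in> carr Y then tens X Y x y else 0)"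
definition rtens :: "('k::field, 'a::ab_group_add) vs \<Rightarrow> ('k, 'b::ab_group_add) vs \<Rightarrow> 'b \<Rightarrow>
    ('k, 'a, ('k, 'a, 'b) tensor) lmap" where
  "rtens X Y y = LMap X (X \<otimes> Y) (\<lambda>x. if x \<in> carr X then tens X Y x y else 0)"

lemma elt_hom: "vspace X \<Longrightarrow> x \<in> carr X \<Longrightarrow> elt X x \<in> hom base_field X"
proof -
  assume X: "vspace X" "x \<in> carr X"
  then interpret X: vector_space "scl X" by (simp add: vspace_def)
  show ?thesis using X by (simp add: elt_def hom_def vspace_scl X.scale_left_distrib)
qed

lemma ltens_hom: "vspace Y \<Longrightarrow> x \<in> carr X \<Longrightarrow> ltens X Y x \<in> hom Y (X \<otimes> Y)"
  and rtens_hom: "vspace X \<Longrightarrow> y \<in> carr Y \<Longrightarrow> rtens X Y y \<in> hom X (X \<otimes> Y)"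
  unfolding ltens_def rtens_def by (rule tens_left_hom tens_right_hom; assumption)+

lemma special_app [simp]:
  "app (elt X x) c = scl X c x"
  "y \<in> carr Y \<Longrightarrow> app (ltens X Y x) y = tens X Y x y"
  "x' \<in> carr X \<Longrightarrow> app (rtens X Y y') x' = tens X Y x' y'"
  by (simp_all add: elt_def ltens_def rtens_def)

lemma scl_one: "vspace X \<Longrightarrow> scl X 1 x = x"
proof -
  assume "vspace X"
  then interpret vector_space "scl X" by (simp add: vspace_def)
  show ?thesis by simp
qed

lemma rep_elt:
  assumes "coords B C X" "x \<in> carr X"
  obtains E where "rep B cK C (elt X x) E" "fn E 1 = app (cm C) x"
proof -
  obtain E where E: "rep B cK C (elt X x) E"
    using rep_ex[OF valid_cK coords_valid[OF assms(1)], of "elt X x"] elt_hom[OF coords_vspace[OF assms(1)] assms(2)]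
        coords_sp[OF assms(1)]
    by auto
  show ?thesis
    by (rule that[OF E]) (use rep_app[OF E, of 1] in \<open>simp add: scl_one coords_vspace[OF assms(1)]\<close>)
qed

lemma elt_fn:
  assumes "coords B C X" "rep B cK C (elt X x) E"
  shows "fn E 1 = app (cm C) x"
  using rep_app[OF assms(2), of 1] by (simp add: scl_one coords_vspace[OF assms(1)])

lemma one_tsp: "1 \<in> tsp B []"
  using tsp_mon[of "[]" B "[]"] by (simp add: mon_Nil)

lemma rep_ltens:
  assumes C: "coords B C X" and D: "coords B D Y" and x: "x \<in> carr X" and E: "rep B cK C (elt X x) E"
  shows "rep B D (C \<boxtimes> D) (ltens X Y x) (awh B [] E (wo D))"
  unfolding rep_def
proof (intro conjI ballI)
  fix y assume y: "y \<in> carr (sp D)"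
  have "fn (awh B [] E (wo D)) (1 * app (cm D) y) = fn E 1 * app (cm D) y"
    using rep_arrow[OF E] y by (intro awh_left) (simp_all add: one_tsp valid_in coords_valid[OF D])
  then show "app (cm (C \<boxtimes> D)) (app (ltens X Y x) y) = fn (awh B [] E (wo D)) (app (cm D) y)"
    using y x elt_fn[OF C E] coords_sp[OF C] coords_sp[OF D] ctens_tens[OF coords_valid[OF C] coords_valid[OF D]]
        by simp
qed (use rep_arrow[OF E] C D ltens_hom[OF coords_vspace[OF D] x] in \<open>auto simp: coords_def valid_ctens\<close>)

lemma rep_rtens:
  assumes C: "coords B C X" and D: "coords B D Y" and y: "y \<in> carr Y" and E: "rep B cK D (elt Y y) E"
  shows "rep B C (C \<boxtimes> D) (rtens X Y y) (awh B (rev (wo C)) E [])"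
  unfolding rep_def
proof (intro conjI ballI)
  fix x assume x: "x \<in> carr (sp C)"
  have "fn (awh B (rev (wo C)) E []) (app (cm C) x * 1) = app (cm C) x * fn E 1"
    using rep_arrow[OF E] x by (intro awh_right) (simp_all add: one_tsp valid_in coords_valid[OF C])
  then show "app (cm (C \<boxtimes> D)) (app (rtens X Y y) x) = fn (awh B (rev (wo C)) E []) (app (cm C) x)"
    using y x elt_fn[OF D E] coords_sp[OF C] coords_sp[OF D] ctens_tens[OF coords_valid[OF C] coords_valid[OF D]]
        by simp
qed (use rep_arrow[OF E] C D rtens_hom[OF coords_vspace[OF C] y] in \<open>auto simp: coords_def valid_ctens\<close>)

lemma comp_ltens_eq_iff:
  assumes "p \<in> hom (X \<otimes> Y) Z" "g \<in> hom Y Z" "vspace Y" "x \<in> carr X"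
  shows "p \<odot> ltens X Y x = g \<longleftrightarrow> (\<forall>y\<in>carr Y. app p (tens X Y x y) = app g y)"
proof -
  note l = ltens_hom[OF assms(3,4)]
  show ?thesis
    using hom_eqI[OF comp_hom[OF l assms(1,3)] assms(2)] comp_app[OF l, of _ p] by auto
qed

lemma comp_rtens_eq_iff:
  assumes "p \<in> hom (X \<otimes> Y) Z" "g \<in> hom X Z" "vspace X" "y \<in> carr Y"
  shows "p \<odot> rtens X Y y = g \<longleftrightarrow> (\<forall>x\<in>carr X. app p (tens X Y x y) = app g x)"
proof -
  note l = rtens_hom[OF assms(3,4)]
  show ?thesis
    using hom_eqI[OF comp_hom[OF l assms(1,3)] assms(2)] comp_app[OF l, of _ p] by auto
qed

lemma mon_inj: "(mon u :: 'i list \<Rightarrow>\<^sub>0 'k::field) = mon v \<longleftrightarrow> u = v"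
proof
  assume "(mon u :: 'i list \<Rightarrow>\<^sub>0 'k) = mon v"
  then have "Poly_Mapping.keys (mon u :: 'i list \<Rightarrow>\<^sub>0 'k) = Poly_Mapping.keys (mon v :: 'i list \<Rightarrow>\<^sub>0 'k)" by simp
  then show "u = v" by (simp add: mon_def)
qed simp

lemma mon_independent: "sc.independent (mon ` S :: ('i list \<Rightarrow>\<^sub>0 'k::field) set)"
proof -
  have *: "Poly_Mapping.lookup t u = 0" if "t \<in> sc.span (mon ` S - {mon u})" for t :: "'i list \<Rightarrow>\<^sub>0 'k" and u
    using that
  proof (induction rule: sc.span_induct_alt)
    case base
    show ?case by simp
  next
    case (step c x y)
    then show ?case by (auto simp: sc_mon lookup_add lookup_single when_def)
  qed
  show ?thesis unfolding sc.dependent_def using * by (force simp: mon_def)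
qed

text \<open>Coordinates of length one come from a basis \<open>S\<close>, embedded into the letters by \<open>\<iota>\<close>. The basis is chosen
  before \<open>B\<close>, so that a single \<open>B\<close> can be defined for several spaces at once.\<close>
lemma crd_ex:
  fixes X :: "('k::field, 'a::ab_group_add) vs" and \<iota> :: "'a \<Rightarrow> 'i"
  assumes X: "vspace X" and \<iota>: "inj \<iota>"
  obtains S where "\<And>(B :: 'l \<Rightarrow> 'i set) l. B l = \<iota> ` S \<Longrightarrow> \<exists>C. coords B C X \<and> wo C = [l]"
proof -
  interpret X: vector_space "scl X" using X by (simp add: vspace_def)
  interpret P: vector_space_pair "scl X" "sc :: 'k \<Rightarrow> ('i list \<Rightarrow>\<^sub>0 'k) \<Rightarrow> _" ..
  obtain S where S: "S \<subseteq> carr X" "X.independent S" "X.span S = carr X"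
    using X.basis_exists[of "carr X"] X.span_minimal[of _ "carr X"] X unfolding vspace_def
    by (metis subset_antisym)
  obtain g where g: "Vector_Spaces.linear (scl X) sc g" "\<And>x. x \<in> S \<Longrightarrow> g x = mon [\<iota> x]"
    using P.linear_independent_extend[OF S(2), of "\<lambda>x. mon [\<iota> x]"] by blast
  interpret g: Vector_Spaces.linear "scl X" sc g by fact
  have im: "g ` S = mon ` (\<lambda>x. [\<iota> x]) ` S" using g(2) by (auto simp: image_iff)
  have inj: "inj_on g S"
    using \<iota> g(2) by (auto simp: inj_on_def mon_inj dest: injD)
  show ?thesis
  proof (rule that[of S])
    fix B :: "'l \<Rightarrow> 'i set" and l assume B: "B l = \<iota> ` S"
    let ?C = "Crd [l] (LMap X falg (\<lambda>x. if x \<in> carr X then g x else 0))"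
    have "tsp B [l] = sc.span (g ` S)"
      unfolding tsp_def idx_single B im by (simp add: image_image)
    also have "\<dots> = g ` carr X" unfolding S(3)[symmetric] by (rule g.span_image)
    finally have "g ` carr X = tsp B [l]" ..
    moreover have "inj_on g (carr X)"
      unfolding S(3)[symmetric] 
      using P.linear_inj_on_span_iff_independent_image[OF g(1), of S] inj mon_independent im by metis
    ultimately have "bij_betw g (carr X) (tsp B [l])" by (simp add: bij_betw_def)
    then have "bij_betw (app (cm ?C)) (carr X) (tsp B [l])"
      by (simp cong: bij_betw_cong)
    then have "coords B ?C X" using X
      by (simp add: coords_def valid_def) (rule homI, simp_all add: g.add g.scale)
    then show "\<exists>C. coords B C X \<and> wo C = [l]" by (intro exI[of _ ?C]) simp
  qed
qed

section \<open>Functionals and slices of tensors\<close>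

text \<open>Linearity on the carrier only, with no condition outside. Evaluations \<open>\<lambda>f. f a\<close> on a space of functionals
  are of this kind.\<close>
definition lfun :: "('k::field, 'a::ab_group_add) vs \<Rightarrow> ('a \<Rightarrow> 'k) \<Rightarrow> bool" where
  "lfun X f \<longleftrightarrow> (\<forall>x\<in>carr X. \<forall>y\<in>carr X. f (x + y) = f x + f y) \<and> (\<forall>c. \<forall>x\<in>carr X. f (scl X c x) = c * f x)"

lemma lfunD: "lfun X f \<Longrightarrow> x \<in> carr X \<Longrightarrow> y \<in> carr X \<Longrightarrow> f (x + y) = f x + f y"
  "lfun X f \<Longrightarrow> x \<in> carr X \<Longrightarrow> f (scl X c x) = c * f x"
  by (simp_all add: lfun_def)

lemma dual_iff: "f \<in> carr (dual X) \<longleftrightarrow> lfun X f \<and> (\<forall>x. x \<notin> carr X \<longrightarrow> f x = 0)"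
  by (auto simp: dual_def hom_def lfun_def)

lemma dual_lfun: "f \<in> carr (dual X) \<Longrightarrow> lfun X f" by (simp add: dual_iff)

lemma scl_dual [simp]: "scl (dual X) = fscl" by (simp add: dual_def)

lemma vspace_dual: "vspace (dual X)"
proof -
  interpret vector_space "fscl :: 'a \<Rightarrow> ('b \<Rightarrow> 'a) \<Rightarrow> _" by (rule vector_space_fscl)
  show ?thesis unfolding vspace_def
    by (auto simp: vector_space_axioms subspace_def dual_iff lfun_def plus_fun_apply zero_fun_apply algebra_simps)
qed

lemma lfun_0: "vspace X \<Longrightarrow> lfun X f \<Longrightarrow> f 0 = 0"
  using lfunD(1)[of X f 0 0] vspace_0[of X] by (metis add_0 add_cancel_right_left)

lemma dual_eqI:
  assumes "f \<in> carr (dual X)" "g \<in> carr (dual X)" "\<And>x. x \<in> carr X \<Longrightarrow> f x = g x"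
  shows "f = g"
  using assms by (auto simp: dual_iff fun_eq_iff) metis

text \<open>A nonzero vector is independent, so some functional has value \<open>1\<close> on it.\<close>
lemma dual_separates:
  assumes V: "vspace V" and x: "x \<in> carr V" "y \<in> carr V" and e: "\<And>e. e \<in> carr (dual V) \<Longrightarrow> e x = e y"
  shows "x = y"
proof (rule ccontr)
  interpret V: vector_space "scl V" using V by (simp add: vspace_def)
  interpret F: vector_space "(*) :: 'a \<Rightarrow> 'a \<Rightarrow> 'a" by unfold_locales (auto simp: algebra_simps)
  interpret P: vector_space_pair "scl V" "(*) :: 'a \<Rightarrow> 'a \<Rightarrow> 'a" ..
  assume "x \<noteq> y"
  then have "V.independent {x - y}" by (simp add: V.dependent_single)
  then obtain g where g: "Vector_Spaces.linear (scl V) (*) g" "g (x - y) = 1"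
    using P.linear_independent_extend[of "{x - y}" "\<lambda>_. 1"] by auto
  interpret g: Vector_Spaces.linear "scl V" "(*)" g by fact
  have "(\<lambda>z. if z \<in> carr V then g z else 0) \<in> carr (dual V)"
    using V by (simp add: dual_iff lfun_def g.add g.scale vspace_add vspace_scl)
  from e[OF this] x have "g x = g y" by simp
  then show False using g(2) by (simp add: g.diff)
qed

lemma tensor_eval_tens: "bilin X Y base_field b \<Longrightarrow> tens X Y x y b = b x y"
  by (simp add: tens_def)

lemma bilin_lfun: "lfun X f \<Longrightarrow> lfun Y g \<Longrightarrow> bilin X Y base_field (\<lambda>x y. f x * g y)"
  by (simp add: bilin_def lfun_def algebra_simps)

lemma tform_app: "t \<in> carr (P \<otimes> Q) \<Longrightarrow> tform P Q b t = t b" by (simp add: tform_def)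

lemma tform_dual: "tform P Q b \<in> carr (dual (P \<otimes> Q))"
  by (simp add: dual_iff lfun_def tform_def vspace_add[OF vspace_tprod] vspace_scl[OF vspace_tprod, simplified]
      plus_fun_apply)

lemma dual_tens_eqI:
  assumes P: "vspace P" and f: "f \<in> carr (dual (P \<otimes> Q))" and g: "g \<in> carr (dual (P \<otimes> Q))"
    and e: "\<And>x y. x \<in> carr P \<Longrightarrow> y \<in> carr Q \<Longrightarrow> f (tens P Q x y) = g (tens P Q x y)"
  shows "f = g"
proof (rule dual_eqI[OF f g])
  note l = f[THEN dual_lfun] g[THEN dual_lfun]
  fix t assume "t \<in> carr (P \<otimes> Q)"
  with P show "f t = g t"
    by (induction rule: tens_induct)
      (simp_all only: lfun_0[OF vspace_tprod l(1)] lfun_0[OF vspace_tprod l(2)] lfunD(1)[OF l(1)] lfunD(1)[OF l(2)]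
          tens_in e)
qed

text \<open>The common shape of the maps into duals of tensor products: four-fold linear forms that are grouped in
  pairs.\<close>
lemma tlift_tform:
  assumes X: "vspace X" and P: "vspace P"
    and PQ: "\<And>x y. x \<in> carr X \<Longrightarrow> y \<in> carr Y \<Longrightarrow> bilin P Q base_field (\<beta> x y)"
    and XY: "\<And>a b. a \<in> carr P \<Longrightarrow> b \<in> carr Q \<Longrightarrow> bilin X Y base_field (\<lambda>x y. \<beta> x y a b)"
    and Y: "vspace Y"
  shows tlift_tform_hom: "tlift X Y (dual (P \<otimes> Q)) (\<lambda>x y. tform P Q (\<beta> x y)) \<in> hom (X \<otimes> Y) (dual (P \<otimes> Q))"
    and tlift_tform_app: "x \<in> carr X \<Longrightarrow> y \<in> carr Y \<Longrightarrow> a \<in> carr P \<Longrightarrow> b \<in> carr Q \<Longrightarrow>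
      app (tlift X Y (dual (P \<otimes> Q)) (\<lambda>x y. tform P Q (\<beta> x y))) (tens X Y x y) (tens P Q a b) = \<beta> x y a b"
proof -
  let ?g = "\<lambda>x y. tform P Q (\<beta> x y)"
  have g: "?g x y (tens P Q a b) = \<beta> x y a b"
    if "x \<in> carr X" "y \<in> carr Y" "a \<in> carr P" "b \<in> carr Q" for x y a b
    using that by (simp add: tform_app tens_in tensor_eval_tens[OF PQ])
  have scl_in: "fscl c (?g x y) \<in> carr (dual (P \<otimes> Q))" for c x y
    using vspace_scl[OF vspace_dual tform_dual] by (simp only: scl_dual)
  have b: "bilin X Y (dual (P \<otimes> Q)) ?g"
    unfolding bilin_def scl_dual
  proof (intro conjI ballI allI tform_dual)
    fix x x' y assume *: "x \<in> carr X" "x' \<in> carr X" "y \<in> carr Y"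
    show "?g (x + x') y = ?g x y + ?g x' y"
      by (rule dual_tens_eqI[OF P tform_dual vspace_add[OF vspace_dual tform_dual tform_dual]])
        (simp add: plus_fun_apply g * vspace_add[OF X] bilin_add_left[OF XY])
  next
    fix x y y' assume *: "x \<in> carr X" "y \<in> carr Y" "y' \<in> carr Y"
    show "?g x (y + y') = ?g x y + ?g x y'"
      by (rule dual_tens_eqI[OF P tform_dual vspace_add[OF vspace_dual tform_dual tform_dual]])
        (simp add: plus_fun_apply g * vspace_add[OF Y] bilin_add_right[OF XY])
  next
    fix c x y assume *: "x \<in> carr X" "y \<in> carr Y"
    show "?g (scl X c x) y = fscl c (?g x y)"
      by (rule dual_tens_eqI[OF P tform_dual scl_in]) (simp add: g * vspace_scl[OF X] bilin_scl_left[OF XY])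
    show "?g x (scl Y c y) = fscl c (?g x y)"
      by (rule dual_tens_eqI[OF P tform_dual scl_in]) (simp add: g * vspace_scl[OF Y] bilin_scl_right[OF XY])
  qed
  show "tlift X Y (dual (P \<otimes> Q)) ?g \<in> hom (X \<otimes> Y) (dual (P \<otimes> Q))"
    by (rule tlift_hom[OF X vspace_dual b])
  show "app (tlift X Y (dual (P \<otimes> Q)) ?g) (tens X Y x y) (tens P Q a b) = \<beta> x y a b"
    if "x \<in> carr X" "y \<in> carr Y" "a \<in> carr P" "b \<in> carr Q"
    unfolding tlift_tens[OF X vspace_dual b that(1,2)] by (rule g[OF that])
qed

text \<open>The value of an embedded tensor is its value at the bilinear form that defines the pairing.\<close>
lemma temb_facts:
  assumes X: "vspace X" "vspace Y" and P: "vspace P"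
    and s: "bilin X P base_field s" and t: "bilin Y Q base_field t"
  shows temb_hom: "temb X Y P Q s t \<in> hom (X \<otimes> Y) (dual (P \<otimes> Q))"
    and temb_app: "\<tau> \<in> carr (X \<otimes> Y) \<Longrightarrow> a \<in> carr P \<Longrightarrow> b \<in> carr Q \<Longrightarrow>
      app (temb X Y P Q s t) \<tau> (tens P Q a b) = \<tau> (\<lambda>\<xi> \<eta>. s \<xi> a * t \<eta> b)"
proof -
  have PQ: "bilin P Q base_field (\<lambda>x y. s \<xi> x * t \<eta> y)" if "\<xi> \<in> carr X" "\<eta> \<in> carr Y" for \<xi> \<eta>
    by (rule bilin_lfun) (use s t that in \<open>simp_all add: bilin_def lfun_def\<close>)
  have XY: "bilin X Y base_field (\<lambda>\<xi> \<eta>. s \<xi> a * t \<eta> b)" if "a \<in> carr P" "b \<in> carr Q" for a b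
    by (rule bilin_lfun) (use s t that in \<open>simp_all add: bilin_def lfun_def\<close>)
  note f = tlift_tform[OF X(1) P PQ XY X(2), folded temb_def, simplified]
  show h: "temb X Y P Q s t \<in> hom (X \<otimes> Y) (dual (P \<otimes> Q))" by (rule f(1))
  show "app (temb X Y P Q s t) \<tau> (tens P Q a b) = \<tau> (\<lambda>\<xi> \<eta>. s \<xi> a * t \<eta> b)"
    if "\<tau> \<in> carr (X \<otimes> Y)" and ab: "a \<in> carr P" "b \<in> carr Q"
    using X(1) that(1)
  proof (induction rule: tens_induct)
    case zero
    show ?case unfolding hom_0[OF h vspace_tprod] by (simp add: zero_fun_apply)
  next
    case (add x y \<tau>)
    then have 1: "app (temb X Y P Q s t) (tens X Y x y + \<tau>) (tens P Q a b) = s x a * t y b + \<tau> (\<lambda>\<xi> \<eta>. s \<xi> a * t \<eta> b)"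
      using f(2)[OF add(1,2) ab] unfolding hom_add[OF h tens_in[OF add(1,2)] add(3)] by (simp add: plus_fun_apply)
    show ?case unfolding 1 by (simp add: plus_fun_apply tensor_eval_tens[OF XY[OF ab]])
  qed
qed

text \<open>The contraction \<open>x \<otimes> y \<mapsto> \<phi>(y) x\<close>, and below its mirror image \<open>x \<otimes> y \<mapsto> \<phi>(x) y\<close>.\<close>
definition slice_right :: "('k::field, 'a::ab_group_add) vs \<Rightarrow> ('k, 'b::ab_group_add) vs \<Rightarrow> ('b \<Rightarrow> 'k) \<Rightarrow>
    ('k, ('k, 'a, 'b) tensor, 'a) lmap" where
  "slice_right X Y \<phi> = tlift X Y X (\<lambda>x y. scl X (\<phi> y) x)"
definition slice_left :: "('k::field, 'a::ab_group_add) vs \<Rightarrow> ('k, 'b::ab_group_add) vs \<Rightarrow> ('a \<Rightarrow> 'k) \<Rightarrow>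
    ('k, ('k, 'a, 'b) tensor, 'b) lmap" where
  "slice_left X Y \<phi> = tlift X Y Y (\<lambda>x y. scl Y (\<phi> x) y)"

lemma slice_right_facts:
  assumes X: "vspace X" and l: "lfun Y \<phi>"
  shows slice_right_hom: "slice_right X Y \<phi> \<in> hom (X \<otimes> Y) X"
    and slice_right_tens: "x \<in> carr X \<Longrightarrow> y \<in> carr Y \<Longrightarrow> app (slice_right X Y \<phi>) (tens X Y x y) = scl X (\<phi> y) x"
proof -
  interpret X: vector_space "scl X" using X by (simp add: vspace_def)
  have b: "bilin X Y X (\<lambda>x y. scl X (\<phi> y) x)"
    using X l by (simp add: bilin_def lfun_def vspace_scl X.scale_left_distrib X.scale_right_distrib mult.commute)
  show "slice_right X Y \<phi> \<in> hom (X \<otimes> Y) X" "x \<in> carr X \<Longrightarrow> y \<in> carr Y \<Longrightarrow> app (slice_right X Y \<phi>) (tens X Y x y) =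
      scl X (\<phi> y) x"
    unfolding slice_right_def using tlift_hom[OF X X b] tlift_tens[OF X X b] by simp_all
qed

lemma slice_left_facts:
  assumes X: "vspace X" and Y: "vspace Y" and l: "lfun X \<phi>"
  shows slice_left_hom: "slice_left X Y \<phi> \<in> hom (X \<otimes> Y) Y"
    and slice_left_tens: "x \<in> carr X \<Longrightarrow> y \<in> carr Y \<Longrightarrow> app (slice_left X Y \<phi>) (tens X Y x y) = scl Y (\<phi> x) y"
proof -
  interpret Y: vector_space "scl Y" using Y by (simp add: vspace_def)
  have b: "bilin X Y Y (\<lambda>x y. scl Y (\<phi> x) y)"
    using Y l by (simp add: bilin_def lfun_def vspace_scl Y.scale_left_distrib Y.scale_right_distrib mult.commute)
  show "slice_left X Y \<phi> \<in> hom (X \<otimes> Y) Y" "x \<in> carr X \<Longrightarrow> y \<in> carr Y \<Longrightarrow> app (slice_left X Y \<phi>) (tens X Y x y) =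
      scl Y (\<phi> x) y"
    unfolding slice_left_def using tlift_hom[OF X Y b] tlift_tens[OF X Y b] by simp_all
qed

lemma lfun_slice_right:
  assumes X: "vspace X" and l: "lfun Y \<phi>" and e: "lfun X e" and t: "t \<in> carr (X \<otimes> Y)"
  shows "e (app (slice_right X Y \<phi>) t) = t (\<lambda>x y. e x * \<phi> y)"
  using X t
proof (induction rule: tens_induct)
  case zero
  show ?case unfolding hom_0[OF slice_right_hom[OF X l] vspace_tprod] by (simp add: zero_fun_apply lfun_0[OF X e])
next
  case (add x y s)
  have 1: "e (app (slice_right X Y \<phi>) (tens X Y x y + s)) = e x * \<phi> y + s (\<lambda>x y. e x * \<phi> y)"
    using add X by (simp add: hom_add[OF slice_right_hom[OF X l]] tens_in slice_right_tens[OF X l] lfunD[OF e]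
        vspace_scl
      hom_in[OF slice_right_hom[OF X l]] mult.commute)
  show ?case unfolding 1 by (simp add: plus_fun_apply tensor_eval_tens[OF bilin_lfun[OF e l]])
qed

lemma lfun_slice_left:
  assumes X: "vspace X" and Y: "vspace Y" and l: "lfun X \<phi>" and e: "lfun Y e" and t: "t \<in> carr (X \<otimes> Y)"
  shows "e (app (slice_left X Y \<phi>) t) = t (\<lambda>x y. \<phi> x * e y)"
  using X t
proof (induction rule: tens_induct)
  case zero
  show ?case unfolding hom_0[OF slice_left_hom[OF X Y l] vspace_tprod] by (simp add: zero_fun_apply lfun_0[OF Y e])
next
  case (add x y s)
  have 1: "e (app (slice_left X Y \<phi>) (tens X Y x y + s)) = \<phi> x * e y + s (\<lambda>x y. \<phi> x * e y)"
    using add Y by (simp add: hom_add[OF slice_left_hom[OF X Y l]] tens_in slice_left_tens[OF X Y l] lfunD[OF e]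
        vspace_scl
      hom_in[OF slice_left_hom[OF X Y l]])
  show ?case unfolding 1 by (simp add: plus_fun_apply tensor_eval_tens[OF bilin_lfun[OF l e]])
qed

lemma subspace_dual_vspace: "is_subspace U (dual H) \<Longrightarrow> vspace U"
  by (auto simp: is_subspace_def vspace_def vector_space_fscl)

lemma subspace_dualD:
  assumes "is_subspace U (dual H)"
  shows "scl U = fscl" "f \<in> carr U \<Longrightarrow> f \<in> carr (dual H)" "f \<in> carr U \<Longrightarrow> lfun H f"
  using assms by (auto simp: is_subspace_def intro: dual_lfun)

lemma lfun_eval: "is_subspace U (dual H) \<Longrightarrow> lfun U (\<lambda>f. f a)"
  by (simp add: lfun_def subspace_dualD plus_fun_apply)

text \<open>The set of tensors of this form is closed under sums, and it contains \<open>x \<otimes> y\<close> since \<open>x\<close> is a combination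
  of elements of \<open>S\<close>.\<close>
lemma tensor_basis_expansion:
  fixes X :: "('k::field, 'a::ab_group_add) vs" and Y :: "('k, 'b::ab_group_add) vs"
  assumes X: "vspace X" and Y: "vspace Y" and t: "t \<in> carr (X \<otimes> Y)"
    and S: "module.span (scl X) S = carr X"
  shows "\<exists>F g. finite F \<and> F \<subseteq> S \<and> (\<forall>b\<in>F. g b \<in> carr Y) \<and> t = (\<Sum>b\<in>F. tens X Y b (g b))"
proof -
  interpret X: vector_space "scl X" using X by (simp add: vspace_def)
  interpret Y: vector_space "scl Y" using Y by (simp add: vspace_def)
  have SX: "S \<subseteq> carr X" using S X.span_superset by blast
  have t0: "tens X Y b 0 = 0" if "b \<in> carr X" for b
    using tens_simps(2)[OF that vspace_0[OF Y] vspace_0[OF Y]] by simp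
  let ?Q = "\<lambda>t. \<exists>F g. finite F \<and> F \<subseteq> S \<and> (\<forall>b\<in>F. g b \<in> carr Y) \<and> t = (\<Sum>b\<in>F. tens X Y b (g b))"
  have Q_add: "?Q (s + t)" if "?Q s" "?Q t" for s t
  proof -
    from that(1) obtain F g where F: "finite F" "F \<subseteq> S" "\<forall>b\<in>F. g b \<in> carr Y"
      "s = (\<Sum>b\<in>F. tens X Y b (g b))" by (elim exE conjE)
    from that(2) obtain F' g' where F': "finite F'" "F' \<subseteq> S" "\<forall>b\<in>F'. g' b \<in> carr Y"
      "t = (\<Sum>b\<in>F'. tens X Y b (g' b))" by (elim exE conjE)
    let ?g = "\<lambda>b. if b \<in> F then g b else 0" and ?g' = "\<lambda>b. if b \<in> F' then g' b else 0"
    have Y0: "0 \<in> carr Y" by (rule vspace_0[OF Y])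
    have "s = (\<Sum>b\<in>F \<union> F'. tens X Y b (?g b))" unfolding F(4)
      by (rule sum.mono_neutral_cong_left) (use F(1-3) F'(1-3) SX t0 in auto)
    moreover have "t = (\<Sum>b\<in>F \<union> F'. tens X Y b (?g' b))" unfolding F'(4)
      by (rule sum.mono_neutral_cong_left) (use F(1-3) F'(1-3) SX t0 in auto)
    ultimately have "s + t = (\<Sum>b\<in>F \<union> F'. tens X Y b (?g b) + tens X Y b (?g' b))"
      by (simp only: sum.distrib)
    also have "\<dots> = (\<Sum>b\<in>F \<union> F'. tens X Y b (?g b + ?g' b))"
      by (rule sum.cong[OF refl]) (rule tens_simps(2)[symmetric], use F(1-3) F'(1-3) SX Y0 in auto)
    finally show ?thesis
      using F(1-3) F'(1-3) Y0
      by (intro exI[of _ "F \<union> F'"] exI[of _ "\<lambda>b. ?g b + ?g' b"] conjI ballI vspace_add[OF Y]) auto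
  qed
  have Q_zero: "?Q 0" by (rule exI[of _ "{}"], rule exI[of _ "\<lambda>_. 0"]) simp
  have el: "x \<in> carr X \<and> ?Q (tens X Y x y)" if x: "x \<in> X.span S" and y: "y \<in> carr Y" for x y
    using x
  proof (induction rule: X.span_induct_alt)
    case base
    have "tens X Y 0 y = 0" using tens_simps(1)[OF vspace_0[OF X] vspace_0[OF X] y] by simp
    then show ?case using Q_zero vspace_0[OF X] by simp
  next
    case (step c b x)
    then have bx: "b \<in> carr X" "x \<in> carr X" and IH: "?Q (tens X Y x y)" using SX by blast+
    have "?Q (tens X Y b (scl Y c y))"
      by (rule exI[of _ "{b}"], rule exI[of _ "\<lambda>_. scl Y c y"]) (use step y in \<open>simp add: vspace_scl[OF Y]\<close>)
    from Q_add[OF this IH] have "?Q (tens X Y (scl X c b + x) y)"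
      unfolding tens_simps(1)[OF vspace_scl[OF X bx(1), of c] bx(2) y] tens_simps(3,4)[OF bx(1) y, of c] .
    then show ?case using vspace_add[OF X vspace_scl[OF X bx(1), of c] bx(2)] by blast
  qed
  show ?thesis
    using X t
  proof (induction rule: tens_induct)
    case zero
    show ?case by (rule Q_zero)
  next
    case (add x y s)
    have "?Q (tens X Y x y)" using el[OF _ add(2)] add(1) S by blast
    from Q_add[OF this add(4)] show ?case .
  qed
qed

text \<open>Expand \<open>t\<close> as a sum of \<open>b \<otimes> g b\<close> over a basis of \<open>X\<close>. The slice at \<open>a\<close> has the coefficients \<open>g b a\<close>,
  which therefore vanish for all \<open>a\<close>, so that the functionals \<open>g b\<close> vanish.\<close>
lemma sepR_0:
  fixes X :: "('k::field, 'a::ab_group_add) vs" and U :: "('k, 'h::ab_group_add \<Rightarrow> 'k) vs"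
  assumes X: "vspace X" and U: "is_subspace U (dual H)" and t: "t \<in> carr (X \<otimes> U)"
    and e: "\<And>a. a \<in> carr H \<Longrightarrow> app (slice_right X U (\<lambda>f. f a)) t = 0"
  shows "t = 0"
proof -
  interpret X: vector_space "scl X" using X by (simp add: vspace_def)
  obtain S where S: "X.independent S" "X.span S = carr X"
    using X.basis_exists[of "carr X"] X.span_minimal[of _ "carr X"] X unfolding vspace_def
    by (metis subset_antisym)
  obtain F g where F: "finite F" "F \<subseteq> S" "\<forall>b\<in>F. g b \<in> carr U" "t = (\<Sum>b\<in>F. tens X U b (g b))"
    using tensor_basis_expansion[OF X subspace_dual_vspace[OF U] t S(2)] by blast
  have FX: "b \<in> carr X" if "b \<in> F" for b using F(2) S(2) that X.span_base by blast
  \<comment> \<open>The slice of a partial sum, by induction; all of \<open>F\<close> gives \<open>0\<close>, and \<open>F\<close> is independent.\<close>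
  have "g b a = 0" if "b \<in> F" "a \<in> carr H" for a b
  proof -
    note l = lfun_eval[OF U, of a]
    note h = slice_right_hom[OF X l]
    have "app (slice_right X U (\<lambda>f. f a)) (\<Sum>b\<in>G. tens X U b (g b)) = (\<Sum>b\<in>G. scl X (g b a) b) \<and>
        (\<Sum>b\<in>G. tens X U b (g b)) \<in> carr (X \<otimes> U)" if "G \<subseteq> F" for G
      using finite_subset[OF that F(1)] that
    proof (induction rule: finite_induct)
      case empty
      show ?case unfolding sum.empty using hom_0[OF h vspace_tprod] vspace_0[OF vspace_tprod] by blast
    next
      case (insert b G)
      then have b: "b \<in> carr X" "g b \<in> carr U" and G: "(\<Sum>b\<in>G. tens X U b (g b)) \<in> carr (X \<otimes> U)"
        "app (slice_right X U (\<lambda>f. f a)) (\<Sum>b\<in>G. tens X U b (g b)) = (\<Sum>b\<in>G. scl X (g b a) b)"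
        using F FX by auto
      show ?case unfolding sum.insert[OF insert(1,2)] hom_add[OF h tens_in[OF b] G(1)] G(2) slice_right_tens[OF X l b]
        using vspace_add[OF vspace_tprod tens_in[OF b] G(1)] by blast
    qed
    from this[of F] e[OF that(2)] F(4) have "(\<Sum>b\<in>F. scl X (g b a) b) = 0" by simp
    then show ?thesis using X.independentD[OF S(1) F(1,2), of "\<lambda>b. g b a"] that(1) by blast
  qed
  then have "g b a = 0" if "b \<in> F" for a b
    using that F(3) subspace_dualD(2)[OF U, of "g b"] by (cases "a \<in> carr H") (auto simp: dual_iff)
  then have "g b = 0" if "b \<in> F" for b
    using that by (simp add: fun_eq_iff zero_fun_apply)
  then have "tens X U b (g b) = 0" if "b \<in> F" for b
    using that tens_simps(2)[OF FX[OF that] vspace_0 vspace_0, of U] subspace_dual_vspace[OF U] by simp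
  then show ?thesis unfolding F(4) by (rule sum.neutral[rule_format])
qed

text \<open>Slices at elements of \<open>H\<close> separate the tensors in \<open>X \<otimes> U\<close>. All transpositions rest on this.\<close>
lemma sepR:
  assumes X: "vspace X" and U: "is_subspace U (dual H)" and t: "t \<in> carr (X \<otimes> U)" "t' \<in> carr (X \<otimes> U)"
    and e: "\<And>a. a \<in> carr H \<Longrightarrow> app (slice_right X U (\<lambda>f. f a)) t = app (slice_right X U (\<lambda>f. f a)) t'"
  shows "t = t'"
proof -
  interpret T: vector_space "scl (X \<otimes> U)" using vspace_tprod[of X U] by (simp add: vspace_def)
  interpret X: vector_space "scl X" using X by (simp add: vspace_def)
  have s: "scl (X \<otimes> U) (-1) t' \<in> carr (X \<otimes> U)" by (rule vspace_scl[OF vspace_tprod t(2)])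
  have "t + scl (X \<otimes> U) (-1) t' = 0"
  proof (rule sepR_0[OF X U vspace_add[OF vspace_tprod t(1) s]])
    fix a assume "a \<in> carr H"
    note h = slice_right_hom[OF X lfun_eval[OF U, of a]]
    show "app (slice_right X U (\<lambda>f. f a)) (t + scl (X \<otimes> U) (-1) t') = 0"
      unfolding hom_add[OF h t(1) s] hom_scl[OF h t(2)] e[OF \<open>a \<in> _\<close>] X.scale_minus_left X.scale_one by simp
  qed
  then show ?thesis unfolding T.scale_minus_left T.scale_one by simp
qed

text \<open>Exchanging the factors, by which \<open>sepL\<close> follows from \<open>sepR\<close>.\<close>
definition flip :: "('k::field, 'a::ab_group_add) vs \<Rightarrow> ('k, 'b::ab_group_add) vs \<Rightarrow>
    ('k, ('k, 'a, 'b) tensor, ('k, 'b, 'a) tensor) lmap" where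
  "flip X Y = tlift X Y (Y \<otimes> X) (\<lambda>x y. tens Y X y x)"

lemma flip_facts:
  assumes X: "vspace X"
  shows flip_hom: "flip X Y \<in> hom (X \<otimes> Y) (Y \<otimes> X)"
    and flip_tens: "x \<in> carr X \<Longrightarrow> y \<in> carr Y \<Longrightarrow> app (flip X Y) (tens X Y x y) = tens Y X y x"
proof -
  have b: "bilin X Y (Y \<otimes> X) (\<lambda>x y. tens Y X y x)"
    unfolding bilin_def by (simp add: tens_in tens_simps)
  show "flip X Y \<in> hom (X \<otimes> Y) (Y \<otimes> X)" "x \<in> carr X \<Longrightarrow> y \<in> carr Y \<Longrightarrow> app (flip X Y) (tens X Y x y) = tens Y X y x"
    unfolding flip_def using tlift_hom[OF X vspace_tprod b] tlift_tens[OF X vspace_tprod b] by simp_all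
qed

lemma flip_flip: "vspace X \<Longrightarrow> vspace Y \<Longrightarrow> flip Y X \<odot> flip X Y = idm (X \<otimes> Y)"
  by (rule hom_tens_eqI[OF _ comp_hom[OF flip_hom flip_hom vspace_tprod] idm_hom[OF vspace_tprod]])
    (simp_all add: comp_app[OF flip_hom] tens_in flip_tens idm_app)

lemma sepL:
  assumes X: "vspace X" and U: "is_subspace U (dual H)" and t: "t \<in> carr (U \<otimes> X)" "t' \<in> carr (U \<otimes> X)"
    and e: "\<And>a. a \<in> carr H \<Longrightarrow> app (slice_left U X (\<lambda>f. f a)) t = app (slice_left U X (\<lambda>f. f a)) t'"
  shows "t = t'"
proof -
  note u = subspace_dual_vspace[OF U]
  note f = flip_hom[OF u, of X]
  have c: "slice_right X U (\<lambda>f. f a) \<odot> flip U X = slice_left U X (\<lambda>f. f a)" for a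
    by (rule hom_tens_eqI[OF u comp_hom[OF f slice_right_hom[OF X lfun_eval[OF U]] vspace_tprod]
        slice_left_hom[OF u X lfun_eval[OF U]]])
      (simp add: comp_app[OF f] tens_in flip_tens[OF u] slice_right_tens[OF X lfun_eval[OF U]]
          slice_left_tens[OF u X lfun_eval[OF U]])
  have "app (flip U X) t = app (flip U X) t'"
    by (rule sepR[OF X U hom_in[OF f t(1)] hom_in[OF f t(2)]])
      (simp only: comp_app[OF f t(1), symmetric] comp_app[OF f t(2), symmetric] c e)
  then have "app (flip X U \<odot> flip U X) t = app (flip X U \<odot> flip U X) t'"
    by (simp add: comp_app[OF f] t)
  then show ?thesis using t by (simp add: flip_flip[OF u X] idm_app)
qed

text \<open>Since \<open>j\<close> is injective, the preimages under \<open>j\<close> inherit linearity from \<open>f\<close> and \<open>j\<close>.\<close>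
lemma corestrict_facts:
  assumes j: "j \<in> hom Y D" "inj_on (app j) (carr Y)" and f: "f \<in> hom X D"
    and im: "app f ` carr X \<subseteq> app j ` carr Y" and X: "vspace X" and Y: "vspace Y"
  shows corestrict_hom: "corestrict j f \<in> hom X Y"
    and corestrict_app: "x \<in> carr X \<Longrightarrow> app j (app (corestrict j f) x) = app f x"
proof -
  let ?g = "\<lambda>x. inv_into (carr Y) (app j) (app f x)"
  have g: "?g x \<in> carr Y" "app j (?g x) = app f x" if "x \<in> carr X" for x
    using im that by (auto intro!: inv_into_into f_inv_into_f)
  have eq: "?g x = y" if "x \<in> carr X" "y \<in> carr Y" "app j y = app f x" for x y
    using that j(2) by (metis inv_into_f_f)
  have "?g (x + y) = ?g x + ?g y" if "x \<in> carr X" "y \<in> carr X" for x y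
    by (rule eq) (use that in \<open>simp_all add: g X Y vspace_add hom_add[OF j(1)] hom_add[OF f]\<close>)
  moreover have "?g (scl X c x) = scl Y c (?g x)" if "x \<in> carr X" for c x
    by (rule eq) (use that in \<open>simp_all add: g X Y vspace_scl hom_scl[OF j(1)] hom_scl[OF f]\<close>)
  ultimately show "corestrict j f \<in> hom X Y"
    unfolding corestrict_def hom_src[OF f] hom_src[OF j(1)]
    by (intro homI g X)
  show "x \<in> carr X \<Longrightarrow> app j (app (corestrict j f) x) = app f x"
    by (simp add: corestrict_def hom_src[OF f] hom_src[OF j(1)] g)
qed

lemma corestrict_iso:
  assumes j: "j \<in> hom Y D" "inj_on (app j) (carr Y)" and f: "f \<in> hom X D"
    and b: "bij_onto j f" and X: "vspace X" and Y: "vspace Y"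
  shows "corestrict j f \<in> iso X Y"
proof -
  have b: "bij_betw (app f) (carr X) (app j ` carr Y)"
    using b by (simp add: bij_onto_def hom_src[OF f] hom_src[OF j(1)])
  then have im: "app f ` carr X \<subseteq> app j ` carr Y" by (simp add: bij_betw_def)
  note c = corestrict_hom[OF j f im X Y] corestrict_app[OF j f im X Y]
  have "inj_on (app (corestrict j f)) (carr X)"
    using b c(2) unfolding bij_betw_def inj_on_def by metis
  moreover have "\<exists>x\<in>carr X. app (corestrict j f) x = y" if "y \<in> carr Y" for y
  proof -
    from that b obtain x where "x \<in> carr X" "app j y = app f x" by (auto simp: bij_betw_def image_iff)
    with c hom_in[OF c(1)] j(2) that show ?thesis by (metis inj_onD)
  qed
  ultimately show ?thesis using c(1) hom_in[OF c(1)] by (auto simp: iso_def bij_betw_def image_iff)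
qed

section \<open>Braidings, coactions, coproduct and product of the dual\<close>

lemma bilin_ev: "is_subspace U (dual H) \<Longrightarrow> bilin U H base_field ev"
  using subspace_dualD[of U H] by (auto simp: bilin_def ev_def lfun_def plus_fun_apply)

lemma bilin_coev: "bilin V (dual V) base_field coev"
  by (auto simp: bilin_def coev_def dual_iff lfun_def plus_fun_apply)

lemma lfun_tpair: "lfun (X \<otimes> Y) (tpair \<xi> \<eta>)"
  by (simp add: lfun_def tpair_def plus_fun_apply)

text \<open>The pairing as a slice: contract one factor with a functional, then apply the other functional.\<close>
lemma tpair_slice_right: "vspace X \<Longrightarrow> lfun Y \<xi> \<Longrightarrow> lfun X \<eta> \<Longrightarrow> t \<in> carr (X \<otimes> Y) \<Longrightarrow> \<eta> (app (slice_right X Y \<xi>) t) =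
    tpair \<xi> \<eta> t"
  unfolding tpair_def by (subst lfun_slice_right) (simp_all add: mult.commute)
lemma tpair_slice_left: "vspace X \<Longrightarrow> vspace Y \<Longrightarrow> lfun Y \<xi> \<Longrightarrow> lfun X \<eta> \<Longrightarrow> t \<in> carr (X \<otimes> Y) \<Longrightarrow> \<xi> (app (slice_left X Y \<eta>) t) =
    tpair \<xi> \<eta> t"
  unfolding tpair_def by (subst lfun_slice_left) (simp_all add: mult.commute)

lemma tpair_bilin:
  assumes U: "is_subspace U (dual Y)" and W: "is_subspace W (dual X)" and X: "vspace X" and Y: "vspace Y"
    and t: "t \<in> carr (X \<otimes> Y)"
  shows "bilin U W base_field (\<lambda>\<xi> \<eta>. tpair \<xi> \<eta> t)"
proof -
  note U' = subspace_dualD[OF U] and W' = subspace_dualD[OF W]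
  note u = subspace_dual_vspace[OF U] and w = subspace_dual_vspace[OF W]
  have 1: "tpair \<xi> \<eta> t = \<eta> (app (slice_right X Y \<xi>) t)" "tpair \<xi> \<eta> t = \<xi> (app (slice_left X Y \<eta>) t)"
    if "\<xi> \<in> carr U" "\<eta> \<in> carr W" for \<xi> \<eta>
    using that X Y t by (simp_all add: tpair_slice_right tpair_slice_left U' W')
  show ?thesis unfolding bilin_def
  proof (intro conjI ballI allI)
    fix x x' y assume *: "x \<in> carr U" "x' \<in> carr U" "y \<in> carr W"
    show "tpair (x + x') y t = tpair x y t + tpair x' y t"
      unfolding 1(2)[OF *(1,3)] 1(2)[OF *(2,3)] 1(2)[OF vspace_add[OF u *(1,2)] *(3)] plus_fun_apply ..
  next
    fix x y y' assume *: "x \<in> carr U" "y \<in> carr W" "y' \<in> carr W"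
    show "tpair x (y + y') t = tpair x y t + tpair x y' t"
      unfolding 1(1)[OF *(1,2)] 1(1)[OF *(1,3)] 1(1)[OF *(1) vspace_add[OF w *(2,3)]] plus_fun_apply ..
  next
    fix c x y assume *: "x \<in> carr U" "y \<in> carr W"
    show "tpair (scl U c x) y t = scl base_field c (tpair x y t)"
      using 1(2)[OF *] 1(2)[OF vspace_scl[OF u *(1), of c] *(2)] by (simp add: U'(1))
    show "tpair x (scl W c y) t = scl base_field c (tpair x y t)"
      using 1(1)[OF *] 1(1)[OF *(1) vspace_scl[OF w *(2), of c]] by (simp add: W'(1))
  qed simp
qed

lemma subspace_refl: "is_subspace (dual V) (dual V)"
  using vspace_dual[of V] by (simp add: is_subspace_def vspace_def)

lemma bilin_base_swap: "bilin X Y base_field b \<Longrightarrow> bilin Y X base_field (\<lambda>y x. b x y)"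
  by (auto simp: bilin_def)

text \<open>Injectivity: a tensor in \<open>U \<otimes> U\<close> is determined by its slices, and a slice, being a functional on \<open>H\<close>, by
  its values.\<close>
lemma emb_UU_facts:
  assumes U: "is_subspace U (dual H)" and H: "vspace H"
  shows "emb_UU H U \<in> hom (U \<otimes> U) (dual (H \<otimes> H))" and "inj_on (app (emb_UU H U)) (carr (U \<otimes> U))"
    and "t \<in> carr (U \<otimes> U) \<Longrightarrow> a \<in> carr H \<Longrightarrow> b \<in> carr H \<Longrightarrow> app (emb_UU H U) t (tens H H b a) = tpair' t a b"
    and tpair'_inject: "t \<in> carr (U \<otimes> U) \<Longrightarrow> t' \<in> carr (U \<otimes> U) \<Longrightarrow>
      (\<And>a b. a \<in> carr H \<Longrightarrow> b \<in> carr H \<Longrightarrow> tpair' t a b = tpair' t' a b) \<Longrightarrow> t = t'"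
proof -
  note u = subspace_dual_vspace[OF U]
  note f = temb_facts[OF u u H bilin_ev[OF U] bilin_ev[OF U]]
  show "emb_UU H U \<in> hom (U \<otimes> U) (dual (H \<otimes> H))" by (rule f)
  show e: "app (emb_UU H U) t (tens H H b a) = tpair' t a b" if "t \<in> carr (U \<otimes> U)" "a \<in> carr H" "b \<in> carr H" for t a b
    unfolding f(2)[OF that(1,3,2)] tpair'_def ev_def ..
  show inj: "t = t'" if t: "t \<in> carr (U \<otimes> U)" "t' \<in> carr (U \<otimes> U)"
    "\<And>a b. a \<in> carr H \<Longrightarrow> b \<in> carr H \<Longrightarrow> tpair' t a b = tpair' t' a b" for t t'
  proof (rule sepR[OF u U t(1,2)])
    fix a assume a: "a \<in> carr H"
    note h = slice_right_hom[OF u lfun_eval[OF U, of a]]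
    have *: "app (slice_right U U (\<lambda>f. f a)) t b = tpair' t a b" if "t \<in> carr (U \<otimes> U)" for t b
      using lfun_slice_right[OF u lfun_eval[OF U] lfun_eval[OF U] that, of a b] by (simp add: tpair'_def)
    show "app (slice_right U U (\<lambda>f. f a)) t = app (slice_right U U (\<lambda>f. f a)) t'"
      by (rule dual_eqI[where X=H])
        (use h t a in \<open>auto simp: * intro: subspace_dualD(2)[OF U] dest: hom_in\<close>)
  qed
  show "inj_on (app (emb_UU H U)) (carr (U \<otimes> U))"
    by (rule inj_onI, rule inj) (simp_all flip: e)
qed

text \<open>Injectivity: the functionals in \<open>V'\<close> separate the slices in \<open>V\<close>, and the slices separate the tensors.\<close>
lemma emb_VU_facts:
  assumes U: "is_subspace U (dual H)" and V: "vspace V"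
  shows "emb_VU H U V \<in> hom (V \<otimes> U) (dual (dual V \<otimes> H))" and "inj_on (app (emb_VU H U V)) (carr (V \<otimes> U))"
    and "t \<in> carr (V \<otimes> U) \<Longrightarrow> a \<in> carr H \<Longrightarrow> e \<in> carr (dual V) \<Longrightarrow>
       app (emb_VU H U V) t (tens (dual V) H e a) = e (app (slice_right V U (\<lambda>f. f a)) t)"
proof -
  note u = subspace_dual_vspace[OF U]
  note f = temb_facts[OF V u vspace_dual bilin_coev bilin_ev[OF U]]
  show "emb_VU H U V \<in> hom (V \<otimes> U) (dual (dual V \<otimes> H))" by (rule f)
  show e: "app (emb_VU H U V) t (tens (dual V) H e a) = e (app (slice_right V U (\<lambda>f. f a)) t)"
    if "t \<in> carr (V \<otimes> U)" "a \<in> carr H" "e \<in> carr (dual V)" for t a e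
    unfolding f(2)[OF that(1,3,2)] lfun_slice_right[OF V lfun_eval[OF U] dual_lfun[OF that(3)] that(1)]
        coev_def ev_def ..
  show "inj_on (app (emb_VU H U V)) (carr (V \<otimes> U))"
  proof (rule inj_onI)
    fix t t' assume t: "t \<in> carr (V \<otimes> U)" "t' \<in> carr (V \<otimes> U)" "app (emb_VU H U V) t = app (emb_VU H U V) t'"
    show "t = t'"
    proof (rule sepR[OF V U t(1,2)])
      fix a assume a: "a \<in> carr H"
      note h = hom_in[OF slice_right_hom[OF V lfun_eval[OF U, of a]]]
      show "app (slice_right V U (\<lambda>f. f a)) t = app (slice_right V U (\<lambda>f. f a)) t'"
        by (rule dual_separates[OF V h[OF t(1)] h[OF t(2)]]) (simp add: e[symmetric] t a)
    qed
  qed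
qed

lemma emb_UV_facts:
  assumes U: "is_subspace U (dual H)" and V: "vspace V" and H: "vspace H"
  shows "emb_UV H U V \<in> hom (U \<otimes> V) (dual (H \<otimes> dual V))" and "inj_on (app (emb_UV H U V)) (carr (U \<otimes> V))"
    and "t \<in> carr (U \<otimes> V) \<Longrightarrow> a \<in> carr H \<Longrightarrow> e \<in> carr (dual V) \<Longrightarrow>
       app (emb_UV H U V) t (tens H (dual V) a e) = e (app (slice_left U V (\<lambda>f. f a)) t)"
proof -
  note u = subspace_dual_vspace[OF U]
  note f = temb_facts[OF u V H bilin_ev[OF U] bilin_coev]
  show "emb_UV H U V \<in> hom (U \<otimes> V) (dual (H \<otimes> dual V))" by (rule f)
  show e: "app (emb_UV H U V) t (tens H (dual V) a e) = e (app (slice_left U V (\<lambda>f. f a)) t)"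
    if "t \<in> carr (U \<otimes> V)" "a \<in> carr H" "e \<in> carr (dual V)" for t a e
    unfolding f(2)[OF that] lfun_slice_left[OF u V lfun_eval[OF U] dual_lfun[OF that(3)] that(1)] coev_def ev_def ..
  show "inj_on (app (emb_UV H U V)) (carr (U \<otimes> V))"
  proof (rule inj_onI)
    fix t t' assume t: "t \<in> carr (U \<otimes> V)" "t' \<in> carr (U \<otimes> V)" "app (emb_UV H U V) t = app (emb_UV H U V) t'"
    show "t = t'"
    proof (rule sepL[OF V U t(1,2)])
      fix a assume a: "a \<in> carr H"
      note h = hom_in[OF slice_left_hom[OF u V lfun_eval[OF U, of a]]]
      show "app (slice_left U V (\<lambda>f. f a)) t = app (slice_left U V (\<lambda>f. f a)) t'"
        by (rule dual_separates[OF V h[OF t(1)] h[OF t(2)]]) (simp add: e[symmetric] t a)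
    qed
  qed
qed

lemma tpair_hom_bilin:
  assumes "bilin P Q (X \<otimes> Y) b"
  shows "bilin P Q base_field (\<lambda>x y. tpair \<xi> \<eta> (b x y))"
  using assms lfun_tpair[of X Y \<xi> \<eta>] by (auto simp: bilin_def lfun_def)

text \<open>The braiding of \<open>U\<close> is determined by its pairing with elements of \<open>H\<close>. The maps into a dual space that
  occur in the statement are used only through descriptions of this kind.\<close>
lemma braid_UU_facts:
  assumes U: "is_subspace U (dual H)" and H: "vspace H" and p: "p \<in> hom (H \<otimes> H) (H \<otimes> H)"
    and b: "UU_bijective H p U"
  shows braid_UU_iso: "braid_UU H p U \<in> iso (U \<otimes> U) (U \<otimes> U)"
    and braid_UU_pair: "f \<in> carr U \<Longrightarrow> g \<in> carr U \<Longrightarrow> a \<in> carr H \<Longrightarrow> b \<in> carr H \<Longrightarrow>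
      tpair' (app (braid_UU H p U) (tens U U f g)) a b = tpair f g (app p (tens H H a b))"
proof -
  note u = subspace_dual_vspace[OF U]
  have PQ: "bilin H H base_field (\<lambda>b a. tpair f g (app p (tens H H a b)))" for f g
    by (rule bilin_base_swap, rule tpair_hom_bilin[OF bilin_hom_tens[OF p]])
  have XY: "bilin U U base_field (\<lambda>f g. tpair f g (app p (tens H H a b)))"
    if "b \<in> carr H" "a \<in> carr H" for a b
    by (rule tpair_bilin[OF U U H H hom_in[OF p tens_in[OF that(2,1)]]])
  note r = tlift_tform[OF u H PQ XY u, folded raw_UU_def, simplified]
  note e = emb_UU_facts[OF U H]
  show i: "braid_UU H p U \<in> iso (U \<otimes> U) (U \<otimes> U)"
    unfolding braid_UU_def by (rule corestrict_iso[OF e(1,2) r(1) b[unfolded UU_bijective_def]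
        vspace_tprod vspace_tprod])
  have im: "app (raw_UU H p U) ` carr (U \<otimes> U) \<subseteq> app (emb_UU H U) ` carr (U \<otimes> U)"
    using b unfolding UU_bijective_def bij_onto_def hom_src[OF r(1)] hom_src[OF e(1)] by (simp add: bij_betw_def)
  assume fg: "f \<in> carr U" "g \<in> carr U" and ab: "a \<in> carr H" "b \<in> carr H"
  note t = tens_in[OF fg]
  have "app (emb_UU H U) (app (braid_UU H p U) (tens U U f g)) = app (raw_UU H p U) (tens U U f g)"
    unfolding braid_UU_def by (rule corestrict_app[OF e(1,2) r(1) im vspace_tprod vspace_tprod t])
  then show "tpair' (app (braid_UU H p U) (tens U U f g)) a b = tpair f g (app p (tens H H a b))"
    using r(2)[OF fg ab(2,1)] e(3)[OF hom_in[OF isoD(1)[OF i vspace_tprod vspace_tprod] t] ab] by simp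
qed

text \<open>The functionals in \<open>V'\<close> separate points of \<open>V\<close>, hence they can be removed from the definition of the
  braiding. What is left is an equation between slices.\<close>
lemma braid_UV_facts:
  assumes U: "is_subspace U (dual H)" and H: "vspace H" and V: "vspace V"
    and q: "linv q \<in> hom (V \<otimes> H) (H \<otimes> V)" and b: "UV_bijective H U V q"
  shows braid_UV_iso: "braid_UV H U V q \<in> iso (U \<otimes> V) (V \<otimes> U)"
    and braid_UV_slice: "f \<in> carr U \<Longrightarrow> v \<in> carr V \<Longrightarrow> a \<in> carr H \<Longrightarrow>
      app (slice_right V U (\<lambda>f. f a)) (app (braid_UV H U V q) (tens U V f v)) =
      app (slice_left H V f) (app (linv q) (tens V H v a))"
proof -
  note u = subspace_dual_vspace[OF U]
  have PQ: "bilin (dual V) H base_field (\<lambda>e a. tpair e f (app (linv q) (tens V H v a)))"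
    if "f \<in> carr U" "v \<in> carr V" for f v
  proof -
    have 1: "bilin (dual V) U base_field (\<lambda>e f. tpair e f (app (linv q) (tens V H v a)))" if "a \<in> carr H" for a
      by (rule tpair_bilin[OF subspace_refl U H V hom_in[OF q tens_in[OF \<open>v \<in> _\<close> that]]])
    show ?thesis
      using 1 tpair_hom_bilin[OF bilin_hom_tens[OF q]] that
      unfolding bilin_def by simp
  qed
  have XY: "bilin U V base_field (\<lambda>f v. tpair e f (app (linv q) (tens V H v a)))"
    if "e \<in> carr (dual V)" "a \<in> carr H" for e a
  proof -
    have 1: "bilin (dual V) U base_field (\<lambda>e f. tpair e f (app (linv q) (tens V H v a)))" if "v \<in> carr V" for v
      by (rule tpair_bilin[OF subspace_refl U H V hom_in[OF q tens_in[OF that \<open>a \<in> _\<close>]]])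
    show ?thesis
      using 1 tpair_hom_bilin[OF bilin_hom_tens[OF q]] that
      unfolding bilin_def by simp
  qed
  note r = tlift_tform[OF u vspace_dual PQ XY V, folded raw_UV_def, simplified]
  note e = emb_VU_facts[OF U V]
  show i: "braid_UV H U V q \<in> iso (U \<otimes> V) (V \<otimes> U)"
    unfolding braid_UV_def by (rule corestrict_iso[OF e(1,2) r(1) b[unfolded UV_bijective_def]
        vspace_tprod vspace_tprod])
  have im: "app (raw_UV H U V q) ` carr (U \<otimes> V) \<subseteq> app (emb_VU H U V) ` carr (V \<otimes> U)"
    using b unfolding UV_bijective_def bij_onto_def hom_src[OF r(1)] hom_src[OF e(1)] by (simp add: bij_betw_def)
  assume fv: "f \<in> carr U" "v \<in> carr V" and a: "a \<in> carr H"
  note t = tens_in[OF fv]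
  note t' = hom_in[OF isoD(1)[OF i vspace_tprod vspace_tprod] t]
  note s = hom_in[OF q tens_in[OF fv(2) a]]
  have eq: "app (emb_VU H U V) (app (braid_UV H U V q) (tens U V f v)) = app (raw_UV H U V q) (tens U V f v)"
    unfolding braid_UV_def by (rule corestrict_app[OF e(1,2) r(1) im vspace_tprod vspace_tprod t])
  show "app (slice_right V U (\<lambda>f. f a)) (app (braid_UV H U V q) (tens U V f v)) =
      app (slice_left H V f) (app (linv q) (tens V H v a))"
  proof (rule dual_separates[OF V])
    note lf = subspace_dualD(3)[OF U fv(1)]
    show "app (slice_right V U (\<lambda>f. f a)) (app (braid_UV H U V q) (tens U V f v)) \<in> carr V"
      by (rule hom_in[OF slice_right_hom[OF V lfun_eval[OF U]] t'])
    show "app (slice_left H V f) (app (linv q) (tens V H v a)) \<in> carr V"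
      by (rule hom_in[OF slice_left_hom[OF H V lf] s])
    fix d assume d: "d \<in> carr (dual V)"
    show "d (app (slice_right V U (\<lambda>f. f a)) (app (braid_UV H U V q) (tens U V f v))) =
        d (app (slice_left H V f) (app (linv q) (tens V H v a)))"
      using e(3)[OF t' a d] r(2)[OF fv d a] eq tpair_slice_left[OF H V dual_lfun[OF d] lf s] by simp
  qed
qed

lemma braid_VU_facts:
  assumes U: "is_subspace U (dual H)" and H: "vspace H" and V: "vspace V"
    and q: "linv q \<in> hom (H \<otimes> V) (V \<otimes> H)" and b: "VU_bijective H U V q"
  shows braid_VU_iso: "braid_VU H U V q \<in> iso (V \<otimes> U) (U \<otimes> V)"
    and braid_VU_slice: "v \<in> carr V \<Longrightarrow> f \<in> carr U \<Longrightarrow> a \<in> carr H \<Longrightarrow>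
      app (slice_left U V (\<lambda>f. f a)) (app (braid_VU H U V q) (tens V U v f)) =
      app (slice_right V H f) (app (linv q) (tens H V a v))"
proof -
  note u = subspace_dual_vspace[OF U]
  have PQ: "bilin H (dual V) base_field (\<lambda>a e. tpair f e (app (linv q) (tens H V a v)))"
    if "v \<in> carr V" "f \<in> carr U" for f v
  proof -
    have 1: "bilin U (dual V) base_field (\<lambda>f e. tpair f e (app (linv q) (tens H V a v)))" if "a \<in> carr H" for a
      by (rule tpair_bilin[OF U subspace_refl V H hom_in[OF q tens_in[OF that \<open>v \<in> _\<close>]]])
    show ?thesis
      using 1 tpair_hom_bilin[OF bilin_hom_tens[OF q]] that
      unfolding bilin_def by simp
  qed
  have XY: "bilin V U base_field (\<lambda>v f. tpair f e (app (linv q) (tens H V a v)))"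
    if "a \<in> carr H" "e \<in> carr (dual V)" for e a
  proof -
    have 1: "bilin U (dual V) base_field (\<lambda>f e. tpair f e (app (linv q) (tens H V a v)))" if "v \<in> carr V" for v
      by (rule tpair_bilin[OF U subspace_refl V H hom_in[OF q tens_in[OF \<open>a \<in> _\<close> that]]])
    show ?thesis
      using 1 tpair_hom_bilin[OF bilin_hom_tens[OF q]] that
      unfolding bilin_def by simp
  qed
  note r = tlift_tform[OF V H PQ XY u, folded raw_VU_def, simplified]
  note e = emb_UV_facts[OF U V H]
  show i: "braid_VU H U V q \<in> iso (V \<otimes> U) (U \<otimes> V)"
    unfolding braid_VU_def by (rule corestrict_iso[OF e(1,2) r(1) b[unfolded VU_bijective_def]
        vspace_tprod vspace_tprod])
  have im: "app (raw_VU H U V q) ` carr (V \<otimes> U) \<subseteq> app (emb_UV H U V) ` carr (U \<otimes> V)"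
    using b unfolding VU_bijective_def bij_onto_def hom_src[OF r(1)] hom_src[OF e(1)] by (simp add: bij_betw_def)
  assume fv: "v \<in> carr V" "f \<in> carr U" and a: "a \<in> carr H"
  note t = tens_in[OF fv]
  note t' = hom_in[OF isoD(1)[OF i vspace_tprod vspace_tprod] t]
  note s = hom_in[OF q tens_in[OF a fv(1)]]
  have eq: "app (emb_UV H U V) (app (braid_VU H U V q) (tens V U v f)) = app (raw_VU H U V q) (tens V U v f)"
    unfolding braid_VU_def by (rule corestrict_app[OF e(1,2) r(1) im vspace_tprod vspace_tprod t])
  show "app (slice_left U V (\<lambda>f. f a)) (app (braid_VU H U V q) (tens V U v f)) =
      app (slice_right V H f) (app (linv q) (tens H V a v))"
  proof (rule dual_separates[OF V])
    note lf = subspace_dualD(3)[OF U fv(2)]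
    show "app (slice_left U V (\<lambda>f. f a)) (app (braid_VU H U V q) (tens V U v f)) \<in> carr V"
      by (rule hom_in[OF slice_left_hom[OF u V lfun_eval[OF U]] t'])
    show "app (slice_right V H f) (app (linv q) (tens H V a v)) \<in> carr V"
      by (rule hom_in[OF slice_right_hom[OF V lf] s])
    fix d assume d: "d \<in> carr (dual V)"
    show "d (app (slice_left U V (\<lambda>f. f a)) (app (braid_VU H U V q) (tens V U v f))) =
        d (app (slice_right V H f) (app (linv q) (tens H V a v)))"
      using e(3)[OF t' a d] r(2)[OF fv a d] eq tpair_slice_right[OF V lf dual_lfun[OF d] s] by simp
  qed
qed

lemma rho_R_facts:
  assumes U: "is_subspace U (dual H)" and V: "vspace V"
    and q: "linv q \<in> hom (V \<otimes> H) (H \<otimes> V)" and \<nu>: "\<nu> \<in> hom (H \<otimes> V) V"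
    and im: "app (raw_rho_R H V q \<nu>) ` carr V \<subseteq> app (emb_VU H U V) ` carr (V \<otimes> U)"
  shows rho_R_hom: "rho_R H U V q \<nu> \<in> hom V (V \<otimes> U)"
    and rho_R_slice: "v \<in> carr V \<Longrightarrow> a \<in> carr H \<Longrightarrow>
      app (slice_right V U (\<lambda>f. f a)) (app (rho_R H U V q \<nu>) v) = app \<nu> (app (linv q) (tens V H v a))"
proof -
  let ?\<beta> = "\<lambda>v e a. e (app \<nu> (app (linv q) (tens V H v a)))"
  note b = bilin_hom[OF \<nu> bilin_hom_tens[OF q]]
  have PQ: "bilin (dual V) H base_field (?\<beta> v)" if "v \<in> carr V" for v
    using bilinD[OF b] that by (auto simp: bilin_def dual_iff lfun_def plus_fun_apply)
  have g: "tform (dual V) H (?\<beta> v) (tens (dual V) H e a) = ?\<beta> v e a"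
    if "v \<in> carr V" "a \<in> carr H" "e \<in> carr (dual V)" for v a e
    using that by (simp add: tform_app tens_in tensor_eval_tens[OF PQ])
  have scl_in: "fscl c (tform (dual V) H (?\<beta> v)) \<in> carr (dual (dual V \<otimes> H))" for c v
    using vspace_scl[OF vspace_dual tform_dual] by (simp only: scl_dual)
  have r: "raw_rho_R H V q \<nu> \<in> hom V (dual (dual V \<otimes> H))"
    unfolding raw_rho_R_def
  proof (rule homI[OF tform_dual _ _ V])
    fix x y assume "x \<in> carr V" "y \<in> carr V"
    then show "tform (dual V) H (?\<beta> (x + y)) = tform (dual V) H (?\<beta> x) + tform (dual V) H (?\<beta> y)"
      by (intro dual_tens_eqI[OF vspace_dual tform_dual vspace_add[OF vspace_dual tform_dual tform_dual]])
        (simp add: g plus_fun_apply vspace_add[OF V] bilinD[OF b] dual_iff lfun_def)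
  next
    fix c x assume "x \<in> carr V"
    then show "tform (dual V) H (?\<beta> (scl V c x)) = scl (dual (dual V \<otimes> H)) c (tform (dual V) H (?\<beta> x))"
      unfolding scl_dual
      by (intro dual_tens_eqI[OF vspace_dual tform_dual scl_in])
        (simp add: g vspace_scl[OF V] bilinD[OF b] dual_iff lfun_def)
  qed
  note e = emb_VU_facts[OF U V]
  note c = corestrict_facts[OF e(1,2) r im V vspace_tprod, folded rho_R_def]
  show "rho_R H U V q \<nu> \<in> hom V (V \<otimes> U)" by (rule c)
  assume v: "v \<in> carr V" and a: "a \<in> carr H"
  show "app (slice_right V U (\<lambda>f. f a)) (app (rho_R H U V q \<nu>) v) = app \<nu> (app (linv q) (tens V H v a))"
  proof (rule dual_separates[OF V])
    show "app (slice_right V U (\<lambda>f. f a)) (app (rho_R H U V q \<nu>) v) \<in> carr V"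
      by (rule hom_in[OF slice_right_hom[OF V lfun_eval[OF U]] hom_in[OF c(1) v]])
    show "app \<nu> (app (linv q) (tens V H v a)) \<in> carr V" by (rule bilin_in[OF b v a])
    fix d assume d: "d \<in> carr (dual V)"
    have "app (raw_rho_R H V q \<nu>) v = tform (dual V) H (?\<beta> v)" using v by (simp add: raw_rho_R_def)
    then show "d (app (slice_right V U (\<lambda>f. f a)) (app (rho_R H U V q \<nu>) v)) =
        d (app \<nu> (app (linv q) (tens V H v a)))"
      using e(3)[OF hom_in[OF c(1) v] a d] c(2)[OF v] g[OF v a d] by simp
  qed
qed

lemma rho_L_facts:
  assumes U: "is_subspace U (dual H)" and V: "vspace V" and H: "vspace H"
    and q: "linv q \<in> hom (H \<otimes> V) (V \<otimes> H)" and \<nu>: "\<nu> \<in> hom (V \<otimes> H) V"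
    and im: "app (raw_rho_L H V q \<nu>) ` carr V \<subseteq> app (emb_UV H U V) ` carr (U \<otimes> V)"
  shows rho_L_hom: "rho_L H U V q \<nu> \<in> hom V (U \<otimes> V)"
    and rho_L_slice: "v \<in> carr V \<Longrightarrow> a \<in> carr H \<Longrightarrow>
      app (slice_left U V (\<lambda>f. f a)) (app (rho_L H U V q \<nu>) v) = app \<nu> (app (linv q) (tens H V a v))"
proof -
  let ?\<beta> = "\<lambda>v a e. e (app \<nu> (app (linv q) (tens H V a v)))"
  note b = bilin_hom[OF \<nu> bilin_hom_tens[OF q]]
  have PQ: "bilin H (dual V) base_field (?\<beta> v)" if "v \<in> carr V" for v
    using bilinD[OF b] that by (auto simp: bilin_def dual_iff lfun_def plus_fun_apply)
  have g: "tform H (dual V) (?\<beta> v) (tens H (dual V) a e) = ?\<beta> v a e"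
    if "v \<in> carr V" "a \<in> carr H" "e \<in> carr (dual V)" for v a e
    using that by (simp add: tform_app tens_in tensor_eval_tens[OF PQ])
  have scl_in: "fscl c (tform H (dual V) (?\<beta> v)) \<in> carr (dual (H \<otimes> dual V))" for c v
    using vspace_scl[OF vspace_dual tform_dual] by (simp only: scl_dual)
  have r: "raw_rho_L H V q \<nu> \<in> hom V (dual (H \<otimes> dual V))"
    unfolding raw_rho_L_def
  proof (rule homI[OF tform_dual _ _ V])
    fix x y assume "x \<in> carr V" "y \<in> carr V"
    then show "tform H (dual V) (?\<beta> (x + y)) = tform H (dual V) (?\<beta> x) + tform H (dual V) (?\<beta> y)"
      by (intro dual_tens_eqI[OF H tform_dual vspace_add[OF vspace_dual tform_dual tform_dual]])
        (simp add: g plus_fun_apply vspace_add[OF V] bilinD[OF b] dual_iff lfun_def)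
  next
    fix c x assume "x \<in> carr V"
    then show "tform H (dual V) (?\<beta> (scl V c x)) = scl (dual (H \<otimes> dual V)) c (tform H (dual V) (?\<beta> x))"
      unfolding scl_dual
      by (intro dual_tens_eqI[OF H tform_dual scl_in])
        (simp add: g vspace_scl[OF V] bilinD[OF b] dual_iff lfun_def)
  qed
  note e = emb_UV_facts[OF U V H]
  note c = corestrict_facts[OF e(1,2) r im V vspace_tprod, folded rho_L_def]
  note u = subspace_dual_vspace[OF U]
  show "rho_L H U V q \<nu> \<in> hom V (U \<otimes> V)" by (rule c)
  assume v: "v \<in> carr V" and a: "a \<in> carr H"
  show "app (slice_left U V (\<lambda>f. f a)) (app (rho_L H U V q \<nu>) v) = app \<nu> (app (linv q) (tens H V a v))"
  proof (rule dual_separates[OF V])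
    show "app (slice_left U V (\<lambda>f. f a)) (app (rho_L H U V q \<nu>) v) \<in> carr V"
      by (rule hom_in[OF slice_left_hom[OF u V lfun_eval[OF U]] hom_in[OF c(1) v]])
    show "app \<nu> (app (linv q) (tens H V a v)) \<in> carr V" by (rule bilin_in[OF b a v])
    fix d assume d: "d \<in> carr (dual V)"
    have "app (raw_rho_L H V q \<nu>) v = tform H (dual V) (?\<beta> v)" using v by (simp add: raw_rho_L_def)
    then show "d (app (slice_left U V (\<lambda>f. f a)) (app (rho_L H U V q \<nu>) v)) = d (app \<nu> (app (linv q) (tens H V a v)))"
      using e(3)[OF hom_in[OF c(1) v] a d] c(2)[OF v] g[OF v a d] by simp
  qed
qed

lemma tpair'_linear: "tpair' (t + t') a b = tpair' t a b + tpair' t' a b" "tpair' (fscl c t) a b = c * tpair' t a b"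
  by (simp_all add: tpair'_def plus_fun_apply)

text \<open>The coproduct of a functional is unique because pairings with \<open>a\<close> and \<open>b\<close> separate the tensors in
  \<open>U \<otimes> U\<close>. Linearity follows from uniqueness.\<close>
lemma dual_comult_facts:
  assumes U: "is_subspace U (dual H)" and H: "vspace H" and c: "comult_closed H m p U"
    and m: "m \<in> hom (H \<otimes> H) H" and p: "p \<in> hom (H \<otimes> H) (H \<otimes> H)"
  shows dual_comult_hom: "dual_comult H m p U \<in> hom U (U \<otimes> U)"
    and dual_comult_pair: "f \<in> carr U \<Longrightarrow> a \<in> carr H \<Longrightarrow> b \<in> carr H \<Longrightarrow>
      tpair' (app (dual_comult H m p U) f) a b = f (app m (app p (tens H H a b)))"
proof -
  note u = subspace_dual_vspace[OF U]
  note inj = tpair'_inject[OF U H]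
  have ex: "is_dual_coprod H m p U f (app (dual_comult H m p U) f)" if f: "f \<in> carr U" for f
  proof -
    obtain t where t: "is_dual_coprod H m p U f t" using c f by (auto simp: comult_closed_def)
    have "(THE t. is_dual_coprod H m p U f t) = t"
      by (rule the_equality, rule t, rule inj) (use t in \<open>auto simp: is_dual_coprod_def\<close>)
    then show ?thesis using t f by (simp add: dual_comult_def)
  qed
  have eq: "app (dual_comult H m p U) f = t" if "f \<in> carr U" "is_dual_coprod H m p U f t" for f t
    by (rule inj) (use ex[OF that(1)] that(2) in \<open>auto simp: is_dual_coprod_def\<close>)
  show "dual_comult H m p U \<in> hom U (U \<otimes> U)"
    unfolding hom_def
  proof (intro CollectI conjI ballI allI impI)
    show "src (dual_comult H m p U) = U" "trg (dual_comult H m p U) = U \<otimes> U" by (simp_all add: dual_comult_def)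
    show "app (dual_comult H m p U) f = 0" if "f \<notin> carr U" for f using that by (simp add: dual_comult_def)
    show "app (dual_comult H m p U) f \<in> carr (U \<otimes> U)" if "f \<in> carr U" for f
      using ex[OF that] by (simp add: is_dual_coprod_def)
    show "app (dual_comult H m p U) (f + g) = app (dual_comult H m p U) f + app (dual_comult H m p U) g"
      if "f \<in> carr U" "g \<in> carr U" for f g
      by (rule eq[OF vspace_add[OF u that]]) (use ex[OF that(1)] ex[OF that(2)] in
        \<open>simp add: is_dual_coprod_def vspace_add[OF vspace_tprod] tpair'_linear plus_fun_apply\<close>)
    show "app (dual_comult H m p U) (scl U c f) = scl (U \<otimes> U) c (app (dual_comult H m p U) f)"
      if "f \<in> carr U" for c f
      unfolding scl_tens
      by (rule eq[OF vspace_scl[OF u that]]) (use ex[OF that] in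
        \<open>simp add: is_dual_coprod_def vspace_scl[OF vspace_tprod, simplified] tpair'_linear subspace_dualD(1)[OF U]\<close>)
  qed
  show "f \<in> carr U \<Longrightarrow> a \<in> carr H \<Longrightarrow> b \<in> carr H \<Longrightarrow>
      tpair' (app (dual_comult H m p U) f) a b = f (app m (app p (tens H H a b)))"
    using ex by (simp add: is_dual_coprod_def)
qed

lemma dual_mult_facts:
  assumes U: "is_subspace U (dual H)" and H: "vspace H"
    and c: "\<And>f g. f \<in> carr U \<Longrightarrow> g \<in> carr U \<Longrightarrow> dual_mult_fun H \<Delta> p f g \<in> carr U"
    and \<Delta>: "\<Delta> \<in> hom H (H \<otimes> H)" and p: "linv p \<in> hom (H \<otimes> H) (H \<otimes> H)"
  shows dual_mult_hom: "dual_mult H \<Delta> p U \<in> hom (U \<otimes> U) U"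
    and dual_mult_app: "f \<in> carr U \<Longrightarrow> g \<in> carr U \<Longrightarrow> a \<in> carr H \<Longrightarrow>
      app (dual_mult H \<Delta> p U) (tens U U f g) a = tpair f g (app (linv p) (app \<Delta> a))"
proof -
  note u = subspace_dual_vspace[OF U]
  have t: "bilin U U base_field (\<lambda>f g. tpair f g (app (linv p) (app \<Delta> a)))" if "a \<in> carr H" for a
    by (rule tpair_bilin[OF U U H H hom_in[OF p hom_in[OF \<Delta> that]]])
  have b: "bilin U U U (dual_mult_fun H \<Delta> p)"
    unfolding bilin_def
    by (intro conjI ballI allI ext c) (auto simp: dual_mult_fun_def plus_fun_apply subspace_dualD(1)[OF U]
      bilin_add_left[OF t] bilin_add_right[OF t] bilin_scl_left[OF t, simplified subspace_dualD(1)[OF U]]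
      bilin_scl_right[OF t, simplified subspace_dualD(1)[OF U]])
  show "dual_mult H \<Delta> p U \<in> hom (U \<otimes> U) U" unfolding dual_mult_def by (rule tlift_hom[OF u u b])
  show "f \<in> carr U \<Longrightarrow> g \<in> carr U \<Longrightarrow> a \<in> carr H \<Longrightarrow>
      app (dual_mult H \<Delta> p U) (tens U U f g) a = tpair f g (app (linv p) (app \<Delta> a))"
    unfolding dual_mult_def by (simp add: tlift_tens[OF u u b] dual_mult_fun_def)
qed

section \<open>Transposition of arrows\<close>

text \<open>Arrows are linear, and the words in their domain are products of coordinates of vectors.\<close>
lemma arrow_eqI2:
  assumes F: "is_arrow B F" and G: "is_arrow B G" and C: "valid B C" and D: "valid B D"
    and w: "adm F = wo C @ wo D" "adm G = adm F" "acd F = acd G"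
    and e: "\<And>x y. x \<in> carr (sp C) \<Longrightarrow> y \<in> carr (sp D) \<Longrightarrow>
      fn F (app (cm C) x * app (cm D) y) = fn G (app (cm C) x * app (cm D) y)"
  shows "F = G"
proof (rule arrow_eqI[OF F G])
  fix w assume "w \<in> idx B (adm F)"
  then obtain x y where u: "w = x @ y" "x \<in> idx B (wo C)" "y \<in> idx B (wo D)"
    using w by (auto simp: idx_append)
  obtain a b where "a \<in> carr (sp C)" "mon x = app (cm C) a" "b \<in> carr (sp D)" "mon y = app (cm D) b"
    using valid_surj[OF C tsp_mon[OF u(2)]] valid_surj[OF D tsp_mon[OF u(3)]] by blast
  then show "fn F (mon w) = fn G (mon w)" using e by (simp add: u flip: mon_mult)
qed (simp_all add: w)

lemma arrow_eqI3:
  assumes F: "is_arrow B F" and G: "is_arrow B G" and C: "valid B C" and D: "valid B D" and E: "valid B E"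
    and w: "adm F = wo C @ wo D @ wo E" "adm G = adm F" "acd F = acd G"
    and e: "\<And>x y z. x \<in> carr (sp C) \<Longrightarrow> y \<in> carr (sp D) \<Longrightarrow> z \<in> carr (sp E) \<Longrightarrow>
      fn F (app (cm C) x * app (cm D) y * app (cm E) z) = fn G (app (cm C) x * app (cm D) y * app (cm E) z)"
  shows "F = G"
proof (rule arrow_eqI[OF F G])
  fix w assume "w \<in> idx B (adm F)"
  then obtain x y z where u: "w = x @ y @ z" "x \<in> idx B (wo C)" "y \<in> idx B (wo D)" "z \<in> idx B (wo E)"
    using w by (auto simp: idx_append)
  obtain a b c where "a \<in> carr (sp C)" "mon x = app (cm C) a" "b \<in> carr (sp D)" "mon y = app (cm D) b"
    "c \<in> carr (sp E)" "mon z = app (cm E) c"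
    using valid_surj[OF C tsp_mon[OF u(2)]] valid_surj[OF D tsp_mon[OF u(3)]] valid_surj[OF E tsp_mon[OF u(4)]]
        by blast
  then show "fn F (mon w) = fn G (mon w)" using e[of a b c] by (simp add: u mult.assoc flip: mon_mult)
qed (simp_all add: w)

lemma arrow_eqI4:
  assumes F: "is_arrow B F" and G: "is_arrow B G"
    and C: "valid B C" and D: "valid B D" and E: "valid B E" and J: "valid B J"
    and w: "adm F = wo C @ wo D @ wo E @ wo J" "adm G = adm F" "acd F = acd G"
    and e: "\<And>x y z t. x \<in> carr (sp C) \<Longrightarrow> y \<in> carr (sp D) \<Longrightarrow> z \<in> carr (sp E) \<Longrightarrow> t \<in> carr (sp J) \<Longrightarrow>
      fn F ((app (cm C) x * app (cm D) y) * (app (cm E) z * app (cm J) t)) =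
      fn G ((app (cm C) x * app (cm D) y) * (app (cm E) z * app (cm J) t))"
  shows "F = G"
proof (rule arrow_eqI[OF F G])
  fix w assume "w \<in> idx B (adm F)"
  then obtain x y z t where u: "w = x @ y @ z @ t" "x \<in> idx B (wo C)" "y \<in> idx B (wo D)" "z \<in> idx B (wo E)"
      "t \<in> idx B (wo J)"
    using w by (auto simp: idx_append)
  obtain a b c d where "a \<in> carr (sp C)" "mon x = app (cm C) a" "b \<in> carr (sp D)" "mon y = app (cm D) b"
    "c \<in> carr (sp E)" "mon z = app (cm E) c" "d \<in> carr (sp J)" "mon t = app (cm J) d"
    using valid_surj[OF C tsp_mon[OF u(2)]] valid_surj[OF D tsp_mon[OF u(3)]] valid_surj[OF E tsp_mon[OF u(4)]]
      valid_surj[OF J tsp_mon[OF u(5)]] by blast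
  then show "fn F (mon w) = fn G (mon w)" using e[of a b c d] by (simp add: u mult.assoc flip: mon_mult)
qed (simp_all add: w)

text \<open>If an arrow \<open>E\<close> without outputs evaluates the functional \<open>\<phi>\<close>, then with strands \<open>wo D\<close> on its left it
  takes the slice by \<open>\<phi>\<close>.\<close>
lemma contract_left:
  assumes E: "is_arrow B E" "adm E = wo CX @ wo CY" "acd E = []"
    and CX: "valid B CX" and CY: "valid B CY" and D: "valid B D"
    and e: "\<And>x. x \<in> carr (sp CX) \<Longrightarrow> fn E (app (cm CX) x * app (cm CY) y) = sc (\<phi> x) 1"
    and l: "lfun (sp CX) \<phi>" and y: "y \<in> carr (sp CY)" and t: "t \<in> carr (sp D \<otimes> sp CX)"
  shows "fn (awh B (rev (wo D)) E []) (app (cm (D \<boxtimes> CX)) t * app (cm CY) y) =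
    app (cm D) (app (slice_right (sp D) (sp CX) \<phi>) t)"
proof -
  note d = valid_vspace[OF D]
  note s = slice_right_hom[OF d l]
  note h = ctens_hom[OF D CX]
  note ln = is_arrow_lnr[OF is_arrow_wh[OF E(1)]]
  from d t show ?thesis
  proof (induction rule: tens_induct)
    case zero
    show ?case unfolding hom_0[OF h vspace_tprod] hom_0[OF s vspace_tprod] hom_0[OF valid_hom[OF D] d]
      by (simp add: lnr_0[OF ln])
  next
    case (add x z t)
    have "fn (awh B (rev (wo D)) E []) (app (cm D) x * (app (cm CX) z * app (cm CY) y)) =
       app (cm D) x * fn E (app (cm CX) z * app (cm CY) y)"
      using add y by (intro awh_right E) (simp_all add: E valid_in D CX CY tsp_mult)
    then show ?case using add
      by (simp add: hom_add[OF h] hom_add[OF s] tens_in ctens_tens[OF D CX] slice_right_tens[OF d l] distrib_right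
        lnr_add[OF ln] mult.assoc e mult_sc_right hom_add[OF valid_hom[OF D]] hom_scl[OF valid_hom[OF D]]
        vspace_scl[OF d] hom_in[OF s])
  qed
qed

lemma contract_right:
  assumes E: "is_arrow B E" "adm E = wo CX @ wo CY" "acd E = []"
    and CX: "valid B CX" and CY: "valid B CY" and D: "valid B D"
    and e: "\<And>y. y \<in> carr (sp CY) \<Longrightarrow> fn E (app (cm CX) x * app (cm CY) y) = sc (\<phi> y) 1"
    and l: "lfun (sp CY) \<phi>" and x: "x \<in> carr (sp CX)" and t: "t \<in> carr (sp CY \<otimes> sp D)"
  shows "fn (awh B [] E (wo D)) (app (cm CX) x * app (cm (CY \<boxtimes> D)) t) =
    app (cm D) (app (slice_left (sp CY) (sp D) \<phi>) t)"
proof -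
  note d = valid_vspace[OF D] and c = valid_vspace[OF CY]
  note s = slice_left_hom[OF c d l]
  note h = ctens_hom[OF CY D]
  note ln = is_arrow_lnr[OF is_arrow_wh[OF E(1)]]
  from c t show ?thesis
  proof (induction rule: tens_induct)
    case zero
    show ?case unfolding hom_0[OF h vspace_tprod] hom_0[OF s vspace_tprod] hom_0[OF valid_hom[OF D] d]
      by (simp add: lnr_0[OF ln])
  next
    case (add y z t)
    have "fn (awh B [] E (wo D)) ((app (cm CX) x * app (cm CY) y) * app (cm D) z) =
       fn E (app (cm CX) x * app (cm CY) y) * app (cm D) z"
      using add x by (intro awh_left E) (simp_all add: E valid_in D CX CY tsp_mult)
    then show ?case using add
      by (simp add: hom_add[OF h] hom_add[OF s] tens_in ctens_tens[OF CY D] slice_left_tens[OF c d l] distrib_left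
        lnr_add[OF ln] mult.assoc e mult_sc_left hom_add[OF valid_hom[OF D]] hom_scl[OF valid_hom[OF D]]
        vspace_scl[OF d] hom_in[OF s])
  qed
qed

text \<open>The span of an arbitrary word, with the identity as coordinate map. It allows \<open>sepR\<close> to be applied with
  the span of any word as the first factor.\<close>
definition word_crd :: "('l \<Rightarrow> 'i set) \<Rightarrow> 'l list \<Rightarrow> ('k::field, 'i list \<Rightarrow>\<^sub>0 'k, 'l, 'i list \<Rightarrow>\<^sub>0 'k) crd" where
  "word_crd B w = Crd w (LMap (VS (tsp B w) sc) falg (\<lambda>t. if t \<in> tsp B w then t else 0))"

lemma word_crd_simps [simp]: "wo (word_crd B w) = w" "sp (word_crd B w) = VS (tsp B w) sc"
  "t \<in> tsp B w \<Longrightarrow> app (cm (word_crd B w)) t = t"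
  by (simp_all add: word_crd_def)

lemma valid_word_crd: "valid B (word_crd B w)"
proof -
  have "vspace (VS (tsp B w) sc)"
    by (simp add: vspace_def sc.vector_space_axioms sc.subspace_def tsp_0 tsp_add tsp_sc)
  moreover have "cm (word_crd B w) \<in> hom (VS (tsp B w) sc) falg"
    by (simp add: word_crd_def hom_def tsp_add tsp_sc)
  moreover have "bij_betw (app (cm (word_crd B w))) (tsp B w) (tsp B w)"
    by (simp add: bij_betw_def inj_on_def)
  ultimately show ?thesis by (simp add: valid_def)
qed

text \<open>Coordinates for \<open>H\<close> and \<open>U\<close> whose words are the single letters \<open>h\<close> and \<open>u\<close>. The arc between them is given
  in both orders: \<open>EV\<close> is used in diagrams for right coactions, \<open>EV'\<close> in their mirror images for left coactions.\<close>
locale dual_crd =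
  fixes B :: "'l \<Rightarrow> 'i set" and H :: "('k::field, 'h::ab_group_add) vs" and U :: "('k, 'h \<Rightarrow> 'k) vs"
    and CH CU h u EV EV'
  assumes U: "is_subspace U (dual H)"
    and CH: "coords B CH H" "wo CH = [h]" and CU: "coords B CU U" "wo CU = [u]"
    and EV: "is_arrow B EV" "adm EV = [u, h]" "acd EV = []"
      "\<And>f a. f \<in> carr U \<Longrightarrow> a \<in> carr H \<Longrightarrow> fn EV (app (cm CU) f * app (cm CH) a) = sc (f a) 1"
    and EV': "is_arrow B EV'" "adm EV' = [h, u]" "acd EV' = []"
      "\<And>f a. f \<in> carr U \<Longrightarrow> a \<in> carr H \<Longrightarrow> fn EV' (app (cm CH) a * app (cm CU) f) = sc (f a) 1"
begin

abbreviation "CHH \<equiv> CH \<boxtimes> CH"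
abbreviation "CUU \<equiv> CU \<boxtimes> CU"
abbreviation "kH \<equiv> app (cm CH)"
abbreviation "kU \<equiv> app (cm CU)"
abbreviation "kHH \<equiv> app (cm CHH)"
abbreviation "kUU \<equiv> app (cm CUU)"

lemmas v = coords_valid[OF CH(1)] coords_valid[OF CU(1)]
lemmas [simp] = coords_sp[OF CH(1)] coords_sp[OF CU(1)] CH(2) CU(2) EV(1-3) EV'(1-3)
lemmas vs = coords_vspace[OF CH(1)] coords_vspace[OF CU(1)]

lemma in_tsp: "a \<in> carr H \<Longrightarrow> kH a \<in> tsp B [h]" "f \<in> carr U \<Longrightarrow> kU f \<in> tsp B [u]"
  "s \<in> carr (H \<otimes> H) \<Longrightarrow> kHH s \<in> tsp B [h,h]"
  "t \<in> carr (U \<otimes> U) \<Longrightarrow> kUU t \<in> tsp B [u,u]"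
  using valid_in[OF v(1), of a] valid_in[OF v(2), of f] valid_in[OF valid_ctens[OF v(1,1)], of s]
    valid_in[OF valid_ctens[OF v(2,2)], of t] by simp_all

lemma lf: "f \<in> carr U \<Longrightarrow> lfun H f" by (rule subspace_dualD(3)[OF U])

lemma EV_slice_right: "valid B D \<Longrightarrow> t \<in> carr (sp D \<otimes> U) \<Longrightarrow> a \<in> carr H \<Longrightarrow>
    fn (awh B (rev (wo D)) EV []) (app (cm (D \<boxtimes> CU)) t * kH a) = app (cm D) (app (slice_right (sp D) U (\<lambda>f. f a)) t)"
  using contract_left[of B EV CU CH D a "\<lambda>f. f a" t] v EV lfun_eval[OF U] by simp
lemma EV_slice_left: "valid B D \<Longrightarrow> s \<in> carr (H \<otimes> sp D) \<Longrightarrow> f \<in> carr U \<Longrightarrow>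
    fn (awh B [] EV (wo D)) (kU f * app (cm (CH \<boxtimes> D)) s) = app (cm D) (app (slice_left H (sp D) f) s)"
  using contract_right[of B EV CU CH D f f s] v EV lf by simp
lemma EV'_slice_right: "valid B D \<Longrightarrow> s \<in> carr (sp D \<otimes> H) \<Longrightarrow> f \<in> carr U \<Longrightarrow>
    fn (awh B (rev (wo D)) EV' []) (app (cm (D \<boxtimes> CH)) s * kU f) = app (cm D) (app (slice_right (sp D) H f) s)"
  using contract_left[of B EV' CH CU D f f s] v EV' lf by simp
lemma EV'_slice_left: "valid B D \<Longrightarrow> t \<in> carr (U \<otimes> sp D) \<Longrightarrow> a \<in> carr H \<Longrightarrow>
    fn (awh B [] EV' (wo D)) (kH a * app (cm (CU \<boxtimes> D)) t) = app (cm D) (app (slice_left U (sp D) (\<lambda>f. f a)) t)"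
  using contract_right[of B EV' CH CU D a "\<lambda>f. f a" t] v EV' lfun_eval[OF U] by simp

text \<open>The separation assumption of \<open>dual_pairing\<close>: the values of \<open>F\<close> are coordinates of tensors in \<open>W \<otimes> U\<close>,
  whose slices are computed by the arc.\<close>
lemma sep_right:
  assumes F: "is_arrow B F" and G: "is_arrow B G" and w: "adm F = adm G" "acd F = w @ [u]" "acd G = w @ [u]"
    and e: "awh B (rev w) EV [] \<cdot> awh B [] F [h] = awh B (rev w) EV [] \<cdot> awh B [] G [h]"
  shows "F = G"
proof (rule arrow_eqI[OF F G])
  fix x assume x: "x \<in> idx B (adm F)"
  obtain W :: "('k, 'i list \<Rightarrow>\<^sub>0 'k, 'l, 'i list \<Rightarrow>\<^sub>0 'k) crd" where W: "valid B W" "wo W = w"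
    using valid_word_crd word_crd_simps(1) by blast
  note WU = valid_ctens[OF W(1) v(2)]
  have in_W: "fn F (mon x) \<in> tsp B (wo (W \<boxtimes> CU))" "fn G (mon x) \<in> tsp B (wo (W \<boxtimes> CU))"
    using is_arrow_into[OF F, of "mon x"] is_arrow_into[OF G, of "mon x"] w W by simp_all
  from valid_surj[OF WU in_W(1)] obtain s where s: "s \<in> carr (sp W \<otimes> U)" "fn F (mon x) = app (cm (W \<boxtimes> CU)) s"
    unfolding ctens_simps coords_sp[OF CU(1)] by blast
  from valid_surj[OF WU in_W(2)] obtain t where t: "t \<in> carr (sp W \<otimes> U)" "fn G (mon x) = app (cm (W \<boxtimes> CU)) t"
    unfolding ctens_simps coords_sp[OF CU(1)] by blast
  have "s = t"
  proof (rule sepR[OF valid_vspace[OF W(1)] U s(1) t(1)])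
    fix a assume a: "a \<in> carr H"
    have "fn (awh B [] F [h]) (mon x * kH a) = fn F (mon x) * kH a"
      by (rule awh_left[OF F]) (use x w in \<open>simp_all add: tsp_mon in_tsp a\<close>)
    moreover have "fn (awh B [] G [h]) (mon x * kH a) = fn G (mon x) * kH a"
      by (rule awh_left[OF G]) (use x w in \<open>simp_all add: tsp_mon in_tsp a\<close>)
    moreover have "fn (awh B (rev w) EV [] \<cdot> awh B [] F [h]) (mon x * kH a) =
        fn (awh B (rev w) EV [] \<cdot> awh B [] G [h]) (mon x * kH a)"
      by (simp only: e)
    ultimately have "app (cm W) (app (slice_right (sp W) U (\<lambda>f. f a)) s) =
        app (cm W) (app (slice_right (sp W) U (\<lambda>f. f a)) t)"
      using EV_slice_right[OF W(1) s(1) a] EV_slice_right[OF W(1) t(1) a] unfolding sel_simps s(2) t(2) W(2) by simp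
    then show "app (slice_right (sp W) U (\<lambda>f. f a)) s = app (slice_right (sp W) U (\<lambda>f. f a)) t"
      by (rule valid_inj[OF W(1) hom_in[OF slice_right_hom[OF valid_vspace[OF W(1)] lfun_eval[OF U, of a]] s(1)]
          hom_in[OF slice_right_hom[OF valid_vspace[OF W(1)] lfun_eval[OF U, of a]] t(1)]])
  qed
  then show "fn F (mon x) = fn G (mon x)" unfolding s(2) t(2) by simp
qed (simp_all add: w)

lemma sep_left:
  assumes F: "is_arrow B F" and G: "is_arrow B G" and w: "adm F = adm G" "acd F = u # w" "acd G = u # w"
    and e: "awh B [] EV' w \<cdot> awh B [h] F [] = awh B [] EV' w \<cdot> awh B [h] G []"
  shows "F = G"
proof (rule arrow_eqI[OF F G])
  fix x assume x: "x \<in> idx B (adm F)"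
  obtain W :: "('k, 'i list \<Rightarrow>\<^sub>0 'k, 'l, 'i list \<Rightarrow>\<^sub>0 'k) crd" where W: "valid B W" "wo W = w"
    using valid_word_crd word_crd_simps(1) by blast
  note WU = valid_ctens[OF v(2) W(1)]
  have in_W: "fn F (mon x) \<in> tsp B (wo (CU \<boxtimes> W))" "fn G (mon x) \<in> tsp B (wo (CU \<boxtimes> W))"
    using is_arrow_into[OF F, of "mon x"] is_arrow_into[OF G, of "mon x"] w W by simp_all
  from valid_surj[OF WU in_W(1)] obtain s where s: "s \<in> carr (U \<otimes> sp W)" "fn F (mon x) = app (cm (CU \<boxtimes> W)) s"
    unfolding ctens_simps coords_sp[OF CU(1)] by blast
  from valid_surj[OF WU in_W(2)] obtain t where t: "t \<in> carr (U \<otimes> sp W)" "fn G (mon x) = app (cm (CU \<boxtimes> W)) t"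
    unfolding ctens_simps coords_sp[OF CU(1)] by blast
  have "s = t"
  proof (rule sepL[OF valid_vspace[OF W(1)] U s(1) t(1)])
    fix a assume a: "a \<in> carr H"
    have "fn (awh B [h] F []) (kH a * mon x) = kH a * fn F (mon x)"
      by (rule awh_right[OF F]) (use x w in \<open>simp_all add: tsp_mon in_tsp a\<close>)
    moreover have "fn (awh B [h] G []) (kH a * mon x) = kH a * fn G (mon x)"
      by (rule awh_right[OF G]) (use x w in \<open>simp_all add: tsp_mon in_tsp a\<close>)
    moreover have "fn (awh B [] EV' w \<cdot> awh B [h] F []) (kH a * mon x) =
        fn (awh B [] EV' w \<cdot> awh B [h] G []) (kH a * mon x)"
      by (simp only: e)
    ultimately have "app (cm W) (app (slice_left U (sp W) (\<lambda>f. f a)) s) =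
        app (cm W) (app (slice_left U (sp W) (\<lambda>f. f a)) t)"
      using EV'_slice_left[OF W(1) s(1) a] EV'_slice_left[OF W(1) t(1) a] unfolding sel_simps s(2) t(2) W(2) by simp
    then show "app (slice_left U (sp W) (\<lambda>f. f a)) s = app (slice_left U (sp W) (\<lambda>f. f a)) t"
      by (rule valid_inj[OF W(1) hom_in[OF slice_left_hom[OF vs(2) valid_vspace[OF W(1)] lfun_eval[OF U, of a]] s(1)]
          hom_in[OF slice_left_hom[OF vs(2) valid_vspace[OF W(1)] lfun_eval[OF U, of a]] t(1)]])
  qed
  then show "fn F (mon x) = fn G (mon x)" unfolding s(2) t(2) by simp
qed (simp_all add: w)

text \<open>Two nested arcs compute the pairing of \<open>U \<otimes> U\<close> with \<open>H \<otimes> H\<close>: the inner arc takes a slice and the outer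
  arc evaluates it.\<close>
lemma ev2_tpair':
  assumes t: "t \<in> carr (U \<otimes> U)" and a: "a \<in> carr H" and b: "b \<in> carr H"
  shows "fn EV (fn (awh B [u] EV [h]) (kUU t * (kH a * kH b))) = sc (tpair' t a b) 1"
    and "fn EV' (fn (awh B [h] EV' [u]) (kH a * kH b * kUU t)) = sc (tpair' t a b) 1"
proof -
  let ?r = "app (slice_right U U (\<lambda>f. f a)) t" and ?l = "app (slice_left U U (\<lambda>f. f b)) t"
  have rl: "?r \<in> carr U" "?l \<in> carr U"
    by (rule hom_in[OF slice_right_hom[OF vs(2) lfun_eval[OF U]]
        t], rule hom_in[OF slice_left_hom[OF vs(2,2) lfun_eval[OF U]] t])
  have "fn (awh B [u] EV [h]) (kUU t * (kH a * kH b)) =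
      fn (awh B [] (awh B [u] EV []) [h]) ((kUU t * kH a) * kH b)"
    by (simp add: EV(1) mult.assoc)
  also have "\<dots> = fn (awh B [u] EV []) (kUU t * kH a) * kH b"
    using tsp_mult[OF in_tsp(4,1), OF t a] by (intro awh_left is_arrow_wh) (simp_all add: in_tsp a b)
  also have "fn (awh B [u] EV []) (kUU t * kH a) = kU ?r"
    using EV_slice_right[OF v(2), of t a] t a by simp
  finally show "fn EV (fn (awh B [u] EV [h]) (kUU t * (kH a * kH b))) = sc (tpair' t a b) 1"
    using EV(4)[OF rl(1) b] lfun_slice_right[OF vs(2) lfun_eval[OF U] lfun_eval[OF U] t, of a b]
        by (simp only: tpair'_def)
  have "fn (awh B [h] EV' [u]) (kH a * kH b * kUU t) =
      fn (awh B [h] (awh B [] EV' [u]) []) (kH a * (kH b * kUU t))"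
    by (simp add: EV'(1) mult.assoc)
  also have "\<dots> = kH a * fn (awh B [] EV' [u]) (kH b * kUU t)"
    using tsp_mult[OF in_tsp(1,4), OF b t] by (intro awh_right is_arrow_wh) (simp_all add: in_tsp a b)
  also have "fn (awh B [] EV' [u]) (kH b * kUU t) = kU ?l"
    using EV'_slice_left[OF v(2), of t b] t b by simp
  finally show "fn EV' (fn (awh B [h] EV' [u]) (kH a * kH b * kUU t)) = sc (tpair' t a b) 1"
    using EV'(4)[OF rl(2) a] lfun_slice_left[OF vs(2,2) lfun_eval[OF U] lfun_eval[OF U] t, of b a]
        by (simp only: tpair'_def)
qed

lemma ev2_tpair:
  assumes s: "s \<in> carr (H \<otimes> H)" and f: "f \<in> carr U" and g: "g \<in> carr U"
  shows "fn EV (fn (awh B [u] EV [h]) (kU f * kU g * kHH s)) = sc (tpair f g s) 1"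
    and "fn EV' (fn (awh B [h] EV' [u]) (kHH s * (kU f * kU g))) = sc (tpair f g s) 1"
proof -
  let ?l = "app (slice_left H H g) s" and ?r = "app (slice_right H H f) s"
  have rl: "?l \<in> carr H" "?r \<in> carr H"
    by (rule hom_in[OF slice_left_hom[OF vs(1,1) lf[OF g]] s], rule hom_in[OF slice_right_hom[OF vs(1) lf[OF f]] s])
  have "fn (awh B [u] EV [h]) (kU f * kU g * kHH s) =
      fn (awh B [u] (awh B [] EV [h]) []) (kU f * (kU g * kHH s))"
    by (simp add: EV(1) mult.assoc)
  also have "\<dots> = kU f * fn (awh B [] EV [h]) (kU g * kHH s)"
    using tsp_mult[OF in_tsp(2,3), OF g s] by (intro awh_right is_arrow_wh) (simp_all add: in_tsp f g)
  also have "fn (awh B [] EV [h]) (kU g * kHH s) = kH ?l"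
    using EV_slice_left[OF v(1), of s g] s g by simp
  finally show "fn EV (fn (awh B [u] EV [h]) (kU f * kU g * kHH s)) = sc (tpair f g s) 1"
    using EV(4)[OF f rl(1)] tpair_slice_left[OF vs(1,1) lf[OF f] lf[OF g] s] by simp
  have "fn (awh B [h] EV' [u]) (kHH s * (kU f * kU g)) =
      fn (awh B [] (awh B [h] EV' []) [u]) ((kHH s * kU f) * kU g)"
    by (simp add: EV'(1) mult.assoc)
  also have "\<dots> = fn (awh B [h] EV' []) (kHH s * kU f) * kU g"
    using tsp_mult[OF in_tsp(3,2), OF s f] by (intro awh_left is_arrow_wh) (simp_all add: in_tsp f g)
  also have "fn (awh B [h] EV' []) (kHH s * kU f) = kH ?r"
    using EV'_slice_right[OF v(1), of s f] s f by simp
  finally show "fn EV' (fn (awh B [h] EV' [u]) (kHH s * (kU f * kU g))) = sc (tpair f g s) 1"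
    using EV'(4)[OF g rl(2)] tpair_slice_right[OF vs(1) lf[OF f] lf[OF g] s] by simp
qed

text \<open>The pairings that characterise the maps on \<open>U\<close> become transposition rules for their arrows, in each of
  the two reflections.\<close>
lemma adj_braiding:
  assumes R: "rep B CUU CUU r R" and P: "rep B CHH CHH p P"
    and e: "\<And>f g a b. f \<in> carr U \<Longrightarrow> g \<in> carr U \<Longrightarrow> a \<in> carr H \<Longrightarrow> b \<in> carr H \<Longrightarrow>
      tpair' (app r (tens U U f g)) a b = tpair f g (app p (tens H H a b))"
  shows "EV \<cdot> awh B [u] EV [h] \<cdot> awh B [] R [h,h] = EV \<cdot> awh B [u] EV [h] \<cdot> awh B [u,u] P []"
    and "EV' \<cdot> awh B [h] EV' [u] \<cdot> awh B [h,h] R [] = EV' \<cdot> awh B [h] EV' [u] \<cdot> awh B [] P [u,u]"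
proof -
  note a = rep_arrow[OF R] rep_arrow[OF P]
  have t: "kU f * kU g = kUU (tens U U f g)"
     "fn R (kUU (tens U U f g)) = kUU (app r (tens U U f g))"
     "app r (tens U U f g) \<in> carr (U \<otimes> U)" "tens U U f g \<in> carr (U \<otimes> U)"
    if "f \<in> carr U" "g \<in> carr U" for f g
    using that ctens_tens[OF v(2,2)] rep_app[OF R] hom_in[OF rep_hom[OF R]] by (simp_all add: tens_in)
  have s: "kH c * kH d = kHH (tens H H c d)"
     "fn P (kHH (tens H H c d)) = kHH (app p (tens H H c d))"
     "app p (tens H H c d) \<in> carr (H \<otimes> H)" "tens H H c d \<in> carr (H \<otimes> H)"
    if "c \<in> carr H" "d \<in> carr H" for c d
    using that ctens_tens[OF v(1,1)] rep_app[OF P] hom_in[OF rep_hom[OF P]] by (simp_all add: tens_in)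
  show "EV \<cdot> awh B [u] EV [h] \<cdot> awh B [] R [h,h] = EV \<cdot> awh B [u] EV [h] \<cdot> awh B [u,u] P []"
  proof (rule arrow_eqI4[OF _ _ v(2,2,1,1)])
    fix f g c d assume x: "f \<in> carr (sp CU)" "g \<in> carr (sp CU)" "c \<in> carr (sp CH)" "d \<in> carr (sp CH)"
    then have x: "f \<in> carr U" "g \<in> carr U" "c \<in> carr H" "d \<in> carr H" by simp_all
    have 1: "fn (awh B [] R [h,h]) (kUU (tens U U f g) * kHH (tens H H c d)) =
        kUU (app r (tens U U f g)) * kHH (tens H H c d)"
      unfolding t(2)[OF x(1,2), symmetric] using a t(4)[OF x(1,2)] s(4)[OF x(3,4)]
      by (intro awh_left) (simp_all add: in_tsp)
    have 2: "fn (awh B [u,u] P []) (kUU (tens U U f g) * kHH (tens H H c d)) =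
        kUU (tens U U f g) * kHH (app p (tens H H c d))"
      unfolding s(2)[OF x(3,4), symmetric] using a t(4)[OF x(1,2)] s(4)[OF x(3,4)]
      by (intro awh_right) (simp_all add: in_tsp)
    show "fn (EV \<cdot> awh B [u] EV [h] \<cdot> awh B [] R [h,h]) ((kU f * kU g) * (kH c * kH d)) =
      fn (EV \<cdot> awh B [u] EV [h] \<cdot> awh B [u,u] P []) ((kU f * kU g) * (kH c * kH d))"
      unfolding sel_simps t(1)[OF x(1,2)] s(1)[OF x(3,4)] 1 2
      unfolding t(1)[OF x(1,2), symmetric] s(1)[OF x(3,4), symmetric] ev2_tpair'(1)[OF t(3)[OF x(1,2)] x(3,4)]
        ev2_tpair(1)[OF s(3)[OF x(3,4)] x(1,2)] e[OF x] ..
  qed (use a in \<open>simp_all add: is_arrow_comp is_arrow_wh\<close>)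
  show "EV' \<cdot> awh B [h] EV' [u] \<cdot> awh B [h,h] R [] = EV' \<cdot> awh B [h] EV' [u] \<cdot> awh B [] P [u,u]"
  proof (rule arrow_eqI4[OF _ _ v(1,1,2,2)])
    fix c d f g assume x: "f \<in> carr (sp CU)" "g \<in> carr (sp CU)" "c \<in> carr (sp CH)" "d \<in> carr (sp CH)"
    then have x: "f \<in> carr U" "g \<in> carr U" "c \<in> carr H" "d \<in> carr H" by simp_all
    have 1: "fn (awh B [h,h] R []) (kHH (tens H H c d) * kUU (tens U U f g)) =
        kHH (tens H H c d) * kUU (app r (tens U U f g))"
      unfolding t(2)[OF x(1,2), symmetric] using a t(4)[OF x(1,2)] s(4)[OF x(3,4)]
      by (intro awh_right) (simp_all add: in_tsp)
    have 2: "fn (awh B [] P [u,u]) (kHH (tens H H c d) * kUU (tens U U f g)) =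
        kHH (app p (tens H H c d)) * kUU (tens U U f g)"
      unfolding s(2)[OF x(3,4), symmetric] using a t(4)[OF x(1,2)] s(4)[OF x(3,4)]
      by (intro awh_left) (simp_all add: in_tsp)
    show "fn (EV' \<cdot> awh B [h] EV' [u] \<cdot> awh B [h,h] R []) ((kH c * kH d) * (kU f * kU g)) =
      fn (EV' \<cdot> awh B [h] EV' [u] \<cdot> awh B [] P [u,u]) ((kH c * kH d) * (kU f * kU g))"
      unfolding sel_simps t(1)[OF x(1,2)] s(1)[OF x(3,4)] 1 2
      unfolding t(1)[OF x(1,2), symmetric] s(1)[OF x(3,4), symmetric] ev2_tpair'(2)[OF t(3)[OF x(1,2)] x(3,4)]
        ev2_tpair(2)[OF s(3)[OF x(3,4)] x(1,2)] e[OF x] ..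
  qed (use a in \<open>simp_all add: is_arrow_comp is_arrow_wh\<close>)
qed

lemma adj_comult:
  assumes D: "rep B CU CUU d D" and M: "rep B CHH CH m M"
    and e: "\<And>f a b. f \<in> carr U \<Longrightarrow> a \<in> carr H \<Longrightarrow> b \<in> carr H \<Longrightarrow> tpair' (app d f) a b = f (app m (tens H H a b))"
  shows "EV \<cdot> awh B [u] EV [h] \<cdot> awh B [] D [h,h] = EV \<cdot> awh B [u] M []"
    and "EV' \<cdot> awh B [h] EV' [u] \<cdot> awh B [h,h] D [] = EV' \<cdot> awh B [] M [u]"
proof -
  note a = rep_arrow[OF D] rep_arrow[OF M]
  have t: "fn D (kU f) = kUU (app d f)" "app d f \<in> carr (U \<otimes> U)"
    if "f \<in> carr U" for f
    using that rep_app[OF D] hom_in[OF rep_hom[OF D]] by simp_all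
  have s: "kH x * kH y = kHH (tens H H x y)"
     "fn M (kHH (tens H H x y)) = kH (app m (tens H H x y))"
     "app m (tens H H x y) \<in> carr H" "tens H H x y \<in> carr (H \<otimes> H)"
    if "x \<in> carr H" "y \<in> carr H" for x y
    using that ctens_tens[OF v(1,1)] rep_app[OF M] hom_in[OF rep_hom[OF M]] by (simp_all add: tens_in)
  show "EV \<cdot> awh B [u] EV [h] \<cdot> awh B [] D [h,h] = EV \<cdot> awh B [u] M []"
  proof (rule arrow_eqI3[OF _ _ v(2,1,1)])
    fix f x y assume "f \<in> carr (sp CU)" "x \<in> carr (sp CH)" "y \<in> carr (sp CH)"
    then have x: "f \<in> carr U" "x \<in> carr H" "y \<in> carr H" by simp_all
    have 1: "fn (awh B [] D [h,h]) (kU f * kHH (tens H H x y)) =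
        kUU (app d f) * kHH (tens H H x y)"
      unfolding t(1)[OF x(1), symmetric] using a x s(4)[OF x(2,3)] by (intro awh_left) (simp_all add: in_tsp)
    have 2: "fn (awh B [u] M []) (kU f * kHH (tens H H x y)) =
        kU f * kH (app m (tens H H x y))"
      unfolding s(2)[OF x(2,3), symmetric] using a x s(4)[OF x(2,3)] by (intro awh_right) (simp_all add: in_tsp)
    show "fn (EV \<cdot> awh B [u] EV [h] \<cdot> awh B [] D [h,h]) (kU f * kH x * kH y) =
      fn (EV \<cdot> awh B [u] M []) (kU f * kH x * kH y)"
      unfolding sel_simps mult.assoc s(1)[OF x(2,3)] 1 2 EV(4)[OF x(1) s(3)[OF x(2,3)]]
      unfolding s(1)[OF x(2,3), symmetric] ev2_tpair'(1)[OF t(2)[OF x(1)] x(2,3)] e[OF x] ..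
  qed (use a in \<open>simp_all add: is_arrow_comp is_arrow_wh\<close>)
  show "EV' \<cdot> awh B [h] EV' [u] \<cdot> awh B [h,h] D [] = EV' \<cdot> awh B [] M [u]"
  proof (rule arrow_eqI3[OF _ _ v(1,1,2)])
    fix f x y assume "f \<in> carr (sp CU)" "x \<in> carr (sp CH)" "y \<in> carr (sp CH)"
    then have x: "f \<in> carr U" "x \<in> carr H" "y \<in> carr H" by simp_all
    have 1: "fn (awh B [h,h] D []) (kHH (tens H H x y) * kU f) =
        kHH (tens H H x y) * kUU (app d f)"
      unfolding t(1)[OF x(1), symmetric] using a x s(4)[OF x(2,3)] by (intro awh_right) (simp_all add: in_tsp)
    have 2: "fn (awh B [] M [u]) (kHH (tens H H x y) * kU f) =
        kH (app m (tens H H x y)) * kU f"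
      unfolding s(2)[OF x(2,3), symmetric] using a x s(4)[OF x(2,3)] by (intro awh_left) (simp_all add: in_tsp)
    show "fn (EV' \<cdot> awh B [h] EV' [u] \<cdot> awh B [h,h] D []) (kH x * kH y * kU f) =
      fn (EV' \<cdot> awh B [] M [u]) (kH x * kH y * kU f)"
      unfolding sel_simps s(1)[OF x(2,3)] 1 2 EV'(4)[OF x(1) s(3)[OF x(2,3)]]
      unfolding s(1)[OF x(2,3), symmetric] ev2_tpair'(2)[OF t(2)[OF x(1)] x(2,3)] e[OF x] ..
  qed (use a in \<open>simp_all add: is_arrow_comp is_arrow_wh\<close>)
qed

lemma adj_mult:
  assumes M: "rep B CUU CU m M" and D: "rep B CH CHH d D"
    and e: "\<And>f g a. f \<in> carr U \<Longrightarrow> g \<in> carr U \<Longrightarrow> a \<in> carr H \<Longrightarrow> app m (tens U U f g) a = tpair f g (app d a)"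
  shows "EV \<cdot> awh B [] M [h] = EV \<cdot> awh B [u] EV [h] \<cdot> awh B [u,u] D []"
    and "EV' \<cdot> awh B [h] M [] = EV' \<cdot> awh B [h] EV' [u] \<cdot> awh B [] D [u,u]"
proof -
  note a = rep_arrow[OF D] rep_arrow[OF M]
  have t: "fn D (kH x) = kHH (app d x)" "app d x \<in> carr (H \<otimes> H)"
    if "x \<in> carr H" for x
    using that rep_app[OF D] hom_in[OF rep_hom[OF D]] by simp_all
  have s: "kU f * kU g = kUU (tens U U f g)"
     "fn M (kUU (tens U U f g)) = kU (app m (tens U U f g))"
     "app m (tens U U f g) \<in> carr U" "tens U U f g \<in> carr (U \<otimes> U)"
    if "f \<in> carr U" "g \<in> carr U" for f g
    using that ctens_tens[OF v(2,2)] rep_app[OF M] hom_in[OF rep_hom[OF M]] by (simp_all add: tens_in)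
  show "EV \<cdot> awh B [] M [h] = EV \<cdot> awh B [u] EV [h] \<cdot> awh B [u,u] D []"
  proof (rule arrow_eqI3[OF _ _ v(2,2,1)])
    fix f g x assume "f \<in> carr (sp CU)" "g \<in> carr (sp CU)" "x \<in> carr (sp CH)"
    then have x: "f \<in> carr U" "g \<in> carr U" "x \<in> carr H" by simp_all
    have 1: "fn (awh B [] M [h]) (kUU (tens U U f g) * kH x) =
        kU (app m (tens U U f g)) * kH x"
      unfolding s(2)[OF x(1,2), symmetric] using a x s(4)[OF x(1,2)] by (intro awh_left) (simp_all add: in_tsp)
    have 2: "fn (awh B [u,u] D []) (kUU (tens U U f g) * kH x) =
        kUU (tens U U f g) * kHH (app d x)"
      unfolding t(1)[OF x(3), symmetric] using a x s(4)[OF x(1,2)] by (intro awh_right) (simp_all add: in_tsp)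
    show "fn (EV \<cdot> awh B [] M [h]) (kU f * kU g * kH x) =
      fn (EV \<cdot> awh B [u] EV [h] \<cdot> awh B [u,u] D []) (kU f * kU g * kH x)"
      unfolding sel_simps s(1)[OF x(1,2)] 1 2 EV(4)[OF s(3)[OF x(1,2)] x(3)]
      unfolding s(1)[OF x(1,2), symmetric] ev2_tpair(1)[OF t(2)[OF x(3)] x(1,2)] e[OF x] ..
  qed (use a in \<open>simp_all add: is_arrow_comp is_arrow_wh\<close>)
  show "EV' \<cdot> awh B [h] M [] = EV' \<cdot> awh B [h] EV' [u] \<cdot> awh B [] D [u,u]"
  proof (rule arrow_eqI3[OF _ _ v(1,2,2)])
    fix f g x assume "f \<in> carr (sp CU)" "g \<in> carr (sp CU)" "x \<in> carr (sp CH)"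
    then have x: "f \<in> carr U" "g \<in> carr U" "x \<in> carr H" by simp_all
    have 1: "fn (awh B [h] M []) (kH x * kUU (tens U U f g)) =
        kH x * kU (app m (tens U U f g))"
      unfolding s(2)[OF x(1,2), symmetric] using a x s(4)[OF x(1,2)] by (intro awh_right) (simp_all add: in_tsp)
    have 2: "fn (awh B [] D [u,u]) (kH x * kUU (tens U U f g)) =
        kHH (app d x) * kUU (tens U U f g)"
      unfolding t(1)[OF x(3), symmetric] using a x s(4)[OF x(1,2)] by (intro awh_left) (simp_all add: in_tsp)
    show "fn (EV' \<cdot> awh B [h] M []) (kH x * kU f * kU g) =
      fn (EV' \<cdot> awh B [h] EV' [u] \<cdot> awh B [] D [u,u]) (kH x * kU f * kU g)"
      unfolding sel_simps mult.assoc s(1)[OF x(1,2)] 1 2 EV'(4)[OF s(3)[OF x(1,2)] x(3)]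
      unfolding s(1)[OF x(1,2), symmetric] ev2_tpair(2)[OF t(2)[OF x(3)] x(1,2)] e[OF x] ..
  qed (use a in \<open>simp_all add: is_arrow_comp is_arrow_wh\<close>)
qed

lemma adj_unit:
  assumes N: "rep B cK CU (elt U f) N" and E: "rep B CH cK \<epsilon> E" and f: "f \<in> carr U"
    and e: "\<And>a. a \<in> carr H \<Longrightarrow> app \<epsilon> a = f a"
  shows "EV \<cdot> awh B [] N [h] = E" and "EV' \<cdot> awh B [h] N [] = E"
proof -
  note a = rep_arrow[OF N] rep_arrow[OF E]
  have x: "\<exists>x\<in>carr H. mon w = kH x" if "w \<in> idx B [h]" for w
    using valid_surj[OF v(1), of "mon w"] tsp_mon[OF that] by simp
  have eE: "fn E (kH x) = sc (f x) 1" if "x \<in> carr H" for x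
    using rep_app[OF E, of x] that e by simp
  show "EV \<cdot> awh B [] N [h] = E"
  proof (rule arrow_eqI)
    fix w assume "w \<in> idx B (adm (EV \<cdot> awh B [] N [h]))"
    then obtain x where x: "x \<in> carr H" "mon w = kH x" using x a by auto
    have "fn (awh B [] N [h]) (1 * kH x) = fn N 1 * kH x"
      using a x by (intro awh_left) (simp_all add: in_tsp one_tsp)
    then show "fn (EV \<cdot> awh B [] N [h]) (mon w) = fn E (mon w)"
      using elt_fn[OF CU(1) N] EV(4)[OF f x(1)] eE[OF x(1)] by (simp add: x(2))
  qed (use a in \<open>simp_all add: is_arrow_comp is_arrow_wh\<close>)
  show "EV' \<cdot> awh B [h] N [] = E"
  proof (rule arrow_eqI)
    fix w assume "w \<in> idx B (adm (EV' \<cdot> awh B [h] N []))"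
    then obtain x where x: "x \<in> carr H" "mon w = kH x" using x a by auto
    have "fn (awh B [h] N []) (kH x * 1) = kH x * fn N 1"
      using a x by (intro awh_right) (simp_all add: in_tsp one_tsp)
    then show "fn (EV' \<cdot> awh B [h] N []) (mon w) = fn E (mon w)"
      using elt_fn[OF CU(1) N] EV'(4)[OF f x(1)] eE[OF x(1)] by (simp add: x(2))
  qed (use a in \<open>simp_all add: is_arrow_comp is_arrow_wh\<close>)
qed

lemma adj_counit:
  assumes N: "rep B cK CH (elt H x) N" and E: "rep B CU cK \<epsilon> E" and x: "x \<in> carr H"
    and e: "\<And>f. f \<in> carr U \<Longrightarrow> app \<epsilon> f = f x"
  shows "E = EV \<cdot> awh B [u] N []" and "E = EV' \<cdot> awh B [] N [u]"
proof -
  note a = rep_arrow[OF N] rep_arrow[OF E]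
  have f: "\<exists>f\<in>carr U. mon w = kU f" if "w \<in> idx B [u]" for w
    using valid_surj[OF v(2), of "mon w"] tsp_mon[OF that] by simp
  have eE: "fn E (kU f) = sc (f x) 1" if "f \<in> carr U" for f
    using rep_app[OF E, of f] that e by simp
  show "E = EV \<cdot> awh B [u] N []"
  proof (rule arrow_eqI)
    fix w assume "w \<in> idx B (adm E)"
    then obtain f where f: "f \<in> carr U" "mon w = kU f" using f a by auto
    have "fn (awh B [u] N []) (kU f * 1) = kU f * fn N 1"
      using a f by (intro awh_right) (simp_all add: in_tsp one_tsp)
    then show "fn E (mon w) = fn (EV \<cdot> awh B [u] N []) (mon w)"
      using elt_fn[OF CH(1) N] EV(4)[OF f(1) x] eE[OF f(1)] by (simp add: f(2))
  qed (use a in \<open>simp_all add: is_arrow_comp is_arrow_wh\<close>)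
  show "E = EV' \<cdot> awh B [] N [u]"
  proof (rule arrow_eqI)
    fix w assume "w \<in> idx B (adm E)"
    then obtain f where f: "f \<in> carr U" "mon w = kU f" using f a by auto
    have "fn (awh B [] N [u]) (1 * kU f) = fn N 1 * kU f"
      using a f by (intro awh_left) (simp_all add: in_tsp one_tsp)
    then show "fn E (mon w) = fn (EV' \<cdot> awh B [] N [u]) (mon w)"
      using elt_fn[OF CH(1) N] EV'(4)[OF f(1) x] eE[OF f(1)] by (simp add: f(2))
  qed (use a in \<open>simp_all add: is_arrow_comp is_arrow_wh\<close>)
qed

end

locale dual_crd_module = dual_crd B H U CH CU h u EV EV'
  for B :: "'l \<Rightarrow> 'i set" and H :: "('k::field, 'h::ab_group_add) vs" and U CH CU h u EV EV' +
  fixes V :: "('k, 'v::ab_group_add) vs" and CV :: "('k, 'v, 'l, 'i list \<Rightarrow>\<^sub>0 'k) crd" and v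
  assumes CV: "coords B CV V" "wo CV = [v]"
begin

abbreviation "CHV \<equiv> CH \<boxtimes> CV"
abbreviation "CVH \<equiv> CV \<boxtimes> CH"
abbreviation "CUV \<equiv> CU \<boxtimes> CV"
abbreviation "CVU \<equiv> CV \<boxtimes> CU"
abbreviation "CVV \<equiv> CV \<boxtimes> CV"
abbreviation "kV \<equiv> app (cm CV)"
abbreviation "kHV \<equiv> app (cm CHV)"
abbreviation "kVH \<equiv> app (cm CVH)"
abbreviation "kUV \<equiv> app (cm CUV)"
abbreviation "kVU \<equiv> app (cm CVU)"

lemmas vV = coords_valid[OF CV(1)]
lemmas vsV = coords_vspace[OF CV(1)]
lemmas [simp] = coords_sp[OF CV(1)] CV(2)

lemma adj_braid_UV:
  assumes S: "rep B CUV CVU s S" and D: "rep B CVH CHV d D"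
    and e: "\<And>f x a. f \<in> carr U \<Longrightarrow> x \<in> carr V \<Longrightarrow> a \<in> carr H \<Longrightarrow>
      app (slice_right V U (\<lambda>f. f a)) (app s (tens U V f x)) = app (slice_left H V f) (app d (tens V H x a))"
  shows "awh B [v] EV [] \<cdot> awh B [] S [h] = awh B [] EV [v] \<cdot> awh B [u] D []"
proof (rule arrow_eqI3[OF _ _ v(2) vV v(1)])
  note a = rep_arrow[OF S] rep_arrow[OF D]
  fix f x y assume "f \<in> carr (sp CU)" "x \<in> carr (sp CV)" "y \<in> carr (sp CH)"
  then have x: "f \<in> carr U" "x \<in> carr V" "y \<in> carr H" by simp_all
  have i: "app s (tens U V f x) \<in> carr (V \<otimes> U)" "app d (tens V H x y) \<in> carr (H \<otimes> V)"
    using hom_in[OF rep_hom[OF S]] hom_in[OF rep_hom[OF D]] x by (simp_all add: tens_in)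
  have UV: "kU f * kV x = kUV (tens U V f x)"
    and VH: "kV x * kH y = kVH (tens V H x y)"
    using ctens_tens[OF v(2) vV] ctens_tens[OF vV v(1)] x by simp_all
  have 1: "fn (awh B [] S [h]) (kUV (tens U V f x) * kH y) =
      fn S (kUV (tens U V f x)) * kH y"
    using a x valid_in[OF valid_ctens[OF v(2) vV], of "tens U V f x"]
    by (intro awh_left) (simp_all add: in_tsp tens_in)
  have 2: "fn (awh B [u] D []) (kU f * kVH (tens V H x y)) =
      kU f * fn D (kVH (tens V H x y))"
    using a x valid_in[OF valid_ctens[OF vV v(1)], of "tens V H x y"]
    by (intro awh_right) (simp_all add: in_tsp tens_in)
  have r: "fn S (kUV (tens U V f x)) = kVU (app s (tens U V f x))"
    "fn D (kVH (tens V H x y)) = kHV (app d (tens V H x y))"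
    using rep_app[OF S] rep_app[OF D] x by (simp_all add: tens_in)
  have "fn (awh B [v] EV [] \<cdot> awh B [] S [h]) (kU f * kV x * kH y) =
      kV (app (slice_right V U (\<lambda>f. f y)) (app s (tens U V f x)))"
    unfolding UV using EV_slice_right[OF vV, of "app s (tens U V f x)" y] i x by (simp add: 1 r)
  moreover have "fn (awh B [] EV [v] \<cdot> awh B [u] D []) (kU f * (kV x * kH y)) =
      kV (app (slice_left H V f) (app d (tens V H x y)))"
    unfolding VH using EV_slice_left[OF vV, of "app d (tens V H x y)" f] i x by (simp add: 2 r)
  ultimately show "fn (awh B [v] EV [] \<cdot> awh B [] S [h]) (kU f * kV x * kH y) =
      fn (awh B [] EV [v] \<cdot> awh B [u] D []) (kU f * kV x * kH y)"
    unfolding e[OF x] by (simp only: mult.assoc)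
qed (use rep_arrow[OF S] rep_arrow[OF D] in \<open>simp_all add: is_arrow_comp is_arrow_wh\<close>)

lemma adj_braid_VU:
  assumes S: "rep B CVU CUV s S" and D: "rep B CHV CVH d D"
    and e: "\<And>x f a. x \<in> carr V \<Longrightarrow> f \<in> carr U \<Longrightarrow> a \<in> carr H \<Longrightarrow>
      app (slice_left U V (\<lambda>f. f a)) (app s (tens V U x f)) = app (slice_right V H f) (app d (tens H V a x))"
  shows "awh B [] EV' [v] \<cdot> awh B [h] S [] = awh B [v] EV' [] \<cdot> awh B [] D [u]"
proof (rule arrow_eqI3[OF _ _ v(1) vV v(2)])
  note a = rep_arrow[OF S] rep_arrow[OF D]
  fix y x f assume "f \<in> carr (sp CU)" "x \<in> carr (sp CV)" "y \<in> carr (sp CH)"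
  then have x: "x \<in> carr V" "f \<in> carr U" "y \<in> carr H" by simp_all
  have i: "app s (tens V U x f) \<in> carr (U \<otimes> V)" "app d (tens H V y x) \<in> carr (V \<otimes> H)"
    using hom_in[OF rep_hom[OF S]] hom_in[OF rep_hom[OF D]] x by (simp_all add: tens_in)
  have VU: "kV x * kU f = kVU (tens V U x f)"
    and HV: "kH y * kV x = kHV (tens H V y x)"
    using ctens_tens[OF vV v(2)] ctens_tens[OF v(1) vV] x by simp_all
  have 1: "fn (awh B [h] S []) (kH y * kVU (tens V U x f)) =
      kH y * fn S (kVU (tens V U x f))"
    using a x valid_in[OF valid_ctens[OF vV v(2)], of "tens V U x f"]
    by (intro awh_right) (simp_all add: in_tsp tens_in)
  have 2: "fn (awh B [] D [u]) (kHV (tens H V y x) * kU f) =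
      fn D (kHV (tens H V y x)) * kU f"
    using a x valid_in[OF valid_ctens[OF v(1) vV], of "tens H V y x"]
    by (intro awh_left) (simp_all add: in_tsp tens_in)
  have r: "fn S (kVU (tens V U x f)) = kUV (app s (tens V U x f))"
    "fn D (kHV (tens H V y x)) = kVH (app d (tens H V y x))"
    using rep_app[OF S] rep_app[OF D] x by (simp_all add: tens_in)
  have "fn (awh B [] EV' [v] \<cdot> awh B [h] S []) (kH y * (kV x * kU f)) =
      kV (app (slice_left U V (\<lambda>f. f y)) (app s (tens V U x f)))"
    unfolding VU using EV'_slice_left[OF vV, of "app s (tens V U x f)" y] i x by (simp add: 1 r)
  moreover have "fn (awh B [v] EV' [] \<cdot> awh B [] D [u]) (kH y * kV x * kU f) =
      kV (app (slice_right V H f) (app d (tens H V y x)))"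
    unfolding HV using EV'_slice_right[OF vV, of "app d (tens H V y x)" f] i x by (simp add: 2 r)
  ultimately show "fn (awh B [] EV' [v] \<cdot> awh B [h] S []) (kH y * kV x * kU f) =
      fn (awh B [v] EV' [] \<cdot> awh B [] D [u]) (kH y * kV x * kU f)"
    unfolding e[OF x] by (simp only: mult.assoc)
qed (use rep_arrow[OF S] rep_arrow[OF D] in \<open>simp_all add: is_arrow_comp is_arrow_wh\<close>)

lemma adj_rho_R:
  assumes R: "rep B CV CVU r R" and N: "rep B CVH CV n N"
    and e: "\<And>x a. x \<in> carr V \<Longrightarrow> a \<in> carr H \<Longrightarrow> app (slice_right V U (\<lambda>f. f a)) (app r x) = app n (tens V H x a)"
  shows "awh B [v] EV [] \<cdot> awh B [] R [h] = N"
proof (rule arrow_eqI2[OF _ _ vV v(1)])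
  note a = rep_arrow[OF R] rep_arrow[OF N]
  fix x y assume "x \<in> carr (sp CV)" "y \<in> carr (sp CH)"
  then have x: "x \<in> carr V" "y \<in> carr H" by simp_all
  have i: "app r x \<in> carr (V \<otimes> U)" using hom_in[OF rep_hom[OF R]] x by simp
  have 1: "fn (awh B [] R [h]) (kV x * kH y) = fn R (kV x) * kH y"
    using a x valid_in[OF vV, of x] by (intro awh_left) (simp_all add: in_tsp)
  have r: "fn R (kV x) = kVU (app r x)"
    using rep_app[OF R] x by simp
  have n: "fn N (kV x * kH y) = kV (app n (tens V H x y))"
    using rep_app[OF N, of "tens V H x y"] x ctens_tens[OF vV v(1), of x y] by (simp add: tens_in)
  show "fn (awh B [v] EV [] \<cdot> awh B [] R [h]) (kV x * kH y) =
      fn N (kV x * kH y)"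
    unfolding sel_simps 1 r n using EV_slice_right[OF vV, of "app r x" y] i x e[OF x] by simp
qed (use rep_arrow[OF R] rep_arrow[OF N] in \<open>simp_all add: is_arrow_comp is_arrow_wh\<close>)

lemma adj_rho_L:
  assumes R: "rep B CV CUV r R" and N: "rep B CHV CV n N"
    and e: "\<And>x a. x \<in> carr V \<Longrightarrow> a \<in> carr H \<Longrightarrow> app (slice_left U V (\<lambda>f. f a)) (app r x) = app n (tens H V a x)"
  shows "awh B [] EV' [v] \<cdot> awh B [h] R [] = N"
proof (rule arrow_eqI2[OF _ _ v(1) vV])
  note a = rep_arrow[OF R] rep_arrow[OF N]
  fix y x assume "x \<in> carr (sp CV)" "y \<in> carr (sp CH)"
  then have x: "x \<in> carr V" "y \<in> carr H" by simp_all
  have i: "app r x \<in> carr (U \<otimes> V)" using hom_in[OF rep_hom[OF R]] x by simp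
  have 1: "fn (awh B [h] R []) (kH y * kV x) = kH y * fn R (kV x)"
    using a x valid_in[OF vV, of x] by (intro awh_right) (simp_all add: in_tsp)
  have r: "fn R (kV x) = kUV (app r x)"
    using rep_app[OF R] x by simp
  have n: "fn N (kH y * kV x) = kV (app n (tens H V y x))"
    using rep_app[OF N, of "tens H V y x"] x ctens_tens[OF v(1) vV, of y x] by (simp add: tens_in)
  show "fn (awh B [] EV' [v] \<cdot> awh B [h] R []) (kH y * kV x) =
      fn N (kH y * kV x)"
    unfolding sel_simps 1 r n using EV'_slice_left[OF vV, of "app r x" y] i x e[OF x] by simp
qed (use rep_arrow[OF R] rep_arrow[OF N] in \<open>simp_all add: is_arrow_comp is_arrow_wh\<close>)

end

section \<open>The axioms in terms of arrows: braidings, products and coproducts\<close>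

text \<open>Coordinates on \<open>X\<close> whose word is the single letter \<open>x\<close>.\<close>
definition lcoords :: "('l \<Rightarrow> 'i set) \<Rightarrow> ('k::field, 'a::ab_group_add, 'l, 'i list \<Rightarrow>\<^sub>0 'k) crd \<Rightarrow> ('k, 'a) vs \<Rightarrow> 'l \<Rightarrow>
    bool" where
  "lcoords B C X x \<longleftrightarrow> coords B C X \<and> wo C = [x]"

lemma lcoords_coords: "lcoords B C X x \<Longrightarrow> coords B C X" and lcoords_wo: "lcoords B C X x \<Longrightarrow> wo C = [x]"
  by (simp_all add: lcoords_def)

lemmas rep_rules = rep_comp rep_tmap_right rep_tmap_left rep_tmap rep_assoc rep_unassoc rep_lunit rep_runit
  rep_idt rep_mid rep_idm' coords_ctens coords_cK

text \<open>The lemmas of this section are instances: \<open>rep_rules\<close> computes the arrows of the two sides of an axiom,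
  and their equality simplifies to an equation without constraints.\<close>
lemma rep_iff: "rep B C D f F \<Longrightarrow> rep B C D g G \<Longrightarrow> (F = G) = X \<Longrightarrow> (f = g) = X"
  using rep_eq_iff by blast

lemma lcoords_vspace: "lcoords B C X x \<Longrightarrow> vspace X"
  by (rule coords_vspace[OF lcoords_coords])

lemma ybe_rep:
  assumes c: "lcoords B C V v" and r: "rep B (C \<boxtimes> C) (C \<boxtimes> C) p P"
  shows "(p \<otimes>\<^sub>m idm V) \<odot> idt V V V p \<odot> (p \<otimes>\<^sub>m idm V) = idt V V V p \<odot> (p \<otimes>\<^sub>m idm V) \<odot> idt V V V p \<longleftrightarrow>
    awh B [] P [v] \<cdot> awh B [v] P [] \<cdot> awh B [] P [v] = awh B [v] P [] \<cdot> awh B [] P [v] \<cdot> awh B [v] P []"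
  by (rule rep_iff[where B=B and C="(C \<boxtimes> C) \<boxtimes> C"], (rule rep_rules c[THEN lcoords_coords] r)+,
    simp add: c[THEN lcoords_wo] rep_arrow[OF r])

lemma left_ybe_rep:
  assumes c0: "lcoords B C V v" and c1: "lcoords B D W w" and r0: "rep B (C \<boxtimes> C) (C \<boxtimes> C) p P"
    and r1: "rep B (C \<boxtimes> D) (D \<boxtimes> C) q Q"
  shows "(q \<otimes>\<^sub>m idm V) \<odot> idt V V W q \<odot> (p \<otimes>\<^sub>m idm W) = idt W V V p \<odot> (q \<otimes>\<^sub>m idm V) \<odot> idt V V W q \<longleftrightarrow>
    awh B [] Q [v] \<cdot> awh B [v] Q [] \<cdot> awh B [] P [w] = awh B [w] P [] \<cdot> awh B [] Q [v] \<cdot> awh B [v] Q []"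
  by (rule rep_iff[where B=B and C="(C \<boxtimes> C) \<boxtimes> D"], (rule rep_rules c0[THEN lcoords_coords] c1[THEN lcoords_coords]
      r0 r1)+,
    simp add: c0[THEN lcoords_wo] c1[THEN lcoords_wo] rep_arrow[OF r0] rep_arrow[OF r1])

lemma right_ybe_rep:
  assumes c0: "lcoords B D V v" and c1: "lcoords B C W w" and r0: "rep B (C \<boxtimes> C) (C \<boxtimes> C) p P"
    and r1: "rep B (D \<boxtimes> C) (C \<boxtimes> D) q Q"
  shows "idt W V W q \<odot> (q \<otimes>\<^sub>m idm W) \<odot> idt V W W p = (p \<otimes>\<^sub>m idm V) \<odot> idt W V W q \<odot> (q \<otimes>\<^sub>m idm W) \<longleftrightarrow>
    awh B [w] Q [] \<cdot> awh B [] Q [w] \<cdot> awh B [v] P [] = awh B [] P [v] \<cdot> awh B [w] Q [] \<cdot> awh B [] Q [w]"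
  by (rule rep_iff[where B=B and C="(D \<boxtimes> C) \<boxtimes> C"], (rule rep_rules c0[THEN lcoords_coords] c1[THEN lcoords_coords]
      r0 r1)+,
    simp add: c0[THEN lcoords_wo] c1[THEN lcoords_wo] rep_arrow[OF r0] rep_arrow[OF r1])

lemma assoc_mult_rep:
  assumes c: "lcoords B C A a" and r: "rep B (C \<boxtimes> C) C m M"
  shows "m \<odot> (m \<otimes>\<^sub>m idm A) = m \<odot> (idm A \<otimes>\<^sub>m m) \<odot> assoc A A A \<longleftrightarrow>
    M \<cdot> awh B [] M [a] = M \<cdot> awh B [a] M []"
  by (rule rep_iff[where B=B and C="(C \<boxtimes> C) \<boxtimes> C"], (rule rep_rules c[THEN lcoords_coords] r)+,
    simp add: c[THEN lcoords_wo] rep_arrow[OF r])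

lemma coassoc_rep:
  assumes c: "lcoords B C A a" and r: "rep B C (C \<boxtimes> C) \<Delta> D"
  shows "assoc A A A \<odot> (\<Delta> \<otimes>\<^sub>m idm A) \<odot> \<Delta> = (idm A \<otimes>\<^sub>m \<Delta>) \<odot> \<Delta> \<longleftrightarrow>
    awh B [] D [a] \<cdot> D = awh B [a] D [] \<cdot> D"
  by (rule rep_iff[where B=B and C="C"], (rule rep_rules c[THEN lcoords_coords] r)+,
    simp add: c[THEN lcoords_wo] rep_arrow[OF r])

lemma counit_left_rep:
  assumes c: "lcoords B C A a" and r0: "rep B C (C \<boxtimes> C) \<Delta> D" and r1: "rep B C cK \<epsilon> E"
  shows "lunit A \<odot> (\<epsilon> \<otimes>\<^sub>m idm A) \<odot> \<Delta> = idm A \<longleftrightarrow>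
    awh B [] E [a] \<cdot> D = aid B [a]"
  by (rule rep_iff[where B=B and C="C"], (rule rep_rules c[THEN lcoords_coords] r0 r1)+,
    simp add: c[THEN lcoords_wo] rep_arrow[OF r0] rep_arrow[OF r1])

lemma counit_right_rep:
  assumes c: "lcoords B C A a" and r0: "rep B C (C \<boxtimes> C) \<Delta> D" and r1: "rep B C cK \<epsilon> E"
  shows "runit A \<odot> (idm A \<otimes>\<^sub>m \<epsilon>) \<odot> \<Delta> = idm A \<longleftrightarrow>
    awh B [a] E [] \<cdot> D = aid B [a]"
  by (rule rep_iff[where B=B and C="C"], (rule rep_rules c[THEN lcoords_coords] r0 r1)+,
    simp add: c[THEN lcoords_wo] rep_arrow[OF r0] rep_arrow[OF r1])

lemma mult_left_rep:
  assumes c0: "lcoords B C V v" and c1: "lcoords B D W w" and r0: "rep B (C \<boxtimes> C) C m M"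
    and r1: "rep B (C \<boxtimes> D) (D \<boxtimes> C) q Q"
  shows "q \<odot> (m \<otimes>\<^sub>m idm W) = (idm W \<otimes>\<^sub>m m) \<odot> assoc W V V \<odot> (q \<otimes>\<^sub>m idm V) \<odot> idt V V W q \<longleftrightarrow>
    Q \<cdot> awh B [] M [w] = awh B [w] M [] \<cdot> awh B [] Q [v] \<cdot> awh B [v] Q []"
  by (rule rep_iff[where B=B and C="(C \<boxtimes> C) \<boxtimes> D"], (rule rep_rules c0[THEN lcoords_coords] c1[THEN lcoords_coords]
      r0 r1)+,
    simp add: c0[THEN lcoords_wo] c1[THEN lcoords_wo] rep_arrow[OF r0] rep_arrow[OF r1])

lemma mult_right_rep:
  assumes c0: "lcoords B C V v" and c1: "lcoords B D W w" and r0: "rep B (D \<boxtimes> D) D m M"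
    and r1: "rep B (C \<boxtimes> D) (D \<boxtimes> C) q Q"
  shows "q \<odot> (idm V \<otimes>\<^sub>m m) \<odot> assoc V W W = (m \<otimes>\<^sub>m idm V) \<odot> idt W V W q \<odot> (q \<otimes>\<^sub>m idm W) \<longleftrightarrow>
    Q \<cdot> awh B [v] M [] = awh B [] M [v] \<cdot> awh B [w] Q [] \<cdot> awh B [] Q [w]"
  by (rule rep_iff[where B=B and C="(C \<boxtimes> D) \<boxtimes> D"], (rule rep_rules c0[THEN lcoords_coords] c1[THEN lcoords_coords]
      r0 r1)+,
    simp add: c0[THEN lcoords_wo] c1[THEN lcoords_wo] rep_arrow[OF r0] rep_arrow[OF r1])

lemma comult_left_rep:
  assumes c0: "lcoords B C V v" and c1: "lcoords B E W w" and r0: "rep B C (C \<boxtimes> C) \<Delta> D"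
    and r1: "rep B (C \<boxtimes> E) (E \<boxtimes> C) q Q"
  shows "unassoc W V V \<odot> (idm W \<otimes>\<^sub>m \<Delta>) \<odot> q = (q \<otimes>\<^sub>m idm V) \<odot> idt V V W q \<odot> (\<Delta> \<otimes>\<^sub>m idm W) \<longleftrightarrow>
    awh B [w] D [] \<cdot> Q = awh B [] Q [v] \<cdot> awh B [v] Q [] \<cdot> awh B [] D [w]"
  by (rule rep_iff[where B=B and C="C \<boxtimes> E"], (rule rep_rules c0[THEN lcoords_coords] c1[THEN lcoords_coords] r0 r1)+,
    simp add: c0[THEN lcoords_wo] c1[THEN lcoords_wo] rep_arrow[OF r0] rep_arrow[OF r1])

lemma comult_left_counit_rep:
  assumes c0: "lcoords B C V v" and c1: "lcoords B D W w" and r0: "rep B C cK \<epsilon> E"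
    and r1: "rep B (C \<boxtimes> D) (D \<boxtimes> C) q Q"
  shows "runit W \<odot> (idm W \<otimes>\<^sub>m \<epsilon>) \<odot> q = lunit W \<odot> (\<epsilon> \<otimes>\<^sub>m idm W) \<longleftrightarrow>
    awh B [w] E [] \<cdot> Q = awh B [] E [w]"
  by (rule rep_iff[where B=B and C="C \<boxtimes> D"], (rule rep_rules c0[THEN lcoords_coords] c1[THEN lcoords_coords] r0 r1)+,
    simp add: c0[THEN lcoords_wo] c1[THEN lcoords_wo] rep_arrow[OF r0] rep_arrow[OF r1])

lemma comult_right_rep:
  assumes c0: "lcoords B C V v" and c1: "lcoords B E W w" and r0: "rep B E (E \<boxtimes> E) \<Delta> D"
    and r1: "rep B (C \<boxtimes> E) (E \<boxtimes> C) q Q"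
  shows "(\<Delta> \<otimes>\<^sub>m idm V) \<odot> q = idt W V W q \<odot> (q \<otimes>\<^sub>m idm W) \<odot> unassoc V W W \<odot> (idm V \<otimes>\<^sub>m \<Delta>) \<longleftrightarrow>
    awh B [] D [v] \<cdot> Q = awh B [w] Q [] \<cdot> awh B [] Q [w] \<cdot> awh B [v] D []"
  by (rule rep_iff[where B=B and C="C \<boxtimes> E"], (rule rep_rules c0[THEN lcoords_coords] c1[THEN lcoords_coords] r0 r1)+,
    simp add: c0[THEN lcoords_wo] c1[THEN lcoords_wo] rep_arrow[OF r0] rep_arrow[OF r1])

lemma comult_right_counit_rep:
  assumes c0: "lcoords B C V v" and c1: "lcoords B D W w" and r0: "rep B D cK \<epsilon> E"
    and r1: "rep B (C \<boxtimes> D) (D \<boxtimes> C) q Q"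
  shows "lunit V \<odot> (\<epsilon> \<otimes>\<^sub>m idm V) \<odot> q = runit V \<odot> (idm V \<otimes>\<^sub>m \<epsilon>) \<longleftrightarrow>
    awh B [] E [v] \<cdot> Q = awh B [v] E []"
  by (rule rep_iff[where B=B and C="C \<boxtimes> D"], (rule rep_rules c0[THEN lcoords_coords] c1[THEN lcoords_coords] r0 r1)+,
    simp add: c0[THEN lcoords_wo] c1[THEN lcoords_wo] rep_arrow[OF r0] rep_arrow[OF r1])

lemma bialgebra_rep:
  assumes c: "lcoords B C A a" and r0: "rep B (C \<boxtimes> C) C m M" and r1: "rep B C (C \<boxtimes> C) \<Delta> D"
    and r2: "rep B (C \<boxtimes> C) (C \<boxtimes> C) p P"
  shows "\<Delta> \<odot> m = (m \<otimes>\<^sub>m m) \<odot> mid A A A A p \<odot> (\<Delta> \<otimes>\<^sub>m \<Delta>) \<longleftrightarrow>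
    D \<cdot> M = awh B [] M [a] \<cdot> awh B [a,a] M [] \<cdot> awh B [a] P [a] \<cdot> awh B [] D [a,a] \<cdot> awh B [a] D []"
  by (rule rep_iff[where B=B and C="C \<boxtimes> C"], (rule rep_rules c[THEN lcoords_coords] r0 r1 r2)+,
    simp add: c[THEN lcoords_wo] rep_arrow[OF r0] rep_arrow[OF r1] rep_arrow[OF r2])

lemma left_module_rep:
  assumes c0: "lcoords B C A a" and c1: "lcoords B D W w" and r0: "rep B (C \<boxtimes> C) C m M"
    and r1: "rep B (C \<boxtimes> D) D \<nu> N"
  shows "\<nu> \<odot> (idm A \<otimes>\<^sub>m \<nu>) \<odot> assoc A A W = \<nu> \<odot> (m \<otimes>\<^sub>m idm W) \<longleftrightarrow>
    N \<cdot> awh B [a] N [] = N \<cdot> awh B [] M [w]"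
  by (rule rep_iff[where B=B and C="(C \<boxtimes> C) \<boxtimes> D"], (rule rep_rules c0[THEN lcoords_coords] c1[THEN lcoords_coords]
      r0 r1)+,
    simp add: c0[THEN lcoords_wo] c1[THEN lcoords_wo] rep_arrow[OF r0] rep_arrow[OF r1])

lemma left_module_braid_rep:
  assumes c0: "lcoords B C A a" and c1: "lcoords B D W w" and r0: "rep B (C \<boxtimes> C) (C \<boxtimes> C) p P"
    and r1: "rep B (C \<boxtimes> D) (D \<boxtimes> C) q Q" and r2: "rep B (C \<boxtimes> D) D \<nu> N"
  shows "q \<odot> (idm A \<otimes>\<^sub>m \<nu>) \<odot> assoc A A W = (\<nu> \<otimes>\<^sub>m idm A) \<odot> idt A A W q \<odot> (p \<otimes>\<^sub>m idm W) \<longleftrightarrow>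
    Q \<cdot> awh B [a] N [] = awh B [] N [a] \<cdot> awh B [a] Q [] \<cdot> awh B [] P [w]"
  by (rule rep_iff[where B=B and C="(C \<boxtimes> C) \<boxtimes> D"], (rule rep_rules c0[THEN lcoords_coords] c1[THEN lcoords_coords]
      r0 r1 r2)+,
    simp add: c0[THEN lcoords_wo] c1[THEN lcoords_wo] rep_arrow[OF r0] rep_arrow[OF r1] rep_arrow[OF r2])

lemma right_module_rep:
  assumes c0: "lcoords B C A a" and c1: "lcoords B D W w" and r0: "rep B (C \<boxtimes> C) C m M"
    and r1: "rep B (D \<boxtimes> C) D \<nu> N"
  shows "\<nu> \<odot> (\<nu> \<otimes>\<^sub>m idm A) = \<nu> \<odot> (idm W \<otimes>\<^sub>m m) \<odot> assoc W A A \<longleftrightarrow>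
    N \<cdot> awh B [] N [a] = N \<cdot> awh B [w] M []"
  by (rule rep_iff[where B=B and C="(D \<boxtimes> C) \<boxtimes> C"], (rule rep_rules c0[THEN lcoords_coords] c1[THEN lcoords_coords]
      r0 r1)+,
    simp add: c0[THEN lcoords_wo] c1[THEN lcoords_wo] rep_arrow[OF r0] rep_arrow[OF r1])

lemma right_module_braid_rep:
  assumes c0: "lcoords B C A a" and c1: "lcoords B D W w" and r0: "rep B (C \<boxtimes> C) (C \<boxtimes> C) p P"
    and r1: "rep B (D \<boxtimes> C) (C \<boxtimes> D) q Q" and r2: "rep B (D \<boxtimes> C) D \<nu> N"
  shows "q \<odot> (\<nu> \<otimes>\<^sub>m idm A) = (idm A \<otimes>\<^sub>m \<nu>) \<odot> assoc A W A \<odot> (q \<otimes>\<^sub>m idm A) \<odot> idt W A A p \<longleftrightarrow>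
    Q \<cdot> awh B [] N [a] = awh B [a] N [] \<cdot> awh B [] Q [a] \<cdot> awh B [w] P []"
  by (rule rep_iff[where B=B and C="(D \<boxtimes> C) \<boxtimes> C"], (rule rep_rules c0[THEN lcoords_coords] c1[THEN lcoords_coords]
      r0 r1 r2)+,
    simp add: c0[THEN lcoords_wo] c1[THEN lcoords_wo] rep_arrow[OF r0] rep_arrow[OF r1] rep_arrow[OF r2])

lemma right_comodule_rep:
  assumes c0: "lcoords B C A a" and c1: "lcoords B E V v" and r0: "rep B C (C \<boxtimes> C) \<Delta> D"
    and r1: "rep B E (E \<boxtimes> C) \<rho> R"
  shows "(\<rho> \<otimes>\<^sub>m idm A) \<odot> \<rho> = unassoc V A A \<odot> (idm V \<otimes>\<^sub>m \<Delta>) \<odot> \<rho> \<longleftrightarrow>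
    awh B [] R [a] \<cdot> R = awh B [v] D [] \<cdot> R"
  by (rule rep_iff[where B=B and C="E"], (rule rep_rules c0[THEN lcoords_coords] c1[THEN lcoords_coords] r0 r1)+,
    simp add: c0[THEN lcoords_wo] c1[THEN lcoords_wo] rep_arrow[OF r0] rep_arrow[OF r1])

lemma right_comodule_counit_rep:
  assumes c0: "lcoords B C A a" and c1: "lcoords B D V v" and r0: "rep B C cK \<epsilon> E"
    and r1: "rep B D (D \<boxtimes> C) \<rho> R"
  shows "runit V \<odot> (idm V \<otimes>\<^sub>m \<epsilon>) \<odot> \<rho> = idm V \<longleftrightarrow>
    awh B [v] E [] \<cdot> R = aid B [v]"
  by (rule rep_iff[where B=B and C="D"], (rule rep_rules c0[THEN lcoords_coords] c1[THEN lcoords_coords] r0 r1)+,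
    simp add: c0[THEN lcoords_wo] c1[THEN lcoords_wo] rep_arrow[OF r0] rep_arrow[OF r1])

lemma right_comodule_braid_rep:
  assumes c0: "lcoords B C A a" and c1: "lcoords B D V v" and r0: "rep B (C \<boxtimes> C) (C \<boxtimes> C) p P"
    and r1: "rep B (C \<boxtimes> D) (D \<boxtimes> C) q Q" and r2: "rep B D (D \<boxtimes> C) \<rho> R"
  shows "(\<rho> \<otimes>\<^sub>m idm A) \<odot> q = idt V A A p \<odot> (q \<otimes>\<^sub>m idm A) \<odot> unassoc A V A \<odot> (idm A \<otimes>\<^sub>m \<rho>) \<longleftrightarrow>
    awh B [] R [a] \<cdot> Q = awh B [v] P [] \<cdot> awh B [] Q [a] \<cdot> awh B [a] R []"
  by (rule rep_iff[where B=B and C="C \<boxtimes> D"], (rule rep_rules c0[THEN lcoords_coords] c1[THEN lcoords_coords]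
      r0 r1 r2)+,
    simp add: c0[THEN lcoords_wo] c1[THEN lcoords_wo] rep_arrow[OF r0] rep_arrow[OF r1] rep_arrow[OF r2])

lemma left_comodule_rep:
  assumes c0: "lcoords B C A a" and c1: "lcoords B E V v" and r0: "rep B C (C \<boxtimes> C) \<Delta> D"
    and r1: "rep B E (C \<boxtimes> E) \<rho> R"
  shows "(idm A \<otimes>\<^sub>m \<rho>) \<odot> \<rho> = assoc A A V \<odot> (\<Delta> \<otimes>\<^sub>m idm V) \<odot> \<rho> \<longleftrightarrow>
    awh B [a] R [] \<cdot> R = awh B [] D [v] \<cdot> R"
  by (rule rep_iff[where B=B and C="E"], (rule rep_rules c0[THEN lcoords_coords] c1[THEN lcoords_coords] r0 r1)+,
    simp add: c0[THEN lcoords_wo] c1[THEN lcoords_wo] rep_arrow[OF r0] rep_arrow[OF r1])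

lemma left_comodule_counit_rep:
  assumes c0: "lcoords B C A a" and c1: "lcoords B D V v" and r0: "rep B C cK \<epsilon> E"
    and r1: "rep B D (C \<boxtimes> D) \<rho> R"
  shows "lunit V \<odot> (\<epsilon> \<otimes>\<^sub>m idm V) \<odot> \<rho> = idm V \<longleftrightarrow>
    awh B [] E [v] \<cdot> R = aid B [v]"
  by (rule rep_iff[where B=B and C="D"], (rule rep_rules c0[THEN lcoords_coords] c1[THEN lcoords_coords] r0 r1)+,
    simp add: c0[THEN lcoords_wo] c1[THEN lcoords_wo] rep_arrow[OF r0] rep_arrow[OF r1])

lemma left_comodule_braid_rep:
  assumes c0: "lcoords B C A a" and c1: "lcoords B D V v" and r0: "rep B (C \<boxtimes> C) (C \<boxtimes> C) p P"
    and r1: "rep B (D \<boxtimes> C) (C \<boxtimes> D) q Q" and r2: "rep B D (C \<boxtimes> D) \<rho> R"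
  shows "(idm A \<otimes>\<^sub>m \<rho>) \<odot> q = assoc A A V \<odot> (p \<otimes>\<^sub>m idm V) \<odot> idt A V A q \<odot> (\<rho> \<otimes>\<^sub>m idm A) \<longleftrightarrow>
    awh B [a] R [] \<cdot> Q = awh B [] P [v] \<cdot> awh B [a] Q [] \<cdot> awh B [] R [a]"
  by (rule rep_iff[where B=B and C="D \<boxtimes> C"], (rule rep_rules c0[THEN lcoords_coords] c1[THEN lcoords_coords]
      r0 r1 r2)+,
    simp add: c0[THEN lcoords_wo] c1[THEN lcoords_wo] rep_arrow[OF r0] rep_arrow[OF r1] rep_arrow[OF r2])

lemma left_module_algebra_rep:
  assumes c0: "lcoords B C A a" and c1: "lcoords B E V v" and r0: "rep B C (C \<boxtimes> C) \<Delta> D"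
    and r1: "rep B (E \<boxtimes> E) E mB M" and r2: "rep B (C \<boxtimes> E) (E \<boxtimes> C) q Q" and r3: "rep B (C \<boxtimes> E) E \<nu> N"
  shows "\<nu> \<odot> (idm A \<otimes>\<^sub>m mB) = mB \<odot> (\<nu> \<otimes>\<^sub>m \<nu>) \<odot> mid A A V V q \<odot> (\<Delta> \<otimes>\<^sub>m idm (V \<otimes> V)) \<longleftrightarrow>
    N \<cdot> awh B [a] M [] = M \<cdot> awh B [] N [v] \<cdot> awh B [v,a] N [] \<cdot> awh B [a] Q [v] \<cdot> awh B [] D [v,v]"
  by (rule rep_iff[where B=B and C="C \<boxtimes> (E \<boxtimes> E)"], (rule rep_rules c0[THEN lcoords_coords] c1[THEN lcoords_coords]
      r0 r1 r2 r3)+,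
    simp add: c0[THEN lcoords_wo] c1[THEN lcoords_wo] rep_arrow[OF r0] rep_arrow[OF r1] rep_arrow[OF r2]
        rep_arrow[OF r3])

lemma right_module_algebra_rep:
  assumes c0: "lcoords B C A a" and c1: "lcoords B E V v" and r0: "rep B C (C \<boxtimes> C) \<Delta> D"
    and r1: "rep B (E \<boxtimes> E) E mB M" and r2: "rep B (E \<boxtimes> C) (C \<boxtimes> E) q Q" and r3: "rep B (E \<boxtimes> C) E \<nu> N"
  shows "\<nu> \<odot> (mB \<otimes>\<^sub>m idm A) = mB \<odot> (\<nu> \<otimes>\<^sub>m \<nu>) \<odot> mid V V A A q \<odot> (idm (V \<otimes> V) \<otimes>\<^sub>m \<Delta>) \<longleftrightarrow>
    N \<cdot> awh B [] M [a] = M \<cdot> awh B [] N [v] \<cdot> awh B [a,v] N [] \<cdot> awh B [v] Q [a] \<cdot> awh B [v,v] D []"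
  by (rule rep_iff[where B=B and C="(E \<boxtimes> E) \<boxtimes> C"], (rule rep_rules c0[THEN lcoords_coords] c1[THEN lcoords_coords]
      r0 r1 r2 r3)+,
    simp add: c0[THEN lcoords_wo] c1[THEN lcoords_wo] rep_arrow[OF r0] rep_arrow[OF r1] rep_arrow[OF r2]
        rep_arrow[OF r3])

lemma right_comodule_algebra_rep:
  assumes c0: "lcoords B C A a" and c1: "lcoords B E V v" and r0: "rep B (C \<boxtimes> C) C m M'"
    and r1: "rep B (E \<boxtimes> E) E mB M" and r2: "rep B (C \<boxtimes> E) (E \<boxtimes> C) q Q" and r3: "rep B E (E \<boxtimes> C) \<rho> R"
  shows "\<rho> \<odot> mB = (mB \<otimes>\<^sub>m m) \<odot> mid V A V A q \<odot> (\<rho> \<otimes>\<^sub>m \<rho>) \<longleftrightarrow>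
    R \<cdot> M = awh B [] M [a] \<cdot> awh B [v,v] M' [] \<cdot> awh B [v] Q [a] \<cdot> awh B [] R [v,a] \<cdot> awh B [v] R []"
  by (rule rep_iff[where B=B and C="E \<boxtimes> E"], (rule rep_rules c0[THEN lcoords_coords] c1[THEN lcoords_coords]
      r0 r1 r2 r3)+,
    simp add: c0[THEN lcoords_wo] c1[THEN lcoords_wo] rep_arrow[OF r0] rep_arrow[OF r1] rep_arrow[OF r2]
        rep_arrow[OF r3])

lemma left_comodule_algebra_rep:
  assumes c0: "lcoords B C A a" and c1: "lcoords B E V v" and r0: "rep B (C \<boxtimes> C) C m M'"
    and r1: "rep B (E \<boxtimes> E) E mB M" and r2: "rep B (E \<boxtimes> C) (C \<boxtimes> E) q Q" and r3: "rep B E (C \<boxtimes> E) \<rho> R"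
  shows "\<rho> \<odot> mB = (m \<otimes>\<^sub>m mB) \<odot> mid A V A V q \<odot> (\<rho> \<otimes>\<^sub>m \<rho>) \<longleftrightarrow>
    R \<cdot> M = awh B [] M' [v] \<cdot> awh B [a,a] M [] \<cdot> awh B [a] Q [v] \<cdot> awh B [] R [a,v] \<cdot> awh B [v] R []"
  by (rule rep_iff[where B=B and C="E \<boxtimes> E"], (rule rep_rules c0[THEN lcoords_coords] c1[THEN lcoords_coords]
      r0 r1 r2 r3)+,
    simp add: c0[THEN lcoords_wo] c1[THEN lcoords_wo] rep_arrow[OF r0] rep_arrow[OF r1] rep_arrow[OF r2]
        rep_arrow[OF r3])

section \<open>The axioms in terms of arrows: units and counits\<close>

lemma rep_elt_ex:
  assumes "lcoords B C X x" "a \<in> carr X"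
  obtains E where "rep B cK C (elt X a) E"
  using rep_elt[OF lcoords_coords[OF assms(1)] assms(2)] .

text \<open>A condition on an element \<open>a\<close> and all \<open>b\<close> is an equation between linear maps in \<open>b\<close>. In its arrow, \<open>a\<close> is
  a diagram without inputs.\<close>
lemma ltens_app_iff:
  assumes C: "lcoords B C X x" and D: "lcoords B D Y y" and G: "valid B G"
    and f: "rep B (C \<boxtimes> D) G f F" and g: "rep B D G g K" and E: "rep B cK C (elt X a) E" and a: "a \<in> carr X"
  shows "(\<forall>b\<in>carr Y. app f (tens X Y a b) = app g b) \<longleftrightarrow> F \<cdot> awh B [] E [y] = K"
proof -
  note s = coords_sp[OF lcoords_coords[OF C]] coords_sp[OF lcoords_coords[OF D]]
  have "f \<odot> ltens X Y a = g \<longleftrightarrow> (\<forall>b\<in>carr Y. app f (tens X Y a b) = app g b)"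
    using rep_hom[OF f] rep_hom[OF g] s a by (intro comp_ltens_eq_iff[where Z="sp G"]) (simp_all add:
        lcoords_vspace[OF D])
  moreover have "f \<odot> ltens X Y a = g \<longleftrightarrow> F \<cdot> awh B [] E [y] = K"
    using rep_eq_iff[OF rep_comp[OF rep_ltens[OF lcoords_coords[OF C] lcoords_coords[OF D] a E] f] g]
        by (simp add: lcoords_wo[OF D])
  ultimately show ?thesis by blast
qed

lemma rtens_app_iff:
  assumes C: "lcoords B C X x" and D: "lcoords B D Y y" and G: "valid B G"
    and f: "rep B (C \<boxtimes> D) G f F" and g: "rep B C G g K" and E: "rep B cK D (elt Y a) E" and a: "a \<in> carr Y"
  shows "(\<forall>b\<in>carr X. app f (tens X Y b a) = app g b) \<longleftrightarrow> F \<cdot> awh B [x] E [] = K"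
proof -
  note s = coords_sp[OF lcoords_coords[OF C]] coords_sp[OF lcoords_coords[OF D]]
  have "f \<odot> rtens X Y a = g \<longleftrightarrow> (\<forall>b\<in>carr X. app f (tens X Y b a) = app g b)"
    using rep_hom[OF f] rep_hom[OF g] s a by (intro comp_rtens_eq_iff[where Z="sp G"]) (simp_all add:
        lcoords_vspace[OF C])
  moreover have "f \<odot> rtens X Y a = g \<longleftrightarrow> F \<cdot> awh B [x] E [] = K"
    using rep_eq_iff[OF rep_comp[OF rep_rtens[OF lcoords_coords[OF C] lcoords_coords[OF D] a E] f] g]
        by (simp add: lcoords_wo[OF C])
  ultimately show ?thesis by blast
qed

lemma unit_left_iff:
  assumes C: "lcoords B C X x" and D: "lcoords B D Y y" and q: "rep B (C \<boxtimes> D) (D \<boxtimes> C) q Q"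
    and E: "rep B cK C (elt X a) E" and a: "a \<in> carr X"
  shows "(\<forall>b\<in>carr Y. app q (tens X Y a b) = tens Y X b a) \<longleftrightarrow> Q \<cdot> awh B [] E [y] = awh B [y] E []"
  using ltens_app_iff[OF C D _ q rep_rtens[OF lcoords_coords[OF D] lcoords_coords[OF C] a E] E a]
    valid_ctens[OF coords_valid[OF lcoords_coords[OF D]] coords_valid[OF lcoords_coords[OF C]]] lcoords_wo[OF D]
        by simp

lemma unit_right_iff:
  assumes C: "lcoords B C X x" and D: "lcoords B D Y y" and q: "rep B (C \<boxtimes> D) (D \<boxtimes> C) q Q"
    and E: "rep B cK D (elt Y a) E" and a: "a \<in> carr Y"
  shows "(\<forall>b\<in>carr X. app q (tens X Y b a) = tens Y X a b) \<longleftrightarrow> Q \<cdot> awh B [x] E [] = awh B [] E [x]"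
  using rtens_app_iff[OF C D _ q rep_ltens[OF lcoords_coords[OF D] lcoords_coords[OF C] a E] E a]
    valid_ctens[OF coords_valid[OF lcoords_coords[OF D]] coords_valid[OF lcoords_coords[OF C]]] lcoords_wo[OF C]
        by simp

lemma act_unit_left_iff:
  assumes C: "lcoords B C X x" and D: "lcoords B D Y y" and m: "rep B (C \<boxtimes> D) D m M"
    and E: "rep B cK C (elt X a) E" and a: "a \<in> carr X"
  shows "(\<forall>b\<in>carr Y. app m (tens X Y a b) = b) \<longleftrightarrow> M \<cdot> awh B [] E [y] = aid B [y]"
  using ltens_app_iff[OF C D coords_valid[OF lcoords_coords[OF D]] m rep_idm'[OF lcoords_coords[OF D]] E a]
      lcoords_wo[OF D]
  by (simp add: idm_app)

lemma act_unit_right_iff: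
  assumes C: "lcoords B C X x" and D: "lcoords B D Y y" and m: "rep B (D \<boxtimes> C) D m M"
    and E: "rep B cK C (elt X a) E" and a: "a \<in> carr X"
  shows "(\<forall>b\<in>carr Y. app m (tens Y X b a) = b) \<longleftrightarrow> M \<cdot> awh B [y] E [] = aid B [y]"
  using rtens_app_iff[OF D C coords_valid[OF lcoords_coords[OF D]] m rep_idm'[OF lcoords_coords[OF D]] E a]
      lcoords_wo[OF D]
  by (simp add: idm_app)

lemma act_on_unit_right_iff:
  assumes C: "lcoords B C X x" and D: "lcoords B D Y y" and m: "rep B (C \<boxtimes> D) D \<nu> N" and e: "rep B C cK \<epsilon> F"
    and E: "rep B cK D (elt Y b) E" and b: "b \<in> carr Y"
  shows "(\<forall>a\<in>carr X. app \<nu> (tens X Y a b) = scl Y (app \<epsilon> a) b) \<longleftrightarrow> N \<cdot> awh B [x] E [] = E \<cdot> F"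
proof -
  have "app (elt Y b \<odot> \<epsilon>) a = scl Y (app \<epsilon> a) b" if "a \<in> carr X" for a
    using comp_app[OF rep_hom[OF e], of a "elt Y b"] that coords_sp[OF lcoords_coords[OF C]] by simp
  then show ?thesis
    using rtens_app_iff[OF C D coords_valid[OF lcoords_coords[OF D]] m rep_comp[OF e E] E b] by simp
qed

lemma act_on_unit_left_iff:
  assumes C: "lcoords B C X x" and D: "lcoords B D Y y" and m: "rep B (D \<boxtimes> C) D \<nu> N" and e: "rep B C cK \<epsilon> F"
    and E: "rep B cK D (elt Y b) E" and b: "b \<in> carr Y"
  shows "(\<forall>a\<in>carr X. app \<nu> (tens Y X b a) = scl Y (app \<epsilon> a) b) \<longleftrightarrow> N \<cdot> awh B [] E [x] = E \<cdot> F"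
proof -
  have "app (elt Y b \<odot> \<epsilon>) a = scl Y (app \<epsilon> a) b" if "a \<in> carr X" for a
    using comp_app[OF rep_hom[OF e], of a "elt Y b"] that coords_sp[OF lcoords_coords[OF C]] by simp
  then show ?thesis
    using ltens_app_iff[OF D C coords_valid[OF lcoords_coords[OF D]] m rep_comp[OF e E] E b] by simp
qed

lemma rep_elt_iff:
  assumes f: "rep B cK C f F" and g: "rep B cK C g G"
  shows "F = G \<longleftrightarrow> app f 1 = app g 1"
proof -
  note h = rep_hom[OF f] rep_hom[OF g]
  have "f = g" if 1: "app f 1 = app g 1"
  proof (rule hom_eqI[OF h])
    fix c show "app f c = app g c"
      using hom_scl[OF h(1), of 1 c] hom_scl[OF h(2), of 1 c] 1 by simp
  qed
  then show ?thesis using rep_eq_iff[OF f g] by auto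
qed

text \<open>An elementary tensor consists of two diagrams without inputs, and either of them can be drawn first.\<close>
lemma image_elt_iff:
  assumes C: "coords B C X" and D: "lcoords B D Y y" and J: "lcoords B J Z z"
    and f: "rep B C (D \<boxtimes> J) f F" and E: "rep B cK C (elt X a) E" and a: "a \<in> carr X"
    and G: "rep B cK D (elt Y b) G" and b: "b \<in> carr Y" and K: "rep B cK J (elt Z c) K" and c: "c \<in> carr Z"
  shows "app f a = tens Y Z b c \<longleftrightarrow> F \<cdot> E = awh B [] G [z] \<cdot> K"
    and "app f a = tens Y Z b c \<longleftrightarrow> F \<cdot> E = awh B [y] K [] \<cdot> G"
proof -
  note e1 = elt_hom[OF coords_vspace[OF C] a] and e2 = elt_hom[OF lcoords_vspace[OF D] b] and e3 =
      elt_hom[OF lcoords_vspace[OF J] c]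
  note s = scl_one[OF coords_vspace[OF C]] scl_one[OF lcoords_vspace[OF D]] scl_one[OF lcoords_vspace[OF J]]
  show "app f a = tens Y Z b c \<longleftrightarrow> F \<cdot> E = awh B [] G [z] \<cdot> K"
    using rep_elt_iff[OF rep_comp[OF E f] rep_comp[OF K rep_ltens[OF lcoords_coords[OF D] lcoords_coords[OF J] b G]]]
      comp_app[OF e1, of 1 f] comp_app[OF e3, of 1 "ltens Y Z b"] c
    by (simp add: s lcoords_wo[OF J])
  show "app f a = tens Y Z b c \<longleftrightarrow> F \<cdot> E = awh B [y] K [] \<cdot> G"
    using rep_elt_iff[OF rep_comp[OF E f] rep_comp[OF G rep_rtens[OF lcoords_coords[OF D] lcoords_coords[OF J] c K]]]
      comp_app[OF e1, of 1 f] comp_app[OF e2, of 1 "rtens Y Z c"] b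
    by (simp add: s lcoords_wo[OF D])
qed

text \<open>The product of two values of \<open>\<epsilon>\<close> is obtained from \<open>id \<otimes> \<epsilon>\<close> by a unit constraint, which is an identity in
  coordinates.\<close>
lemma counit_mult_iff:
  assumes C: "lcoords B C A a" and m: "rep B (C \<boxtimes> C) C m M" and e: "rep B C cK \<epsilon> E"
  shows "(\<forall>x\<in>carr A. \<forall>y\<in>carr A. app \<epsilon> (app m (tens A A x y)) = app \<epsilon> x * app \<epsilon> y) \<longleftrightarrow>
    E \<cdot> M = E \<cdot> awh B [a] E []"
proof -
  note sp = coords_sp[OF lcoords_coords[OF C]]
  note A = lcoords_vspace[OF C]
  let ?g = "\<epsilon> \<odot> runit A \<odot> (idm A \<otimes>\<^sub>m \<epsilon>)"
  have hm: "m \<in> hom (A \<otimes> A) A" and he: "\<epsilon> \<in> hom A base_field" using rep_hom[OF m] rep_hom[OF e] by (simp_all add: sp)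
  note t = tmap_hom[OF idm_hom[OF A] he A] tmap_tens[OF idm_hom[OF A] he A]
  note r = comp_hom[OF t(1) runit_hom(1)[OF A] vspace_tprod]
  have g: "app ?g (tens A A x y) = app \<epsilon> x * app \<epsilon> y" if "x \<in> carr A" "y \<in> carr A" for x y
    using that by (simp add: comp_app[OF r] comp_app[OF t(1)] tens_in t(2) idm_app runit_tens[OF A] hom_scl[OF he]
        mult.commute)
  have f: "app (\<epsilon> \<odot> m) (tens A A x y) = app \<epsilon> (app m (tens A A x y))" if "x \<in> carr A" "y \<in> carr A" for x y
    using that by (simp add: comp_app[OF hm] tens_in)
  have "\<epsilon> \<odot> m = ?g \<longleftrightarrow> (\<forall>x\<in>carr A. \<forall>y\<in>carr A. app \<epsilon> (app m (tens A A x y)) = app \<epsilon> x * app \<epsilon> y)"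
    using hom_tens_eqI[OF A comp_hom[OF hm he vspace_tprod] comp_hom[OF r he vspace_tprod]] f g by metis
  moreover have "\<epsilon> \<odot> m = ?g \<longleftrightarrow> E \<cdot> M = E \<cdot> awh B [a] E []"
    by (rule rep_iff[where B=B and C="C \<boxtimes> C"], (rule rep_rules C[THEN lcoords_coords] m e)+)
      (simp add: C[THEN lcoords_wo] rep_arrow[OF m] rep_arrow[OF e])
  ultimately show ?thesis by simp
qed

lemma counit_unit_iff:
  assumes C: "lcoords B C A a" and e: "rep B C cK \<epsilon> E" and E: "rep B cK C (elt A x) X" and x: "x \<in> carr A"
  shows "app \<epsilon> x = 1 \<longleftrightarrow> E \<cdot> X = aid B []"
  using rep_elt_iff[OF rep_comp[OF E e] rep_idm'[OF coords_cK]] comp_app[OF elt_hom[OF lcoords_vspace[OF C]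
      x], of 1 \<epsilon>]
  by (simp add: idm_app scl_one[OF lcoords_vspace[OF C]])

lemma braided_algebra_rep:
  assumes C: "lcoords B C A a" and p: "rep B (C \<boxtimes> C) (C \<boxtimes> C) p P" and m: "rep B (C \<boxtimes> C) C m M"
    and E: "rep B cK C (elt A e) E" and e: "e \<in> carr A"
  shows "braided_algebra A m (Some e) p \<longleftrightarrow> p \<in> iso (A \<otimes> A) (A \<otimes> A) \<and>
    awh B [] P [a] \<cdot> awh B [a] P [] \<cdot> awh B [] P [a] =
      awh B [a] P [] \<cdot> awh B [] P [a] \<cdot> awh B [a] P [] \<and>
    M \<cdot> awh B [] M [a] = M \<cdot> awh B [a] M [] \<and>
    M \<cdot> awh B [] E [a] = aid B [a] \<and> M \<cdot> awh B [a] E [] = aid B [a] \<and>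
    P \<cdot> awh B [] M [a] = awh B [a] M [] \<cdot> awh B [] P [a] \<cdot> awh B [a] P [] \<and>
    P \<cdot> awh B [a] M [] = awh B [] M [a] \<cdot> awh B [a] P [] \<cdot> awh B [] P [a] \<and>
    P \<cdot> awh B [] E [a] = awh B [a] E [] \<and> P \<cdot> awh B [a] E [] = awh B [] E [a]"
  unfolding braided_algebra_def braided_def algebra_def compat_mult_left_def compat_mult_right_def
    ybe_rep[OF C p] assoc_mult_rep[OF C m] mult_left_rep[OF C C m p] mult_right_rep[OF C C m p]
  using lcoords_vspace[OF C] e rep_hom[OF m] coords_sp[OF lcoords_coords[OF C]]
    unit_left_iff[OF C C p E e] unit_right_iff[OF C C p E e]
    act_unit_left_iff[OF C C m E e] act_unit_right_iff[OF C C m E e]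
  by auto

lemma braided_coalgebra_rep:
  assumes C: "lcoords B C A a" and p: "rep B (C \<boxtimes> C) (C \<boxtimes> C) p P" and d: "rep B C (C \<boxtimes> C) \<Delta> D"
    and e: "rep B C cK \<epsilon> E"
  shows "braided_coalgebra A \<Delta> \<epsilon> p \<longleftrightarrow> p \<in> iso (A \<otimes> A) (A \<otimes> A) \<and>
    awh B [] P [a] \<cdot> awh B [a] P [] \<cdot> awh B [] P [a] =
      awh B [a] P [] \<cdot> awh B [] P [a] \<cdot> awh B [a] P [] \<and>
    awh B [] D [a] \<cdot> D = awh B [a] D [] \<cdot> D \<and>
    awh B [] E [a] \<cdot> D = aid B [a] \<and> awh B [a] E [] \<cdot> D = aid B [a] \<and>
    awh B [a] D [] \<cdot> P = awh B [] P [a] \<cdot> awh B [a] P [] \<cdot> awh B [] D [a] \<and>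
    awh B [] D [a] \<cdot> P = awh B [a] P [] \<cdot> awh B [] P [a] \<cdot> awh B [a] D [] \<and>
    awh B [a] E [] \<cdot> P = awh B [] E [a] \<and> awh B [] E [a] \<cdot> P = awh B [a] E []"
  unfolding braided_coalgebra_def braided_def coalgebra_def compat_comult_left_def compat_comult_right_def
    ybe_rep[OF C p] coassoc_rep[OF C d] counit_left_rep[OF C d e] counit_right_rep[OF C d e]
    comult_left_rep[OF C C d p] comult_right_rep[OF C C d p]
    comult_left_counit_rep[OF C C e p] comult_right_counit_rep[OF C C e p]
  using lcoords_vspace[OF C] rep_hom[OF d] rep_hom[OF e] coords_sp[OF lcoords_coords[OF C]]
  by auto

lemma braided_bialgebra_rep:
  assumes C: "lcoords B C A a" and p: "rep B (C \<boxtimes> C) (C \<boxtimes> C) p P" and m: "rep B (C \<boxtimes> C) C m M"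
    and E: "rep B cK C (elt A e) E" and e: "e \<in> carr A"
    and d: "rep B C (C \<boxtimes> C) \<Delta> D" and c: "rep B C cK \<epsilon> F"
  shows "braided_bialgebra A m e \<Delta> \<epsilon> p \<longleftrightarrow> braided_algebra A m (Some e) p \<and> braided_coalgebra A \<Delta> \<epsilon> p \<and>
    D \<cdot> M = awh B [] M [a] \<cdot> awh B [a,a] M [] \<cdot> awh B [a] P [a] \<cdot>
      awh B [] D [a,a] \<cdot> awh B [a] D [] \<and>
    D \<cdot> E = awh B [] E [a] \<cdot> E \<and> F \<cdot> M = F \<cdot> awh B [a] F [] \<and> F \<cdot> E = aid B []"
  unfolding braided_bialgebra_def bialgebra_rep[OF C m d p] counit_mult_iff[OF C m c] counit_unit_iff[OF C c E e]
    image_elt_iff(1)[OF lcoords_coords[OF C] C C d E e E e E e] ..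

section \<open>The braided bialgebra of functionals and its comodules\<close>

text \<open>The reflected category of words. Passing it to the locales above yields the statements about left
  coactions.\<close>
abbreviation "mir_dom \<equiv> \<lambda>f. rev (adm f)"
abbreviation "mir_cod \<equiv> \<lambda>f. rev (acd f)"
abbreviation "mir_id B \<equiv> \<lambda>w. aid B (rev w)"
abbreviation "mir_wh B \<equiv> \<lambda>L f R. awh B R f L"

lemma dual_counit_facts:
  assumes U: "is_subspace U (dual H)"
  shows "dual_counit e U \<in> hom U base_field" and "f \<in> carr U \<Longrightarrow> app (dual_counit e U) f = f e"
  unfolding dual_counit_def using lfun_eval[OF U, of e] subspace_dual_vspace[OF U] subspace_dualD(1)[OF U]
  by (auto intro!: homI simp: lfun_def)

context dual_crd
begin

lemma cH: "lcoords B CH H h" and cU: "lcoords B CU U u"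
  using CH CU by (auto simp: lcoords_def)

lemma sep_mirror:
  assumes "is_arrow B F" "is_arrow B G" "rev (adm F) = rev (adm G)" "rev (acd F) = W @ [u]" "rev (acd G) = W @ [u]"
    and "awh B [] EV' (rev W) \<cdot> awh B [h] F [] = awh B [] EV' (rev W) \<cdot> awh B [h] G []"
  shows "F = G"
proof (rule sep_left[OF assms(1,2) _ _ _ assms(6)])
  show "acd F = u # rev W" "acd G = u # rev W"
    using assms(4,5)[THEN arg_cong[where f=rev]] by simp_all
qed (use assms(3) in simp)

text \<open>The arrows of a braided algebra \<open>H\<close> and of the maps on \<open>U\<close> fit into the abstract duality in both
  reflections. The arc is \<open>EV\<close> for diagrams as they are and \<open>EV'\<close> for reflected ones.\<close>
lemma coalgebra_arrows:
  assumes alg: "braided_algebra H m (Some e) p" and cc: "comult_closed H m p U" and bij: "UU_bijective H p U"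
  obtains P Pi R Ri M E Du eu where
    "rep B CHH CHH p P" "rep B CHH CHH (linv p) Pi"
    "rep B CUU CUU (braid_UU H p U) R" "rep B CUU CUU (linv (braid_UU H p U)) Ri"
    "rep B CHH CH m M" "rep B cK CH (elt H e) E"
    "rep B CU CUU (dual_comult H m p U) Du" "rep B CU cK (dual_counit e U) eu"
    "dual_coalgebra (is_arrow B) adm acd acomp (aid B) (awh B) h u P Pi R Ri EV M E Du eu"
    "dual_coalgebra (is_arrow B) mir_dom mir_cod acomp (mir_id B) (mir_wh B) h u P Pi R Ri EV' M E Du eu"
proof -
  have iso: "p \<in> iso (H \<otimes> H) (H \<otimes> H)" and hm: "m \<in> hom (H \<otimes> H) H" and e: "e \<in> carr H"
    using alg by (auto simp: braided_algebra_def braided_def algebra_def)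
  note hp = isoD[OF iso vspace_tprod vspace_tprod]
  note ri = braid_UU_facts[OF U vs(1) hp(1) bij]
  note dc = dual_comult_facts[OF U vs(1) cc hm hp(1)]
  note de = dual_counit_facts[OF U, where e=e]
  note vHH = valid_ctens[OF v(1,1)] and vUU = valid_ctens[OF v(2,2)]
  obtain P where P: "rep B CHH CHH p P" using rep_ex[OF vHH vHH, of p] hp(1) by auto
  obtain Pi where Pi: "rep B CHH CHH (linv p) Pi" "Pi \<cdot> P = aid B [h,h]" "P \<cdot> Pi = aid B [h,h]"
    using rep_linv[OF P] iso by auto
  obtain R where R: "rep B CUU CUU (braid_UU H p U) R"
    using rep_ex[OF vUU vUU, of "braid_UU H p U"] isoD(1)[OF ri(1) vspace_tprod vspace_tprod] by auto
  obtain Ri where Ri: "rep B CUU CUU (linv (braid_UU H p U)) Ri" "Ri \<cdot> R = aid B [u,u]" "R \<cdot> Ri = aid B [u,u]"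
    using rep_linv[OF R] ri(1) by auto
  obtain M where M: "rep B CHH CH m M" using rep_ex[OF vHH v(1), of m] hm by auto
  obtain E where E: "rep B cK CH (elt H e) E" using rep_elt_ex[OF cH e] .
  obtain Du where Du: "rep B CU CUU (dual_comult H m p U) Du"
    using rep_ex[OF v(2) vUU, of "dual_comult H m p U"] dc(1) by auto
  obtain eu where eu: "rep B CU cK (dual_counit e U) eu"
    using rep_ex[OF v(2) valid_cK, of "dual_counit e U"] de(1) by auto
  note ty = rep_arrow[OF P] rep_arrow[OF Pi(1)] rep_arrow[OF R] rep_arrow[OF Ri(1)] rep_arrow[OF M] rep_arrow[OF E]
    rep_arrow[OF Du] rep_arrow[OF eu]
  note A = alg[unfolded braided_algebra_rep[OF cH P M E e], THEN conjunct2, THEN conjunct1]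
    alg[unfolded braided_algebra_rep[OF cH P M E e], THEN conjunct2, THEN conjunct2]
  have A2: "M \<cdot> awh B [] M [h] = M \<cdot> awh B [h] M []"
    "M \<cdot> awh B [] E [h] = aid B [h]" "M \<cdot> awh B [h] E [] = aid B [h]"
    "P \<cdot> awh B [] M [h] = awh B [h] M [] \<cdot> awh B [] P [h] \<cdot> awh B [h] P []"
    "P \<cdot> awh B [h] M [] = awh B [] M [h] \<cdot> awh B [h] P [] \<cdot> awh B [] P [h]"
    "P \<cdot> awh B [] E [h] = awh B [h] E []" "P \<cdot> awh B [h] E [] = awh B [] E [h]"
    using A(2) by blast+
  note aR = adj_braiding[OF R P ri(2)]
  have aD: "EV \<cdot> awh B [u] EV [h] \<cdot> awh B [] Du [h,h] = EV \<cdot> awh B [u] M [] \<cdot> awh B [u] P []"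
    "EV' \<cdot> awh B [h] EV' [u] \<cdot> awh B [h,h] Du [] = EV' \<cdot> awh B [] M [u] \<cdot> awh B [] P [u]"
    using adj_comult[OF Du rep_comp[OF P M]] dc(2) comp_app[OF hp(1), of _ m] ty by (simp_all add: tens_in)
  note aE = adj_counit[OF E eu e de(2)]
  note F = A(1) A(1)[symmetric] A2 A2(1)[symmetric] aR aD aE
  show ?thesis
  proof (rule that[OF P Pi(1) R Ri(1) M E Du eu])
    show "dual_coalgebra (is_arrow B) adm acd acomp (aid B) (awh B) h u P Pi R Ri EV M E Du eu"
      by (intro dual_coalgebra.intro dual_pairing.intro words.strict_monoidal_axioms dual_pairing_axioms.intro
          dual_coalgebra_axioms.intro)
        (rule F | (rule sep_right; (assumption | simp; fail)) | (simp add: ty Pi Ri EV; fail))+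
    show "dual_coalgebra (is_arrow B) mir_dom mir_cod acomp (mir_id B) (mir_wh B) h u P Pi R Ri EV' M E Du eu"
      by (intro dual_coalgebra.intro dual_pairing.intro words.mirror dual_pairing_axioms.intro
          dual_coalgebra_axioms.intro)
        (rule F | (rule sep_mirror; (assumption | simp; fail)) | (simp add: ty Pi Ri EV' A2; fail))+
  qed
qed

lemma braided_coalgebra_U:
  assumes "dual_coalgebra (is_arrow B) adm acd acomp (aid B) (awh B) h u P Pi R Ri EV M E Du eu"
    and R: "rep B CUU CUU r R" "r \<in> iso (U \<otimes> U) (U \<otimes> U)"
    and Ri: "rep B CUU CUU (linv r) Ri"
    and Du: "rep B CU CUU d Du" and eu: "rep B CU cK \<epsilon> eu"
  shows "braided_coalgebra U (tw_comult r d) \<epsilon> r"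
proof -
  interpret S: dual_coalgebra "is_arrow B" adm acd acomp "aid B" "awh B" h u P Pi R Ri EV M E Du eu by fact
  have D: "rep B CU CUU (tw_comult r d) S.\<Delta>n"
    unfolding tw_comult_def S.\<Delta>n_def by (intro rep_comp[OF _ Ri] rep_comp[OF Du Ri])
  show ?thesis
    unfolding braided_coalgebra_rep[OF cU R(1) D eu]
    using R(2) S.yb_R S.\<Delta>n_coassoc S.\<Delta>n_counit S.R_\<Delta>n S.R_\<epsilon>u by simp
qed

lemma bialgebra_arrows:
  assumes C: "dual_coalgebra (is_arrow B) adm acd acomp (aid B) (awh B) h u P Pi R Ri EV M E Du eu"
    and C': "dual_coalgebra (is_arrow B) mir_dom mir_cod acomp (mir_id B) (mir_wh B) h u P Pi R Ri EV' M E Du eu"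
    and P: "rep B CHH CHH p P" and Pi: "rep B CHH CHH (linv p) Pi"
    and M: "rep B CHH CH m M" and E: "rep B cK CH (elt H e) E"
    and bi: "braided_bialgebra H m e \<Delta> \<epsilon> p" and \<epsilon>: "app \<epsilon> \<in> carr U"
    and cl: "\<And>f g. f \<in> carr U \<Longrightarrow> g \<in> carr U \<Longrightarrow> dual_mult_fun H \<Delta> p f g \<in> carr U"
  obtains Dl F MU NU where
    "rep B CH CHH \<Delta> Dl" "rep B CH cK \<epsilon> F" "rep B CUU CU (dual_mult H \<Delta> p U) MU"
    "rep B cK CU (elt U (app \<epsilon>)) NU"
    "dual_bialgebra (is_arrow B) adm acd acomp (aid B) (awh B) h u P Pi R Ri EV M E Du eu Dl F MU NU"
    "dual_bialgebra (is_arrow B) mir_dom mir_cod acomp (mir_id B) (mir_wh B) h u P Pi R Ri EV' M E Du eu Dl F MU NU"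
proof -
  have h\<Delta>: "\<Delta> \<in> hom H (H \<otimes> H)" and h\<epsilon>: "\<epsilon> \<in> hom H base_field" and e: "e \<in> carr H"
    using bi by (auto simp: braided_bialgebra_def braided_algebra_def algebra_def braided_coalgebra_def coalgebra_def)
  note hPi = rep_hom[OF Pi, simplified]
  note dm = dual_mult_facts[OF U vs(1) cl h\<Delta> hPi]
  obtain Dl where D: "rep B CH CHH \<Delta> Dl" using rep_ex[OF v(1) valid_ctens[OF v(1,1)], of \<Delta>] h\<Delta> by auto
  obtain F where F: "rep B CH cK \<epsilon> F" using rep_ex[OF v(1) valid_cK, of \<epsilon>] h\<epsilon> by auto
  obtain MU where MU: "rep B CUU CU (dual_mult H \<Delta> p U) MU"
    using rep_ex[OF valid_ctens[OF v(2,2)] v(2), of "dual_mult H \<Delta> p U"] dm(1) by auto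
  obtain NU where NU: "rep B cK CU (elt U (app \<epsilon>)) NU" using rep_elt_ex[OF cU \<epsilon>] .
  note ty = rep_arrow[OF P] rep_arrow[OF Pi] rep_arrow[OF M] rep_arrow[OF E] rep_arrow[OF D] rep_arrow[OF F]
    rep_arrow[OF MU] rep_arrow[OF NU]
  note bi' = bi[unfolded braided_bialgebra_rep[OF cH P M E e D F]]
  have co: "awh B [] Dl [h] \<cdot> Dl = awh B [h] Dl [] \<cdot> Dl"
    "awh B [] F [h] \<cdot> Dl = aid B [h]" "awh B [h] F [] \<cdot> Dl = aid B [h]"
    "awh B [h] Dl [] \<cdot> P = awh B [] P [h] \<cdot> awh B [h] P [] \<cdot> awh B [] Dl [h]"
    "awh B [] Dl [h] \<cdot> P = awh B [h] P [] \<cdot> awh B [] P [h] \<cdot> awh B [h] Dl []"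
    "awh B [h] F [] \<cdot> P = awh B [] F [h]" "awh B [] F [h] \<cdot> P = awh B [h] F []"
    using bi' unfolding braided_coalgebra_rep[OF cH P D F] by blast+
  have b: "Dl \<cdot> M = awh B [] M [h] \<cdot> awh B [h,h] M [] \<cdot> awh B [h] P [h] \<cdot>
      awh B [] Dl [h,h] \<cdot> awh B [h] Dl []"
    "Dl \<cdot> E = awh B [] E [h] \<cdot> E" "F \<cdot> M = F \<cdot> awh B [h] F []" "F \<cdot> E = aid B []"
    using bi' by blast+
  have x: "awh B [] M [h] \<cdot> awh B [h,h] M [] = awh B [h] M [] \<cdot> awh B [] M [h,h]"
    "awh B [] Dl [h,h] \<cdot> awh B [h] Dl [] = awh B [h,h] Dl [] \<cdot> awh B [] Dl [h]"
    "awh B [] E [h] \<cdot> E = awh B [h] E [] \<cdot> E" "F \<cdot> awh B [h] F [] = F \<cdot> awh B [] F [h]"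
    using words.interchange[of B M M] words.interchange[of B Dl Dl] words.interchange[of B E E]
      words.interchange[of B F F] ty by simp_all
  have "Dl \<cdot> M = (awh B [] M [h] \<cdot> awh B [h,h] M []) \<cdot> awh B [h] P [h] \<cdot>
      awh B [] Dl [h,h] \<cdot> awh B [h] Dl []" unfolding b(1) by simp
  \<comment> \<open>The same axioms with the two factors in the other order, as the reflected category needs them.\<close>
  then have b': "Dl \<cdot> M = awh B [h] M [] \<cdot> awh B [] M [h,h] \<cdot> awh B [h] P [h] \<cdot>
      awh B [h,h] Dl [] \<cdot> awh B [] Dl [h]"
    "Dl \<cdot> E = awh B [h] E [] \<cdot> E" "F \<cdot> M = F \<cdot> awh B [] F [h]"
    unfolding x b(2,3) by simp_all
  have am: "EV \<cdot> awh B [] MU [h] = EV \<cdot> awh B [u] EV [h] \<cdot> awh B [u,u] Pi [] \<cdot> awh B [u,u] Dl []"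
    "EV' \<cdot> awh B [h] MU [] = EV' \<cdot> awh B [h] EV' [u] \<cdot> awh B [] Pi [u,u] \<cdot> awh B [] Dl [u,u]"
    using adj_mult[OF MU rep_comp[OF D Pi]] dm(2) comp_app[OF h\<Delta>, of _ "linv p"] ty by simp_all
  note ae = adj_unit[OF NU F \<epsilon> refl]
  note Q = co co(1)[symmetric] b b' am ae
  show ?thesis
  proof (rule that[OF D F MU NU])
    show "dual_bialgebra (is_arrow B) adm acd acomp (aid B) (awh B) h u P Pi R Ri EV M E Du eu Dl F MU NU"
      by (intro dual_bialgebra.intro C dual_bialgebra_axioms.intro) (rule Q | (simp add: ty; fail))+
    show "dual_bialgebra (is_arrow B) mir_dom mir_cod acomp (mir_id B) (mir_wh B) h u P Pi R Ri EV' M E Du eu Dl F MU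
        NU"
      by (intro dual_bialgebra.intro C' dual_bialgebra_axioms.intro) (rule Q | (simp add: ty co b; fail))+
  qed
qed

lemma rep_tw_mult:
  assumes "dual_bialgebra (is_arrow B) adm acd acomp (aid B) (awh B) h u P Pi R Ri EV M E Du eu Dl F MU NU"
    and R: "rep B CUU CUU r R" and MU: "rep B CUU CU mu MU"
  shows "rep B CUU CU (tw_mult r mu) (dual_bialgebra.mun acomp R MU)"
  unfolding tw_mult_def dual_bialgebra.mun_def[OF assms(1)] by (rule rep_comp[OF rep_comp[OF R R] MU])

lemma rep_tw_comult:
  assumes "dual_coalgebra (is_arrow B) adm acd acomp (aid B) (awh B) h u P Pi R Ri EV M E Du eu"
    and Ri: "rep B CUU CUU (linv r) Ri" and Du: "rep B CU CUU d Du"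
  shows "rep B CU CUU (tw_comult r d) (dual_coalgebra.\<Delta>n acomp Ri Du)"
  unfolding tw_comult_def dual_coalgebra.\<Delta>n_def[OF assms(1)] by (intro rep_comp[OF _ Ri] rep_comp[OF Du Ri])

lemma braided_bialgebra_U:
  assumes A: "dual_bialgebra (is_arrow B) adm acd acomp (aid B) (awh B) h u P Pi R Ri EV M E Du eu Dl F MU NU"
    and R: "rep B CUU CUU r R" "r \<in> iso (U \<otimes> U) (U \<otimes> U)"
    and Ri: "rep B CUU CUU (linv r) Ri"
    and Du: "rep B CU CUU d Du" and eu: "rep B CU cK \<epsilon>' eu"
    and MU: "rep B CUU CU mu MU" and NU: "rep B cK CU (elt U \<eta>) NU" and \<eta>: "\<eta> \<in> carr U"
  shows "braided_bialgebra U (tw_mult r mu) \<eta> (tw_comult r d) \<epsilon>' r"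
proof -
  interpret S: dual_bialgebra "is_arrow B" adm acd acomp "aid B" "awh B" h u P Pi R Ri EV M E Du eu Dl F MU NU by fact
  note c = S.dual_coalgebra_axioms
  note D = rep_tw_comult[OF c Ri Du] and M = rep_tw_mult[OF A R(1) MU]
  show ?thesis
    unfolding braided_bialgebra_rep[OF cU R(1) M NU \<eta> D eu] braided_algebra_rep[OF cU R(1) M NU \<eta>]
    using braided_coalgebra_U[OF c R Ri Du eu] R(2) S.yb_R S.mun_assoc S.mun_unit S.R_mun S.R_\<eta>u
      S.\<Delta>n_mun S.\<Delta>n_\<eta>u S.\<epsilon>u_mun S.\<epsilon>u_\<eta>u by simp
qed

end

context dual_crd_module
begin

lemma cV: "lcoords B CV V v"
  using CV by (auto simp: lcoords_def)

lemma right_comodule_arrows: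
  assumes C: "dual_coalgebra (is_arrow B) adm acd acomp (aid B) (awh B) h u P Pi R Ri EV M E Du eu"
    and P: "rep B CHH CHH p P" and M: "rep B CHH CH m M" and E: "rep B cK CH (elt H e) E"
    and e: "e \<in> carr H"
    and mod: "braided_left_module H m e p V q \<nu>" and bij: "UV_bijective H U V q"
    and im: "app (raw_rho_R H V q \<nu>) ` carr V \<subseteq> app (emb_VU H U V) ` carr (V \<otimes> U)"
  obtains Q D S Si N Rh where
    "rep B CHV CVH q Q" "rep B CUV CVU (braid_UV H U V q) S"
    "rep B CHV CV \<nu> N" "rep B CV CVU (rho_R H U V q \<nu>) Rh"
    "braid_UV H U V q \<in> iso (U \<otimes> V) (V \<otimes> U)"
    "dual_comodule (is_arrow B) adm acd acomp (aid B) (awh B) h u P Pi R Ri EV M E Du eu v Q D S Si N Rh"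
proof -
  have iso: "q \<in> iso (H \<otimes> V) (V \<otimes> H)" and h\<nu>: "\<nu> \<in> hom (H \<otimes> V) V"
    using mod by (auto simp: braided_left_module_def left_braided_def)
  note hq = isoD[OF iso vspace_tprod vspace_tprod]
  note s = braid_UV_facts[OF U vs(1) vsV hq(2) bij]
  note r = rho_R_facts[OF U vsV hq(2) h\<nu> im]
  obtain Q where Q: "rep B CHV CVH q Q"
    using rep_ex[OF valid_ctens[OF v(1) vV] valid_ctens[OF vV v(1)], of q] hq(1) by auto
  obtain D where D: "rep B CVH CHV (linv q) D" "D \<cdot> Q = aid B [h,v]" "Q \<cdot> D = aid B [v,h]"
    using rep_linv[OF Q] iso by auto
  obtain S where S: "rep B CUV CVU (braid_UV H U V q) S"
    using rep_ex[OF valid_ctens[OF v(2) vV] valid_ctens[OF vV v(2)], of "braid_UV H U V q"]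
      isoD(1)[OF s(1) vspace_tprod vspace_tprod] by auto
  obtain Si where Si: "rep B CVU CUV (linv (braid_UV H U V q)) Si" "Si \<cdot> S = aid B [u,v]" "S \<cdot> Si = aid B [v,u]"
    using rep_linv[OF S] s(1) by auto
  obtain N where N: "rep B CHV CV \<nu> N" using rep_ex[OF valid_ctens[OF v(1) vV] vV, of \<nu>] h\<nu> by auto
  obtain Rh where Rh: "rep B CV CVU (rho_R H U V q \<nu>) Rh"
    using rep_ex[OF vV valid_ctens[OF vV v(2)], of "rho_R H U V q \<nu>"] r(1) by auto
  note ty = rep_arrow[OF Q] rep_arrow[OF D(1)] rep_arrow[OF S] rep_arrow[OF Si(1)] rep_arrow[OF N] rep_arrow[OF Rh]
  have F: "awh B [] Q [h] \<cdot> awh B [h] Q [] \<cdot> awh B [] P [v] =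
      awh B [v] P [] \<cdot> awh B [] Q [h] \<cdot> awh B [h] Q []"
    "Q \<cdot> awh B [] M [v] = awh B [v] M [] \<cdot> awh B [] Q [h] \<cdot> awh B [h] Q []"
    "Q \<cdot> awh B [] E [v] = awh B [v] E []"
    "N \<cdot> awh B [h] N [] = N \<cdot> awh B [] M [v]"
    "N \<cdot> awh B [] E [v] = aid B [v]"
    "Q \<cdot> awh B [h] N [] = awh B [] N [h] \<cdot> awh B [h] Q [] \<cdot> awh B [] P [v]"
    using mod unit_left_iff[OF cH cV Q E e] act_unit_left_iff[OF cH cV N E e]
    unfolding braided_left_module_def left_braided_def compat_mult_left_def left_ybe_rep[OF cH cV P Q]
      mult_left_rep[OF cH cV M Q] left_module_rep[OF cH cV M N] left_module_braid_rep[OF cH cV P Q N]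
    by auto
  note aS = adj_braid_UV[OF S D(1) s(2)]
  have aR: "awh B [v] EV [] \<cdot> awh B [] Rh [h] = N \<cdot> D"
    using adj_rho_R[OF Rh rep_comp[OF D(1) N]] r(2) comp_app[OF hq(2), of _ \<nu>] by (simp add: tens_in)
  have "dual_comodule (is_arrow B) adm acd acomp (aid B) (awh B) h u P Pi R Ri EV M E Du eu v Q D S Si N Rh"
    by (intro dual_comodule.intro C dual_comodule_axioms.intro) (rule F aS aR | (simp add: ty D Si; fail))+
  then show ?thesis by (rule that[OF Q S N Rh s(1)])
qed

lemma braided_right_comodule_U:
  assumes A: "dual_comodule (is_arrow B) adm acd acomp (aid B) (awh B) h u P Pi R Ri EV M E Du eu v Q D S Si N Rh"
    and R: "rep B CUU CUU r R" "r \<in> iso (U \<otimes> U) (U \<otimes> U)"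
    and Ri: "rep B CUU CUU (linv r) Ri"
    and Du: "rep B CU CUU d Du" and eu: "rep B CU cK \<epsilon>' eu"
    and S: "rep B CUV CVU s S" "s \<in> iso (U \<otimes> V) (V \<otimes> U)" and Rh: "rep B CV CVU \<rho> Rh"
  shows "braided_right_comodule U (tw_comult r d) \<epsilon>' r V s \<rho>"
proof -
  interpret S: dual_comodule "is_arrow B" adm acd acomp "aid B" "awh B" h u P Pi R Ri EV M E Du eu v Q D S Si N Rh
      by fact
  note c = S.dual_coalgebra_axioms
  note D = rep_tw_comult[OF c Ri Du]
  have "braided U r" using R(2) S.yb_R vs(2) by (simp add: braided_def ybe_rep[OF cU R(1)])
  then show ?thesis
    unfolding braided_right_comodule_def left_braided_def compat_comult_left_def left_ybe_rep[OF cU cV R(1) S(1)]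
      comult_left_rep[OF cU cV D S(1)] comult_left_counit_rep[OF cU cV eu S(1)] right_comodule_rep[OF cU cV D Rh]
      right_comodule_counit_rep[OF cU cV eu Rh] right_comodule_braid_rep[OF cU cV R(1) S(1) Rh]
    using braided_coalgebra_U[OF c R Ri Du eu] vsV S(2) rep_hom[OF Rh] S.yb_S S.S_\<Delta>n S.S_\<epsilon>u
      S.\<rho>_coassoc S.\<rho>_counit S.\<rho>_S by simp
qed

lemma braided_right_comodule_algebra_U:
  assumes A: "dual_comodule (is_arrow B) adm acd acomp (aid B) (awh B) h u P Pi R Ri EV M E Du eu v Q D S Si N Rh"
    and bi: "dual_bialgebra (is_arrow B) adm acd acomp (aid B) (awh B) h u P Pi R Ri EV M E Du eu Dl F MU NU"
    and R: "rep B CUU CUU r R" "r \<in> iso (U \<otimes> U) (U \<otimes> U)"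
    and Ri: "rep B CUU CUU (linv r) Ri"
    and Du: "rep B CU CUU d Du" and eu: "rep B CU cK \<epsilon>' eu"
    and Q: "rep B CHV CVH q Q" and N: "rep B CHV CV \<nu> N"
    and S: "rep B CUV CVU s S" "s \<in> iso (U \<otimes> V) (V \<otimes> U)" and Rh: "rep B CV CVU \<rho> Rh"
    and Dl: "rep B CH CHH \<Delta> Dl" and F: "rep B CH cK \<epsilon> F"
    and MU: "rep B CUU CU mu MU" and NU: "rep B cK CU (elt U \<eta>) NU" and \<eta>: "\<eta> \<in> carr U"
    and alg: "braided_left_module_algebra H m e \<Delta> \<epsilon> p V mV uV pV q \<nu>"
  shows "braided_right_comodule_algebra U (tw_mult r mu) \<eta> (tw_comult r d) \<epsilon>' r V mV uV pV s \<rho>"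
proof -
  have hmV: "mV \<in> hom (V \<otimes> V) V" and uV: "\<And>b. uV = Some b \<Longrightarrow> b \<in> carr V"
    using alg by (auto simp: braided_left_module_algebra_def braided_algebra_def algebra_def)
  obtain MV where MV: "rep B CVV CV mV MV" using rep_ex[OF valid_ctens[OF vV vV] vV, of mV] hmV by auto
  have K: "awh B [v] Dl [] \<cdot> Q = awh B [] Q [h] \<cdot> awh B [h] Q [] \<cdot> awh B [] Dl [v]"
    "awh B [v] F [] \<cdot> Q = awh B [] F [v]"
    "Q \<cdot> awh B [h] MV [] = awh B [] MV [h] \<cdot> awh B [v] Q [] \<cdot> awh B [] Q [v]"
    "N \<cdot> awh B [h] MV [] = MV \<cdot> awh B [] N [v] \<cdot> awh B [v,h] N [] \<cdot>
       awh B [h] Q [v] \<cdot> awh B [] Dl [v,v]"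
    using alg unfolding braided_left_module_algebra_def compat_comult_left_def compat_mult_right_def
      comult_left_rep[OF cH cV Dl Q] comult_left_counit_rep[OF cH cV F Q] mult_right_rep[OF cH cV MV Q]
      left_module_algebra_rep[OF cH cV Dl MV Q N] by blast+
  have KV: "Q \<cdot> awh B [h] NV [] = awh B [] NV [h]" "N \<cdot> awh B [h] NV [] = NV \<cdot> F"
    if "uV = Some b" "rep B cK CV (elt V b) NV" for b NV
    using alg that unit_right_iff[OF cH cV Q that(2) uV[OF that(1)]]
        act_on_unit_right_iff[OF cH cV N F that(2) uV[OF that(1)]]
    unfolding braided_left_module_algebra_def compat_mult_right_def by auto
  have "dual_comodule_algebra (is_arrow B) adm acd acomp (aid B) (awh B) h u P Pi R Ri EV M E Du eu v Q D S Si N Rh Dl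
      F MU NU MV"
    by (intro dual_comodule_algebra.intro A bi dual_comodule_algebra_axioms.intro)
      (rule K | (simp add: rep_arrow[OF MV]; fail))+
  then interpret S: dual_comodule_algebra "is_arrow B" adm acd acomp "aid B" "awh B"
      h u P Pi R Ri EV M E Du eu v Q D S Si N Rh Dl F MU NU MV .
  note c = S.dual_coalgebra_axioms
  note M = rep_tw_mult[OF bi R(1) MU]
  have "(\<forall>x\<in>carr V. app s (tens U V \<eta> x) = tens V U x \<eta>)"
    unfolding unit_left_iff[OF cU cV S(1) NU \<eta>] by (rule S.S_\<eta>u)
  moreover have "(\<forall>x\<in>carr U. app s (tens U V x b) = tens V U b x)" "app \<rho> b = tens V U b \<eta>" if b: "uV = Some b" for b
  proof -
    obtain NV where NV: "rep B cK CV (elt V b) NV" using rep_elt_ex[OF cV uV[OF b]] .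
    note a = rep_arrow[OF NV]
    show "\<forall>x\<in>carr U. app s (tens U V x b) = tens V U b x"
      unfolding unit_right_iff[OF cU cV S(1) NV uV[OF b]] using a KV[OF b NV] by (intro S.S_\<eta>V) simp_all
    show "app \<rho> b = tens V U b \<eta>"
      unfolding image_elt_iff(1)[OF CV(1) cV cU Rh NV uV[OF b] NV uV[OF b] NU \<eta>]
      using a KV[OF b NV] by (intro S.\<rho>_\<eta>V) simp_all
  qed
  ultimately show ?thesis
    unfolding braided_right_comodule_algebra_def compat_mult_left_def compat_mult_right_def
      mult_left_rep[OF cU cV M S(1)] mult_right_rep[OF cU cV MV S(1)]
          right_comodule_algebra_rep[OF cU cV M MV S(1) Rh]
    using braided_bialgebra_U[OF bi R Ri Du eu MU NU \<eta>] braided_right_comodule_U[OF A R Ri Du eu S Rh] alg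
      S.S_mun S.S_mV S.\<rho>_mV
    by (auto simp: braided_left_module_algebra_def braided_right_comodule_def)
qed

lemma left_comodule_arrows:
  assumes C: "dual_coalgebra (is_arrow B) mir_dom mir_cod acomp (mir_id B) (mir_wh B) h u P Pi R Ri EV' M E Du eu"
    and P: "rep B CHH CHH p P" and M: "rep B CHH CH m M" and E: "rep B cK CH (elt H e) E"
    and e: "e \<in> carr H"
    and mod: "braided_right_module H m e p V q \<nu>" and bij: "VU_bijective H U V q"
    and im: "app (raw_rho_L H V q \<nu>) ` carr V \<subseteq> app (emb_UV H U V) ` carr (U \<otimes> V)"
  obtains Q D S Si N Rh where
    "rep B CVH CHV q Q" "rep B CVU CUV (braid_VU H U V q) S"
    "rep B CVH CV \<nu> N" "rep B CV CUV (rho_L H U V q \<nu>) Rh"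
    "braid_VU H U V q \<in> iso (V \<otimes> U) (U \<otimes> V)"
    "dual_comodule (is_arrow B) mir_dom mir_cod acomp (mir_id B) (mir_wh B) h u P Pi R Ri EV' M E Du eu v Q D S Si N
      Rh"
proof -
  have iso: "q \<in> iso (V \<otimes> H) (H \<otimes> V)" and h\<nu>: "\<nu> \<in> hom (V \<otimes> H) V"
    using mod by (auto simp: braided_right_module_def right_braided_def)
  note hq = isoD[OF iso vspace_tprod vspace_tprod]
  note s = braid_VU_facts[OF U vs(1) vsV hq(2) bij]
  note r = rho_L_facts[OF U vsV vs(1) hq(2) h\<nu> im]
  obtain Q where Q: "rep B CVH CHV q Q"
    using rep_ex[OF valid_ctens[OF vV v(1)] valid_ctens[OF v(1) vV], of q] hq(1) by auto
  obtain D where D: "rep B CHV CVH (linv q) D" "D \<cdot> Q = aid B [v,h]" "Q \<cdot> D = aid B [h,v]"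
    using rep_linv[OF Q] iso by auto
  obtain S where S: "rep B CVU CUV (braid_VU H U V q) S"
    using rep_ex[OF valid_ctens[OF vV v(2)] valid_ctens[OF v(2) vV], of "braid_VU H U V q"]
      isoD(1)[OF s(1) vspace_tprod vspace_tprod] by auto
  obtain Si where Si: "rep B CUV CVU (linv (braid_VU H U V q)) Si" "Si \<cdot> S = aid B [v,u]" "S \<cdot> Si = aid B [u,v]"
    using rep_linv[OF S] s(1) by auto
  obtain N where N: "rep B CVH CV \<nu> N" using rep_ex[OF valid_ctens[OF vV v(1)] vV, of \<nu>] h\<nu> by auto
  obtain Rh where Rh: "rep B CV CUV (rho_L H U V q \<nu>) Rh"
    using rep_ex[OF vV valid_ctens[OF v(2) vV], of "rho_L H U V q \<nu>"] r(1) by auto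
  note ty = rep_arrow[OF Q] rep_arrow[OF D(1)] rep_arrow[OF S] rep_arrow[OF Si(1)] rep_arrow[OF N] rep_arrow[OF Rh]
  have F: "awh B [h] Q [] \<cdot> awh B [] Q [h] \<cdot> awh B [v] P [] =
      awh B [] P [v] \<cdot> awh B [h] Q [] \<cdot> awh B [] Q [h]"
    "Q \<cdot> awh B [v] M [] = awh B [] M [v] \<cdot> awh B [h] Q [] \<cdot> awh B [] Q [h]"
    "Q \<cdot> awh B [v] E [] = awh B [] E [v]"
    "N \<cdot> awh B [] N [h] = N \<cdot> awh B [v] M []"
    "N \<cdot> awh B [v] E [] = aid B [v]"
    "Q \<cdot> awh B [] N [h] = awh B [h] N [] \<cdot> awh B [] Q [h] \<cdot> awh B [v] P []"
    using mod unit_right_iff[OF cV cH Q E e] act_unit_right_iff[OF cH cV N E e]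
    unfolding braided_right_module_def right_braided_def compat_mult_right_def right_ybe_rep[OF cV cH P Q]
      mult_right_rep[OF cV cH M Q] right_module_rep[OF cH cV M N] right_module_braid_rep[OF cH cV P Q N]
    by auto
  note aS = adj_braid_VU[OF S D(1) s(2)]
  have aR: "awh B [] EV' [v] \<cdot> awh B [h] Rh [] = N \<cdot> D"
    using adj_rho_L[OF Rh rep_comp[OF D(1) N]] r(2) comp_app[OF hq(2), of _ \<nu>] by (simp add: tens_in)
  have "dual_comodule (is_arrow B) mir_dom mir_cod acomp (mir_id B) (mir_wh B) h u P Pi R Ri EV' M E Du eu v Q D S Si
      N Rh"
    by (intro dual_comodule.intro C dual_comodule_axioms.intro) (rule F aS aR | (simp add: ty D Si F; fail))+
  then show ?thesis by (rule that[OF Q S N Rh s(1)])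
qed

text \<open>The comodule axioms are taken from the reflected category. The axioms of the braided coalgebra \<open>U\<close> are
  symmetric under reflection and are taken from the category itself.\<close>
lemma braided_left_comodule_U:
  assumes A: "dual_comodule (is_arrow B) mir_dom mir_cod acomp (mir_id B) (mir_wh B) h u P Pi R Ri EV' M E Du eu v Q D
      S Si N Rh"
    and C: "dual_coalgebra (is_arrow B) adm acd acomp (aid B) (awh B) h u P Pi R Ri EV M E Du eu"
    and R: "rep B CUU CUU r R" "r \<in> iso (U \<otimes> U) (U \<otimes> U)"
    and Ri: "rep B CUU CUU (linv r) Ri"
    and Du: "rep B CU CUU d Du" and eu: "rep B CU cK \<epsilon>' eu"
    and S: "rep B CVU CUV s S" "s \<in> iso (V \<otimes> U) (U \<otimes> V)" and Rh: "rep B CV CUV \<rho> Rh"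
  shows "braided_left_comodule U (tw_comult r d) \<epsilon>' r V s \<rho>"
proof -
  interpret S: dual_comodule "is_arrow B" "mir_dom" "mir_cod" acomp "mir_id B" "mir_wh B"
      h u P Pi R Ri EV' M E Du eu v Q D S Si N Rh by fact
  note D = rep_tw_comult[OF C Ri Du]
  note U = braided_coalgebra_U[OF C R Ri Du eu]
  then have "braided U r" by (simp add: braided_coalgebra_def)
  then show ?thesis
    unfolding braided_left_comodule_def right_braided_def compat_comult_right_def right_ybe_rep[OF cV cU R(1) S(1)]
      comult_right_rep[OF cV cU D S(1)] comult_right_counit_rep[OF cV cU eu S(1)] left_comodule_rep[OF cU cV D Rh]
      left_comodule_counit_rep[OF cU cV eu Rh] left_comodule_braid_rep[OF cU cV R(1) S(1) Rh]
    using U vsV S(2) rep_hom[OF Rh] S.yb_S S.S_\<Delta>n S.S_\<epsilon>u S.\<rho>_coassoc S.\<rho>_counit S.\<rho>_S by simp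
qed

lemma braided_left_comodule_algebra_U:
  assumes A: "dual_comodule (is_arrow B) mir_dom mir_cod acomp (mir_id B) (mir_wh B) h u P Pi R Ri EV' M E Du eu v Q D
      S Si N Rh"
    and C: "dual_coalgebra (is_arrow B) adm acd acomp (aid B) (awh B) h u P Pi R Ri EV M E Du eu"
    and bi': "dual_bialgebra (is_arrow B) mir_dom mir_cod acomp (mir_id B) (mir_wh B) h u P Pi R Ri EV' M E Du eu Dl F
        MU NU"
    and bi: "dual_bialgebra (is_arrow B) adm acd acomp (aid B) (awh B) h u P Pi R Ri EV M E Du eu Dl F MU NU"
    and R: "rep B CUU CUU r R" "r \<in> iso (U \<otimes> U) (U \<otimes> U)"
    and Ri: "rep B CUU CUU (linv r) Ri"
    and Du: "rep B CU CUU d Du" and eu: "rep B CU cK \<epsilon>' eu"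
    and Q: "rep B CVH CHV q Q" and N: "rep B CVH CV \<nu> N"
    and S: "rep B CVU CUV s S" "s \<in> iso (V \<otimes> U) (U \<otimes> V)" and Rh: "rep B CV CUV \<rho> Rh"
    and Dl: "rep B CH CHH \<Delta> Dl" and F: "rep B CH cK \<epsilon> F"
    and MU: "rep B CUU CU mu MU" and NU: "rep B cK CU (elt U \<eta>) NU" and \<eta>: "\<eta> \<in> carr U"
    and alg: "braided_right_module_algebra H m e \<Delta> \<epsilon> p V mV uV pV q \<nu>"
  shows "braided_left_comodule_algebra U (tw_mult r mu) \<eta> (tw_comult r d) \<epsilon>' r V mV uV pV s \<rho>"
proof -
  have hmV: "mV \<in> hom (V \<otimes> V) V" and uV: "\<And>b. uV = Some b \<Longrightarrow> b \<in> carr V"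
    using alg by (auto simp: braided_right_module_algebra_def braided_algebra_def algebra_def)
  obtain MV where MV: "rep B CVV CV mV MV" using rep_ex[OF valid_ctens[OF vV vV] vV, of mV] hmV by auto
  note ty = rep_arrow[OF MV] rep_arrow[OF N] rep_arrow[OF Rh]
  have K: "awh B [] Dl [v] \<cdot> Q = awh B [h] Q [] \<cdot> awh B [] Q [h] \<cdot> awh B [v] Dl []"
    "awh B [] F [v] \<cdot> Q = awh B [v] F []"
    "Q \<cdot> awh B [] MV [h] = awh B [h] MV [] \<cdot> awh B [] Q [v] \<cdot> awh B [v] Q []"
    and K4: "N \<cdot> awh B [] MV [h] = MV \<cdot> awh B [] N [v] \<cdot> awh B [h,v] N [] \<cdot>
       awh B [v] Q [h] \<cdot> awh B [v,v] Dl []"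
    using alg unfolding braided_right_module_algebra_def compat_comult_right_def compat_mult_left_def
      comult_right_rep[OF cV cH Dl Q] comult_right_counit_rep[OF cV cH F Q] mult_left_rep[OF cV cH MV Q]
      right_module_algebra_rep[OF cH cV Dl MV Q N] by blast+
  have "awh B [] N [v] \<cdot> awh B [h,v] N [] = awh B [v] N [] \<cdot> awh B [] N [v,h]"
    using words.interchange[of B N N] ty by simp
  with K4 have K4': "N \<cdot> awh B [] MV [h] = MV \<cdot> awh B [v] N [] \<cdot> awh B [] N [v,h] \<cdot>
       awh B [v] Q [h] \<cdot> awh B [v,v] Dl []"
    by (metis words.comp_assoc)
  have KV: "Q \<cdot> awh B [] NV [h] = awh B [h] NV []" "N \<cdot> awh B [] NV [h] = NV \<cdot> F"
    if "uV = Some b" "rep B cK CV (elt V b) NV" for b NV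
    using alg that unit_left_iff[OF cV cH Q that(2) uV[OF that(1)]]
        act_on_unit_left_iff[OF cH cV N F that(2) uV[OF that(1)]]
    unfolding braided_right_module_algebra_def compat_mult_left_def by auto
  have "dual_comodule_algebra (is_arrow B) mir_dom mir_cod acomp (mir_id B) (mir_wh B) h u P Pi R Ri EV' M E Du eu v Q
      D S Si N Rh Dl F MU NU MV"
    by (intro dual_comodule_algebra.intro A bi' dual_comodule_algebra_axioms.intro)
      (rule K K4' | (simp add: ty; fail))+
  then interpret S: dual_comodule_algebra "is_arrow B" "mir_dom" "mir_cod" acomp "mir_id B" "mir_wh B"
      h u P Pi R Ri EV' M E Du eu v Q D S Si N Rh Dl F MU NU MV .
  note M = rep_tw_mult[OF bi R(1) MU]
  have "(\<forall>x\<in>carr V. app s (tens V U x \<eta>) = tens U V \<eta> x)"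
    unfolding unit_right_iff[OF cV cU S(1) NU \<eta>] using S.S_\<eta>u by simp
  moreover have "(\<forall>x\<in>carr U. app s (tens V U b x) = tens U V x b)" "app \<rho> b = tens U V \<eta> b" if b: "uV = Some b" for b
  proof -
    obtain NV where NV: "rep B cK CV (elt V b) NV" using rep_elt_ex[OF cV uV[OF b]] .
    note a = rep_arrow[OF NV]
    show "\<forall>x\<in>carr U. app s (tens V U b x) = tens U V x b"
      unfolding unit_left_iff[OF cV cU S(1) NV uV[OF b]] using S.S_\<eta>V[of NV] a KV[OF b NV] by simp
    show "app \<rho> b = tens U V \<eta> b"
      unfolding image_elt_iff(2)[OF CV(1) cU cV Rh NV uV[OF b] NU \<eta> NV uV[OF b]]
      using S.\<rho>_\<eta>V[of NV] a KV[OF b NV] by simp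
  qed
  moreover have "Rh \<cdot> MV = awh B [] (dual_bialgebra.mun acomp R MU) [v] \<cdot> awh B [u,u] MV [] \<cdot>
      awh B [u] S [v] \<cdot> awh B [] Rh [u,v] \<cdot> awh B [v] Rh []"
  proof -
    have "awh B [] (dual_bialgebra.mun acomp R MU) [v] \<cdot> awh B [u,u] MV [] =
        awh B [u] MV [] \<cdot> awh B [] (dual_bialgebra.mun acomp R MU) [v,v]"
      using words.interchange[of B "dual_bialgebra.mun acomp R MU" MV] rep_arrow[OF M] ty by simp
    moreover have "awh B [] Rh [u,v] \<cdot> awh B [v] Rh [] = awh B [v,u] Rh [] \<cdot> awh B [] Rh [v]"
      using words.interchange[of B Rh Rh] ty by simp
    ultimately show ?thesis using S.\<rho>_mV by (metis words.comp_assoc)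
  qed
  ultimately show ?thesis
    unfolding braided_left_comodule_algebra_def compat_mult_left_def compat_mult_right_def
      mult_right_rep[OF cV cU M S(1)] mult_left_rep[OF cV cU MV S(1)] left_comodule_algebra_rep[OF cU cV M MV S(1) Rh]
    using braided_bialgebra_U[OF bi R Ri Du eu MU NU \<eta>] braided_left_comodule_U[OF A C R Ri Du eu S Rh] alg
      S.S_mun S.S_mV
    by (auto simp: braided_right_module_algebra_def braided_left_comodule_def)
qed

end

section \<open>Choice of coordinates\<close>

datatype letter = Letter_H | Letter_U | Letter_V

text \<open>The bases of \<open>H\<close>, \<open>U\<close> and \<open>V\<close> are placed in the three parts of a sum type, which serves as the set of
  generators of the free algebra.\<close>
lemma dual_crd_module_exists:
  fixes H :: "('k::field, 'h::ab_group_add) vs" and U :: "('k, 'h \<Rightarrow> 'k) vs" and V :: "('k, 'v::ab_group_add) vs"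
  assumes U: "is_subspace U (dual H)" and H: "vspace H" and V: "vspace V"
  obtains B :: "letter \<Rightarrow> ('h + ('h \<Rightarrow> 'k) + 'v) set" and CH CU CV EV EV'
  where "dual_crd_module B H U CH CU Letter_H Letter_U EV EV' V CV Letter_V"
proof -
  note vU = subspace_dual_vspace[OF U]
  have inj: "inj (Inl :: 'h \<Rightarrow> 'h + ('h \<Rightarrow> 'k) + 'v)" "inj (Inr \<circ> Inl :: ('h \<Rightarrow> 'k) \<Rightarrow> 'h + ('h \<Rightarrow> 'k) + 'v)"
    "inj (Inr \<circ> Inr :: 'v \<Rightarrow> 'h + ('h \<Rightarrow> 'k) + 'v)"
    by (simp_all add: inj_def)
  obtain SH where SH: "\<And>(B :: letter \<Rightarrow> ('h + ('h \<Rightarrow> 'k) + 'v) set) l. B l = Inl ` SH \<Longrightarrow> \<exists>C. coords B C H \<and> wo C = [l]"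
    using crd_ex[OF H inj(1), where 'l=letter] by blast
  obtain SU where SU: "\<And>(B :: letter \<Rightarrow> ('h + ('h \<Rightarrow> 'k) + 'v) set) l. B l = (Inr \<circ> Inl) ` SU \<Longrightarrow> \<exists>C. coords B C U \<and>
      wo C = [l]"
    using crd_ex[OF vU inj(2), where 'l=letter] by blast
  obtain SV where SV: "\<And>(B :: letter \<Rightarrow> ('h + ('h \<Rightarrow> 'k) + 'v) set) l. B l = (Inr \<circ> Inr) ` SV \<Longrightarrow> \<exists>C. coords B C V \<and>
      wo C = [l]"
    using crd_ex[OF V inj(3), where 'l=letter] by blast
  define B :: "letter \<Rightarrow> ('h + ('h \<Rightarrow> 'k) + 'v) set" where
    "B = case_letter (Inl ` SH) ((Inr \<circ> Inl) ` SU) ((Inr \<circ> Inr) ` SV)"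
  obtain CH where CH: "coords B CH H" "wo CH = [Letter_H]" using SH[of B Letter_H] by (auto simp: B_def)
  obtain CU where CU: "coords B CU U" "wo CU = [Letter_U]" using SU[of B Letter_U] by (auto simp: B_def)
  obtain CV where CV: "coords B CV V" "wo CV = [Letter_V]" using SV[of B Letter_V] by (auto simp: B_def)
  note v = coords_valid[OF CH(1)] coords_valid[OF CU(1)]
  note [simp] = coords_sp[OF CH(1)] coords_sp[OF CU(1)]
  have b: "bilin U H base_field (\<lambda>f a. f a)" "bilin H U base_field (\<lambda>a f. f a)"
    using subspace_dualD[OF U] by (auto simp: bilin_def lfun_def plus_fun_apply)
  obtain EV where EV: "rep B (CU \<boxtimes> CH) cK (tlift U H base_field (\<lambda>f a. f a)) EV"
    using rep_ex[OF valid_ctens[OF v(2,1)] valid_cK, of "tlift U H base_field (\<lambda>f a. f a)"]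
      tlift_hom[OF vU vspace_base_field b(1)] by auto
  obtain EV' where EV': "rep B (CH \<boxtimes> CU) cK (tlift H U base_field (\<lambda>a f. f a)) EV'"
    using rep_ex[OF valid_ctens[OF v(1,2)] valid_cK, of "tlift H U base_field (\<lambda>a f. f a)"]
      tlift_hom[OF H vspace_base_field b(2)] by auto
  have e: "fn EV (app (cm CU) f * app (cm CH) a) = sc (f a) 1" "fn EV' (app (cm CH) a * app (cm CU) f) = sc (f a) 1"
    if "f \<in> carr U" "a \<in> carr H" for f a
    using rep_app[OF EV, of "tens U H f a"] rep_app[OF EV', of "tens H U a f"] that
      ctens_tens[OF v(2,1), of f a] ctens_tens[OF v(1,2), of a f]
      tlift_tens[OF vU vspace_base_field b(1) that] tlift_tens[OF H vspace_base_field b(2) that(2,1)]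
    by (simp_all add: tens_in)
  have "dual_crd_module B H U CH CU Letter_H Letter_U EV EV' V CV Letter_V"
    by (intro dual_crd_module.intro dual_crd.intro dual_crd_module_axioms.intro U CH CU CV e)
      (use rep_arrow[OF EV] rep_arrow[OF EV'] CH CU in auto)
  then show ?thesis by (rule that)
qed

lemma subcoalgebra_subspace:
  assumes "is_subcoalgebra H m e p U"
  shows "is_subspace U (dual H)" and "comult_closed H m p U"
  using assms by (auto simp: is_subcoalgebra_def is_subspace_def finite_dual_def dual_def)

theorem theorem5p6:
  fixes H :: "('k::field, 'h::ab_group_add) vs"
    and m :: "('k, ('k, 'h, 'h) tensor, 'h) lmap"
    and e :: 'h
    and p :: "('k, ('k, 'h, 'h) tensor, ('k, 'h, 'h) tensor) lmap"
    and V :: "('k, 'v::ab_group_add) vs"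
    and U :: "('k, 'h \<Rightarrow> 'k) vs"
  assumes "braided_algebra H m (Some e) p"
    and "is_subcoalgebra H m e p U"
    and "nondegenerate U H"
    and "UU_bijective H p U"
  shows
    "(\<forall>q \<nu>.
        braided_left_module H m e p V q \<nu> \<longrightarrow>
        UV_bijective H U V q \<longrightarrow>
        app (raw_rho_R H V q \<nu>) ` carr V \<subseteq> app (emb_VU H U V) ` carr (V \<otimes> U) \<longrightarrow>
        braided_right_comodule U (dual_comult2 H m p U) (dual_counit e U) (braid_UU H p U)
          V (braid_UV H U V q) (rho_R H U V q \<nu>) \<and>
        (\<forall>\<Delta> \<epsilon> mV uV pV.
          braided_bialgebra H m e \<Delta> \<epsilon> p \<longrightarrow>
          braided_left_module_algebra H m e \<Delta> \<epsilon> p V mV uV pV q \<nu> \<longrightarrow>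
          standard_left_dual H m \<Delta> \<epsilon> p U \<longrightarrow>
          braided_right_comodule_algebra
            U (tw_mult (braid_UU H p U) (dual_mult H \<Delta> p U)) (app \<epsilon>)
            (tw_comult (braid_UU H p U) (dual_comult H m p U)) (dual_counit e U) (braid_UU H p U)
            V mV uV pV (braid_UV H U V q) (rho_R H U V q \<nu>))) \<and>
     (\<forall>q \<nu>.
        braided_right_module H m e p V q \<nu> \<longrightarrow>
        VU_bijective H U V q \<longrightarrow>
        app (raw_rho_L H V q \<nu>) ` carr V \<subseteq> app (emb_UV H U V) ` carr (U \<otimes> V) \<longrightarrow>
        braided_left_comodule U (dual_comult2 H m p U) (dual_counit e U) (braid_UU H p U)
          V (braid_VU H U V q) (rho_L H U V q \<nu>) \<and>
        (\<forall>\<Delta> \<epsilon> mV uV pV.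
          braided_bialgebra H m e \<Delta> \<epsilon> p \<longrightarrow>
          braided_right_module_algebra H m e \<Delta> \<epsilon> p V mV uV pV q \<nu> \<longrightarrow>
          standard_right_dual H m \<Delta> \<epsilon> p U \<longrightarrow>
          braided_left_comodule_algebra
            U (tw_mult (braid_UU H p U) (dual_mult H \<Delta> p U)) (app \<epsilon>)
            (tw_comult (braid_UU H p U) (dual_comult H m p U)) (dual_counit e U) (braid_UU H p U)
            V mV uV pV (braid_VU H U V q) (rho_L H U V q \<nu>)))"
proof (cases "vspace V")
  \<comment> \<open>Both parts assume that \<open>V\<close> is a vector space.\<close>
  case False
  then show ?thesis
    by (simp add: braided_left_module_def left_braided_def braided_right_module_def right_braided_def)
next
  case True
  note U = subcoalgebra_subspace[OF assms(2)]
  have H: "vspace H" and e: "e \<in> carr H" using assms(1) by (auto simp: braided_algebra_def braided_def algebra_def)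
  obtain B :: "letter \<Rightarrow> ('h + ('h \<Rightarrow> 'k) + 'v) set" and CH CU CV EV EV'
    where "dual_crd_module B H U CH CU Letter_H Letter_U EV EV' V CV Letter_V"
    using dual_crd_module_exists[OF U(1) H True] .
  then interpret X: dual_crd_module B H U CH CU Letter_H Letter_U EV EV' V CV Letter_V .
  obtain P Pi R Ri M E Du eu where P: "rep B (CH \<boxtimes> CH) (CH \<boxtimes> CH) p P" "rep B (CH \<boxtimes> CH) (CH \<boxtimes> CH) (linv p) Pi"
    and R: "rep B (CU \<boxtimes> CU) (CU \<boxtimes> CU) (braid_UU H p U) R" "rep B (CU \<boxtimes> CU) (CU \<boxtimes> CU) (linv (braid_UU H p U)) Ri"
    and M: "rep B (CH \<boxtimes> CH) CH m M" "rep B cK CH (elt H e) E"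
    and D: "rep B CU (CU \<boxtimes> CU) (dual_comult H m p U) Du" "rep B CU cK (dual_counit e U) eu"
    and C: "dual_coalgebra (is_arrow B) adm acd acomp (aid B) (awh B) Letter_H Letter_U P Pi R Ri EV M E Du eu"
    and C': "dual_coalgebra (is_arrow B) mir_dom mir_cod acomp (mir_id B) (mir_wh B) Letter_H Letter_U P Pi R Ri EV' M
        E Du eu"
    by (rule X.coalgebra_arrows[OF assms(1) U(2) assms(4)])
  have "p \<in> iso (H \<otimes> H) (H \<otimes> H)" using assms(1) by (simp add: braided_algebra_def braided_def)
  then have r: "braid_UU H p U \<in> iso (U \<otimes> U) (U \<otimes> U)"
    using braid_UU_facts(1)[OF U(1) H isoD(1)[OF _ vspace_tprod vspace_tprod] assms(4)] by blast
  show ?thesis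
  proof (intro conjI allI impI)
    fix q \<nu>
    assume 1: "braided_left_module H m e p V q \<nu>" "UV_bijective H U V q"
      "app (raw_rho_R H V q \<nu>) ` carr V \<subseteq> app (emb_VU H U V) ` carr (V \<otimes> U)"
    obtain Q QD S Si N Rh where Q: "rep B (CH \<boxtimes> CV) (CV \<boxtimes> CH) q Q"
      and S: "rep B (CU \<boxtimes> CV) (CV \<boxtimes> CU) (braid_UV H U V q) S" and N: "rep B (CH \<boxtimes> CV) CV \<nu> N"
      and Rh: "rep B CV (CV \<boxtimes> CU) (rho_R H U V q \<nu>) Rh" and s: "braid_UV H U V q \<in> iso (U \<otimes> V) (V \<otimes> U)"
      and A: "dual_comodule (is_arrow B) adm acd acomp (aid B) (awh B) Letter_H Letter_U P Pi R Ri EV M E Du eu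
        Letter_V Q QD S Si N Rh"
      by (rule X.right_comodule_arrows[OF C P(1) M e 1])
    show "braided_right_comodule U (dual_comult2 H m p U) (dual_counit e U) (braid_UU H p U)
        V (braid_UV H U V q) (rho_R H U V q \<nu>)"
      unfolding dual_comult2_def by (rule X.braided_right_comodule_U[OF A R(1) r R(2) D S s Rh])
    fix \<Delta> \<epsilon> mV uV pV
    assume 2: "braided_bialgebra H m e \<Delta> \<epsilon> p" "braided_left_module_algebra H m e \<Delta> \<epsilon> p V mV uV pV q \<nu>"
      "standard_left_dual H m \<Delta> \<epsilon> p U"
    have \<epsilon>: "app \<epsilon> \<in> carr U" and cl: "\<And>f g. f \<in> carr U \<Longrightarrow> g \<in> carr U \<Longrightarrow> dual_mult_fun H \<Delta> p f g \<in> carr U"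
      using 2(3) by (auto simp: standard_left_dual_def standard_dual_def)
    obtain Dl F MU NU where Dl: "rep B CH (CH \<boxtimes> CH) \<Delta> Dl" "rep B CH cK \<epsilon> F"
      and MU: "rep B (CU \<boxtimes> CU) CU (dual_mult H \<Delta> p U) MU" "rep B cK CU (elt U (app \<epsilon>)) NU"
      and bi: "dual_bialgebra (is_arrow B) adm acd acomp (aid B) (awh B) Letter_H Letter_U
        P Pi R Ri EV M E Du eu Dl F MU NU"
      and bi': "dual_bialgebra (is_arrow B) mir_dom mir_cod acomp (mir_id B) (mir_wh B) Letter_H Letter_U P Pi R Ri
          EV' M E Du eu Dl F MU NU"
      by (rule X.bialgebra_arrows[OF C C' P M 2(1) \<epsilon> cl])
    show "braided_right_comodule_algebra
            U (tw_mult (braid_UU H p U) (dual_mult H \<Delta> p U)) (app \<epsilon>)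
            (tw_comult (braid_UU H p U) (dual_comult H m p U)) (dual_counit e U) (braid_UU H p U)
            V mV uV pV (braid_UV H U V q) (rho_R H U V q \<nu>)"
      by (rule X.braided_right_comodule_algebra_U[OF A bi R(1) r R(2) D Q N S s Rh Dl MU \<epsilon> 2(2)])
  next
    fix q \<nu>
    assume 1: "braided_right_module H m e p V q \<nu>" "VU_bijective H U V q"
      "app (raw_rho_L H V q \<nu>) ` carr V \<subseteq> app (emb_UV H U V) ` carr (U \<otimes> V)"
    obtain Q QD S Si N Rh where Q: "rep B (CV \<boxtimes> CH) (CH \<boxtimes> CV) q Q"
      and S: "rep B (CV \<boxtimes> CU) (CU \<boxtimes> CV) (braid_VU H U V q) S" and N: "rep B (CV \<boxtimes> CH) CV \<nu> N"
      and Rh: "rep B CV (CU \<boxtimes> CV) (rho_L H U V q \<nu>) Rh" and s: "braid_VU H U V q \<in> iso (V \<otimes> U) (U \<otimes> V)"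
      and A: "dual_comodule (is_arrow B) mir_dom mir_cod acomp (mir_id B) (mir_wh B) Letter_H Letter_U P Pi R Ri EV' M
          E Du eu Letter_V Q QD S Si N Rh"
      by (rule X.left_comodule_arrows[OF C' P(1) M e 1])
    show "braided_left_comodule U (dual_comult2 H m p U) (dual_counit e U) (braid_UU H p U)
        V (braid_VU H U V q) (rho_L H U V q \<nu>)"
      unfolding dual_comult2_def by (rule X.braided_left_comodule_U[OF A C R(1) r R(2) D S s Rh])
    fix \<Delta> \<epsilon> mV uV pV
    assume 2: "braided_bialgebra H m e \<Delta> \<epsilon> p" "braided_right_module_algebra H m e \<Delta> \<epsilon> p V mV uV pV q \<nu>"
      "standard_right_dual H m \<Delta> \<epsilon> p U"
    have \<epsilon>: "app \<epsilon> \<in> carr U" and cl: "\<And>f g. f \<in> carr U \<Longrightarrow> g \<in> carr U \<Longrightarrow> dual_mult_fun H \<Delta> p f g \<in> carr U"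
      using 2(3) by (auto simp: standard_right_dual_def standard_dual_def)
    obtain Dl F MU NU where Dl: "rep B CH (CH \<boxtimes> CH) \<Delta> Dl" "rep B CH cK \<epsilon> F"
      and MU: "rep B (CU \<boxtimes> CU) CU (dual_mult H \<Delta> p U) MU" "rep B cK CU (elt U (app \<epsilon>)) NU"
      and bi: "dual_bialgebra (is_arrow B) adm acd acomp (aid B) (awh B) Letter_H Letter_U
        P Pi R Ri EV M E Du eu Dl F MU NU"
      and bi': "dual_bialgebra (is_arrow B) mir_dom mir_cod acomp (mir_id B) (mir_wh B) Letter_H Letter_U P Pi R Ri
          EV' M E Du eu Dl F MU NU"
      by (rule X.bialgebra_arrows[OF C C' P M 2(1) \<epsilon> cl])
    show "braided_left_comodule_algebra
            U (tw_mult (braid_UU H p U) (dual_mult H \<Delta> p U)) (app \<epsilon>)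
            (tw_comult (braid_UU H p U) (dual_comult H m p U)) (dual_counit e U) (braid_UU H p U)
            V mV uV pV (braid_VU H U V q) (rho_L H U V q \<nu>)"
      by (rule X.braided_left_comodule_algebra_U[OF A C bi' bi R(1) r R(2) D Q N S s Rh Dl MU \<epsilon> 2(2)])
  qed
qed

end
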